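(* Let $n\ge1$. The orthogonal projection $P:\mathcal{A}_n^2(\Pi)\to\mathcal{A}_n^2(\Pi)$ admits the integral representation $$(P\phi)(z)=\int_\Pi\phi(u,v)\,K^\gamma(z,w)\,du\,dv,\qquad w=u+iv,\ \phi\in\mathcal{A}_n^2(\Pi),\ z\in\Pi,$$ where $$K^\gamma(z,w)=\frac1\pi\int_{\mathbb{R}_+}e^{it(x-u)}\,t\,N_n(2ty)^tP_\gamma(t)N_n(2tv)\,dt,\qquad z=x+iy.$$
   Context: $\mathbb{R}_+=(0,\infty)$; $\Pi=\{z=x+iy: y>0\}$ with Lebesgue area measure. $\mathcal{A}^2_n(\Pi)$ is the closed subspace of $L_2(\Pi)$ of $n$-polyanalytic functions (kernel of $(\partial/\partial\overline z)^n$), $\mathcal{A}^2(\Pi)=\mathcal{A}^2_1(\Pi)$, and $B_{\Pi,n}$ is the orthogonal projection of $L_2(\Pi)$ onto $\mathcal{A}_n^2(\Pi)$. Let $\ell_k(y)=(-1)^k\chi_{\mathbb{R}_+}(y)e^{-y/2}\frac{e^y}{k!}\frac{d^k}{dy^k}(e^{-y}y^k)$, $N_m(y)=(\ell_0(y),\dots,\ell_{m-1}(y))^t$. The operator $R_m:L_2(\Pi)\to(L_2(\mathbb{R}_+))^m$, $$(R_m\varphi)(x)=\frac{1}{\sqrt{2\pi}}\int_{\mathbb{R}}e^{-ixt}\int_{\mathbb{R}_+}\varphi(t,r)\sqrt{2x}\,N_m(2xr)\,dr\,dt$$ (Fourier transform in the $L_2$ sense), satisfies $R_m^*R_m=B_{\Pi,m}$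 and $R_mR_m^*=I$, with $(R_m^*f)(x,y)=\frac1{\sqrt{2\pi}}\int_{\mathbb{R}_+}e^{ixt}\sqrt{2t}\,N_m(2ty)^tf(t)\,dt$. Put $\mathbf{R}=\bigoplus_{k=1}^nR_1:(L_2(\Pi))^n\to(L_2(\mathbb{R}_+))^n$. For $1\le k\le n-1$ let $a_k(z)=\chi_{[k-1,k)}(\operatorname{Im}z)$, and $a_n(z)=\chi_{[n-1,\infty)}(\operatorname{Im}z)$; $T_{a_k}$ is the Toeplitz operator $f\mapsto B_{\Pi,1}(a_kf)$ on $\mathcal{A}^2(\Pi)$. Set $P_T=(\sqrt{T_{a_j}}\sqrt{T_{a_k}})_{j,k=1}^n$ on $(\mathcal{A}^2(\Pi))^n$ and $P=R_n^*\mathbf{R}P_T\mathbf{R}^*R_n:\mathcal{A}_n^2(\Pi)\to\mathcal{A}_n^2(\Pi)$; equivalently $P=R_n^*P_\gamma R_n$, where $P_\gamma$ acts by multiplication and $P_\gamma=\left(\sqrt{\gamma^{a_j}}\sqrt{\gamma^{a_k}}\right)_{j,k=1}^n$, $\gamma^{a_k}(t)=e^{-2kt}(e^{2t}-1)$ for $1\le k\le n-1$, $\gamma^{a_n}(t)=e^{-2(n-1)t}$. *)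

theory Defs
  imports "HOL-Analysis.Analysis"
begin

text \<open>
  Elements of \<open>L\<^sub>2\<close> spaces are represented by functions. Elements of the (poly-)Bergman spaces
  are represented by their unique smooth representative, extended by \<open>0\<close> outside the half-plane,
  so that equality in these spaces is equality of functions.
  Vectors of length \<open>m\<close> are functions on \<open>nat\<close>, of which only the components \<open>1, \<dots>, m\<close> matter.
\<close>

definition L2 :: "'a::euclidean_space set \<Rightarrow> ('a \<Rightarrow> complex) set" where
  "L2 A = {f. set_borel_measurable lborel A f \<and>
              set_integrable lborel A (\<lambda>x. (cmod (f x))\<^sup>2)}"

definition l2_inner :: "'a::euclidean_space set \<Rightarrow> ('a \<Rightarrow> complex) \<Rightarrow> ('a \<Rightarrow> complex) \<Rightarrow> complex" where
  "l2_inner A f g = (LINT x:A|lborel. f x * cnj (g x))"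

definition l2_norm :: "'a::euclidean_space set \<Rightarrow> ('a \<Rightarrow> complex) \<Rightarrow> real" where
  "l2_norm A f = sqrt (LINT x:A|lborel. (cmod (f x))\<^sup>2)"

definition L2_tendsto ::
  "'a::euclidean_space set \<Rightarrow> ('b \<Rightarrow> 'a \<Rightarrow> complex) \<Rightarrow> ('a \<Rightarrow> complex) \<Rightarrow> 'b filter \<Rightarrow> bool" where
  "L2_tendsto A F f \<F> \<longleftrightarrow> f \<in> L2 A \<and> (\<forall>\<^sub>F N in \<F>. F N \<in> L2 A) \<and>
     ((\<lambda>N. l2_norm A (\<lambda>x. F N x - f x)) \<longlongrightarrow> 0) \<F>"


subsection \<open>Operators on a subspace \<open>H\<close> of \<open>L2 A\<close>\<close>

definition bounded_operator_on ::
  "'a::euclidean_space set \<Rightarrow> ('a \<Rightarrow> complex) set \<Rightarrow> (('a \<Rightarrow> complex) \<Rightarrow> 'a \<Rightarrow> complex) \<Rightarrow> bool" where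
  "bounded_operator_on A H T \<longleftrightarrow>
     (\<forall>f\<in>H. T f \<in> H) \<and>
     (\<forall>f\<in>H. \<forall>g\<in>H. T (\<lambda>x. f x + g x) = (\<lambda>x. T f x + T g x)) \<and>
     (\<forall>c. \<forall>f\<in>H. T (\<lambda>x. c * f x) = (\<lambda>x. c * T f x)) \<and>
     (\<exists>C. \<forall>f\<in>H. l2_norm A (T f) \<le> C * l2_norm A f)"

definition positive_operator_on ::
  "'a::euclidean_space set \<Rightarrow> ('a \<Rightarrow> complex) set \<Rightarrow> (('a \<Rightarrow> complex) \<Rightarrow> 'a \<Rightarrow> complex) \<Rightarrow> bool" where
  "positive_operator_on A H T \<longleftrightarrow>
     bounded_operator_on A H T \<and> (\<forall>f\<in>H. l2_inner A (T f) f \<in> \<real>\<^sub>\<ge>\<^sub>0)"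

definition orthogonal_projection_on ::
  "'a::euclidean_space set \<Rightarrow> ('a \<Rightarrow> complex) set \<Rightarrow> (('a \<Rightarrow> complex) \<Rightarrow> 'a \<Rightarrow> complex) \<Rightarrow> bool" where
  "orthogonal_projection_on A H T \<longleftrightarrow>
     bounded_operator_on A H T \<and>
     (\<forall>f\<in>H. T (T f) = T f) \<and>
     (\<forall>f\<in>H. \<forall>g\<in>H. l2_inner A (T f) g = l2_inner A f (T g))"

text \<open>The positive square root; the value outside \<open>H\<close> is fixed only to make it unique as a function.\<close>

definition operator_sqrt ::
  "'a::euclidean_space set \<Rightarrow> ('a \<Rightarrow> complex) set \<Rightarrow> (('a \<Rightarrow> complex) \<Rightarrow> 'a \<Rightarrow> complex)
     \<Rightarrow> ('a \<Rightarrow> complex) \<Rightarrow> 'a \<Rightarrow> complex" where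
  "operator_sqrt A H T = (THE S. positive_operator_on A H S \<and>
     (\<forall>f\<in>H. S (S f) = T f) \<and> (\<forall>f. f \<notin> H \<longrightarrow> S f = (\<lambda>x. 0)))"


subsection \<open>Polyanalytic Bergman spaces of the upper half-plane\<close>

definition half_plane :: "complex set" where
  "half_plane = {z. Im z > 0}"

definition dbar :: "(complex \<Rightarrow> complex) \<Rightarrow> complex \<Rightarrow> complex" where
  "dbar f z = (frechet_derivative f (at z) 1 + \<i> * frechet_derivative f (at z) \<i>) / 2"

text \<open>
  Differentiability is real (Frechet) differentiability. No continuity of derivatives is demanded:
  by induction on \<open>n\<close>, a function satisfying this is \<open>\<Sum>k<n. cnj z ^ k * h k z\<close> with
  \<open>h k\<close> holomorphic on the half-plane, hence smooth.
\<close>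

definition polyanalytic :: "nat \<Rightarrow> (complex \<Rightarrow> complex) \<Rightarrow> bool" where
  "polyanalytic n f \<longleftrightarrow>
     (\<forall>j<n. \<forall>z\<in>half_plane. (dbar ^^ j) f differentiable (at z)) \<and>
     (\<forall>z\<in>half_plane. (dbar ^^ n) f z = 0)"

definition poly_bergman :: "nat \<Rightarrow> (complex \<Rightarrow> complex) set" where
  "poly_bergman n = {f \<in> L2 half_plane. polyanalytic n f \<and> (\<forall>z. z \<notin> half_plane \<longrightarrow> f z = 0)}"

definition bergman_projection :: "nat \<Rightarrow> (complex \<Rightarrow> complex) \<Rightarrow> complex \<Rightarrow> complex" where
  "bergman_projection n f = (THE g. g \<in> poly_bergman n \<and>
     (\<forall>h\<in>poly_bergman n. l2_inner half_plane (\<lambda>z. f z - g z) h = 0))"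

definition toeplitz :: "(complex \<Rightarrow> complex) \<Rightarrow> (complex \<Rightarrow> complex) \<Rightarrow> complex \<Rightarrow> complex" where
  "toeplitz a f = bergman_projection 1 (\<lambda>z. a z * f z)"

definition toeplitz_sqrt :: "(complex \<Rightarrow> complex) \<Rightarrow> (complex \<Rightarrow> complex) \<Rightarrow> complex \<Rightarrow> complex" where
  "toeplitz_sqrt a = operator_sqrt half_plane (poly_bergman 1) (toeplitz a)"


subsection \<open>The operators \<open>R\<^sub>m\<close> and their adjoints\<close>

definition ell :: "nat \<Rightarrow> real \<Rightarrow> real" where
  "ell k y = (-1) ^ k * indicator {0<..} y * exp (- y / 2) *
     (exp y / fact k * (deriv ^^ k) (\<lambda>s::real. exp (- s) * s ^ k) y)"

definition Nvec :: "nat \<Rightarrow> real \<Rightarrow> real" where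
  "Nvec j y = ell (j - 1) y"

text \<open>
  The integral over the real line in the definition of \<open>R\<^sub>m\<close> is a Fourier integral in the \<open>L\<^sub>2\<close> sense,
  i.e. the limit in \<open>L\<^sub>2(0,\<infinity>)\<close> of the absolutely convergent integrals over \<open>[-M, M]\<close>.
\<close>

definition R_trunc :: "nat \<Rightarrow> (complex \<Rightarrow> complex) \<Rightarrow> real \<Rightarrow> real \<Rightarrow> complex" where
  "R_trunc j \<phi> M x = complex_of_real (1 / sqrt (2 * pi)) *
     (LINT t:{-M..M}|lborel. cis (- (x * t)) *
        (LINT r:{0<..}|lborel. \<phi> (Complex t r) * complex_of_real (sqrt (2 * x) * Nvec j (2 * x * r))))"

definition R_op :: "nat \<Rightarrow> (complex \<Rightarrow> complex) \<Rightarrow> nat \<Rightarrow> real \<Rightarrow> complex" where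
  "R_op m \<phi> j = (if j \<in> {1..m} then (SOME f. L2_tendsto {0<..} (R_trunc j \<phi>) f at_top)
                 else (\<lambda>x. 0))"

text \<open>
  The adjoint of \<open>R\<^sub>m\<close>, given by its integral formula: this converges absolutely at every point
  and yields the smooth representative of the adjoint's value.
\<close>

definition R_adj :: "nat \<Rightarrow> (nat \<Rightarrow> real \<Rightarrow> complex) \<Rightarrow> complex \<Rightarrow> complex" where
  "R_adj m f z = (if z \<in> half_plane then
     complex_of_real (1 / sqrt (2 * pi)) *
       (LINT t:{0<..}|lborel. cis (Re z * t) * complex_of_real (sqrt (2 * t)) *
          (\<Sum>j=1..m. complex_of_real (Nvec j (2 * t * Im z)) * f j t))
     else 0)"

definition R_sum :: "nat \<Rightarrow> (nat \<Rightarrow> complex \<Rightarrow> complex) \<Rightarrow> nat \<Rightarrow> real \<Rightarrow> complex" where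
  "R_sum n F k = (if k \<in> {1..n} then R_op 1 (F k) 1 else (\<lambda>x. 0))"

definition R_sum_adj :: "nat \<Rightarrow> (nat \<Rightarrow> real \<Rightarrow> complex) \<Rightarrow> nat \<Rightarrow> complex \<Rightarrow> complex" where
  "R_sum_adj n f k = (if k \<in> {1..n} then R_adj 1 (\<lambda>_. f k) else (\<lambda>z. 0))"


subsection \<open>The projection and its kernel\<close>

definition symbol :: "nat \<Rightarrow> nat \<Rightarrow> complex \<Rightarrow> complex" where
  "symbol n k z = (if k = n then indicator {real n - 1..} (Im z)
                   else indicator {real k - 1..<real k} (Im z))"

definition P_T :: "nat \<Rightarrow> (nat \<Rightarrow> complex \<Rightarrow> complex) \<Rightarrow> nat \<Rightarrow> complex \<Rightarrow> complex" where
  "P_T n F j = (if j \<in> {1..n}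
     then (\<lambda>z. \<Sum>k=1..n. toeplitz_sqrt (symbol n j) (toeplitz_sqrt (symbol n k) (F k)) z)
     else (\<lambda>z. 0))"

definition P_op :: "nat \<Rightarrow> (complex \<Rightarrow> complex) \<Rightarrow> complex \<Rightarrow> complex" where
  "P_op n \<phi> = R_adj n (R_sum n (P_T n (R_sum_adj n (R_op n \<phi>))))"

definition gam :: "nat \<Rightarrow> nat \<Rightarrow> real \<Rightarrow> real" where
  "gam n k t = (if k = n then exp (- 2 * (real n - 1) * t)
                else exp (- 2 * real k * t) * (exp (2 * t) - 1))"

definition P_gam :: "nat \<Rightarrow> real \<Rightarrow> nat \<Rightarrow> nat \<Rightarrow> real" where
  "P_gam n t j k = sqrt (gam n j t) * sqrt (gam n k t)"

definition K_integrand :: "nat \<Rightarrow> complex \<Rightarrow> complex \<Rightarrow> real \<Rightarrow> complex" where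
  "K_integrand n z w t = cis (t * (Re z - Re w)) * complex_of_real (t *
     (\<Sum>j=1..n. \<Sum>k=1..n. Nvec j (2 * t * Im z) * P_gam n t j k * Nvec k (2 * t * Im w)))"

definition K_gam :: "nat \<Rightarrow> complex \<Rightarrow> complex \<Rightarrow> complex" where
  "K_gam n z w = complex_of_real (1 / pi) * (LINT t:{0<..}|lborel. K_integrand n z w t)"

end

theory Submission
  imports Defs "HOL-Probability.Characteristic_Functions" "HOL-Complex_Analysis.Complex_Analysis"
begin

text \<open>The space \<open>poly_bergman n\<close> is isometrically isomorphic to the space of \<open>n\<close>-tuples of functions in \<open>L\<^sub>2\<close> of
  the half-line, and under the isomorphism all operators in question become pointwise matrix
  multiplications.

  The isomorphism is \<open>R_adj n\<close>. On a horizontal line \<open>R_adj n f\<close> is a Fourier transform, so Plancherel's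
  theorem computes its norm there, and the orthonormality of the Laguerre functions takes care of
  the integral over the height: \<open>R_adj n\<close> is an isometry (\<open>R_adj_isometry\<close>). Its values are
  polyanalytic, being polynomials in \<open>Im z\<close> with Laplace transforms as coefficients
  (\<open>R_adj_in_poly_bergman\<close>). The operator \<open>R_op n\<close> is its Hilbert space adjoint (\<open>R_op_adjoint\<close>), and
  therefore a left inverse (\<open>R_op_R_adj\<close>).

  That \<open>R_adj n\<close> is onto is shown without a Paley-Wiener theorem, through point evaluations. The Cayley
  transform centred at \<open>w\<close> turns a polyanalytic function on the half-plane into one on the disc,
  and a polyanalytic function \<open>\<Sum>k<n. cnj \<zeta>\<^sup>k h\<^sub>k(\<zeta>)\<close> on the disc is evaluated at \<open>0\<close> by
  integration against a radial weight whose moments of orders \<open>1, \<dots>, n - 1\<close> vanish. Pulled back to the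
  half-plane, this integration becomes the inner product with a rational function of \<open>z\<close> and
  \<open>cnj z\<close>, and a computation with Laplace transforms shows that this function lies in the range of \<open>R_adj n\<close> (\<open>poly_kernel_in_range\<close>). A function \<open>\<phi>\<close> in
  the space and \<open>R_adj n (R_op n \<phi>)\<close> have the same inner products with the range of \<open>R_adj n\<close>, hence
  the same values (\<open>R_adj_R_op\<close>).

  For \<open>n = 1\<close> the isomorphism carries the Toeplitz operator with symbol \<open>symbol n k\<close> to multiplication by
  \<open>gam n k\<close> (\<open>toeplitz_symbol\<close>), and its positive square root, whose uniqueness has to be proved, to
  multiplication by \<open>sqrt (gam n k)\<close> (\<open>operator_sqrt_mult_op\<close>). So \<open>P_op n\<close> is \<open>R_adj n\<close> after the matrix
  \<open>P_gam n t\<close> after \<open>R_op n\<close> (\<open>P_op_eq\<close>). The functions \<open>gam n k\<close> sum to \<open>1\<close>, so this matrix is an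
  orthogonal projection of rank one, and \<open>P_op n\<close> is an orthogonal projection. Finally, the value of
  \<open>R_adj n f\<close> at \<open>z\<close> is the inner product of \<open>f\<close> with the explicit vector \<open>eval_vec z\<close>. Moving the matrix
  and \<open>R_op n\<close> to that vector expresses \<open>P_op n \<phi> z\<close> as an inner product of \<open>\<phi>\<close> with an element of the range of
  \<open>R_adj n\<close>, whose conjugate is \<open>K_gam n z\<close> (\<open>K_gam_eq\<close>).\<close>

section \<open>Square-integrable functions\<close>

lemma borel_measurable_cnj [measurable (raw)]:
  "f \<in> borel_measurable M \<Longrightarrow> (\<lambda>x. cnj (f x)) \<in> borel_measurable M"
  by (rule measurable_compose[of f M borel cnj])
     (auto intro!: borel_measurable_continuous_onI continuous_intros)

text \<open>The measure is a parameter because the line, the half-line and the half-plane all occur.\<close>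

definition sq_integrable :: "'a measure \<Rightarrow> ('a \<Rightarrow> complex) \<Rightarrow> bool" where
  "sq_integrable M f \<longleftrightarrow> f \<in> borel_measurable M \<and> integrable M (\<lambda>x. (cmod (f x))\<^sup>2)"

definition sq_inner :: "'a measure \<Rightarrow> ('a \<Rightarrow> complex) \<Rightarrow> ('a \<Rightarrow> complex) \<Rightarrow> complex" where
  "sq_inner M f g = (\<integral>x. f x * cnj (g x) \<partial>M)"

definition sq_norm :: "'a measure \<Rightarrow> ('a \<Rightarrow> complex) \<Rightarrow> real" where
  "sq_norm M f = sqrt (\<integral>x. (cmod (f x))\<^sup>2 \<partial>M)"

lemma sq_integrable_measurable [measurable_dest]: "sq_integrable M f \<Longrightarrow> f \<in> borel_measurable M"
  by (simp add: sq_integrable_def)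

lemma sq_integrable_integrable: "sq_integrable M f \<Longrightarrow> integrable M (\<lambda>x. (cmod (f x))\<^sup>2)"
  by (simp add: sq_integrable_def)

lemma sq_integrable_dominated:
  assumes "sq_integrable M g" "f \<in> borel_measurable M" "AE x in M. cmod (f x) \<le> C * cmod (g x)"
  shows "sq_integrable M f"
  unfolding sq_integrable_def
proof (intro conjI)
  show "integrable M (\<lambda>x. (cmod (f x))\<^sup>2)"
  proof (rule Bochner_Integration.integrable_bound)
    show "integrable M (\<lambda>x. C\<^sup>2 * (cmod (g x))\<^sup>2)"
      using assms(1) by (simp add: sq_integrable_def)
    show "(\<lambda>x. (cmod (f x))\<^sup>2) \<in> borel_measurable M" using assms(2) by measurable
    show "AE x in M. norm ((cmod (f x))\<^sup>2) \<le> norm (C\<^sup>2 * (cmod (g x))\<^sup>2)"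
      using assms(3)
    proof eventually_elim
      case (elim x)
      then have "(cmod (f x))\<^sup>2 \<le> (C * cmod (g x))\<^sup>2" by (intro power_mono) auto
      then show ?case by (simp add: power_mult_distrib)
    qed
  qed
qed fact

lemma norm_add_sq_le: "(norm (a + b :: 'a::real_normed_vector))\<^sup>2 \<le> 2 * (norm a)\<^sup>2 + 2 * (norm b)\<^sup>2"
proof -
  have "(norm (a + b))\<^sup>2 \<le> (norm a + norm b)\<^sup>2"
    by (intro power_mono norm_triangle_ineq) auto
  also have "\<dots> \<le> 2 * (norm a)\<^sup>2 + 2 * (norm b)\<^sup>2"
    using sum_squares_ge_zero[of "norm a - norm b" 0] by (simp add: power2_eq_square algebra_simps)
  finally show ?thesis .
qed

lemma sq_integrable_add:
  assumes "sq_integrable M f" "sq_integrable M g"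
  shows "sq_integrable M (\<lambda>x. f x + g x)"
  unfolding sq_integrable_def
proof (intro conjI)
  note [measurable] = sq_integrable_measurable[OF assms(1)] sq_integrable_measurable[OF assms(2)]
  show "(\<lambda>x. f x + g x) \<in> borel_measurable M" by measurable
  show "integrable M (\<lambda>x. (cmod (f x + g x))\<^sup>2)"
  proof (rule Bochner_Integration.integrable_bound)
    show "integrable M (\<lambda>x. 2 * (cmod (f x))\<^sup>2 + 2 * (cmod (g x))\<^sup>2)"
      using assms by (simp add: sq_integrable_def)
  qed (auto simp: norm_add_sq_le)
qed

lemma sq_integrable_cmult: "sq_integrable M f \<Longrightarrow> sq_integrable M (\<lambda>x. c * f x)"
  unfolding sq_integrable_def by (auto simp: norm_mult power_mult_distrib)

lemma sq_integrable_zero: "sq_integrable M (\<lambda>x. 0)"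
  by (simp add: sq_integrable_def)

lemma sq_integrable_diff:
  assumes "sq_integrable M f" "sq_integrable M g"
  shows "sq_integrable M (\<lambda>x. f x - g x)"
  using sq_integrable_add[OF assms(1) sq_integrable_cmult[OF assms(2), of "-1"]] by simp

lemma sq_integrable_sum:
  assumes "\<And>i. i \<in> I \<Longrightarrow> sq_integrable M (f i)"
  shows "sq_integrable M (\<lambda>x. \<Sum>i\<in>I. f i x)"
  using assms by (induction I rule: infinite_finite_induct) (auto simp: sq_integrable_zero intro: sq_integrable_add)

lemma sq_integrable_bounded_mult:
  assumes "sq_integrable M f" "m \<in> borel_measurable M" "\<And>x. x \<in> space M \<Longrightarrow> cmod (m x) \<le> C"
  shows "sq_integrable M (\<lambda>x. m x * f x)"
  by (rule sq_integrable_dominated[OF assms(1), where C=C])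
     (use assms in \<open>auto simp: norm_mult intro!: AE_I2 mult_right_mono dest: sq_integrable_measurable\<close>)

lemma sq_integrable_cong_AE:
  assumes "AE x in M. f x = g x" "sq_integrable M f" "g \<in> borel_measurable M"
  shows "sq_integrable M g"
  by (rule sq_integrable_dominated[OF assms(2,3), where C=1]) (use assms(1) in eventually_elim, auto)

lemma sq_integrable_mult_integrable:
  assumes "sq_integrable M f" "sq_integrable M g"
  shows "integrable M (\<lambda>x. f x * cnj (g x))"
proof (rule Bochner_Integration.integrable_bound)
  note [measurable] = sq_integrable_measurable[OF assms(1)] sq_integrable_measurable[OF assms(2)]
  show "integrable M (\<lambda>x. (cmod (f x))\<^sup>2 + (cmod (g x))\<^sup>2)"
    using assms by (simp add: sq_integrable_def)
  show "(\<lambda>x. f x * cnj (g x)) \<in> borel_measurable M" by measurable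
  show "AE x in M. norm (f x * cnj (g x)) \<le> norm ((cmod (f x))\<^sup>2 + (cmod (g x))\<^sup>2)"
  proof (rule AE_I2)
    fix x
    have "cmod (f x) * cmod (g x) \<le> (cmod (f x))\<^sup>2 + (cmod (g x))\<^sup>2"
      using sum_squares_bound[of "cmod (f x)" "cmod (g x)"]
        mult_nonneg_nonneg[of "cmod (f x)" "cmod (g x)"] norm_ge_zero[of "f x"] norm_ge_zero[of "g x"]
      by linarith
    then show "norm (f x * cnj (g x)) \<le> norm ((cmod (f x))\<^sup>2 + (cmod (g x))\<^sup>2)"
      by (simp add: norm_mult)
  qed
qed

lemma sq_inner_cong_AE:
  assumes "AE x in M. f x = f' x" "AE x in M. g x = g' x"
    "f \<in> borel_measurable M" "g \<in> borel_measurable M" "f' \<in> borel_measurable M" "g' \<in> borel_measurable M"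
  shows "sq_inner M f g = sq_inner M f' g'"
  unfolding sq_inner_def
proof (rule integral_cong_AE)
  show "AE x in M. f x * cnj (g x) = f' x * cnj (g' x)" using assms(1,2) by eventually_elim simp
qed (use assms in measurable)

lemma sq_inner_add_left:
  assumes "sq_integrable M f" "sq_integrable M g" "sq_integrable M h"
  shows "sq_inner M (\<lambda>x. f x + g x) h = sq_inner M f h + sq_inner M g h"
  unfolding sq_inner_def using assms
  by (simp add: distrib_right sq_integrable_mult_integrable)

lemma sq_inner_diff_left:
  assumes "sq_integrable M f" "sq_integrable M g" "sq_integrable M h"
  shows "sq_inner M (\<lambda>x. f x - g x) h = sq_inner M f h - sq_inner M g h"
  unfolding sq_inner_def using assms
  by (simp add: left_diff_distrib sq_integrable_mult_integrable)

lemma sq_inner_cmult_left: "sq_inner M (\<lambda>x. c * f x) h = c * sq_inner M f h"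
  unfolding sq_inner_def by (simp add: mult.assoc)

lemma sq_inner_commute: "sq_inner M f g = cnj (sq_inner M g f)"
  unfolding sq_inner_def by (subst Bochner_Integration.integral_cnj[symmetric]) (simp add: mult.commute)

lemma sq_inner_add_right:
  assumes "sq_integrable M f" "sq_integrable M g" "sq_integrable M h"
  shows "sq_inner M h (\<lambda>x. f x + g x) = sq_inner M h f + sq_inner M h g"
  using sq_inner_add_left[OF assms] by (metis complex_cnj_add sq_inner_commute)

lemma sq_inner_cmult_right: "sq_inner M h (\<lambda>x. c * f x) = cnj c * sq_inner M h f"
  by (metis complex_cnj_mult sq_inner_cmult_left sq_inner_commute)

lemma sq_inner_sum_left:
  assumes "\<And>i. i \<in> I \<Longrightarrow> sq_integrable M (f i)" "sq_integrable M h"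
  shows "sq_inner M (\<lambda>x. \<Sum>i\<in>I. f i x) h = (\<Sum>i\<in>I. sq_inner M (f i) h)"
  using assms(1)
proof (induction I rule: infinite_finite_induct)
  case (insert i I)
  then show ?case
    using sq_inner_add_left[of M "f i" "\<lambda>x. \<Sum>i\<in>I. f i x" h] assms(2)
    by (simp add: sq_integrable_sum)
qed (simp_all add: sq_inner_def)

lemma sq_norm_nonneg [simp]: "0 \<le> sq_norm M f"
  by (simp add: sq_norm_def)

lemma sq_norm_power2: "(sq_norm M f)\<^sup>2 = (\<integral>x. (cmod (f x))\<^sup>2 \<partial>M)"
  by (simp add: sq_norm_def)

lemma sq_inner_self: "sq_inner M f f = complex_of_real ((sq_norm M f)\<^sup>2)"
proof -
  have "f x * cnj (f x) = complex_of_real ((cmod (f x))\<^sup>2)" for x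
    using complex_norm_square[of "f x"] by simp
  then show ?thesis unfolding sq_inner_def sq_norm_power2 by (simp del: of_real_power)
qed

lemma sq_norm_zero [simp]: "sq_norm M (\<lambda>x. 0) = 0"
  by (simp add: sq_norm_def)

lemma sq_norm_cmult: "sq_norm M (\<lambda>x. c * f x) = cmod c * sq_norm M f"
  unfolding sq_norm_def by (simp add: norm_mult power_mult_distrib real_sqrt_mult)

lemma sq_norm_uminus_diff: "sq_norm M (\<lambda>x. f x - g x) = sq_norm M (\<lambda>x. g x - f x)"
  by (simp add: sq_norm_def norm_minus_commute)

lemma sq_norm_eq_0_iff:
  assumes "sq_integrable M f"
  shows "sq_norm M f = 0 \<longleftrightarrow> (AE x in M. f x = 0)"
  using integral_nonneg_eq_0_iff_AE[OF sq_integrable_integrable[OF assms]] by (simp add: sq_norm_def)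

lemma sq_norm_expand:
  assumes "sq_integrable M f" "sq_integrable M g"
  shows "(sq_norm M (\<lambda>x. f x + c * g x))\<^sup>2
    = (sq_norm M f)\<^sup>2 + 2 * Re (cnj c * sq_inner M f g) + (cmod c)\<^sup>2 * (sq_norm M g)\<^sup>2"
proof -
  have cg: "sq_integrable M (\<lambda>x. c * g x)" by (rule sq_integrable_cmult) fact
  have s: "sq_integrable M (\<lambda>x. f x + c * g x)" by (rule sq_integrable_add[OF assms(1) cg])
  have "complex_of_real ((sq_norm M (\<lambda>x. f x + c * g x))\<^sup>2)
     = sq_inner M f f + cnj c * sq_inner M f g + c * sq_inner M g f + c * cnj c * sq_inner M g g"
    unfolding sq_inner_self[symmetric]
    using sq_inner_add_left[OF assms(1) cg s] sq_inner_add_right[OF assms(1) cg assms(1)]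
      sq_inner_add_right[OF assms(1) cg cg]
    by (simp add: sq_inner_cmult_left sq_inner_cmult_right algebra_simps)
  also have "c * sq_inner M g f = cnj (cnj c * sq_inner M f g)"
    by (subst sq_inner_commute) simp
  also have "c * cnj c * sq_inner M g g = complex_of_real ((cmod c)\<^sup>2 * (sq_norm M g)\<^sup>2)"
    by (simp only: sq_inner_self of_real_mult complex_norm_square[of c])
  finally have "complex_of_real ((sq_norm M (\<lambda>x. f x + c * g x))\<^sup>2)
     = complex_of_real ((sq_norm M f)\<^sup>2 + 2 * Re (cnj c * sq_inner M f g) + (cmod c)\<^sup>2 * (sq_norm M g)\<^sup>2)"
    unfolding sq_inner_self using complex_add_cnj[of "cnj c * sq_inner M f g"]
    by (simp add: algebra_simps)
  then show ?thesis by (simp only: of_real_eq_iff)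
qed

text \<open>Expand the squared norm of \<open>f + c g\<close> at the minimising \<open>c = - \<langle>f, g\<rangle> / \<parallel>g\<parallel>\<^sup>2\<close>.\<close>

lemma sq_inner_Cauchy_Schwarz:
  assumes "sq_integrable M f" "sq_integrable M g"
  shows "cmod (sq_inner M f g) \<le> sq_norm M f * sq_norm M g"
proof (cases "sq_norm M g = 0")
  case True
  then have "AE x in M. g x = 0" using sq_norm_eq_0_iff[OF assms(2)] by simp
  then have "sq_inner M f g = sq_inner M f (\<lambda>x. 0)"
    using assms by (intro sq_inner_cong_AE) (auto dest: sq_integrable_measurable)
  then show ?thesis by (simp add: sq_inner_def)
next
  case False
  define I where "I = sq_inner M f g"
  define N where "N = (sq_norm M g)\<^sup>2"
  have N: "N > 0" using False unfolding N_def by simp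
  define c where "c = - I / N"
  have "0 \<le> (sq_norm M f)\<^sup>2 + 2 * Re (cnj c * I) + (cmod c)\<^sup>2 * N"
    unfolding I_def N_def sq_norm_expand[OF assms, symmetric] by simp
  also have "cnj c * I = - complex_of_real ((cmod I)\<^sup>2 / N)"
    unfolding c_def using complex_norm_square[of I] by (simp add: mult.commute)
  also have "(cmod c)\<^sup>2 * N = (cmod I)\<^sup>2 / N"
    unfolding c_def using N by (simp add: norm_divide power2_eq_square)
  finally have "(cmod I)\<^sup>2 / N \<le> (sq_norm M f)\<^sup>2" by simp
  then have "(cmod I)\<^sup>2 \<le> (sq_norm M f * sq_norm M g)\<^sup>2"
    using N by (simp add: N_def divide_le_eq power_mult_distrib)
  then show ?thesis unfolding I_def by (rule power2_le_imp_le) simp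
qed

lemma sq_norm_triangle:
  assumes "sq_integrable M f" "sq_integrable M g"
  shows "sq_norm M (\<lambda>x. f x + g x) \<le> sq_norm M f + sq_norm M g"
proof (rule power2_le_imp_le)
  have "Re (sq_inner M f g) \<le> sq_norm M f * sq_norm M g"
    using sq_inner_Cauchy_Schwarz[OF assms] complex_Re_le_cmod order_trans by blast
  then show "(sq_norm M (\<lambda>x. f x + g x))\<^sup>2 \<le> (sq_norm M f + sq_norm M g)\<^sup>2"
    using sq_norm_expand[OF assms, of 1] by (simp add: power2_sum)
qed simp

lemma sq_norm_triangle_diff:
  assumes "sq_integrable M f" "sq_integrable M g" "sq_integrable M h"
  shows "sq_norm M (\<lambda>x. f x - h x) \<le> sq_norm M (\<lambda>x. f x - g x) + sq_norm M (\<lambda>x. g x - h x)"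
  using sq_norm_triangle[OF sq_integrable_diff[OF assms(1,2)] sq_integrable_diff[OF assms(2,3)]] by simp

text \<open>With this, an identity between norms that holds on a subspace passes to inner products.\<close>

lemma sq_inner_polarization:
  assumes "sq_integrable M f" "sq_integrable M g"
  shows "4 * sq_inner M f g = (\<Sum>k<4. \<i> ^ k * complex_of_real ((sq_norm M (\<lambda>x. f x + \<i> ^ k * g x))\<^sup>2))"
proof -
  have *: "{..<4::nat} = {0, Suc 0, Suc (Suc 0), Suc (Suc (Suc 0))}" by auto
  show ?thesis
    unfolding sq_norm_expand[OF assms] *
    by (simp add: complex_eq_iff algebra_simps)
qed

lemma sq_norm_mono:
  assumes "sq_integrable M g" "f \<in> borel_measurable M" "AE x in M. cmod (f x) \<le> cmod (g x)"
  shows "sq_norm M f \<le> sq_norm M g"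
  unfolding sq_norm_def
proof (intro real_sqrt_le_mono integral_mono_AE)
  show "integrable M (\<lambda>x. (cmod (f x))\<^sup>2)"
    by (rule sq_integrable_integrable[OF sq_integrable_dominated[OF assms(1,2), where C=1]])
       (use assms(3) in eventually_elim, simp)
  show "AE x in M. (cmod (f x))\<^sup>2 \<le> (cmod (g x))\<^sup>2"
    using assms(3) by eventually_elim (simp add: power_mono)
qed (use assms(1) in \<open>rule sq_integrable_integrable\<close>)

lemma nn_integral_sq:
  assumes "sq_integrable M f"
  shows "(\<integral>\<^sup>+x. ennreal ((cmod (f x))\<^sup>2) \<partial>M) = ennreal ((sq_norm M f)\<^sup>2)"
  unfolding sq_norm_power2 by (rule nn_integral_eq_integral[OF sq_integrable_integrable[OF assms]]) simp

lemma sq_integrable_nn_integral_iff: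
  assumes "f \<in> borel_measurable M"
  shows "sq_integrable M f \<longleftrightarrow> (\<integral>\<^sup>+x. ennreal ((cmod (f x))\<^sup>2) \<partial>M) < \<infinity>"
  using assms unfolding sq_integrable_def by (simp add: integrable_iff_bounded)

text \<open>Fatou's lemma for squared norms.\<close>

lemma sq_norm_le_liminf:
  assumes "\<And>k. sq_integrable M (f k)" "g \<in> borel_measurable M" "AE x in M. (\<lambda>k. f k x) \<longlonglongrightarrow> g x"
    "\<And>k. k \<ge> K \<Longrightarrow> sq_norm M (f k) \<le> C"
  shows "sq_integrable M g" "sq_norm M g \<le> C"
proof -
  have C0: "0 \<le> C" using assms(4)[of K] sq_norm_nonneg[of M "f K"] by linarith
  have [measurable]: "f k \<in> borel_measurable M" for k using assms(1) by (rule sq_integrable_measurable)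
  have "(\<integral>\<^sup>+x. ennreal ((cmod (g x))\<^sup>2) \<partial>M) = (\<integral>\<^sup>+x. liminf (\<lambda>k. ennreal ((cmod (f k x))\<^sup>2)) \<partial>M)"
  proof (rule nn_integral_cong_AE, use assms(3) in eventually_elim)
    case (elim x)
    have "(\<lambda>k. ennreal ((cmod (f k x))\<^sup>2)) \<longlonglongrightarrow> ennreal ((cmod (g x))\<^sup>2)"
      by (intro tendsto_intros elim)
    then show ?case using lim_imp_Liminf sequentially_bot by metis
  qed
  also have "\<dots> \<le> liminf (\<lambda>k. \<integral>\<^sup>+x. ennreal ((cmod (f k x))\<^sup>2) \<partial>M)"
    by (rule nn_integral_liminf) measurable
  also have "\<dots> \<le> liminf (\<lambda>k. ennreal (C\<^sup>2))"
    unfolding nn_integral_sq[OF assms(1)]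
    by (intro Liminf_mono eventually_sequentiallyI[of K] ennreal_leI power_mono assms(4)) auto
  also have "\<dots> = ennreal (C\<^sup>2)" by (simp add: Liminf_const)
  finally have *: "(\<integral>\<^sup>+x. ennreal ((cmod (g x))\<^sup>2) \<partial>M) \<le> ennreal (C\<^sup>2)" .
  then show i: "sq_integrable M g"
    unfolding sq_integrable_nn_integral_iff[OF assms(2)] using le_less_trans by fastforce
  have "(sq_norm M g)\<^sup>2 \<le> C\<^sup>2" using * unfolding nn_integral_sq[OF i] by simp
  then show "sq_norm M g \<le> C" using C0 by (rule power2_le_imp_le)
qed

text \<open>The weights \<open>2\<^sup>k\<close> take the place of an infinite triangle inequality:
  \<open>\<Sum>k. 2\<^sup>k \<bar>d\<^sub>k\<bar>\<^sup>2\<close> has a finite integral, hence is finite almost everywhere, and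
  \<open>\<bar>d\<^sub>k\<bar> \<le> 2\<^sup>-\<^sup>k + 2\<^sup>k \<bar>d\<^sub>k\<bar>\<^sup>2\<close>.\<close>

lemma sq_norm_sum_AE_summable:
  assumes "\<And>k. sq_integrable M (d k)" "\<And>k. sq_norm M (d k) \<le> (1/2) ^ k"
  shows "AE x in M. summable (\<lambda>k. d k x)"
proof -
  have [measurable]: "d k \<in> borel_measurable M" for k using assms(1) by (rule sq_integrable_measurable)
  have "(\<integral>\<^sup>+x. (\<Sum>k. ennreal (2 ^ k * (cmod (d k x))\<^sup>2)) \<partial>M)
      = (\<Sum>k. \<integral>\<^sup>+x. ennreal (2 ^ k * (cmod (d k x))\<^sup>2) \<partial>M)"
    by (rule nn_integral_suminf) measurable
  also have "\<dots> \<le> (\<Sum>k. ennreal ((1/2) ^ k))"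
  proof (intro suminf_le)
    fix k
    have "(sq_norm M (d k))\<^sup>2 \<le> ((1/2) ^ k)\<^sup>2" by (intro power_mono assms) simp
    then have "2 ^ k * (sq_norm M (d k))\<^sup>2 \<le> 2 ^ k * ((1/2) ^ k)\<^sup>2" by simp
    also have "\<dots> = (1/2) ^ k" by (simp add: power2_eq_square field_simps)
    finally show "(\<integral>\<^sup>+x. ennreal (2 ^ k * (cmod (d k x))\<^sup>2) \<partial>M) \<le> ennreal ((1/2) ^ k)"
      by (simp add: ennreal_mult nn_integral_cmult nn_integral_sq[OF assms(1)])
         (simp flip: ennreal_mult)
  qed simp_all
  also have "\<dots> = ennreal 2"
    by (subst suminf_ennreal2) (auto simp: suminf_geometric)
  finally have "(\<integral>\<^sup>+x. (\<Sum>k. ennreal (2 ^ k * (cmod (d k x))\<^sup>2)) \<partial>M) < \<infinity>"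
    using le_less_trans by fastforce
  then have "AE x in M. (\<Sum>k. ennreal (2 ^ k * (cmod (d k x))\<^sup>2)) \<noteq> \<infinity>"
    by (intro nn_integral_PInf_AE) (auto simp: less_top)
  then show ?thesis
  proof eventually_elim
    case (elim x)
    then have s: "summable (\<lambda>k. 2 ^ k * (cmod (d k x))\<^sup>2)"
      by (intro summable_suminf_not_top) (auto simp: less_top)
    show ?case
    proof (rule summable_norm_cancel, rule summable_comparison_test')
      show "summable (\<lambda>k. (1/2) ^ k + 2 ^ k * (cmod (d k x))\<^sup>2)"
        by (intro summable_add s) simp
      fix k :: nat
      have "cmod (d k x) \<le> (1/2) ^ k + 2 ^ k * (cmod (d k x))\<^sup>2"
      proof (cases "cmod (d k x) \<le> (1/2) ^ k")
        case True then show ?thesis by (simp add: add_increasing2)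
      next
        case False
        then have "1 \<le> 2 ^ k * cmod (d k x)" by (simp add: field_simps)
        then have "1 * cmod (d k x) \<le> 2 ^ k * cmod (d k x) * cmod (d k x)"
          by (intro mult_right_mono) auto
        then show ?thesis by (simp add: power2_eq_square add_increasing ac_simps)
      qed
      then show "norm (norm (d k x)) \<le> (1/2) ^ k + 2 ^ k * (cmod (d k x))\<^sup>2" by simp
    qed
  qed
qed

text \<open>Completeness of \<open>L\<^sub>2\<close>, shaped for truncated integrals: the increments beyond the cut-off \<open>N\<close>
  are controlled by a null function of \<open>N\<close>. Along cut-offs with geometrically decreasing
  increments the family converges almost everywhere, and Fatou's lemma bounds the distance to
  the pointwise limit.\<close>

lemma sq_norm_complete:
  fixes F :: "real \<Rightarrow> 'a \<Rightarrow> complex"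
  assumes F: "\<And>N. 0 \<le> N \<Longrightarrow> sq_integrable M (F N)"
    and \<tau>: "\<And>N N'. 0 \<le> N \<Longrightarrow> N \<le> N' \<Longrightarrow> sq_norm M (\<lambda>x. F N' x - F N x) \<le> \<tau> N"
    and lim: "(\<tau> \<longlongrightarrow> 0) at_top"
  obtains f where "sq_integrable M f" "((\<lambda>N. sq_norm M (\<lambda>x. F N x - f x)) \<longlongrightarrow> 0) at_top"
proof -
  have ex: "\<exists>N\<ge>0. (\<forall>n\<ge>N. \<tau> n < (1/2) ^ k)" for k :: nat
  proof -
    have "\<forall>\<^sub>F n in at_top. \<tau> n < (1/2) ^ k" by (rule order_tendstoD[OF lim]) simp
    then obtain N where "\<forall>n\<ge>N. \<tau> n < (1/2) ^ k" unfolding eventually_at_top_linorder by blast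
    then show ?thesis by (intro exI[of _ "max N 0"]) auto
  qed
  then obtain N0 where N0: "\<And>k. N0 k \<ge> 0" "\<And>k n. n \<ge> N0 k \<Longrightarrow> \<tau> n < (1/2) ^ k" by metis
  \<comment> \<open>the maximum makes the cut-offs increasing\<close>
  define N where "N k = Max (N0 ` {..k})" for k
  have N_ge: "N0 k \<le> N k" for k unfolding N_def by (rule Max_ge) auto
  have N_mono: "k \<le> l \<Longrightarrow> N k \<le> N l" for k l unfolding N_def by (rule Max_mono) auto
  have N_pos: "0 \<le> N k" for k using N0(1) N_ge order_trans by blast
  have diff_le: "sq_norm M (\<lambda>x. F n x - F (N k) x) \<le> (1/2) ^ k" if "n \<ge> N k" for n k
    using \<tau>[OF N_pos that] N0(2)[OF N_ge[of k]] by linarith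
  have sN: "sq_integrable M (F (N k))" for k using F N_pos by blast
  have [measurable]: "F (N k) \<in> borel_measurable M" for k using sN by (rule sq_integrable_measurable)
  have AEs: "AE x in M. summable (\<lambda>k. F (N (Suc k)) x - F (N k) x)"
    by (rule sq_norm_sum_AE_summable) (auto intro!: sq_integrable_diff sN diff_le N_mono)
  have AEc: "AE x in M. convergent (\<lambda>k. F (N k) x)"
    using AEs
  proof eventually_elim
    case (elim x)
    then have "convergent (\<lambda>k. F (N k) x - F (N 0) x)"
      by (simp add: summable_iff_convergent sum_lessThan_telescope[of "\<lambda>i. F (N i) x"])
    then show ?case using convergent_add[OF _ convergent_const[of "F (N 0) x"]] by fastforce
  qed
  define f where "f x = lim (\<lambda>k. F (N k) x)" for x
  have fm [measurable]: "f \<in> borel_measurable M"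
    unfolding f_def by (rule borel_measurable_lim_metric) measurable
  have AEf: "AE x in M. (\<lambda>k. F (N k) x) \<longlonglongrightarrow> f x"
    using AEc by eventually_elim (simp add: f_def convergent_LIMSEQ_iff)
  have *: "sq_integrable M (\<lambda>x. f x - F (N k) x)" "sq_norm M (\<lambda>x. f x - F (N k) x) \<le> (1/2) ^ k" for k
  proof -
    have AEd: "AE x in M. (\<lambda>l. F (N l) x - F (N k) x) \<longlonglongrightarrow> f x - F (N k) x"
      using AEf by eventually_elim (intro tendsto_intros)
    have sd: "sq_integrable M (\<lambda>x. F (N l) x - F (N k) x)" for l by (intro sq_integrable_diff sN)
    have md: "(\<lambda>x. f x - F (N k) x) \<in> borel_measurable M" by measurable
    show "sq_integrable M (\<lambda>x. f x - F (N k) x)" "sq_norm M (\<lambda>x. f x - F (N k) x) \<le> (1/2) ^ k"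
      using sq_norm_le_liminf[OF sd md AEd, of k "(1/2) ^ k"] diff_le N_mono by auto
  qed
  have sf: "sq_integrable M f" using sq_integrable_add[OF *(1)[of 0] sN[of 0]] by simp
  have bound: "sq_norm M (\<lambda>x. F n x - f x) \<le> 2 * (1/2) ^ k" if "n \<ge> N k" for n k
  proof -
    have "0 \<le> n" using that N_pos[of k] by linarith
    then have "sq_norm M (\<lambda>x. F n x - f x)
      \<le> sq_norm M (\<lambda>x. F n x - F (N k) x) + sq_norm M (\<lambda>x. F (N k) x - f x)"
      by (intro sq_norm_triangle_diff F sN sf)
    also have "\<dots> \<le> (1/2) ^ k + (1/2) ^ k"
      using diff_le[OF that] *(2)[of k] by (subst (2) sq_norm_uminus_diff) (rule add_mono)
    finally show ?thesis by simp
  qed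
  have "((\<lambda>n. sq_norm M (\<lambda>x. F n x - f x)) \<longlongrightarrow> 0) at_top"
  proof (rule tendstoI)
    fix e :: real assume "e > 0"
    then obtain k where k: "(1/2) ^ k < e / 2"
      using real_arch_pow_inv[of "e/2" "1/2"] by auto
    then show "\<forall>\<^sub>F n in at_top. dist (sq_norm M (\<lambda>x. F n x - f x)) 0 < e"
      using bound[of k] unfolding eventually_at_top_linorder
      by (intro exI[of _ "N k"]) (force simp: dist_real_def)
  qed
  then show thesis using that sf by blast
qed

lemma sq_inner_tendsto_left:
  assumes "sq_integrable M f" "sq_integrable M g" "\<forall>\<^sub>F N in \<F>. sq_integrable M (F N)"
    "((\<lambda>N. sq_norm M (\<lambda>x. F N x - f x)) \<longlongrightarrow> 0) \<F>"
  shows "((\<lambda>N. sq_inner M (F N) g) \<longlongrightarrow> sq_inner M f g) \<F>"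
proof (rule Lim_transform_eventually[rotated])
  show "\<forall>\<^sub>F N in \<F>. sq_inner M (\<lambda>x. F N x - f x) g + sq_inner M f g = sq_inner M (F N) g"
    using assms(3) by eventually_elim (simp add: sq_inner_diff_left assms)
  have "((\<lambda>N. sq_inner M (\<lambda>x. F N x - f x) g) \<longlongrightarrow> 0) \<F>"
  proof (rule Lim_null_comparison)
    show "\<forall>\<^sub>F N in \<F>. norm (sq_inner M (\<lambda>x. F N x - f x) g) \<le> sq_norm M (\<lambda>x. F N x - f x) * sq_norm M g"
      using assms(3) by eventually_elim (intro sq_inner_Cauchy_Schwarz sq_integrable_diff assms)
    show "((\<lambda>N. sq_norm M (\<lambda>x. F N x - f x) * sq_norm M g) \<longlongrightarrow> 0) \<F>"
      using tendsto_mult_right[OF assms(4), of "sq_norm M g"] by simp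
  qed
  then show "((\<lambda>N. sq_inner M (\<lambda>x. F N x - f x) g + sq_inner M f g) \<longlongrightarrow> sq_inner M f g) \<F>"
    using tendsto_add[OF _ tendsto_const, of _ 0 \<F> "sq_inner M f g"] by simp
qed

lemma sq_norm_tendsto_dominated:
  fixes s :: "nat \<Rightarrow> 'a \<Rightarrow> complex"
  assumes "sq_integrable M w" "\<And>i. s i \<in> borel_measurable M" "AE x in M. (\<lambda>i. s i x) \<longlonglongrightarrow> 0"
    "\<And>i. AE x in M. cmod (s i x) \<le> cmod (w x)"
  shows "(\<lambda>i. sq_norm M (s i)) \<longlonglongrightarrow> 0"
proof -
  note [measurable] = assms(2)
  have "(\<lambda>i. \<integral>x. (cmod (s i x))\<^sup>2 \<partial>M) \<longlonglongrightarrow> (\<integral>x. 0 \<partial>M)"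
  proof (rule integral_dominated_convergence)
    show "integrable M (\<lambda>x. (cmod (w x))\<^sup>2)" by (rule sq_integrable_integrable) fact
    show "AE x in M. (\<lambda>i. (cmod (s i x))\<^sup>2) \<longlonglongrightarrow> 0"
      using assms(3) by eventually_elim (metis tendsto_norm_zero tendsto_null_power zero_less_numeral)
    show "AE x in M. norm ((cmod (s i x))\<^sup>2) \<le> (cmod (w x))\<^sup>2" for i
      using assms(4) by eventually_elim (simp add: power_mono)
  qed measurable
  then show ?thesis unfolding sq_norm_def using tendsto_real_sqrt by fastforce
qed

subsection \<open>The notions over subsets of Euclidean space\<close>

lemma L2_iff: "A \<in> sets borel \<Longrightarrow> f \<in> L2 A \<longleftrightarrow> sq_integrable (restrict_space lborel A) f"
  unfolding L2_def sq_integrable_def set_borel_measurable_def set_integrable_def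
  by (simp add: borel_measurable_restrict_space_iff integrable_restrict_space)

lemma l2_inner_eq: "A \<in> sets borel \<Longrightarrow> l2_inner A f g = sq_inner (restrict_space lborel A) f g"
  unfolding l2_inner_def sq_inner_def set_lebesgue_integral_def
  by (simp add: integral_restrict_space)

lemma l2_norm_eq: "A \<in> sets borel \<Longrightarrow> l2_norm A f = sq_norm (restrict_space lborel A) f"
  unfolding l2_norm_def sq_norm_def set_lebesgue_integral_def
  by (simp add: integral_restrict_space)

section \<open>Plancherel's theorem\<close>

lemma sq_integrable_bounded_interval:
  fixes f :: "real \<Rightarrow> complex"
  assumes "f \<in> borel_measurable lborel" "\<And>x. cmod (f x) \<le> B" "\<And>x. \<bar>x\<bar> > K \<Longrightarrow> f x = 0"
  shows "sq_integrable lborel f"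
proof (rule sq_integrable_dominated[where C = 1])
  show "sq_integrable lborel (\<lambda>x. indicator {-K..K} x * complex_of_real B)"
  proof -
    have *: "(cmod (indicator {-K..K} x * complex_of_real B))\<^sup>2 = B\<^sup>2 * indicator {-K..K} x" for x
      by (simp add: norm_mult power_mult_distrib indicator_def)
    have "integrable lborel (indicat_real {-K..K})"
      by (rule integrable_real_indicator) (auto simp: emeasure_lborel_Icc_eq)
    then show ?thesis unfolding sq_integrable_def * by auto
  qed
  show "AE x in lborel. cmod (f x) \<le> 1 * cmod (indicator {-K..K} x * complex_of_real B)"
  proof (rule AE_I2)
    fix x
    have "0 \<le> B" using assms(2)[of 0] norm_ge_zero order_trans by blast
    then show "cmod (f x) \<le> 1 * cmod (indicator {-K..K} x * complex_of_real B)"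
      using assms(2)[of x] assms(3)[of x] by (cases "\<bar>x\<bar> \<le> K") (auto simp: norm_mult indicator_def)
  qed
qed fact

definition Cc :: "(real \<Rightarrow> complex) set" where
  "Cc = {g. continuous_on UNIV g \<and> (\<exists>K. \<forall>x. \<bar>x\<bar> > K \<longrightarrow> g x = 0)}"

lemma Cc_bounded:
  assumes "g \<in> Cc" obtains B K where "\<And>x. cmod (g x) \<le> B" "\<And>x. \<bar>x\<bar> > K \<Longrightarrow> g x = 0" "0 \<le> B"
proof -
  obtain K where g: "continuous_on UNIV g" "\<And>x. \<bar>x\<bar> > K \<Longrightarrow> g x = 0" using assms by (auto simp: Cc_def)
  have "compact (g ` {-K..K})"
    by (intro compact_continuous_image continuous_on_subset[OF g(1)]) auto
  then obtain B where B: "\<forall>z\<in>g ` {-K..K}. norm z \<le> B" using compact_imp_bounded bounded_iff by metis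
  have "cmod (g x) \<le> max B 0" for x
  proof (cases "\<bar>x\<bar> \<le> K")
    case True
    then have "g x \<in> g ` {-K..K}" by (intro imageI) (auto simp: abs_le_iff)
    then have "cmod (g x) \<le> B" using B by blast
    then show ?thesis by simp
  qed (use g(2) in auto)
  then show thesis using that g(2) by (meson max.cobounded2)
qed

lemma Cc_measurable: "g \<in> Cc \<Longrightarrow> g \<in> borel_measurable lborel"
  by (auto simp: Cc_def intro: borel_measurable_continuous_onI)

lemma Cc_sq_integrable: "g \<in> Cc \<Longrightarrow> sq_integrable lborel g"
  by (metis Cc_bounded Cc_measurable sq_integrable_bounded_interval)

text \<open>A measurable function is almost everywhere a limit of continuous functions. These may be
  given the bound and, nearly, the support of the function, and then dominated convergence
  turns pointwise into \<open>L\<^sub>2\<close> convergence.\<close>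

lemma Cc_dense_bounded:
  fixes h :: "real \<Rightarrow> complex"
  assumes [measurable]: "h \<in> borel_measurable lborel"
    and B: "\<And>x. cmod (h x) \<le> B" and K: "\<And>x. \<bar>x\<bar> > K \<Longrightarrow> h x = 0" and "e > 0"
  obtains g where "g \<in> Cc" "sq_norm lborel (\<lambda>x. h x - g x) < e"
proof -
  have B0: "0 \<le> B" using B[of 0] norm_ge_zero order_trans by blast
  have "h \<in> borel_measurable lebesgue" by (rule measurable_completion) simp
  then have "h measurable_on UNIV" by (rule lebesgue_measurable_imp_measurable_on) simp
  then obtain N g where N: "negligible N" and g: "\<And>n. continuous_on UNIV (g n)"
    and lim: "\<And>x. x \<notin> N \<Longrightarrow> (\<lambda>n. g n x) \<longlonglongrightarrow> h x"
    unfolding measurable_on_def by auto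
  define B' where "B' = B + 1"
  have B': "B' > 0" "B' \<ge> B" using B0 by (auto simp: B'_def)
  \<comment> \<open>\<open>P\<close> retracts the plane onto the disc of radius \<open>B'\<close>, and \<open>\<kappa>\<close> cuts off outside \<open>[-K - 1, K + 1]\<close>;
     both leave the values of \<open>h\<close> unchanged, so the approximants may be bounded this way.\<close>
  define P where "P z = complex_of_real (1 / max 1 (cmod z / B')) * z" for z
  define \<kappa> where "\<kappa> x = complex_of_real (max 0 (min 1 (K + 1 - \<bar>x\<bar>)))" for x :: real
  define G where "G n x = \<kappa> x * P (g n x)" for n x
  have Pcont: "continuous_on UNIV P" unfolding P_def using B'(1)
    by (intro continuous_intros) auto
  have Pb: "cmod (P z) \<le> B'" for z
  proof -
    have "cmod z / B' \<le> max 1 (cmod z / B')" by simp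
    then have "cmod z \<le> B' * max 1 (cmod z / B')"
      using B'(1) by (metis mult.commute pos_divide_le_eq)
    moreover have "cmod (P z) = cmod z / max 1 (cmod z / B')"
      unfolding P_def norm_mult norm_of_real by simp
    ultimately show ?thesis by (simp add: pos_divide_le_eq)
  qed
  have PG: "P z = z" if "cmod z \<le> B" for z
  proof -
    have "max 1 (cmod z / B') = 1" using that B' by (simp add: max_def field_simps)
    then show ?thesis by (simp add: P_def)
  qed
  have \<kappa>cont: "continuous_on UNIV \<kappa>" unfolding \<kappa>_def by (intro continuous_intros)
  have \<kappa>1: "cmod (\<kappa> x) \<le> 1" for x by (simp add: \<kappa>_def)
  have \<kappa>0: "\<kappa> x = 0" if "\<bar>x\<bar> > K + 1" for x using that by (simp add: \<kappa>_def)
  have \<kappa>h: "\<kappa> x * h x = h x" for x using K[of x] by (cases "\<bar>x\<bar> \<le> K") (auto simp: \<kappa>_def min_def)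
  have Gcont: "continuous_on UNIV (G n)" for n unfolding G_def
    by (intro continuous_intros \<kappa>cont continuous_on_compose2[OF Pcont g]) auto
  have GCc: "G n \<in> Cc" for n using Gcont \<kappa>0 unfolding Cc_def G_def by auto
  have Gb: "cmod (G n x) \<le> B'" for n x unfolding G_def norm_mult
    using mult_mono[OF \<kappa>1 Pb[of "g n x"], of x] by simp
  have [measurable]: "G n \<in> borel_measurable lborel" for n using GCc by (rule Cc_measurable)
  have lim2: "(\<lambda>n. h x - G n x) \<longlonglongrightarrow> 0" if "x \<notin> N" for x
  proof -
    have "isCont P (h x)" using Pcont by (simp add: continuous_on_eq_continuous_at)
    then have "(\<lambda>n. P (g n x)) \<longlonglongrightarrow> P (h x)" using isCont_tendsto_compose lim[OF that] by blast
    then have "(\<lambda>n. h x - \<kappa> x * P (g n x)) \<longlonglongrightarrow> h x - \<kappa> x * P (h x)" by (intro tendsto_intros)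
    then show ?thesis using PG[OF B[of x]] \<kappa>h[of x] by (simp add: G_def)
  qed
  have "(\<lambda>n. sq_norm lborel (\<lambda>x. h x - G n x)) \<longlonglongrightarrow> 0"
  proof (rule sq_norm_tendsto_dominated)
    show "sq_integrable lborel (\<lambda>x. indicator {-K - 1..K + 1} x * complex_of_real (B + B'))"
      by (rule sq_integrable_bounded_interval[where B = "B + B'" and K = "K + 1"])
         (use B0 B' in \<open>auto simp: norm_mult indicator_def simp flip: of_real_add\<close>)
    have "N \<in> null_sets lebesgue" using N by (simp add: negligible_iff_null_sets)
    then have "AE x in lebesgue. x \<notin> N" by (rule AE_not_in)
    then have "AE x in lborel. x \<notin> N" by (simp add: AE_completion_iff)
    then show "AE x in lborel. (\<lambda>n. h x - G n x) \<longlonglongrightarrow> 0" by eventually_elim (rule lim2)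
    fix n show "AE x in lborel. cmod (h x - G n x) \<le> cmod (indicator {-K - 1..K + 1} x * complex_of_real (B + B'))"
    proof (rule AE_I2)
      fix x
      have "cmod (h x - G n x) \<le> B + B'" using norm_triangle_ineq4[of "h x" "G n x"] B[of x] Gb[of n x] by linarith
      moreover have "h x - G n x = 0" if "\<bar>x\<bar> > K + 1" using that \<kappa>0 K[of x] by (simp add: G_def)
      ultimately show "cmod (h x - G n x) \<le> cmod (indicator {-K - 1..K + 1} x * complex_of_real (B + B'))"
        using B0 B' by (cases "\<bar>x\<bar> \<le> K + 1") (auto simp: norm_mult indicator_def simp flip: of_real_add)
    qed
  qed measurable
  then have "\<forall>\<^sub>F n in sequentially. sq_norm lborel (\<lambda>x. h x - G n x) < e"
    using order_tendstoD(2) \<open>e > 0\<close> by blast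
  then obtain n where "sq_norm lborel (\<lambda>x. h x - G n x) < e" by (auto simp: eventually_sequentially)
  then show thesis using that GCc by blast
qed

text \<open>Cutting off large arguments and large values reduces this to bounded functions with bounded support.\<close>

lemma Cc_dense:
  fixes h :: "real \<Rightarrow> complex"
  assumes h: "sq_integrable lborel h" and "e > 0"
  obtains g where "g \<in> Cc" "sq_norm lborel (\<lambda>x. h x - g x) < e"
proof -
  note [measurable] = sq_integrable_measurable[OF h]
  define H where "H k x = (if \<bar>x\<bar> \<le> real k \<and> cmod (h x) \<le> real k then h x else 0)" for k x
  have [measurable]: "H k \<in> borel_measurable lborel" for k unfolding H_def by measurable
  have "(\<lambda>k. sq_norm lborel (\<lambda>x. h x - H k x)) \<longlonglongrightarrow> 0"
  proof (rule sq_norm_tendsto_dominated[OF h])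
    show "AE x in lborel. (\<lambda>k. h x - H k x) \<longlonglongrightarrow> 0"
    proof (rule AE_I2, rule tendsto_eventually)
      fix x :: real
      obtain k where "real k \<ge> max \<bar>x\<bar> (cmod (h x))" using real_arch_simple by blast
      then show "\<forall>\<^sub>F k in sequentially. h x - H k x = 0"
        by (intro eventually_sequentiallyI[of k]) (auto simp: H_def)
    qed
    show "AE x in lborel. cmod (h x - H k x) \<le> cmod (h x)" for k by (rule AE_I2) (simp add: H_def)
  qed measurable
  then have "\<forall>\<^sub>F k in sequentially. sq_norm lborel (\<lambda>x. h x - H k x) < e/2"
    using order_tendstoD(2) \<open>e > 0\<close> half_gt_zero by blast
  then obtain k where k: "sq_norm lborel (\<lambda>x. h x - H k x) < e/2" by (auto simp: eventually_sequentially)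
  have Hb: "cmod (H k x) \<le> real k" "\<bar>x\<bar> > real k \<Longrightarrow> H k x = 0" for x by (auto simp: H_def)
  obtain g where g: "g \<in> Cc" "sq_norm lborel (\<lambda>x. H k x - g x) < e/2"
    using Cc_dense_bounded[of "H k" "real k" "real k" "e/2"] Hb \<open>e > 0\<close> by auto
  have "sq_integrable lborel (H k)" by (rule sq_integrable_bounded_interval[OF _ Hb]) auto
  then have "sq_norm lborel (\<lambda>x. h x - g x) < e"
    using sq_norm_triangle_diff[OF h _ Cc_sq_integrable[OF g(1)], of "H k"] k g(2) by simp
  then show thesis using that g(1) by blast
qed

lemma sq_integrable_translate: 
  fixes h :: "real \<Rightarrow> complex"
  assumes "sq_integrable lborel h" shows "sq_integrable lborel (\<lambda>x. h (x + v))"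
  using assms lborel_integrable_real_affine[of "\<lambda>x. (cmod (h x))\<^sup>2" 1 v]
  unfolding sq_integrable_def by (auto simp: add.commute)

lemma sq_norm_translate: 
  fixes h :: "real \<Rightarrow> complex"
  shows "sq_norm lborel (\<lambda>x. h (x + v)) = sq_norm lborel h"
  unfolding sq_norm_def using lborel_integral_real_affine[of 1 "\<lambda>x. (cmod (h x))\<^sup>2" v]
  by (simp add: add.commute)

text \<open>For compactly supported continuous functions this is dominated convergence; density and the
  translation invariance of the norm give the general case.\<close>

lemma sq_norm_translate_continuous:
  fixes h :: "real \<Rightarrow> complex"
  assumes h: "sq_integrable lborel h" and v: "v \<longlonglongrightarrow> 0" "\<And>i::nat. \<bar>v i\<bar> \<le> 1"
  shows "(\<lambda>i. sq_norm lborel (\<lambda>x. h (x + v i) - h x)) \<longlonglongrightarrow> 0"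
proof (rule tendstoI)
  fix e :: real assume "e > 0"
  then obtain g where g: "g \<in> Cc" and hg: "sq_norm lborel (\<lambda>x. h x - g x) < e/3"
    using Cc_dense[OF h, of "e/3"] by auto
  obtain B K where B: "\<And>x. cmod (g x) \<le> B" and K: "\<And>x. \<bar>x\<bar> > K \<Longrightarrow> g x = 0" and B0: "0 \<le> B"
    using Cc_bounded[OF g] by metis
  have gc: "isCont g x" for x using g by (simp add: Cc_def continuous_on_eq_continuous_at)
  have sg: "sq_integrable lborel g" using g by (rule Cc_sq_integrable)
  note [measurable] = Cc_measurable[OF g]
  have "(\<lambda>i. sq_norm lborel (\<lambda>x. g (x + v i) - g x)) \<longlonglongrightarrow> 0"
  proof (rule sq_norm_tendsto_dominated)
    show "sq_integrable lborel (\<lambda>x. indicator {-K - 1..K + 1} x * complex_of_real (B + B))"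
      by (rule sq_integrable_bounded_interval[where B = "B + B" and K = "K + 1"])
         (use B0 in \<open>auto simp: norm_mult indicator_def simp flip: of_real_add\<close>)
    show "AE x in lborel. (\<lambda>i. g (x + v i) - g x) \<longlonglongrightarrow> 0"
    proof (rule AE_I2)
      fix x have "(\<lambda>i. x + v i) \<longlonglongrightarrow> x" using tendsto_add[OF tendsto_const v(1), of x] by simp
      from isCont_tendsto_compose[OF gc this] show "(\<lambda>i. g (x + v i) - g x) \<longlonglongrightarrow> 0"
        by (simp add: LIM_zero_iff)
    qed
    fix i show "AE x in lborel. cmod (g (x + v i) - g x) \<le> cmod (indicator {-K - 1..K + 1} x * complex_of_real (B + B))"
    proof (rule AE_I2)
      fix x
      have "cmod (g (x + v i) - g x) \<le> B + B"
        using norm_triangle_ineq4[of "g (x + v i)" "g x"] B[of x] B[of "x + v i"] by linarith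
      moreover have "g (x + v i) - g x = 0" if "\<bar>x\<bar> > K + 1"
      proof -
        have "\<bar>x\<bar> > K" "\<bar>x + v i\<bar> > K" using that v(2)[of i] by linarith+
        then show ?thesis using K by simp
      qed
      ultimately show "cmod (g (x + v i) - g x) \<le> cmod (indicator {-K - 1..K + 1} x * complex_of_real (B + B))"
        using B0 by (cases "\<bar>x\<bar> \<le> K + 1") (auto simp: norm_mult indicator_def simp flip: of_real_add)
    qed
  qed measurable
  then have "\<forall>\<^sub>F i in sequentially. sq_norm lborel (\<lambda>x. g (x + v i) - g x) < e/3"
    by (rule order_tendstoD(2)) (use \<open>e > 0\<close> in simp)
  then show "\<forall>\<^sub>F i in sequentially. dist (sq_norm lborel (\<lambda>x. h (x + v i) - h x)) 0 < e"
  proof eventually_elim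
    case (elim i)
    note st = sq_integrable_translate
    have "sq_norm lborel (\<lambda>x. h (x + v i) - h x)
      \<le> sq_norm lborel (\<lambda>x. h (x + v i) - g (x + v i)) + sq_norm lborel (\<lambda>x. g (x + v i) - h x)"
      by (intro sq_norm_triangle_diff st h sg)
    also have "sq_norm lborel (\<lambda>x. g (x + v i) - h x)
      \<le> sq_norm lborel (\<lambda>x. g (x + v i) - g x) + sq_norm lborel (\<lambda>x. g x - h x)"
      by (intro sq_norm_triangle_diff st h sg)
    also have "sq_norm lborel (\<lambda>x. h (x + v i) - g (x + v i)) = sq_norm lborel (\<lambda>x. h x - g x)"
      using sq_norm_translate[of "\<lambda>x. h x - g x" "v i"] .
    also have "sq_norm lborel (\<lambda>x. g x - h x) = sq_norm lborel (\<lambda>x. h x - g x)" by (rule sq_norm_uminus_diff)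
    finally show ?case using hg elim by simp
  qed
qed

interpretation N01: prob_space std_normal_distribution
  by (rule prob_space_normal_density) simp

lemma std_normal_integral:
  fixes f :: "real \<Rightarrow> complex"
  assumes "f \<in> borel_measurable borel"
  shows "(\<integral>x. f x \<partial>std_normal_distribution) = (\<integral>x. std_normal_density x *\<^sub>R f x \<partial>lborel)"
  using assms by (subst integral_density) (auto simp: normal_density_nonneg)

text \<open>The phase is that of \<open>R_adj\<close>, and there is no factor \<open>1 / sqrt (2 pi)\<close>.\<close>

definition fourier :: "(real \<Rightarrow> complex) \<Rightarrow> real \<Rightarrow> complex" where
  "fourier h x = (\<integral>t. cis (x * t) * h t \<partial>lborel)"

lemma borel_measurable_cis [measurable (raw)]:
  "f \<in> borel_measurable M \<Longrightarrow> (\<lambda>x. cis (f x)) \<in> borel_measurable M"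
  by (rule measurable_compose[of f M borel cis])
     (auto intro!: borel_measurable_continuous_onI continuous_intros simp: cis_conv_exp)

lemma fourier_measurable [measurable]:
  assumes [measurable]: "h \<in> borel_measurable lborel"
  shows "fourier h \<in> borel_measurable borel"
proof -
  have "(\<lambda>x. \<integral>t. (case (x, t) of (x, t) \<Rightarrow> cis (x * t) * h t) \<partial>lborel) \<in> borel_measurable (borel :: real measure)"
    by (rule lborel.borel_measurable_lebesgue_integral) (simp add: split_beta')
  then show ?thesis unfolding fourier_def by simp
qed

lemma norm_fourier_le:
  assumes "integrable lborel h"
  shows "cmod (fourier h x) \<le> (\<integral>t. cmod (h t) \<partial>lborel)"
  unfolding fourier_def using integral_norm_bound[of lborel "\<lambda>t. cis (x * t) * h t"]
  by (simp add: norm_mult)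

lemma integral_gauss_cis:
  "(\<integral>x. cis (x * a) \<partial>std_normal_distribution) = complex_of_real (exp (- a\<^sup>2 / 2))"
  using fun_cong[OF char_std_normal_distribution, of a]
  by (simp add: char_def cis_conv_exp mult.commute mult.left_commute)

text \<open>This justifies the interchanges of integrals against a finite measure in the next proof.\<close>

lemma integrable_pair_bounded_mult:
  fixes h :: "'a \<Rightarrow> complex" and b :: "'a \<Rightarrow> 'b \<Rightarrow> complex"
  assumes "sigma_finite_measure M" "finite_measure N" "integrable M h"
    and [measurable]: "case_prod b \<in> borel_measurable (M \<Otimes>\<^sub>M N)"
    and b: "\<And>x y. cmod (b x y) \<le> C"
  shows "integrable (M \<Otimes>\<^sub>M N) (\<lambda>(x, y). h x * b x y)"
proof -
  interpret M: sigma_finite_measure M by fact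
  interpret N: finite_measure N by fact
  interpret pair_sigma_finite M N ..
  note [measurable] = borel_measurable_integrable[OF assms(3)]
  have b': "(\<lambda>p. b (fst p) (snd p)) \<in> borel_measurable (M \<Otimes>\<^sub>M N)"
    using assms(4) by (simp add: split_beta')
  have int: "integrable (M \<Otimes>\<^sub>M N) (\<lambda>(x, y). h x)"
  proof (rule Fubini_integrable)
    show "integrable M (\<lambda>x. \<integral>y. norm (case (x, y) of (x, y) \<Rightarrow> h x) \<partial>N)"
      using assms(3) by simp
  qed auto
  show ?thesis
  proof (rule Bochner_Integration.integrable_bound)
    show "integrable (M \<Otimes>\<^sub>M N) (\<lambda>p. complex_of_real C * (case p of (x, y) \<Rightarrow> h x))"
      by (intro integrable_mult_right int)
    show "(\<lambda>(x, y). h x * b x y) \<in> borel_measurable (M \<Otimes>\<^sub>M N)"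
      unfolding split_beta' using b' by measurable
    have "0 \<le> C" using b order_trans[OF norm_ge_zero] by blast
    then show "AE p in M \<Otimes>\<^sub>M N. norm (case p of (x, y) \<Rightarrow> h x * b x y)
        \<le> norm (complex_of_real C * (case p of (x, y) \<Rightarrow> h x))"
      using b by (auto simp: norm_mult mult.commute[of C] intro!: AE_I2 mult_left_mono)
  qed
qed

text \<open>Written as a double integral, \<open>\<bar>fourier h\<bar>\<^sup>2\<close> contains \<open>x\<close> only in the phase \<open>cis (x (s - t) / \<epsilon>)\<close>, and
  the normal distribution averages this to its characteristic function at \<open>(s - t) / \<epsilon>\<close>. What is
  left depends on the autocorrelation of \<open>h\<close> at \<open>v = s - t\<close> alone.\<close>

lemma gaussian_mean_fourier:
  fixes \<epsilon> :: real
  assumes h: "integrable lborel h" and \<epsilon>: "\<epsilon> > 0"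
  defines "\<psi> \<equiv> \<lambda>v. complex_of_real (exp (- (v / \<epsilon>)\<^sup>2 / 2))"
  shows "(\<integral>x. complex_of_real ((cmod (fourier h (x / \<epsilon>)))\<^sup>2) \<partial>std_normal_distribution)
    = (\<integral>v. \<psi> v * (\<integral>t. h (t + v) * cnj (h t) \<partial>lborel) \<partial>lborel)"
proof -
  let ?N = "std_normal_distribution"
  note [measurable] = borel_measurable_integrable[OF h]
  have hm[measurable]: "h \<in> borel_measurable borel" using borel_measurable_integrable[OF h] by simp
  define A where "A = (\<integral>t. cmod (h t) \<partial>lborel)"
  have A: "cmod (fourier h x) \<le> A" for x unfolding A_def by (rule norm_fourier_le[OF h])
  have hc: "integrable lborel (\<lambda>t. cnj (h t))" using h by simp
  interpret LN: pair_sigma_finite lborel ?N ..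
  have fm[measurable]: "fourier h \<in> borel_measurable borel" by (rule fourier_measurable) simp
  have fc: "cnj (fourier h x) = (\<integral>t. cnj (h t) * cis (- (x * t)) \<partial>lborel)" for x
    unfolding fourier_def Bochner_Integration.integral_cnj[symmetric] by (simp add: mult.commute cis_cnj)
  have bm: "(\<lambda>p::real\<times>real. cis (- (snd p / \<epsilon> * fst p)) * fourier h (snd p / \<epsilon>)) \<in> borel_measurable (lborel \<Otimes>\<^sub>M ?N)"
    by measurable
  have "(\<integral>x. complex_of_real ((cmod (fourier h (x / \<epsilon>)))\<^sup>2) \<partial>?N)
     = (\<integral>x. (\<integral>t. cnj (h t) * (cis (- (x / \<epsilon> * t)) * fourier h (x / \<epsilon>)) \<partial>lborel) \<partial>?N)"
  proof (rule Bochner_Integration.integral_cong[OF refl])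
    fix x
    have "complex_of_real ((cmod (fourier h (x / \<epsilon>)))\<^sup>2) = cnj (fourier h (x / \<epsilon>)) * fourier h (x / \<epsilon>)"
      unfolding complex_norm_square by (rule mult.commute)
    also have "\<dots> = (\<integral>t. cnj (h t) * cis (- (x / \<epsilon> * t)) * fourier h (x / \<epsilon>) \<partial>lborel)"
      unfolding fc by simp
    finally show "complex_of_real ((cmod (fourier h (x / \<epsilon>)))\<^sup>2)
      = (\<integral>t. cnj (h t) * (cis (- (x / \<epsilon> * t)) * fourier h (x / \<epsilon>)) \<partial>lborel)" by (simp add: mult.assoc)
  qed
  also have "\<dots> = (\<integral>t. (\<integral>x. cnj (h t) * (cis (- (x / \<epsilon> * t)) * fourier h (x / \<epsilon>)) \<partial>?N) \<partial>lborel)"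
    by (rule LN.Fubini_integral, rule integrable_pair_bounded_mult[OF _ _ hc])
       (use bm A in \<open>auto simp: norm_mult split_beta' intro: N01.finite_measure_axioms lborel.sigma_finite_measure_axioms\<close>)
  also have "\<dots> = (\<integral>t. cnj (h t) * (\<integral>s. h s * \<psi> (s - t) \<partial>lborel) \<partial>lborel)"
  proof (rule Bochner_Integration.integral_cong[OF refl])
    fix t
    have bm2: "(\<lambda>p::real\<times>real. cis ((fst p - t) / \<epsilon> * snd p)) \<in> borel_measurable (lborel \<Otimes>\<^sub>M ?N)"
      by measurable
    have "(\<integral>x. cis (- (x / \<epsilon> * t)) * fourier h (x / \<epsilon>) \<partial>?N)
       = (\<integral>x. (\<integral>s. h s * cis ((s - t) / \<epsilon> * x) \<partial>lborel) \<partial>?N)"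
    proof (rule Bochner_Integration.integral_cong[OF refl])
      fix x
      have "cis (- (x / \<epsilon> * t)) * fourier h (x / \<epsilon>) = (\<integral>s. cis (- (x / \<epsilon> * t)) * (cis (x / \<epsilon> * s) * h s) \<partial>lborel)"
        unfolding fourier_def by simp
      also have "\<dots> = (\<integral>s. h s * cis ((s - t) / \<epsilon> * x) \<partial>lborel)"
      proof (rule Bochner_Integration.integral_cong[OF refl])
        fix s
        have "(s - t) / \<epsilon> * x = - (x / \<epsilon> * t) + x / \<epsilon> * s" by (simp add: algebra_simps diff_divide_distrib)
        then show "cis (- (x / \<epsilon> * t)) * (cis (x / \<epsilon> * s) * h s) = h s * cis ((s - t) / \<epsilon> * x)"
          by (simp add: cis_mult mult.assoc[symmetric] mult.commute[of "h s"])
      qed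
      finally show "cis (- (x / \<epsilon> * t)) * fourier h (x / \<epsilon>) = (\<integral>s. h s * cis ((s - t) / \<epsilon> * x) \<partial>lborel)" .
    qed
    also have "\<dots> = (\<integral>s. (\<integral>x. h s * cis ((s - t) / \<epsilon> * x) \<partial>?N) \<partial>lborel)"
      by (rule LN.Fubini_integral, rule integrable_pair_bounded_mult[OF _ _ h])
         (use bm2 in \<open>auto simp: norm_mult split_beta' intro: N01.finite_measure_axioms lborel.sigma_finite_measure_axioms\<close>)
    also have "\<dots> = (\<integral>s. h s * \<psi> (s - t) \<partial>lborel)"
    proof (rule Bochner_Integration.integral_cong[OF refl])
      fix s
      have "(\<integral>x. cis ((s - t) / \<epsilon> * x) \<partial>?N) = \<psi> (s - t)"
        using integral_gauss_cis[of "(s - t) / \<epsilon>"] by (simp only: \<psi>_def mult.commute)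
      then show "(\<integral>x. h s * cis ((s - t) / \<epsilon> * x) \<partial>?N) = h s * \<psi> (s - t)" by simp
    qed
    finally show "(\<integral>x. cnj (h t) * (cis (- (x / \<epsilon> * t)) * fourier h (x / \<epsilon>)) \<partial>?N)
      = cnj (h t) * (\<integral>s. h s * \<psi> (s - t) \<partial>lborel)" by simp
  qed
  also have "\<dots> = (\<integral>t. (\<integral>v. \<psi> v * (h (t + v) * cnj (h t)) \<partial>lborel) \<partial>lborel)"
  proof (rule Bochner_Integration.integral_cong[OF refl])
    fix t
    have "(\<integral>s. h s * \<psi> (s - t) \<partial>lborel) = (\<integral>v. h (t + v) * \<psi> v \<partial>lborel)"
      using lborel_integral_real_affine[of 1 "\<lambda>s. h s * \<psi> (s - t)" t] by simp
    then show "cnj (h t) * (\<integral>s. h s * \<psi> (s - t) \<partial>lborel) = (\<integral>v. \<psi> v * (h (t + v) * cnj (h t)) \<partial>lborel)"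
      by (simp add: ac_simps flip: integral_mult_right_zero)
  qed
  also have "\<dots> = (\<integral>v. (\<integral>t. \<psi> v * (h (t + v) * cnj (h t)) \<partial>lborel) \<partial>lborel)"
  proof (rule lborel_pair.Fubini_integral[symmetric])
    have hh: "integrable lborel (\<lambda>v. h (t + v))" for t
      using lborel_integrable_real_affine[OF h, of 1 t] by simp
    have m1: "(\<lambda>p::real\<times>real. \<psi> (snd p) * (h (fst p + snd p) * cnj (h (fst p)))) \<in> borel_measurable (lborel \<Otimes>\<^sub>M lborel)"
      unfolding \<psi>_def by measurable
    have ps: "cmod (\<psi> v) \<le> 1" for v by (simp add: \<psi>_def)
    have pm[measurable]: "\<psi> \<in> borel_measurable lborel" unfolding \<psi>_def by measurable
    have i1: "integrable lborel (\<lambda>v. \<psi> v * (h (t + v) * cnj (h t)))" for t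
    proof (rule Bochner_Integration.integrable_bound)
      show "integrable lborel (\<lambda>v. h (t + v) * cnj (h t))" using hh[of t] by (rule integrable_mult_left)
      show "AE v in lborel. norm (\<psi> v * (h (t + v) * cnj (h t))) \<le> norm (h (t + v) * cnj (h t))"
        using ps by (auto simp: norm_mult mult_left_le_one_le)
    qed (use hm pm in measurable)
    show "integrable (lborel \<Otimes>\<^sub>M lborel) (\<lambda>(t, v). \<psi> v * (h (t + v) * cnj (h t)))"
    proof (rule lborel_pair.Fubini_integrable)
      show "(\<lambda>(t, v). \<psi> v * (h (t + v) * cnj (h t))) \<in> borel_measurable (lborel \<Otimes>\<^sub>M lborel)"
        using m1 by (simp add: split_beta')
      show "integrable lborel (\<lambda>t. \<integral>v. norm (case (t, v) of (t, v) \<Rightarrow> \<psi> v * (h (t + v) * cnj (h t))) \<partial>lborel)"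
      proof (rule Bochner_Integration.integrable_bound)
        show "integrable lborel (\<lambda>t. A * cmod (h t))" using h by simp
        show "(\<lambda>t. \<integral>v. norm (case (t, v) of (t, v) \<Rightarrow> \<psi> v * (h (t + v) * cnj (h t))) \<partial>lborel) \<in> borel_measurable lborel"
          by (rule lborel.borel_measurable_lebesgue_integral) (use m1 in \<open>simp add: split_beta'\<close>)
        show "AE t in lborel. norm (\<integral>v. norm (case (t, v) of (t, v) \<Rightarrow> \<psi> v * (h (t + v) * cnj (h t))) \<partial>lborel)
            \<le> norm (A * cmod (h t))"
        proof (rule AE_I2)
          fix t
          have "(\<integral>v. norm (\<psi> v * (h (t + v) * cnj (h t))) \<partial>lborel) \<le> (\<integral>v. cmod (h (t + v)) * cmod (h t) \<partial>lborel)"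
          proof (rule integral_mono)
            show "integrable lborel (\<lambda>v. norm (\<psi> v * (h (t + v) * cnj (h t))))" using i1 by simp
            show "integrable lborel (\<lambda>v. cmod (h (t + v)) * cmod (h t))" using hh[of t] by (intro integrable_mult_left integrable_norm)
            show "norm (\<psi> v * (h (t + v) * cnj (h t))) \<le> cmod (h (t + v)) * cmod (h t)" for v
              using ps[of v] by (simp add: norm_mult mult_left_le_one_le)
          qed
          also have "\<dots> = A * cmod (h t)"
            unfolding A_def using lborel_integral_real_affine[of 1 "\<lambda>s. cmod (h s)" t] by simp
          finally have "(\<integral>v. norm (\<psi> v * (h (t + v) * cnj (h t))) \<partial>lborel) \<le> A * cmod (h t)" .
          moreover have "0 \<le> A * cmod (h t)" unfolding A_def by (simp add: integral_nonneg_AE)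
          ultimately show "norm (\<integral>v. norm (case (t, v) of (t, v) \<Rightarrow> \<psi> v * (h (t + v) * cnj (h t))) \<partial>lborel)
            \<le> norm (A * cmod (h t))" by (simp add: integral_nonneg_AE)
        qed
      qed
    qed (use i1 in auto)
  qed
  finally show ?thesis by simp
qed

text \<open>In the preceding identity, rescaled, let \<open>\<epsilon>\<close> tend to \<open>0\<close>. On the Fourier side the Gaussian weights
  increase to \<open>1\<close>. On the other side the mean concentrates at the value of the autocorrelation at
  \<open>0\<close>, which is the squared norm of \<open>h\<close>; the autocorrelation is continuous there because
  translation is continuous in \<open>L\<^sub>2\<close>.\<close>

theorem Plancherel:
  assumes h: "integrable lborel h" "sq_integrable lborel h"
  shows "(\<integral>\<^sup>+x. ennreal ((cmod (fourier h x))\<^sup>2) \<partial>lborel) = ennreal (2 * pi * (sq_norm lborel h)\<^sup>2)"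
proof -
  let ?N = "std_normal_distribution"
  define C where "C v = (\<integral>t. h (t + v) * cnj (h t) \<partial>lborel)" for v
  define \<epsilon> where "\<epsilon> i = 1 / real (Suc i)" for i
  have \<epsilon>: "\<epsilon> i > 0" for i by (simp add: \<epsilon>_def)
  have hm[measurable]: "h \<in> borel_measurable borel" using sq_integrable_measurable[OF h(2)] by simp
  have fm[measurable]: "fourier h \<in> borel_measurable borel" by (rule fourier_measurable) simp
  have Cm[measurable]: "C \<in> borel_measurable borel"
  proof -
    have "(\<lambda>v. \<integral>t. (case (v, t) of (v, t) \<Rightarrow> h (t + v) * cnj (h t)) \<partial>lborel) \<in> borel_measurable (borel :: real measure)"
      by (rule lborel.borel_measurable_lebesgue_integral) (simp add: split_beta')
    then show ?thesis unfolding C_def by simp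
  qed
  have Cb: "cmod (C v) \<le> (sq_norm lborel h)\<^sup>2" for v
    using sq_inner_Cauchy_Schwarz[OF sq_integrable_translate[OF h(2), of v] h(2)]
    by (simp add: C_def sq_inner_def sq_norm_translate power2_eq_square)
  have Clim: "(\<lambda>i. C (v i)) \<longlonglongrightarrow> complex_of_real ((sq_norm lborel h)\<^sup>2)" if "v \<longlonglongrightarrow> 0" for v
  proof -
    \<comment> \<open>clamping to \<open>[-1, 1]\<close> changes only finitely many terms\<close>
    define w where "w i = max (-1) (min 1 (v i))" for i
    have "(\<lambda>i. max (-1) (min 1 (v i))) \<longlonglongrightarrow> max (-1) (min 1 0)" by (intro tendsto_intros that)
    then have w: "w \<longlonglongrightarrow> 0" "\<And>i. \<bar>w i\<bar> \<le> 1" unfolding w_def by (auto simp: abs_le_iff)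
    have "(\<lambda>i. sq_inner lborel (\<lambda>x. h (x + w i)) h) \<longlonglongrightarrow> sq_inner lborel h h"
      by (rule sq_inner_tendsto_left[OF h(2) h(2)])
         (intro always_eventually allI sq_integrable_translate sq_norm_translate_continuous h w)+
    then have "(\<lambda>i. C (w i)) \<longlonglongrightarrow> complex_of_real ((sq_norm lborel h)\<^sup>2)"
      unfolding C_def sq_inner_self by (simp add: sq_inner_def)
    moreover have "\<forall>\<^sub>F i in sequentially. C (w i) = C (v i)"
    proof -
      have "\<forall>\<^sub>F i in sequentially. \<bar>v i\<bar> < 1" using that order_tendstoD(2)[OF tendsto_rabs[OF that], of 1] by simp
      then show ?thesis by eventually_elim (simp add: w_def)
    qed
    ultimately show ?thesis using Lim_transform_eventually by fast
  qed
  define F where "F x = (cmod (fourier h x))\<^sup>2" for x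
  have Fm[measurable]: "F \<in> borel_measurable borel" unfolding F_def by measurable
  obtain A where A: "\<And>x. F x \<le> A\<^sup>2"
    unfolding F_def using norm_fourier_le[OF h(1)] power_mono[OF _ norm_ge_zero] by metis
  have eq: "(\<integral>x. exp (- (\<epsilon> i * x)\<^sup>2 / 2) * F x \<partial>lborel) = 2 * pi * Re (\<integral>u. C (\<epsilon> i * u) \<partial>?N)" for i
  proof -
    have n: "std_normal_density x = exp (- x\<^sup>2 / 2) / sqrt (2 * pi)" for x by (simp add: std_normal_density_def)
    have "(\<integral>x. complex_of_real (F (x / \<epsilon> i)) \<partial>?N) = (\<integral>x. complex_of_real (std_normal_density x * F (x / \<epsilon> i)) \<partial>lborel)"
      by (subst std_normal_integral) (auto simp: scaleR_conv_of_real)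
    also have "\<dots> = complex_of_real (\<epsilon> i * (\<integral>x. std_normal_density (\<epsilon> i * x) * F x \<partial>lborel))"
      unfolding integral_complex_of_real
      using lborel_integral_real_affine[of "\<epsilon> i" "\<lambda>x. std_normal_density x * F (x / \<epsilon> i)" 0] \<epsilon>[of i] by simp
    finally have 1: "(\<integral>x. complex_of_real (F (x / \<epsilon> i)) \<partial>?N)
      = complex_of_real (\<epsilon> i / sqrt (2 * pi) * (\<integral>x. exp (- (\<epsilon> i * x)\<^sup>2 / 2) * F x \<partial>lborel))"
      unfolding n by (simp add: field_simps)
    have "(\<integral>v. complex_of_real (exp (- (v / \<epsilon> i)\<^sup>2 / 2)) * C v \<partial>lborel)
        = \<epsilon> i *\<^sub>R (\<integral>u. complex_of_real (exp (- u\<^sup>2 / 2)) * C (\<epsilon> i * u) \<partial>lborel)"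
      using lborel_integral_real_affine[of "\<epsilon> i" "\<lambda>v. complex_of_real (exp (- (v / \<epsilon> i)\<^sup>2 / 2)) * C v" 0] \<epsilon>[of i] by simp
    also have "\<dots> = complex_of_real (\<epsilon> i * sqrt (2 * pi)) * (\<integral>u. C (\<epsilon> i * u) \<partial>?N)"
    proof -
      have "(\<integral>u. C (\<epsilon> i * u) \<partial>?N) = (\<integral>u. (1 / sqrt (2 * pi)) *\<^sub>R (complex_of_real (exp (- u\<^sup>2 / 2)) * C (\<epsilon> i * u)) \<partial>lborel)"
        by (subst std_normal_integral) (auto simp: n scaleR_conv_of_real field_simps)
      then show ?thesis by (simp add: scaleR_conv_of_real)
    qed
    finally have 2: "(\<integral>v. complex_of_real (exp (- (v / \<epsilon> i)\<^sup>2 / 2)) * C v \<partial>lborel)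
       = complex_of_real (\<epsilon> i * sqrt (2 * pi)) * (\<integral>u. C (\<epsilon> i * u) \<partial>?N)" .
    have "complex_of_real (\<epsilon> i / sqrt (2 * pi) * (\<integral>x. exp (- (\<epsilon> i * x)\<^sup>2 / 2) * F x \<partial>lborel))
      = complex_of_real (\<epsilon> i * sqrt (2 * pi)) * (\<integral>u. C (\<epsilon> i * u) \<partial>?N)"
      unfolding 1[symmetric] 2[symmetric] unfolding C_def F_def by (rule gaussian_mean_fourier[OF h(1) \<epsilon>])
    moreover have "complex_of_real a = complex_of_real b * z \<Longrightarrow> a = b * Re z" for a b z
      by (auto simp: complex_eq_iff)
    ultimately have "\<epsilon> i / sqrt (2 * pi) * (\<integral>x. exp (- (\<epsilon> i * x)\<^sup>2 / 2) * F x \<partial>lborel)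
      = \<epsilon> i * sqrt (2 * pi) * Re (\<integral>u. C (\<epsilon> i * u) \<partial>?N)"
      by blast
    then have "(\<integral>x. exp (- (\<epsilon> i * x)\<^sup>2 / 2) * F x \<partial>lborel)
      = sqrt (2 * pi) * sqrt (2 * pi) * Re (\<integral>u. C (\<epsilon> i * u) \<partial>?N)"
      using \<epsilon>[of i] by (simp add: field_simps)
    then show ?thesis by simp
  qed
  have int: "integrable lborel (\<lambda>x. exp (- (\<epsilon> i * x)\<^sup>2 / 2) * F x)" for i
  proof (rule Bochner_Integration.integrable_bound)
    have "integrable lborel (\<lambda>x. std_normal_density (0 + \<epsilon> i * x))"
      using \<epsilon>[of i] by (intro lborel_integrable_real_affine) auto
    then show "integrable lborel (\<lambda>x. (sqrt (2 * pi) * A\<^sup>2) * std_normal_density (\<epsilon> i * x))" by simp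
    show "AE x in lborel. norm (exp (- (\<epsilon> i * x)\<^sup>2 / 2) * F x) \<le> norm ((sqrt (2 * pi) * A\<^sup>2) * std_normal_density (\<epsilon> i * x))"
      using A by (auto simp: std_normal_density_def F_def abs_mult mult.commute intro!: AE_I2 mult_left_mono)
  qed measurable
  have "(\<lambda>i. \<integral>u. C (\<epsilon> i * u) \<partial>?N) \<longlonglongrightarrow> (\<integral>u. complex_of_real ((sq_norm lborel h)\<^sup>2) \<partial>?N)"
  proof (rule integral_dominated_convergence)
    show "integrable ?N (\<lambda>u. (sq_norm lborel h)\<^sup>2)" by simp
    show "AE u in ?N. (\<lambda>i. C (\<epsilon> i * u)) \<longlonglongrightarrow> complex_of_real ((sq_norm lborel h)\<^sup>2)"
    proof (rule AE_I2)
      fix u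
      have "\<epsilon> \<longlonglongrightarrow> 0" unfolding \<epsilon>_def by (rule LIMSEQ_Suc[OF lim_1_over_n])
      from tendsto_mult_right[OF this, of u] show "(\<lambda>i. C (\<epsilon> i * u)) \<longlonglongrightarrow> complex_of_real ((sq_norm lborel h)\<^sup>2)"
        by (intro Clim) simp
    qed
  qed (use Cb in auto)
  then have "(\<lambda>i. 2 * pi * Re (\<integral>u. C (\<epsilon> i * u) \<partial>?N)) \<longlonglongrightarrow> 2 * pi * Re (complex_of_real ((sq_norm lborel h)\<^sup>2))"
    using N01.prob_space by (intro tendsto_intros) simp
  then have l1: "(\<lambda>i. ennreal (\<integral>x. exp (- (\<epsilon> i * x)\<^sup>2 / 2) * F x \<partial>lborel)) \<longlonglongrightarrow> ennreal (2 * pi * (sq_norm lborel h)\<^sup>2)"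
    unfolding eq by (intro tendsto_ennrealI) simp
  have l2: "(\<lambda>i. \<integral>\<^sup>+x. ennreal (exp (- (\<epsilon> i * x)\<^sup>2 / 2) * F x) \<partial>lborel) \<longlonglongrightarrow> (\<integral>\<^sup>+x. ennreal (F x) \<partial>lborel)"
  proof (rule nn_integral_LIMSEQ)
    show "incseq (\<lambda>i x. ennreal (exp (- (\<epsilon> i * x)\<^sup>2 / 2) * F x))"
    proof (rule incseq_SucI, rule le_funI)
      fix i and x :: real
      have "\<epsilon> (Suc i) \<le> \<epsilon> i" by (simp add: \<epsilon>_def field_simps)
      then have "(\<epsilon> (Suc i) * x)\<^sup>2 \<le> (\<epsilon> i * x)\<^sup>2"
        unfolding power_mult_distrib using \<epsilon>[of "Suc i"] by (intro mult_right_mono power_mono) auto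
      then show "ennreal (exp (- (\<epsilon> i * x)\<^sup>2 / 2) * F x) \<le> ennreal (exp (- (\<epsilon> (Suc i) * x)\<^sup>2 / 2) * F x)"
        by (intro ennreal_leI mult_right_mono) (auto simp: F_def)
    qed
    fix x :: real
    have "\<epsilon> \<longlonglongrightarrow> 0" unfolding \<epsilon>_def by (rule LIMSEQ_Suc[OF lim_1_over_n])
    then have "(\<lambda>i. exp (- (\<epsilon> i * x)\<^sup>2 / 2) * F x) \<longlonglongrightarrow> exp (- (0 * x)\<^sup>2 / 2) * F x" by (intro tendsto_intros) auto
    then show "(\<lambda>i. ennreal (exp (- (\<epsilon> i * x)\<^sup>2 / 2) * F x)) \<longlonglongrightarrow> ennreal (F x)"
      by (intro tendsto_ennrealI) simp
  qed measurable
  have "(\<integral>\<^sup>+x. ennreal (exp (- (\<epsilon> i * x)\<^sup>2 / 2) * F x) \<partial>lborel) = ennreal (\<integral>x. exp (- (\<epsilon> i * x)\<^sup>2 / 2) * F x \<partial>lborel)" for i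
    by (rule nn_integral_eq_integral[OF int]) (auto simp: F_def)
  then show ?thesis using LIMSEQ_unique[OF l2] l1 unfolding F_def by simp
qed

section \<open>Integrals over the half-line\<close>

abbreviation halfline :: "real measure" where
  "halfline \<equiv> restrict_space lborel {0<..}"

lemma space_halfline [simp]: "space halfline = {0<..}"
  by (simp add: space_restrict_space)

lemma halfline_measurable:
  "f \<in> borel_measurable borel \<Longrightarrow> f \<in> borel_measurable halfline"
  by (rule measurable_restrict_space1) simp

lemma nn_integral_halfline_scale:
  assumes [measurable]: "f \<in> borel_measurable borel" and c: "c > 0"
  shows "(\<integral>\<^sup>+x. f x \<partial>halfline) = ennreal c * (\<integral>\<^sup>+x. f (c * x) \<partial>halfline)"
proof -
  have "(\<integral>\<^sup>+x. f x \<partial>halfline) = ennreal c * (\<integral>\<^sup>+x. f (c * x) * indicator {0<..} (c * x) \<partial>lborel)"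
    using c nn_integral_real_affine[of "\<lambda>x. f x * indicator {0<..} x" c 0]
    by (simp add: nn_integral_restrict_space)
  also have "(\<lambda>x. f (c * x) * indicator {0<..} (c * x)) = (\<lambda>x. f (c * x) * indicator {0<..} x)"
    using c by (intro ext) (simp add: indicator_def zero_less_mult_iff)
  finally show ?thesis by (simp add: nn_integral_restrict_space)
qed

lemma integrable_halfline_scale:
  fixes f :: "real \<Rightarrow> 'a :: {banach, second_countable_topology}"
  assumes c: "c > 0"
  shows "integrable halfline (\<lambda>x. f (c * x)) \<longleftrightarrow> integrable halfline f"
proof -
  have "(\<lambda>x. indicator {0<..} (c * x) *\<^sub>R f (c * x)) = (\<lambda>x. indicator {0<..} x *\<^sub>R f (c * x))"
    using c by (intro ext) (simp add: indicator_def zero_less_mult_iff)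
  then show ?thesis
    using lborel_integrable_real_affine_iff[of c "\<lambda>x. indicator {0<..} x *\<^sub>R f x" 0] c
    by (simp add: integrable_restrict_space)
qed

lemma has_bochner_integral_power_exp:
  "has_bochner_integral halfline (\<lambda>t::real. t ^ k * exp (- t)) (fact k)"
proof (rule has_bochner_integral_nn_integral)
  have "(\<integral>\<^sup>+t. ennreal (t ^ k * exp (- t)) \<partial>halfline)
      = (\<integral>\<^sup>+t. ennreal (t ^ k * exp (- t)) * indicator {0..} t \<partial>lborel)"
  proof (subst nn_integral_restrict_space)
    show "(\<integral>\<^sup>+t. ennreal (t ^ k * exp (- t)) * indicator {0<..} t \<partial>lborel)
      = (\<integral>\<^sup>+t. ennreal (t ^ k * exp (- t)) * indicator {0..} t \<partial>lborel)"
      using AE_lborel_singleton[of "0::real"]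
      by (rule nn_integral_cong_AE[OF eventually_mono]) (auto simp: indicator_def)
  qed simp
  then show "(\<integral>\<^sup>+t. ennreal (t ^ k * exp (- t)) \<partial>halfline) = ennreal (fact k)"
    using nn_intergal_power_times_exp_Ici[of k] by (simp add: ennreal_of_nat_eq_real_of_nat)
  show "AE t in halfline. 0 \<le> t ^ k * exp (- t)" by (rule AE_I2) simp
qed (auto intro!: halfline_measurable)

lemma integrable_power_exp:
  assumes "c > 0" shows "integrable halfline (\<lambda>t::real. t ^ k * exp (- c * t))"
proof -
  have "integrable halfline (\<lambda>t. (c * t) ^ k * exp (- (c * t)))"
    using integrable_halfline_scale[OF assms, of "\<lambda>t. t ^ k * exp (- t)"] has_bochner_integral_power_exp[of k]
    by (simp add: has_bochner_integral_iff)
  then have "integrable halfline (\<lambda>t. (1 / c ^ k) * ((c * t) ^ k * exp (- (c * t))))" by simp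
  then show ?thesis using assms by (simp add: power_mult_distrib)
qed

lemma integrable_cpower_exp:
  fixes c :: complex assumes "Re c > 0"
  shows "integrable halfline (\<lambda>t. of_real t ^ k * exp (- c * of_real t))"
proof (rule Bochner_Integration.integrable_bound[OF integrable_power_exp[OF assms, of k]])
  show "AE t in halfline. norm (of_real t ^ k * exp (- c * of_real t)) \<le> norm (t ^ k * exp (- Re c * t))"
    by (rule AE_I2) (simp add: norm_mult norm_power)
qed (auto intro!: halfline_measurable)

lemma tendsto_cpower_exp:
  fixes c :: complex assumes "Re c > 0"
  shows "((\<lambda>t::real. of_real t ^ k * exp (- c * of_real t)) \<longlongrightarrow> 0) at_top"
proof (rule Lim_null_comparison)
  show "\<forall>\<^sub>F t in at_top. norm (of_real t ^ k * exp (- c * of_real t)) \<le> (1 / Re c ^ k) * ((Re c * t) ^ k / exp (Re c * t))"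
    using eventually_gt_at_top[of "0::real"]
  proof eventually_elim
    case (elim t)
    have "norm (of_real t ^ k * exp (- c * of_real t)) = t ^ k * exp (- (Re c * t))"
      using elim by (simp add: norm_mult norm_power)
    also have "\<dots> = (1 / Re c ^ k) * ((Re c * t) ^ k / exp (Re c * t))"
      using assms by (simp add: power_mult_distrib exp_minus divide_simps)
    finally show ?case by simp
  qed
  have "((\<lambda>t. (Re c * t) ^ k / exp (Re c * t)) \<longlongrightarrow> 0) at_top"
    by (rule filterlim_compose[OF tendsto_power_div_exp_0])
       (use assms in \<open>simp add: filterlim_tendsto_pos_mult_at_top[OF tendsto_const _ filterlim_ident]\<close>)
  from tendsto_mult_left[OF this, of "1 / Re c ^ k"]
  show "((\<lambda>t. (1 / Re c ^ k) * ((Re c * t) ^ k / exp (Re c * t))) \<longlongrightarrow> 0) at_top" by simp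
qed

text \<open>The derivative of \<open>t\<^sup>k e\<^sup>-\<^sup>c\<^sup>t\<close> integrates to its boundary values, which gives a recursion in \<open>k\<close>.\<close>

lemma integral_cpower_exp:
  fixes c :: complex assumes c: "Re c > 0"
  shows "(\<integral>t. of_real t ^ k * exp (- c * of_real t) \<partial>halfline) = fact k / c ^ Suc k"
proof -
  define F where "F k t = of_real t ^ k * exp (- c * of_real t)" for k and t :: real
  have int: "integrable halfline (F k)" for k unfolding F_def by (rule integrable_cpower_exp[OF c])
  have FTC: "(\<integral>t. f t \<partial>halfline) = - F k 0"
    if f: "\<And>t. (F k has_vector_derivative f t) (at t)" "continuous_on UNIV f" "integrable halfline f" for f k
  proof -
    have "(LBINT t=0..\<infinity>. f t) = 0 - F k 0"
    proof (rule interval_integral_FTC_integrable[where F = "F k"])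
      show "set_integrable lborel (einterval 0 \<infinity>) f"
        using f(3) by (simp add: set_integrable_def integrable_restrict_space einterval_def greaterThan_def zero_ereal_def)
      have "F k \<midarrow>0\<rightarrow> F k 0"
        using has_vector_derivative_continuous[OF f(1)] by (simp add: isCont_def)
      then have "(F k \<longlongrightarrow> F k 0) (at_right 0)" by (rule filterlim_mono) (auto simp: at_within_le_at)
      then show "((F k \<circ> real_of_ereal) \<longlongrightarrow> F k 0) (at_right 0)"
        unfolding zero_ereal_def by (simp add: ereal_tendsto_simps1)
      show "((F k \<circ> real_of_ereal) \<longlongrightarrow> 0) (at_left \<infinity>)"
        using tendsto_cpower_exp[OF c, of k] by (simp add: ereal_tendsto_simps1 F_def[abs_def])
    qed (use f in \<open>auto simp: continuous_on_eq_continuous_at\<close>)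
    then show ?thesis
      by (simp add: interval_lebesgue_integral_def set_lebesgue_integral_def integral_restrict_space
          einterval_def greaterThan_def zero_ereal_def)
  qed
  have c0: "c \<noteq> 0" using c by auto
  have "c * (\<integral>t. F k t \<partial>halfline) = fact k / c ^ k"
  proof (induction k)
    case 0
    have "(\<integral>t. - c * F 0 t \<partial>halfline) = - F 0 0"
    proof (rule FTC)
      show "(F 0 has_vector_derivative - c * F 0 t) (at t)" for t
        unfolding F_def
        by (rule has_vector_derivative_real_field) (auto intro!: derivative_eq_intros)
      show "continuous_on UNIV (\<lambda>t. - c * F 0 t)" unfolding F_def by (intro continuous_intros)
      show "integrable halfline (\<lambda>t. - c * F 0 t)" using int by simp
    qed
    then show ?case by (simp add: F_def)
  next
    case (Suc k)
    have "(\<integral>t. of_nat (Suc k) * F k t - c * F (Suc k) t \<partial>halfline) = - F (Suc k) 0"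
    proof (rule FTC)
      show "(F (Suc k) has_vector_derivative of_nat (Suc k) * F k t - c * F (Suc k) t) (at t)" for t
        unfolding F_def
      proof (rule has_vector_derivative_real_field)
        have "((\<lambda>z. z ^ Suc k * exp (- c * z)) has_field_derivative
          of_nat (Suc k) * z ^ k * exp (- c * z) + z ^ Suc k * (exp (- c * z) * - c)) (at z)" for z
        proof -
          have "((\<lambda>z. z ^ Suc k) has_field_derivative of_nat (Suc k) * z ^ k) (at z)"
            using DERIV_power[OF DERIV_ident, of "Suc k" z UNIV] by simp
          moreover have "((\<lambda>z. exp (- c * z)) has_field_derivative exp (- c * z) * - c) (at z)"
            by (auto intro!: derivative_eq_intros)
          ultimately show ?thesis by (rule DERIV_mult[THEN DERIV_cong]) (simp add: mult_ac)
        qed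
        then show "((\<lambda>z. z ^ Suc k * exp (- c * z)) has_field_derivative
          of_nat (Suc k) * (of_real t ^ k * exp (- c * of_real t)) - c * (of_real t ^ Suc k * exp (- c * of_real t))) (at (of_real t))"
          by (rule DERIV_cong) (simp add: algebra_simps)
      qed
      show "continuous_on UNIV (\<lambda>t. of_nat (Suc k) * F k t - c * F (Suc k) t)"
        unfolding F_def by (intro continuous_intros)
      show "integrable halfline (\<lambda>t. of_nat (Suc k) * F k t - c * F (Suc k) t)" 
        by (intro Bochner_Integration.integrable_diff integrable_mult_right int)
    qed
    then have "of_nat (Suc k) * (\<integral>t. F k t \<partial>halfline) = c * (\<integral>t. F (Suc k) t \<partial>halfline)"
      using int by (simp add: F_def[of _ 0])
    moreover have "(\<integral>t. F k t \<partial>halfline) = fact k / c ^ Suc k"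
      using Suc.IH c0 by (simp add: eq_divide_eq mult_ac)
    ultimately show ?case by (simp add: mult.commute)
  qed
  then show ?thesis using c0 unfolding F_def by (simp add: eq_divide_eq mult_ac)
qed

section \<open>Laguerre functions\<close>

text \<open>The derivative conjugated by \<open>e\<^sup>-\<^sup>s\<close>.\<close>

definition rodrigues :: "real poly \<Rightarrow> real poly" where
  "rodrigues p = pderiv p - p"

text \<open>Rodrigues' formula. The sign is the one in \<open>ell\<close>; it makes the leading coefficient positive.\<close>

definition laguerre :: "nat \<Rightarrow> real poly" where
  "laguerre k = smult ((-1) ^ k / fact k) ((rodrigues ^^ k) (monom 1 k))"

lemma higher_deriv_exp_poly:
  "(deriv ^^ k) (\<lambda>s::real. exp (- s) * poly p s) = (\<lambda>s. exp (- s) * poly ((rodrigues ^^ k) p) s)"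
proof (induction k arbitrary: p)
  case (Suc k)
  have "deriv (\<lambda>s::real. exp (- s) * poly p s) = (\<lambda>s. exp (- s) * poly (rodrigues p) s)"
  proof
    fix s :: real
    show "deriv (\<lambda>s. exp (- s) * poly p s) s = exp (- s) * poly (rodrigues p) s"
      by (rule DERIV_imp_deriv) (auto intro!: derivative_eq_intros simp: rodrigues_def algebra_simps)
  qed
  then show ?case by (simp only: funpow_Suc_right o_apply Suc.IH)
qed simp

lemma ell_eq: "ell k y = indicator {0<..} y * (exp (- y / 2) * poly (laguerre k) y)"
proof -
  have "(deriv ^^ k) (\<lambda>s::real. exp (- s) * s ^ k) y = exp (- y) * poly ((rodrigues ^^ k) (monom 1 k)) y"
    using fun_cong[OF higher_deriv_exp_poly[of k "monom 1 k"], of y] by (simp add: poly_monom)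
  then show ?thesis unfolding ell_def laguerre_def by (simp add: exp_minus)
qed

lemma poly_measurable [measurable]: "poly p \<in> borel_measurable borel" for p :: "real poly"
  by (intro borel_measurable_continuous_onI continuous_intros)

lemma ell_measurable [measurable]: "ell k \<in> borel_measurable borel"
  unfolding ell_eq[abs_def] by measurable

lemma Nvec_measurable [measurable]: "Nvec j \<in> borel_measurable borel"
  unfolding Nvec_def[abs_def] by measurable

lemma coeff_rodrigues: "coeff (rodrigues p) j = real (Suc j) * coeff p (Suc j) - coeff p j"
  by (simp add: rodrigues_def coeff_pderiv)

lemma degree_rodrigues_power: "degree p \<le> d \<Longrightarrow> degree ((rodrigues ^^ i) p) \<le> d"
proof (induction i)
  case (Suc i)
  then show ?case
    using degree_diff_le[of "pderiv ((rodrigues ^^ i) p)" d "(rodrigues ^^ i) p"] degree_pderiv[of "(rodrigues ^^ i) p"]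
    by (simp add: rodrigues_def[of "(rodrigues ^^ i) p"])
qed simp

lemma coeff_rodrigues_power_top: "degree p \<le> d \<Longrightarrow> coeff ((rodrigues ^^ i) p) d = (-1) ^ i * coeff p d"
proof (induction i)
  case (Suc i)
  have "coeff ((rodrigues ^^ i) p) (Suc d) = 0"
    using degree_rodrigues_power[OF Suc.prems, of i] by (intro coeff_eq_0) simp
  then show ?case using Suc by (simp add: coeff_rodrigues)
qed simp

lemma coeff_rodrigues_power_low: "j + i < k \<Longrightarrow> coeff ((rodrigues ^^ i) (monom 1 k)) j = 0"
  by (induction i arbitrary: j) (auto simp: coeff_rodrigues)

lemma degree_laguerre: "degree (laguerre k) \<le> k"
  unfolding laguerre_def using degree_rodrigues_power[of "monom 1 k" k k]
  by (simp add: degree_monom_le)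

lemma coeff_laguerre: "coeff (laguerre k) k = 1 / fact k"
  unfolding laguerre_def using coeff_rodrigues_power_top[of "monom 1 k" k k]
  by (simp add: degree_monom_le)

definition laplace_functional :: "real poly \<Rightarrow> real" where
  "laplace_functional p = (\<integral>s. exp (- s) * poly p s \<partial>halfline)"

lemma integrable_exp_poly: "integrable halfline (\<lambda>s. exp (- s) * poly p s)"
proof -
  have "integrable halfline (\<lambda>s. \<Sum>i\<le>degree p. coeff p i * (s ^ i * exp (- s)))"
    using has_bochner_integral_power_exp by (intro Bochner_Integration.integrable_sum integrable_mult_right) (auto simp: has_bochner_integral_iff)
  then show ?thesis by (simp add: poly_altdef sum_distrib_left mult_ac)
qed

lemma laplace_functional_eq:
  assumes "degree p \<le> N"
  shows "laplace_functional p = (\<Sum>i\<le>N. coeff p i * fact i)"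
proof -
  have "poly p s = (\<Sum>i\<le>N. coeff p i * s ^ i)" for s
    unfolding poly_altdef using assms by (intro sum.mono_neutral_left) (auto simp: coeff_eq_0)
  then have "laplace_functional p = (\<integral>s. (\<Sum>i\<le>N. coeff p i * (s ^ i * exp (- s))) \<partial>halfline)"
    unfolding laplace_functional_def by (simp add: sum_distrib_left mult_ac)
  also have "\<dots> = (\<Sum>i\<le>N. coeff p i * fact i)"
    using has_bochner_integral_power_exp
    by (subst Bochner_Integration.integral_sum) (auto simp: has_bochner_integral_iff)
  finally show ?thesis .
qed

lemma laplace_functional_add: "laplace_functional (p + q) = laplace_functional p + laplace_functional q"
  unfolding laplace_functional_def using integrable_exp_poly by (simp add: distrib_left)

lemma laplace_functional_smult: "laplace_functional (smult a p) = a * laplace_functional p"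
  unfolding laplace_functional_def by (simp add: mult.left_commute)

lemma laplace_functional_rodrigues: "laplace_functional (rodrigues p) = - coeff p 0"
proof -
  define N where "N = degree p"
  have d: "degree (pderiv p) \<le> N" "degree p \<le> Suc N" unfolding N_def using degree_pderiv[of p] by auto
  have "laplace_functional p = coeff p 0 + laplace_functional (pderiv p)"
    unfolding laplace_functional_eq[OF d(1)] laplace_functional_eq[OF d(2)] sum.atMost_Suc_shift
    by (simp add: coeff_pderiv mult_ac)
  moreover have "laplace_functional (pderiv p) = laplace_functional (rodrigues p) + laplace_functional p"
    unfolding laplace_functional_add[symmetric] by (simp add: rodrigues_def)
  ultimately show ?thesis by simp
qed

text \<open>For this functional \<open>rodrigues\<close> is the negative adjoint of the derivative, up to a value at \<open>0\<close>.\<close>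

lemma laplace_functional_by_parts:
  assumes "coeff p 0 = 0"
  shows "laplace_functional (rodrigues p * q) = - laplace_functional (p * pderiv q)"
proof -
  have "rodrigues p * q + p * pderiv q = rodrigues (p * q)"
    by (simp add: rodrigues_def pderiv_mult algebra_simps)
  then have "laplace_functional (rodrigues p * q) + laplace_functional (p * pderiv q) = - coeff (p * q) 0"
    unfolding laplace_functional_add[symmetric] laplace_functional_rodrigues[symmetric] by simp
  then show ?thesis using assms by (simp add: coeff_mult)
qed

lemma laplace_functional_rodrigues_power:
  assumes "i \<le> k"
  shows "laplace_functional ((rodrigues ^^ i) (monom 1 k) * q)
    = (-1) ^ i * laplace_functional (monom 1 k * (pderiv ^^ i) q)"
  using assms
proof (induction i arbitrary: q)
  case (Suc i)
  have "coeff ((rodrigues ^^ i) (monom 1 k)) 0 = 0" using Suc.prems by (intro coeff_rodrigues_power_low) simp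
  from laplace_functional_by_parts[OF this, of q]
  have "laplace_functional ((rodrigues ^^ Suc i) (monom 1 k) * q)
      = - laplace_functional ((rodrigues ^^ i) (monom 1 k) * pderiv q)" by simp
  also have "\<dots> = (-1) ^ Suc i * laplace_functional (monom 1 k * (pderiv ^^ i) (pderiv q))"
    using Suc by simp
  also have "(pderiv ^^ i) (pderiv q) = (pderiv ^^ Suc i) q" by (simp only: funpow_Suc_right o_apply)
  finally show ?case .
qed simp

lemma pderiv_power_degree: "degree q \<le> k \<Longrightarrow> (pderiv ^^ k) q = [:fact k * coeff q k:]" for q :: "real poly"
proof (induction k arbitrary: q)
  case 0 then show ?case by (auto elim: degree_eq_zeroE)
next
  case (Suc k)
  have "degree (pderiv q) \<le> k" using Suc.prems by (simp add: degree_pderiv)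
  from Suc.IH[OF this] show ?case
    by (simp add: funpow_Suc_right coeff_pderiv algebra_simps del: funpow.simps(2))
qed

lemma laplace_functional_monom: "laplace_functional (monom 1 k) = fact k"
  unfolding laplace_functional_def using has_bochner_integral_power_exp[of k]
  by (simp add: poly_monom has_bochner_integral_iff mult.commute)

text \<open>Moving all \<open>k\<close> derivatives of Rodrigues' formula to \<open>q\<close> leaves the constant \<open>k! coeff q k\<close>; no
  boundary terms arise because \<open>s\<^sup>k\<close> vanishes at \<open>0\<close> to order \<open>k\<close>.\<close>

lemma laguerre_orthogonal:
  assumes "degree q \<le> k"
  shows "laplace_functional (laguerre k * q) = fact k * coeff q k"
proof -
  have "laplace_functional ((rodrigues ^^ k) (monom 1 k) * q) = (-1) ^ k * (fact k * coeff q k * fact k)"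
    unfolding laplace_functional_rodrigues_power[OF order_refl] pderiv_power_degree[OF assms]
    by (simp add: laplace_functional_smult laplace_functional_monom)
  then show ?thesis unfolding laguerre_def by (simp add: laplace_functional_smult flip: power_mult_distrib)
qed

lemma laguerre_orthonormal: "laplace_functional (laguerre j * laguerre k) = (if j = k then 1 else 0)"
proof -
  have *: "laplace_functional (laguerre k * laguerre j) = (if j = k then 1 else 0)" if "j \<le> k" for j k
    using laguerre_orthogonal[of "laguerre j" k] degree_laguerre[of j] that coeff_laguerre[of k]
    by (cases "j = k") (auto simp: coeff_eq_0)
  show ?thesis using *[of j k] *[of k j] by (cases "j \<le> k") (auto simp: mult.commute)
qed

lemma Nvec_eq: "y > 0 \<Longrightarrow> Nvec j y = exp (- y / 2) * poly (laguerre (j - 1)) y"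
  by (simp add: Nvec_def ell_eq)

lemma Nvec_orthonormal:
  assumes "j \<ge> 1" "k \<ge> 1"
  shows "has_bochner_integral halfline (\<lambda>s. Nvec j s * Nvec k s) (if j = k then 1 else 0)"
proof -
  have "has_bochner_integral halfline (\<lambda>s. exp (- s) * poly (laguerre (j - 1) * laguerre (k - 1)) s) (if j = k then 1 else 0)"
    unfolding has_bochner_integral_iff laplace_functional_def[symmetric] laguerre_orthonormal
    using assms integrable_exp_poly[of "laguerre (j - 1) * laguerre (k - 1)"] by (auto simp del: poly_mult)
  moreover have "Nvec j s * Nvec k s = exp (- s) * poly (laguerre (j - 1) * laguerre (k - 1)) s" if "s > 0" for s
    using that exp_add[of "- s / 2" "- s / 2"] by (simp add: Nvec_eq)
  ultimately show ?thesis by (subst has_bochner_integral_cong[OF refl _ refl]) auto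
qed

text \<open>Triangularity: \<open>laguerre k\<close> has degree exactly \<open>k\<close>.\<close>

lemma laguerre_span:
  assumes "degree p < n" 
  shows "\<exists>c. p = (\<Sum>j<n. smult (c j) (laguerre j))"
  using assms
proof (induction n arbitrary: p)
  case (Suc n)
  define q where "q = p - smult (coeff p n * fact n) (laguerre n)"
  have dq: "degree q \<le> n" unfolding q_def
    using Suc.prems degree_laguerre[of n] by (intro degree_diff_le) auto
  have cq: "coeff q n = 0" unfolding q_def by (simp add: coeff_laguerre)
  show ?case
  proof (cases "n = 0")
    case True
    then have "q = 0" using dq cq leading_coeff_0_iff[of q] by simp
    then show ?thesis using True unfolding q_def
      by (intro exI[of _ "\<lambda>_. coeff p n * fact n"]) simp
  next
    case False
    then have "degree q < n" using dq cq by (metis degree_0 gr0I leading_coeff_0_iff le_neq_implies_less)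
    from Suc.IH[OF this] obtain c where c: "q = (\<Sum>j<n. smult (c j) (laguerre j))" by blast
    have "p = (\<Sum>j<Suc n. smult ((c(n := coeff p n * fact n)) j) (laguerre j))"
      using c unfolding q_def by (simp add: algebra_simps)
    then show ?thesis by blast
  qed
qed simp

section \<open>The isometry \<open>R\<^sup>*\<close>\<close>

lemma Complex_measurable [measurable (raw)]:
  assumes [measurable]: "f \<in> borel_measurable M" "g \<in> borel_measurable M"
  shows "(\<lambda>x. Complex (f x) (g x)) \<in> borel_measurable M"
  unfolding Complex_eq by measurable

lemma lborel_complex:
  "(lborel :: complex measure) = distr (lborel \<Otimes>\<^sub>M lborel) borel (\<lambda>p. Complex (fst p) (snd p))"
proof (rule lborel_eqI)
  fix l u :: complex assume le: "\<And>b. b \<in> Basis \<Longrightarrow> l \<bullet> b \<le> u \<bullet> b"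
  have le': "Re l \<le> Re u" "Im l \<le> Im u" using le[of 1] le[of \<i>] by (auto simp: Basis_complex_def inner_complex_def)
  have "(\<lambda>p. Complex (fst p) (snd p)) -` box l u \<inter> space (lborel \<Otimes>\<^sub>M lborel)
      = {Re l<..<Re u} \<times> {Im l<..<Im u}"
    by (auto simp: in_box_complex_iff space_pair_measure)
  then have "emeasure (distr (lborel \<Otimes>\<^sub>M lborel) borel (\<lambda>p. Complex (fst p) (snd p))) (box l u)
     = emeasure (lborel \<Otimes>\<^sub>M lborel) ({Re l<..<Re u} \<times> {Im l<..<Im u})"
    by (subst emeasure_distr) (auto simp del: space_pair_measure)
  also have "\<dots> = ennreal (Re u - Re l) * ennreal (Im u - Im l)"
    using le' by (subst lborel.emeasure_pair_measure_Times) auto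
  also have "\<dots> = ennreal (\<Prod>b\<in>Basis. (u - l) \<bullet> b)"
    using le' by (simp add: Basis_complex_def inner_complex_def ennreal_mult)
  finally show "emeasure (distr (lborel \<Otimes>\<^sub>M lborel) borel (\<lambda>p. Complex (fst p) (snd p))) (box l u)
     = ennreal (\<Prod>b\<in>Basis. (u - l) \<bullet> b)" .
qed simp

abbreviation upper :: "complex measure" where
  "upper \<equiv> restrict_space lborel half_plane"

lemma half_plane_open: "open half_plane"
  unfolding half_plane_def by (rule open_halfspace_Im_gt)

lemma half_plane_borel [measurable]: "half_plane \<in> sets borel"
  using half_plane_open by simp

lemma space_upper [simp]: "space upper = half_plane"
  by (simp add: space_restrict_space)

lemma upper_measurable:
  "f \<in> borel_measurable borel \<Longrightarrow> f \<in> borel_measurable upper"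
  by (rule measurable_restrict_space1) simp

lemma Re_measurable_upper [measurable]: "Re \<in> borel_measurable upper"
  by (auto intro!: upper_measurable)

lemma Im_measurable_upper [measurable]: "Im \<in> borel_measurable upper"
  by (auto intro!: upper_measurable)

lemma sigma_finite_halfline: "sigma_finite_measure halfline"
  by (rule sigma_finite_measure_restrict_space) (auto intro: lborel.sigma_finite_measure_axioms)

lemma sigma_finite_upper: "sigma_finite_measure upper"
  by (rule sigma_finite_measure_restrict_space) (auto intro: lborel.sigma_finite_measure_axioms)

interpretation halfline: sigma_finite_measure halfline by (rule sigma_finite_halfline)
interpretation upper: sigma_finite_measure upper by (rule sigma_finite_upper)

lemma indicator_half_plane: "indicator half_plane (Complex x y) = indicator {0<..} y"
  by (simp add: half_plane_def indicator_def)

lemma nn_integral_upper: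
  assumes f: "f \<in> borel_measurable upper"
  shows "(\<integral>\<^sup>+z. f z \<partial>upper) = (\<integral>\<^sup>+y. (\<integral>\<^sup>+x. f (Complex x y) \<partial>lborel) \<partial>halfline)"
proof -
  have m[measurable]: "(\<lambda>z. f z * indicator half_plane z) \<in> borel_measurable borel"
    using f by (simp add: borel_measurable_restrict_space_iff_ennreal)
  have m2: "(\<lambda>p. f (Complex (fst p) (snd p)) * indicator {0<..} (snd p)) \<in> borel_measurable (lborel \<Otimes>\<^sub>M lborel)"
    using measurable_compose[OF _ m, of "\<lambda>p. Complex (fst p) (snd p)" "lborel \<Otimes>\<^sub>M lborel"]
    by (simp add: indicator_half_plane)
  have "(\<integral>\<^sup>+z. f z \<partial>upper) = (\<integral>\<^sup>+p. f (Complex (fst p) (snd p)) * indicator {0<..} (snd p) \<partial>(lborel \<Otimes>\<^sub>M lborel))"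
    by (simp add: nn_integral_restrict_space)
       (subst lborel_complex, subst nn_integral_distr, auto simp: indicator_half_plane)
  also have "\<dots> = (\<integral>\<^sup>+y. (\<integral>\<^sup>+x. f (Complex x y) * indicator {0<..} y \<partial>lborel) \<partial>lborel)"
    by (subst lborel_pair.nn_integral_snd[symmetric]) (use m2 in \<open>auto simp: split_beta'\<close>)
  also have "\<dots> = (\<integral>\<^sup>+y. (\<integral>\<^sup>+x. f (Complex x y) \<partial>lborel) * indicator {0<..} y \<partial>lborel)"
    by (intro nn_integral_cong) (simp add: indicator_def)
  finally show ?thesis by (simp add: nn_integral_restrict_space)
qed

lemma integral_upper:
  fixes f :: "complex \<Rightarrow> complex"
  assumes f: "integrable upper f"
  shows "(\<integral>z. f z \<partial>upper) = (\<integral>x. (\<integral>y. f (Complex x y) \<partial>halfline) \<partial>lborel)"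
proof -
  have i: "integrable lborel (\<lambda>z. indicator half_plane z *\<^sub>R f z)"
    using f by (simp add: integrable_restrict_space)
  have m: "(\<lambda>z. indicator half_plane z *\<^sub>R f z) \<in> borel_measurable borel"
    using borel_measurable_integrable[OF i] by simp
  have i2: "integrable (lborel \<Otimes>\<^sub>M lborel) (\<lambda>p. indicator {0<..} (snd p) *\<^sub>R f (Complex (fst p) (snd p)))"
    using i by (subst (asm) lborel_complex, subst (asm) integrable_distr_eq) (use m in \<open>auto simp: indicator_half_plane\<close>)
  have "(\<integral>z. f z \<partial>upper) = (\<integral>p. indicator {0<..} (snd p) *\<^sub>R f (Complex (fst p) (snd p)) \<partial>(lborel \<Otimes>\<^sub>M lborel))"
    by (simp add: integral_restrict_space)
       (subst lborel_complex, subst integral_distr, use m in \<open>auto simp: indicator_half_plane\<close>)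
  also have "\<dots> = (\<integral>x. (\<integral>y. indicator {0<..} y *\<^sub>R f (Complex x y) \<partial>lborel) \<partial>lborel)"
    by (subst lborel_pair.integral_fst'[symmetric, OF i2]) simp
  finally show ?thesis by (simp add: integral_restrict_space)
qed

lemma power_le_fact_exp: "0 \<le> s \<Longrightarrow> s ^ i \<le> fact i * exp s" for s :: real
proof -
  assume "0 \<le> s"
  have "(\<Sum>k\<in>{i}. s ^ k /\<^sub>R fact k) \<le> (\<Sum>k. s ^ k /\<^sub>R fact k)"
    by (rule sum_le_suminf) (use \<open>0 \<le> s\<close> summable_exp[of s] in auto)
  then show ?thesis by (simp add: exp_def field_simps)
qed

text \<open>Each monomial is bounded by a single term of the exponential series.\<close>

lemma exp_poly_bounded: "\<exists>B. \<forall>s\<ge>0::real. \<bar>exp (- s) * poly p s\<bar> \<le> B"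
proof (intro exI allI impI)
  fix s :: real assume s: "0 \<le> s"
  have "\<bar>exp (- s) * poly p s\<bar> = exp (- s) * \<bar>\<Sum>i\<le>degree p. coeff p i * s ^ i\<bar>"
    by (simp add: abs_mult poly_altdef)
  also have "\<dots> \<le> exp (- s) * (\<Sum>i\<le>degree p. \<bar>coeff p i\<bar> * s ^ i)"
    by (intro mult_left_mono order_trans[OF sum_abs]) (use s in \<open>auto simp: abs_mult\<close>)
  also have "\<dots> = (\<Sum>i\<le>degree p. \<bar>coeff p i\<bar> * (exp (- s) * s ^ i))"
    by (simp add: sum_distrib_left mult_ac)
  also have "\<dots> \<le> (\<Sum>i\<le>degree p. \<bar>coeff p i\<bar> * fact i)"
    by (intro sum_mono mult_left_mono) (use power_le_fact_exp[OF s] in \<open>auto simp: exp_minus field_simps\<close>)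
  finally show "\<bar>exp (- s) * poly p s\<bar> \<le> (\<Sum>i\<le>degree p. \<bar>coeff p i\<bar> * fact i)" .
qed

text \<open>The common kernel of \<open>R\<close> and \<open>R\<^sup>*\<close>. The factor \<open>sqrt (2 t)\<close> normalises it as a function of the height \<open>y\<close>.\<close>

definition basis_fun :: "nat \<Rightarrow> real \<Rightarrow> real \<Rightarrow> real" where
  "basis_fun j y t = sqrt (2 * t) * Nvec j (2 * t * y)"

lemma basis_fun_measurable [measurable (raw)]:
  assumes [measurable]: "f \<in> borel_measurable M" "g \<in> borel_measurable M"
  shows "(\<lambda>x. basis_fun j (f x) (g x)) \<in> borel_measurable M"
  unfolding basis_fun_def by measurable

lemma basis_fun_power2:
  assumes "y > 0" "t > 0"
  shows "(basis_fun j y t)\<^sup>2 = (1 / y) * (exp (- (2 * y * t)) * poly (monom 1 1 * laguerre (j - 1) * laguerre (j - 1)) (2 * y * t))"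
proof -
  have "(exp (- (2 * t * y) / 2))\<^sup>2 = exp (- (2 * y * t))"
    by (simp add: power2_eq_square flip: exp_add)
  then show ?thesis using assms
    by (simp add: basis_fun_def Nvec_eq power_mult_distrib poly_monom) (simp add: power2_eq_square field_simps)
qed

lemma basis_fun_bounded: "y > 0 \<Longrightarrow> \<exists>B. \<forall>t>0. \<bar>basis_fun j y t\<bar> \<le> B"
proof -
  assume y: "y > 0"
  obtain B where B: "\<And>s. 0 \<le> s \<Longrightarrow> \<bar>exp (- s) * poly (monom 1 1 * laguerre (j - 1) * laguerre (j - 1)) s\<bar> \<le> B"
    using exp_poly_bounded by metis
  have "\<bar>basis_fun j y t\<bar> \<le> sqrt ((1 / y) * B)" if "t > 0" for t
  proof (rule real_le_rsqrt)
    show "\<bar>basis_fun j y t\<bar>\<^sup>2 \<le> (1 / y) * B"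
      unfolding power2_abs basis_fun_power2[OF y that]
      using B[of "2 * y * t"] y that by (intro mult_left_mono) (auto simp: abs_le_iff)
  qed
  then show ?thesis by blast
qed

lemma basis_fun_sq_integrable: "y > 0 \<Longrightarrow> sq_integrable halfline (\<lambda>t. complex_of_real (basis_fun j y t))"
proof -
  assume y: "y > 0"
  have "integrable halfline (\<lambda>t. exp (- (2 * y * t)) * poly (monom 1 1 * laguerre (j - 1) * laguerre (j - 1)) (2 * y * t))"
    using integrable_halfline_scale[of "2 * y" "\<lambda>s. exp (- s) * poly (monom 1 1 * laguerre (j - 1) * laguerre (j - 1)) s"]
      integrable_exp_poly[of "monom 1 1 * laguerre (j - 1) * laguerre (j - 1)"] y by (simp del: poly_mult)
  then have "integrable halfline (\<lambda>t. (1 / y) * (exp (- (2 * y * t)) * poly (monom 1 1 * laguerre (j - 1) * laguerre (j - 1)) (2 * y * t)))"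
    by (rule integrable_mult_right)
  then have "integrable halfline (\<lambda>t. (basis_fun j y t)\<^sup>2)"
    by (rule Bochner_Integration.integrable_cong[THEN iffD1, rotated 2]) (use basis_fun_power2[OF y] in auto)
  then show ?thesis unfolding sq_integrable_def by (auto intro!: halfline_measurable)
qed

text \<open>Pythagoras for the orthonormal Laguerre functions.\<close>

lemma Nvec_combination_norm:
  fixes c :: "nat \<Rightarrow> complex"
  shows "(\<integral>\<^sup>+s. ennreal ((cmod (\<Sum>j=1..n. of_real (Nvec j s) * c j))\<^sup>2) \<partial>halfline)
    = ennreal (\<Sum>j=1..n. (cmod (c j))\<^sup>2)"
proof -
  have e: "(cmod (\<Sum>j=1..n. of_real (Nvec j s) * c j))\<^sup>2
      = (\<Sum>j=1..n. \<Sum>k=1..n. (Nvec j s * Nvec k s) * Re (c j * cnj (c k)))" for s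
  proof -
    have "complex_of_real ((cmod (\<Sum>j=1..n. of_real (Nvec j s) * c j))\<^sup>2)
      = (\<Sum>j=1..n. of_real (Nvec j s) * c j) * (\<Sum>k=1..n. of_real (Nvec k s) * cnj (c k))"
      unfolding complex_norm_square by simp
    also have "\<dots> = (\<Sum>j=1..n. \<Sum>k=1..n. of_real (Nvec j s * Nvec k s) * (c j * cnj (c k)))"
      unfolding sum_product by (intro sum.cong refl) simp
    finally have "(cmod (\<Sum>j=1..n. of_real (Nvec j s) * c j))\<^sup>2
      = Re (\<Sum>j=1..n. \<Sum>k=1..n. of_real (Nvec j s * Nvec k s) * (c j * cnj (c k)))"
      by (metis Re_complex_of_real)
    also have "\<dots> = (\<Sum>j=1..n. \<Sum>k=1..n. (Nvec j s * Nvec k s) * Re (c j * cnj (c k)))"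
      unfolding Re_sum by (intro sum.cong refl) (simp add: algebra_simps)
    finally show ?thesis .
  qed
  have "has_bochner_integral halfline (\<lambda>s. \<Sum>j=1..n. \<Sum>k=1..n. (Nvec j s * Nvec k s) * Re (c j * cnj (c k)))
      (\<Sum>j=1..n. \<Sum>k=1..n. (if j = k then 1 else 0) * Re (c j * cnj (c k)))"
    by (intro has_bochner_integral_sum has_bochner_integral_mult_left Nvec_orthonormal) auto
  also have "(\<Sum>j=1..n. \<Sum>k=1..n. (if j = k then 1 else 0) * Re (c j * cnj (c k))) = (\<Sum>j=1..n. (cmod (c j))\<^sup>2)"
  proof (rule sum.cong[OF refl])
    fix j assume j: "j \<in> {1..n}"
    have "(\<Sum>k=1..n. (if j = k then 1 else 0) * Re (c j * cnj (c k))) = (\<Sum>k=1..n. if j = k then Re (c j * cnj (c k)) else 0)"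
      by (intro sum.cong refl) simp
    also have "\<dots> = Re (c j * cnj (c j))" using j by simp
    also have "\<dots> = (cmod (c j))\<^sup>2" by (metis Re_complex_of_real complex_norm_square)
    finally show "(\<Sum>k=1..n. (if j = k then 1 else 0) * Re (c j * cnj (c k))) = (cmod (c j))\<^sup>2" .
  qed
  finally have *: "has_bochner_integral halfline (\<lambda>s. (cmod (\<Sum>j=1..n. of_real (Nvec j s) * c j))\<^sup>2) (\<Sum>j=1..n. (cmod (c j))\<^sup>2)"
    unfolding e .
  show ?thesis using nn_integral_eq_integral[of halfline "\<lambda>s. (cmod (\<Sum>j=1..n. of_real (Nvec j s) * c j))\<^sup>2"] *
    by (simp add: has_bochner_integral_iff)
qed

definition L2vec :: "nat \<Rightarrow> (nat \<Rightarrow> real \<Rightarrow> complex) \<Rightarrow> bool" where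
  "L2vec n f \<longleftrightarrow> (\<forall>j\<in>{1..n}. sq_integrable halfline (f j))"

lemma L2vecD: "L2vec n f \<Longrightarrow> j \<in> {1..n} \<Longrightarrow> sq_integrable halfline (f j)"
  by (simp add: L2vec_def)

text \<open>The function on the line whose Fourier transform is the restriction of \<open>R_adj n f\<close> to
  the line of height \<open>y\<close>.\<close>

definition slice :: "nat \<Rightarrow> (nat \<Rightarrow> real \<Rightarrow> complex) \<Rightarrow> real \<Rightarrow> real \<Rightarrow> complex" where
  "slice n f y t = (\<Sum>j=1..n. of_real (basis_fun j y t) * f j t)"

lemma slice_eq: "slice n f y t = of_real (sqrt (2 * t)) * (\<Sum>j=1..n. of_real (Nvec j (2 * t * y)) * f j t)"
  unfolding slice_def basis_fun_def by (simp add: sum_distrib_left mult.assoc)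

lemma R_adj_eq:
  assumes "z \<in> half_plane"
  shows "R_adj n f z = of_real (1 / sqrt (2 * pi)) * (\<integral>t. cis (Re z * t) * slice n f (Im z) t \<partial>halfline)"
  using assms unfolding R_adj_def slice_eq set_lebesgue_integral_def
  by (simp add: integral_restrict_space mult.assoc)

lemma slice_sq_integrable:
  assumes f: "L2vec n f" and y: "y > 0"
  shows "sq_integrable halfline (slice n f y)"
proof -
  have "sq_integrable halfline (\<lambda>t. of_real (basis_fun j y t) * f j t)" if j: "j \<in> {1..n}" for j
  proof -
    obtain B where "\<And>t. t > 0 \<Longrightarrow> \<bar>basis_fun j y t\<bar> \<le> B" using basis_fun_bounded[OF y] by metis
    then show ?thesis
      by (intro sq_integrable_bounded_mult[where C = B] L2vecD[OF f j])
         (auto intro!: halfline_measurable)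
  qed
  then show ?thesis unfolding slice_def[abs_def] by (rule sq_integrable_sum)
qed

lemma slice_integrable:
  assumes f: "L2vec n f" and y: "y > 0"
  shows "integrable halfline (slice n f y)"
proof -
  have "integrable halfline (\<lambda>t. f j t * cnj (complex_of_real (basis_fun j y t)))" if j: "j \<in> {1..n}" for j
    by (rule sq_integrable_mult_integrable[OF L2vecD[OF f j] basis_fun_sq_integrable[OF y]])
  then show ?thesis unfolding slice_def[abs_def]
    by (intro Bochner_Integration.integrable_sum) (simp add: mult.commute)
qed

lemma slice_cis_integrable:
  assumes f: "L2vec n f" and y: "y > 0"
  shows "integrable halfline (\<lambda>t. cis (x * t) * slice n f y t)"
proof (rule Bochner_Integration.integrable_bound[OF slice_integrable[OF f y]])
  show "(\<lambda>t. cis (x * t) * slice n f y t) \<in> borel_measurable halfline"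
    using borel_measurable_integrable[OF slice_integrable[OF f y]]
    by (intro borel_measurable_times) (auto intro!: halfline_measurable)
qed (simp add: norm_mult)

lemma R_adj_fourier:
  assumes y: "y > 0"
  shows "R_adj n f (Complex x y) = of_real (1 / sqrt (2 * pi)) * fourier (\<lambda>t. indicator {0<..} t * slice n f y t) x"
proof -
  have "(\<integral>t. cis (x * t) * slice n f y t \<partial>halfline) = fourier (\<lambda>t. indicator {0<..} t * slice n f y t) x"
    unfolding fourier_def
    by (simp add: integral_restrict_space)
       (intro Bochner_Integration.integral_cong refl, simp add: indicator_def)
  then show ?thesis using y by (subst R_adj_eq) (auto simp: half_plane_def)
qed

lemma joint_slice_measurable:
  assumes f: "L2vec n f" and [measurable]: "g \<in> borel_measurable M"
  shows "(\<lambda>p. slice n f (g (fst p)) (snd p)) \<in> borel_measurable (M \<Otimes>\<^sub>M halfline)"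
  unfolding slice_def
proof (rule borel_measurable_sum)
  fix j assume j: "j \<in> {1..n}"
  note [measurable] = sq_integrable_measurable[OF L2vecD[OF f j]]
  have [measurable]: "(\<lambda>t. t) \<in> borel_measurable halfline" by (rule halfline_measurable) simp
  show "(\<lambda>p. of_real (basis_fun j (g (fst p)) (snd p)) * f j (snd p)) \<in> borel_measurable (M \<Otimes>\<^sub>M halfline)"
    by measurable
qed

lemma R_adj_measurable:
  assumes f: "L2vec n f"
  shows "R_adj n f \<in> borel_measurable upper"
proof -
  note [measurable] = joint_slice_measurable[OF f Im_measurable_upper]
  have [measurable]: "(\<lambda>t. t) \<in> borel_measurable halfline" by (rule halfline_measurable) simp
  have "(\<lambda>p. cis (Re (fst p) * snd p) * slice n f (Im (fst p)) (snd p)) \<in> borel_measurable (upper \<Otimes>\<^sub>M halfline)"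
    by measurable
  then have "(\<lambda>z. \<integral>t. cis (Re z * t) * slice n f (Im z) t \<partial>halfline) \<in> borel_measurable upper"
    by (intro halfline.borel_measurable_lebesgue_integral) (simp add: split_beta')
  then have "(\<lambda>z. of_real (1 / sqrt (2 * pi)) * (\<integral>t. cis (Re z * t) * slice n f (Im z) t \<partial>halfline)) \<in> borel_measurable upper"
    by measurable
  then show ?thesis by (subst measurable_cong[where g = "\<lambda>z. of_real (1 / sqrt (2 * pi)) * (\<integral>t. cis (Re z * t) * slice n f (Im z) t \<partial>halfline)"])
      (auto simp: R_adj_eq)
qed

lemma R_adj_line_norm:
  assumes f: "L2vec n f" and y: "y > 0"
  shows "(\<integral>\<^sup>+x. ennreal ((cmod (R_adj n f (Complex x y)))\<^sup>2) \<partial>lborel)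
    = (\<integral>\<^sup>+t. ennreal ((cmod (slice n f y t))\<^sup>2) \<partial>halfline)"
proof -
  let ?h = "\<lambda>t. indicator {0<..} t * slice n f y t"
  have e: "?h = (\<lambda>t. indicator {0<..} t *\<^sub>R slice n f y t)" by (auto simp: indicator_def)
  have h1: "integrable lborel ?h"
    unfolding e using slice_integrable[OF f y] by (simp add: integrable_restrict_space)
  have e2: "(\<lambda>t. (cmod (?h t))\<^sup>2) = (\<lambda>t. indicator {0<..} t *\<^sub>R (cmod (slice n f y t))\<^sup>2)"
    by (auto simp: indicator_def norm_mult)
  have h2: "sq_integrable lborel ?h"
    unfolding sq_integrable_def e2 using slice_sq_integrable[OF f y] borel_measurable_integrable[OF h1]
    by (simp add: sq_integrable_def integrable_restrict_space)
  have hm: "?h \<in> borel_measurable lborel" using borel_measurable_integrable[OF h1] .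
  have fm: "fourier ?h \<in> borel_measurable borel" by (rule fourier_measurable[OF hm])
  have "(\<integral>\<^sup>+x. ennreal ((cmod (R_adj n f (Complex x y)))\<^sup>2) \<partial>lborel)
      = (\<integral>\<^sup>+x. ennreal (1 / (2 * pi)) * ennreal ((cmod (fourier ?h x))\<^sup>2) \<partial>lborel)"
    unfolding R_adj_fourier[OF y]
    by (intro nn_integral_cong) (simp add: norm_mult power_mult_distrib power_divide norm_divide flip: ennreal_mult)
  also have "\<dots> = ennreal (1 / (2 * pi)) * ennreal (2 * pi * (sq_norm lborel ?h)\<^sup>2)"
    using fm by (subst nn_integral_cmult) (auto simp: Plancherel[OF h1 h2])
  also have "\<dots> = ennreal ((sq_norm lborel ?h)\<^sup>2)"
    by (simp flip: ennreal_mult)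
  also have "\<dots> = (\<integral>\<^sup>+t. ennreal ((cmod (slice n f y t))\<^sup>2) \<partial>halfline)"
    unfolding nn_integral_sq[OF h2, symmetric]
    by (simp add: nn_integral_restrict_space, intro nn_integral_cong, simp add: indicator_def)
  finally show ?thesis .
qed

text \<open>Plancherel's theorem on every horizontal line. The weight \<open>1\<close> leads to the isometry property,
  the indicator of an interval to Toeplitz operators.\<close>

lemma R_adj_weighted_norm:
  assumes f: "L2vec n f" and [measurable]: "\<alpha> \<in> borel_measurable borel"
  shows "(\<integral>\<^sup>+z. \<alpha> (Im z) * ennreal ((cmod (R_adj n f z))\<^sup>2) \<partial>upper)
    = (\<integral>\<^sup>+t. (\<integral>\<^sup>+y. \<alpha> y * ennreal ((cmod (slice n f y t))\<^sup>2) \<partial>halfline) \<partial>halfline)"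
proof -
  interpret HH: pair_sigma_finite halfline halfline ..
  note [measurable] = R_adj_measurable[OF f]
  have id[measurable]: "(\<lambda>t. t) \<in> borel_measurable halfline" by (rule halfline_measurable) simp
  note [measurable] = joint_slice_measurable[OF f id]
  have am[measurable]: "\<alpha> \<in> borel_measurable halfline" by (rule halfline_measurable) measurable
  have "(\<integral>\<^sup>+z. \<alpha> (Im z) * ennreal ((cmod (R_adj n f z))\<^sup>2) \<partial>upper)
    = (\<integral>\<^sup>+y. (\<integral>\<^sup>+x. \<alpha> y * ennreal ((cmod (R_adj n f (Complex x y)))\<^sup>2) \<partial>lborel) \<partial>halfline)"
    by (subst nn_integral_upper) auto
  also have "\<dots> = (\<integral>\<^sup>+y. (\<integral>\<^sup>+t. \<alpha> y * ennreal ((cmod (slice n f y t))\<^sup>2) \<partial>halfline) \<partial>halfline)"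
  proof (rule nn_integral_cong)
    fix y assume "y \<in> space halfline"
    then have y: "y > 0" by simp
    have m1: "(\<lambda>x. R_adj n f (Complex x y)) \<in> borel_measurable lborel"
    proof (rule measurable_compose[OF _ R_adj_measurable[OF f]])
      show "(\<lambda>x. Complex x y) \<in> lborel \<rightarrow>\<^sub>M upper"
        by (rule measurable_restrict_space2) (use y in \<open>auto simp: half_plane_def\<close>)
    qed
    have m2: "slice n f y \<in> borel_measurable halfline" 
      by (rule sq_integrable_measurable[OF slice_sq_integrable[OF f y]])
    have "(\<integral>\<^sup>+x. \<alpha> y * ennreal ((cmod (R_adj n f (Complex x y)))\<^sup>2) \<partial>lborel)
       = \<alpha> y * (\<integral>\<^sup>+x. ennreal ((cmod (R_adj n f (Complex x y)))\<^sup>2) \<partial>lborel)"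
      by (rule nn_integral_cmult, rule measurable_compose[OF m1]) measurable
    also have "\<dots> = (\<integral>\<^sup>+t. \<alpha> y * ennreal ((cmod (slice n f y t))\<^sup>2) \<partial>halfline)"
      unfolding R_adj_line_norm[OF f y] by (rule nn_integral_cmult[symmetric], rule measurable_compose[OF m2]) measurable
    finally show "(\<integral>\<^sup>+x. \<alpha> y * ennreal ((cmod (R_adj n f (Complex x y)))\<^sup>2) \<partial>lborel)
      = (\<integral>\<^sup>+t. \<alpha> y * ennreal ((cmod (slice n f y t))\<^sup>2) \<partial>halfline)" .
  qed
  also have "\<dots> = (\<integral>\<^sup>+t. (\<integral>\<^sup>+y. \<alpha> y * ennreal ((cmod (slice n f y t))\<^sup>2) \<partial>halfline) \<partial>halfline)"
    by (rule HH.Fubini'[symmetric]) (simp add: split_beta')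
  finally show ?thesis .
qed

text \<open>The substitution \<open>s = 2 t y\<close> turns this into the orthonormality of the Laguerre functions.\<close>

lemma slice_vertical_norm:
  assumes "t > 0"
  shows "(\<integral>\<^sup>+y. ennreal ((cmod (slice n f y t))\<^sup>2) \<partial>halfline) = ennreal (\<Sum>j=1..n. (cmod (f j t))\<^sup>2)"
proof -
  have "(\<integral>\<^sup>+y. ennreal ((cmod (slice n f y t))\<^sup>2) \<partial>halfline)
    = (\<integral>\<^sup>+y. ennreal (2 * t) * ennreal ((cmod (\<Sum>j=1..n. of_real (Nvec j (2 * t * y)) * f j t))\<^sup>2) \<partial>halfline)"
    unfolding slice_eq using assms
    by (intro nn_integral_cong) (simp add: norm_mult power_mult_distrib flip: ennreal_mult)
  also have "\<dots> = ennreal (2 * t) * (\<integral>\<^sup>+y. ennreal ((cmod (\<Sum>j=1..n. of_real (Nvec j (2 * t * y)) * f j t))\<^sup>2) \<partial>halfline)"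
    by (intro nn_integral_cmult halfline_measurable) measurable
  also have "\<dots> = (\<integral>\<^sup>+s. ennreal ((cmod (\<Sum>j=1..n. of_real (Nvec j s) * f j t))\<^sup>2) \<partial>halfline)"
    using assms by (subst nn_integral_halfline_scale[of _ "2 * t"]) auto
  finally show ?thesis unfolding Nvec_combination_norm .
qed

text \<open>Plancherel's theorem integrates out the real part of \<open>z\<close>, and the orthonormality of the Laguerre
  functions its imaginary part.\<close>

theorem R_adj_isometry:
  assumes f: "L2vec n f"
  shows "sq_integrable upper (R_adj n f)"
    and "(sq_norm upper (R_adj n f))\<^sup>2 = (\<Sum>j=1..n. (sq_norm halfline (f j))\<^sup>2)"
proof -
  have "(\<integral>\<^sup>+z. ennreal ((cmod (R_adj n f z))\<^sup>2) \<partial>upper) = (\<integral>\<^sup>+t. ennreal (\<Sum>j=1..n. (cmod (f j t))\<^sup>2) \<partial>halfline)"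
    using R_adj_weighted_norm[OF f, of "\<lambda>_. 1"] slice_vertical_norm by (auto intro!: nn_integral_cong)
  also have "\<dots> = (\<Sum>j=1..n. \<integral>\<^sup>+t. ennreal ((cmod (f j t))\<^sup>2) \<partial>halfline)"
    using sq_integrable_measurable[OF L2vecD[OF f]]
    by (subst nn_integral_sum[symmetric]) (auto simp: sum_ennreal intro!: nn_integral_cong)
  also have "\<dots> = ennreal (\<Sum>j=1..n. (sq_norm halfline (f j))\<^sup>2)"
    using f by (simp add: nn_integral_sq[OF L2vecD[OF f]] sum_ennreal)
  finally have *: "(\<integral>\<^sup>+z. ennreal ((cmod (R_adj n f z))\<^sup>2) \<partial>upper) = ennreal (\<Sum>j=1..n. (sq_norm halfline (f j))\<^sup>2)" .
  then show s: "sq_integrable upper (R_adj n f)"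
    by (subst sq_integrable_nn_integral_iff[OF R_adj_measurable[OF f]]) simp
  show "(sq_norm upper (R_adj n f))\<^sup>2 = (\<Sum>j=1..n. (sq_norm halfline (f j))\<^sup>2)"
    using * unfolding nn_integral_sq[OF s] by (subst (asm) ennreal_inj) (auto simp: sum_nonneg)
qed

lemma slice_add: "slice n (\<lambda>j x. f j x + c * g j x) y t = slice n f y t + c * slice n g y t"
  unfolding slice_def by (simp add: distrib_left sum.distrib sum_distrib_left mult_ac)

lemma R_adj_add_cmult:
  assumes f: "L2vec n f" and g: "L2vec n g"
  shows "R_adj n (\<lambda>j x. f j x + c * g j x) = (\<lambda>z. R_adj n f z + c * R_adj n g z)"
proof
  fix z
  show "R_adj n (\<lambda>j x. f j x + c * g j x) z = R_adj n f z + c * R_adj n g z"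
  proof (cases "z \<in> half_plane")
    case True
    then have y: "Im z > 0" by (simp add: half_plane_def)
    have "cis (Re z * t) * slice n (\<lambda>j x. f j x + c * g j x) (Im z) t
      = cis (Re z * t) * slice n f (Im z) t + c * (cis (Re z * t) * slice n g (Im z) t)" for t
      unfolding slice_add by (simp add: distrib_left mult_ac)
    then have "(\<integral>t. cis (Re z * t) * slice n (\<lambda>j x. f j x + c * g j x) (Im z) t \<partial>halfline)
      = (\<integral>t. cis (Re z * t) * slice n f (Im z) t \<partial>halfline) + c * (\<integral>t. cis (Re z * t) * slice n g (Im z) t \<partial>halfline)"
      using slice_cis_integrable[OF f y] slice_cis_integrable[OF g y] by simp
    then show ?thesis using True by (simp only: R_adj_eq distrib_left mult.left_commute)
  qed (simp add: R_adj_def)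
qed

lemma R_adj_cong_AE:
  assumes "L2vec n f" "L2vec n g" "\<And>j. j \<in> {1..n} \<Longrightarrow> AE t in halfline. f j t = g j t"
  shows "R_adj n f = R_adj n g"
proof
  fix z
  show "R_adj n f z = R_adj n g z"
  proof (cases "z \<in> half_plane")
    case True
    then have y: "Im z > 0" by (simp add: half_plane_def)
    have "AE t in halfline. \<forall>j\<in>{1..n}. f j t = g j t"
      by (rule AE_finite_allI) (use assms(3) in auto)
    then have "AE t in halfline. cis (Re z * t) * slice n f (Im z) t = cis (Re z * t) * slice n g (Im z) t"
      by eventually_elim (auto simp: slice_def)
    then have "(\<integral>t. cis (Re z * t) * slice n f (Im z) t \<partial>halfline) = (\<integral>t. cis (Re z * t) * slice n g (Im z) t \<partial>halfline)"
      by (rule integral_cong_AE[rotated 2])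
         (use slice_cis_integrable[OF assms(1) y] slice_cis_integrable[OF assms(2) y] in \<open>auto dest: borel_measurable_integrable\<close>)
    then show ?thesis using True by (simp add: R_adj_eq)
  qed (simp add: R_adj_def)
qed

theorem R_adj_inner:
  assumes f: "L2vec n f" and g: "L2vec n g"
  shows "sq_inner upper (R_adj n f) (R_adj n g) = (\<Sum>j=1..n. sq_inner halfline (f j) (g j))"
proof -
  have "4 * sq_inner upper (R_adj n f) (R_adj n g)
     = (\<Sum>k<4. \<i> ^ k * complex_of_real (\<Sum>j=1..n. (sq_norm halfline (\<lambda>t. f j t + \<i> ^ k * g j t))\<^sup>2))"
  proof (subst sq_inner_polarization[OF R_adj_isometry(1)[OF f] R_adj_isometry(1)[OF g]], intro sum.cong refl)
    fix k :: nat
    have "L2vec n (\<lambda>j x. f j x + \<i> ^ k * g j x)"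
      using f g unfolding L2vec_def by (auto intro!: sq_integrable_add sq_integrable_cmult)
    from R_adj_isometry(2)[OF this]
    show "\<i> ^ k * complex_of_real ((sq_norm upper (\<lambda>x. R_adj n f x + \<i> ^ k * R_adj n g x))\<^sup>2)
      = \<i> ^ k * complex_of_real (\<Sum>j=1..n. (sq_norm halfline (\<lambda>t. f j t + \<i> ^ k * g j t))\<^sup>2)"
      by (simp add: R_adj_add_cmult[OF f g])
  qed
  also have "\<dots> = (\<Sum>j=1..n. \<Sum>k<4. \<i> ^ k * complex_of_real ((sq_norm halfline (\<lambda>t. f j t + \<i> ^ k * g j t))\<^sup>2))"
    by (subst sum.swap) (simp add: sum_distrib_left)
  also have "\<dots> = (\<Sum>j=1..n. 4 * sq_inner halfline (f j) (g j))"
    by (intro sum.cong refl sq_inner_polarization[symmetric] L2vecD[OF f] L2vecD[OF g])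
  finally show ?thesis by (simp add: sum_distrib_left[symmetric])
qed

section \<open>Polyanalytic functions\<close>

text \<open>On the half-plane this describes the polyanalytic functions, without iterated derivatives and in a form
  that is stable under products and holomorphic substitutions.\<close>

definition polyholomorphic_on :: "nat \<Rightarrow> complex set \<Rightarrow> (complex \<Rightarrow> complex) \<Rightarrow> bool" where
  "polyholomorphic_on n S f \<longleftrightarrow>
     (\<exists>h. (\<forall>a<n. h a holomorphic_on S) \<and> (\<forall>z\<in>S. f z = (\<Sum>a<n. cnj z ^ a * h a z)))"

lemma polyholomorphic_on_zero: "polyholomorphic_on n S (\<lambda>z. 0)"
  unfolding polyholomorphic_on_def by (intro exI[of _ "\<lambda>_ _. 0"]) auto

lemma polyholomorphic_on_add:
  assumes "polyholomorphic_on n S f" "polyholomorphic_on n S g"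
  shows "polyholomorphic_on n S (\<lambda>z. f z + g z)"
proof -
  obtain h k where "\<forall>a<n. h a holomorphic_on S" "\<forall>z\<in>S. f z = (\<Sum>a<n. cnj z ^ a * h a z)"
    "\<forall>a<n. k a holomorphic_on S" "\<forall>z\<in>S. g z = (\<Sum>a<n. cnj z ^ a * k a z)"
    using assms unfolding polyholomorphic_on_def by blast
  then show ?thesis unfolding polyholomorphic_on_def
    by (intro exI[of _ "\<lambda>a z. h a z + k a z"])
       (auto intro!: holomorphic_intros simp: sum.distrib distrib_left)
qed

lemma polyholomorphic_on_sum:
  "(\<And>i. i \<in> I \<Longrightarrow> polyholomorphic_on n S (f i)) \<Longrightarrow> polyholomorphic_on n S (\<lambda>z. \<Sum>i\<in>I. f i z)"
  by (induction I rule: infinite_finite_induct)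
     (auto intro: polyholomorphic_on_add simp: polyholomorphic_on_zero)

lemma polyholomorphic_on_mono:
  assumes "polyholomorphic_on n S f" "n \<le> m"
  shows "polyholomorphic_on m S f"
proof -
  obtain h where h: "\<forall>a<n. h a holomorphic_on S" "\<forall>z\<in>S. f z = (\<Sum>a<n. cnj z ^ a * h a z)"
    using assms unfolding polyholomorphic_on_def by blast
  have "(\<Sum>a<n. cnj z ^ a * h a z) = (\<Sum>a<m. cnj z ^ a * (if a < n then h a z else 0))" for z
    using assms(2) by (intro sum.mono_neutral_cong_left) auto
  moreover have "(\<lambda>z. if a < n then h a z else 0) holomorphic_on S" for a
    using h(1) by (cases "a < n") auto
  ultimately show ?thesis unfolding polyholomorphic_on_def
    using h(2) by (intro exI[of _ "\<lambda>a z. if a < n then h a z else 0"]) simp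
qed

lemma polyholomorphic_on_mult:
  assumes "polyholomorphic_on n S f" "g holomorphic_on S"
  shows "polyholomorphic_on n S (\<lambda>z. g z * f z)"
proof -
  obtain h where "\<forall>a<n. h a holomorphic_on S" "\<forall>z\<in>S. f z = (\<Sum>a<n. cnj z ^ a * h a z)"
    using assms unfolding polyholomorphic_on_def by blast
  then show ?thesis unfolding polyholomorphic_on_def
    using assms(2) by (intro exI[of _ "\<lambda>a z. g z * h a z"])
       (auto intro!: holomorphic_intros simp: sum_distrib_left mult_ac)
qed

lemma polyholomorphic_on_cnj_mult:
  assumes "polyholomorphic_on n S f"
  shows "polyholomorphic_on (Suc n) S (\<lambda>z. cnj z * f z)"
proof -
  obtain h where h: "\<forall>a<n. h a holomorphic_on S" "\<forall>z\<in>S. f z = (\<Sum>a<n. cnj z ^ a * h a z)"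
    using assms unfolding polyholomorphic_on_def by blast
  define k where "k a z = (case a of 0 \<Rightarrow> 0 | Suc b \<Rightarrow> h b z)" for a z
  have "k 0 = (\<lambda>_. 0)" "k (Suc b) = h b" for b by (auto simp: k_def)
  then have "k a holomorphic_on S" if "a < Suc n" for a
    using that h(1) by (cases a) auto
  moreover have "cnj z * f z = (\<Sum>a<Suc n. cnj z ^ a * k a z)" if "z \<in> S" for z
    unfolding sum.lessThan_Suc_shift using h(2) that by (simp add: k_def sum_distrib_left mult_ac)
  ultimately show ?thesis unfolding polyholomorphic_on_def by blast
qed

lemma polyholomorphic_on_affine_mult:
  assumes "polyholomorphic_on n S f"
  shows "polyholomorphic_on (Suc n) S (\<lambda>z. (\<alpha> + \<beta> * cnj z) * f z)"
proof -
  have "polyholomorphic_on (Suc n) S (\<lambda>z. \<alpha> * f z)" "polyholomorphic_on (Suc n) S (\<lambda>z. \<beta> * (cnj z * f z))"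
    by (auto intro!: polyholomorphic_on_mult polyholomorphic_on_cnj_mult polyholomorphic_on_mono[OF assms] assms)
  from polyholomorphic_on_add[OF this] show ?thesis by (simp add: algebra_simps)
qed

lemma polyholomorphic_on_affine_power_mult:
  "polyholomorphic_on n S f \<Longrightarrow> polyholomorphic_on (n + k) S (\<lambda>z. (\<alpha> + \<beta> * cnj z) ^ k * f z)"
  by (induction k) (auto simp: mult.assoc dest: polyholomorphic_on_affine_mult[of _ _ _ \<alpha> \<beta>])

lemma holomorphic_imp_polyholomorphic_on: "f holomorphic_on S \<Longrightarrow> polyholomorphic_on 1 S f"
  unfolding polyholomorphic_on_def by (intro exI[of _ "\<lambda>_. f"]) auto

lemma polyholomorphic_on_Im_power_mult:
  assumes "h holomorphic_on S" "a < n"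
  shows "polyholomorphic_on n S (\<lambda>z. of_real (Im z) ^ a * h z)"
  using assms(2)
proof (induction n arbitrary: a)
  case (Suc n)
  show ?case
  proof (cases a)
    case 0
    then show ?thesis using holomorphic_imp_polyholomorphic_on[OF assms(1)]
      by (auto intro: polyholomorphic_on_mono)
  next
    case (Suc b)
    have *: "polyholomorphic_on n S (\<lambda>z. of_real (Im z) ^ b * h z)" using Suc.IH Suc.prems Suc by simp
    have "polyholomorphic_on (Suc n) S (\<lambda>z. (z / (2 * \<i>)) * (of_real (Im z) ^ b * h z))"
      by (intro polyholomorphic_on_mult polyholomorphic_on_mono[OF *] holomorphic_intros) auto
    from polyholomorphic_on_add[OF this polyholomorphic_on_affine_mult[OF *, of 0 "- 1 / (2 * \<i>)"]]
    have "polyholomorphic_on (Suc n) S (\<lambda>z. ((z - cnj z) / (2 * \<i>)) * (of_real (Im z) ^ b * h z))"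
      by (simp add: algebra_simps diff_divide_distrib)
    moreover have "(z - cnj z) / (2 * \<i>) = of_real (Im z)" for z
      by (simp add: complex_diff_cnj complex_eq_iff)
    ultimately have "polyholomorphic_on (Suc n) S (\<lambda>z. of_real (Im z) * (of_real (Im z) ^ b * h z))"
      by (simp only:)
    then show ?thesis using Suc by (simp add: mult.assoc)
  qed
qed simp

lemma polyholomorphic_on_compose:
  assumes "polyholomorphic_on n T f" "g holomorphic_on S" "g ` S \<subseteq> T"
  obtains h where "\<And>a. a < n \<Longrightarrow> h a holomorphic_on S" "\<And>z. z \<in> S \<Longrightarrow> f (g z) = (\<Sum>a<n. cnj (g z) ^ a * h a z)"
proof -
  obtain h where h: "\<forall>a<n. h a holomorphic_on T" "\<forall>z\<in>T. f z = (\<Sum>a<n. cnj z ^ a * h a z)"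
    using assms(1) unfolding polyholomorphic_on_def by blast
  show thesis
    by (rule that[of "\<lambda>a z. h a (g z)"])
       (use h assms(2,3) holomorphic_on_compose_gen[of g S _ T] in \<open>auto simp: o_def\<close>)
qed

lemma has_derivative_cnj_power_mult:
  assumes "(h has_field_derivative h') (at z)"
  shows "((\<lambda>z. cnj z ^ a * h z) has_derivative
    (\<lambda>v. (of_nat a * cnj z ^ (a - 1) * h z) * cnj v + (cnj z ^ a * h') * v)) (at z)"
proof -
  have "(h has_derivative (\<lambda>v. h' * v)) (at z)"
    using assms by (simp add: has_field_derivative_def)
  moreover have "((\<lambda>z. cnj z ^ a) has_derivative (\<lambda>v. of_nat a * cnj v * cnj z ^ (a - 1))) (at z)"
    by (auto intro!: derivative_eq_intros simp: mult_ac)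
  ultimately have "((\<lambda>z. cnj z ^ a * h z) has_derivative
      (\<lambda>v. cnj z ^ a * (h' * v) + (of_nat a * cnj v * cnj z ^ (a - 1)) * h z)) (at z)"
    by (intro has_derivative_mult)
  then show ?thesis by (simp add: mult_ac add.commute)
qed

lemma dbar_eqI:
  assumes "(f has_derivative (\<lambda>v. A * cnj v + B * v)) (at z)"
  shows "dbar f z = A"
  unfolding dbar_def frechet_derivative_at[OF assms, symmetric]
  by (simp add: algebra_simps)

lemma polyholomorphic_on_dbar:
  assumes "polyholomorphic_on (Suc n) S f" "open S"
  shows "\<And>z. z \<in> S \<Longrightarrow> f differentiable (at z)" "polyholomorphic_on n S (dbar f)"
proof -
  obtain h where h: "\<And>a. a < Suc n \<Longrightarrow> h a holomorphic_on S"
    and f: "\<And>z. z \<in> S \<Longrightarrow> f z = (\<Sum>a<Suc n. cnj z ^ a * h a z)"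
    using assms(1) unfolding polyholomorphic_on_def by metis
  have der: "(f has_derivative (\<lambda>v. (\<Sum>a<Suc n. of_nat a * cnj z ^ (a - 1) * h a z) * cnj v
      + (\<Sum>a<Suc n. cnj z ^ a * deriv (h a) z) * v)) (at z)" if z: "z \<in> S" for z
  proof -
    have "((\<lambda>z. \<Sum>a<Suc n. cnj z ^ a * h a z) has_derivative
      (\<lambda>v. \<Sum>a<Suc n. (of_nat a * cnj z ^ (a - 1) * h a z) * cnj v + (cnj z ^ a * deriv (h a) z) * v)) (at z)"
      by (intro has_derivative_sum has_derivative_cnj_power_mult holomorphic_derivI[OF h assms(2) z]) auto
    then have "((\<lambda>z. \<Sum>a<Suc n. cnj z ^ a * h a z) has_derivative
      (\<lambda>v. (\<Sum>a<Suc n. of_nat a * cnj z ^ (a - 1) * h a z) * cnj v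
      + (\<Sum>a<Suc n. cnj z ^ a * deriv (h a) z) * v)) (at z)"
      by (simp only: sum.distrib sum_distrib_right)
    then show ?thesis
      by (rule has_derivative_transform_within_open[OF _ assms(2) z]) (simp add: f)
  qed
  show "\<And>z. z \<in> S \<Longrightarrow> f differentiable (at z)" using der unfolding differentiable_def by blast
  have "dbar f z = (\<Sum>a<n. cnj z ^ a * (of_nat (Suc a) * h (Suc a) z))" if "z \<in> S" for z
    using dbar_eqI[OF der[OF that]] unfolding sum.lessThan_Suc_shift by (simp add: mult_ac)
  then show "polyholomorphic_on n S (dbar f)"
    unfolding polyholomorphic_on_def
    by (intro exI[of _ "\<lambda>a z. of_nat (Suc a) * h (Suc a) z"]) (auto intro!: holomorphic_intros h)
qed

lemma polyanalytic_Suc: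
  "polyanalytic (Suc n) f \<longleftrightarrow> (\<forall>z\<in>half_plane. f differentiable (at z)) \<and> polyanalytic n (dbar f)"
proof -
  have *: "(dbar ^^ Suc j) f = (dbar ^^ j) (dbar f)" for j by (simp only: funpow_Suc_right o_apply)
  have "(\<forall>j<Suc n. \<forall>z\<in>half_plane. (dbar ^^ j) f differentiable (at z))
    \<longleftrightarrow> (\<forall>z\<in>half_plane. f differentiable (at z)) \<and> (\<forall>j<n. \<forall>z\<in>half_plane. (dbar ^^ Suc j) f differentiable (at z))"
    unfolding All_less_Suc2 by simp
  then show ?thesis unfolding polyanalytic_def * by blast
qed

lemma polyholomorphic_on_imp_polyanalytic: "polyholomorphic_on n half_plane f \<Longrightarrow> polyanalytic n f"
proof (induction n arbitrary: f)
  case 0 then show ?case by (simp add: polyholomorphic_on_def polyanalytic_def)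
next
  case (Suc n)
  then show ?case using polyholomorphic_on_dbar[OF Suc.prems half_plane_open] by (simp add: polyanalytic_Suc)
qed

lemma dbar_zero_imp_holomorphic:
  assumes "open S" "\<And>z. z \<in> S \<Longrightarrow> f differentiable (at z)" "\<And>z. z \<in> S \<Longrightarrow> dbar f z = 0"
  shows "f holomorphic_on S"
proof -
  have "\<exists>f'. (f has_field_derivative f') (at z)" if z: "z \<in> S" for z
  proof -
    define L where "L = frechet_derivative f (at z)"
    have L: "(f has_derivative L) (at z)" unfolding L_def using assms(2)[OF z] frechet_derivative_works by blast
    then have lin: "bounded_linear L" by (rule has_derivative_bounded_linear)
    have "L 1 + \<i> * L \<i> = 0" using assms(3)[OF z] by (simp add: dbar_def L_def)
    then have Li: "L \<i> = \<i> * L 1" by (auto simp: complex_eq_iff)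
    have "L v = L 1 * v" for v
    proof -
      have "v = Re v *\<^sub>R 1 + Im v *\<^sub>R \<i>" by (simp add: complex_eq_iff)
      then have "L v = L (Re v *\<^sub>R 1 + Im v *\<^sub>R \<i>)" by (rule arg_cong[where f = L])
      also have "\<dots> = Re v *\<^sub>R L 1 + Im v *\<^sub>R L \<i>"
        by (simp only: linear_add linear_scale bounded_linear.linear[OF lin])
      also have "\<dots> = L 1 * v" unfolding Li by (simp add: complex_eq_iff algebra_simps)
      finally show ?thesis .
    qed
    then have "L = (\<lambda>v. L 1 * v)" by (rule ext)
    then show ?thesis using L unfolding has_field_derivative_def by metis
  qed
  then show ?thesis using assms(1) by (simp add: holomorphic_on_open)
qed

text \<open>By induction \<open>dbar f\<close> is a polynomial in \<open>cnj z\<close> with holomorphic coefficients. Subtracting from \<open>f\<close> its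
  antiderivative in \<open>cnj z\<close> leaves a differentiable function annihilated by \<open>dbar\<close>, which is
  holomorphic by the Cauchy-Riemann equations.\<close>

lemma polyanalytic_imp_polyholomorphic_on: "polyanalytic n f \<Longrightarrow> polyholomorphic_on n half_plane f"
proof (induction n arbitrary: f)
  case 0 then show ?case by (simp add: polyholomorphic_on_def polyanalytic_def)
next
  case (Suc n)
  then have fd: "\<And>z. z \<in> half_plane \<Longrightarrow> f differentiable (at z)"
    and "polyholomorphic_on n half_plane (dbar f)" by (auto simp: polyanalytic_Suc)
  then obtain h where h: "\<And>a. a < n \<Longrightarrow> h a holomorphic_on half_plane"
    and df: "\<And>z. z \<in> half_plane \<Longrightarrow> dbar f z = (\<Sum>a<n. cnj z ^ a * h a z)"
    unfolding polyholomorphic_on_def by metis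
  \<comment> \<open>an antiderivative of \<open>dbar f\<close> in the variable \<open>cnj z\<close>\<close>
  define p where "p z = (\<Sum>a<n. cnj z ^ Suc a * (h a z / of_nat (Suc a)))" for z
  have dp: "\<exists>B. (p has_derivative (\<lambda>v. dbar f z * cnj v + B * v)) (at z)" if z: "z \<in> half_plane" for z
  proof -
    have "(p has_derivative (\<lambda>v. \<Sum>a<n. (of_nat (Suc a) * cnj z ^ (Suc a - 1) * (h a z / of_nat (Suc a))) * cnj v
       + (cnj z ^ Suc a * (deriv (h a) z / of_nat (Suc a))) * v)) (at z)"
      unfolding p_def[abs_def]
      by (intro has_derivative_sum has_derivative_cnj_power_mult DERIV_cdivide holomorphic_derivI[OF h half_plane_open z]) auto
    moreover have "of_nat (Suc a) * cnj z ^ (Suc a - 1) * (h a z / of_nat (Suc a)) = cnj z ^ a * h a z" for a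
      by (simp del: of_nat_Suc)
    ultimately show ?thesis unfolding df[OF z] by (simp only: sum.distrib flip: sum_distrib_right) blast
  qed
  define g where "g z = f z - p z" for z
  have g: "g differentiable (at z) \<and> dbar g z = 0" if z: "z \<in> half_plane" for z
  proof -
    obtain B where p': "(p has_derivative (\<lambda>v. dbar f z * cnj v + B * v)) (at z)" using dp[OF z] by blast
    define L where "L = frechet_derivative f (at z)"
    have L: "(f has_derivative L) (at z)" unfolding L_def using fd[OF z] frechet_derivative_works by blast
    have g': "(g has_derivative (\<lambda>v. L v - (dbar f z * cnj v + B * v))) (at z)"
      unfolding g_def[abs_def] by (rule has_derivative_diff[OF L p'])
    have "dbar g z = 0"
      unfolding dbar_def[of g] frechet_derivative_at[OF g', symmetric]
      by (simp add: dbar_def L_def[symmetric] algebra_simps)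
    then show ?thesis using g' unfolding differentiable_def by blast
  qed
  have gh: "g holomorphic_on half_plane" by (rule dbar_zero_imp_holomorphic[OF half_plane_open]) (use g in auto)
  have "polyholomorphic_on (Suc n) half_plane (\<lambda>z. g z + cnj z * (\<Sum>a<n. cnj z ^ a * (h a z / of_nat (Suc a))))"
  proof (rule polyholomorphic_on_add)
    show "polyholomorphic_on (Suc n) half_plane g"
      by (rule polyholomorphic_on_mono[OF holomorphic_imp_polyholomorphic_on[OF gh]]) simp
    have "polyholomorphic_on n half_plane (\<lambda>z. \<Sum>a<n. cnj z ^ a * (h a z / of_nat (Suc a)))"
      unfolding polyholomorphic_on_def
      by (intro exI[of _ "\<lambda>a z. h a z / of_nat (Suc a)"]) (auto intro!: holomorphic_intros h simp del: of_nat_Suc)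
    then show "polyholomorphic_on (Suc n) half_plane (\<lambda>z. cnj z * (\<Sum>a<n. cnj z ^ a * (h a z / of_nat (Suc a))))"
      by (rule polyholomorphic_on_cnj_mult)
  qed
  moreover have "g z + cnj z * (\<Sum>a<n. cnj z ^ a * (h a z / of_nat (Suc a))) = f z" for z
    by (simp add: g_def p_def sum_distrib_left mult.assoc del: of_nat_Suc)
  ultimately show ?case by simp
qed

lemma poly_bergmanD:
  assumes "f \<in> poly_bergman n"
  shows "sq_integrable upper f" "polyholomorphic_on n half_plane f" "\<And>z. z \<notin> half_plane \<Longrightarrow> f z = 0"
  using assms polyanalytic_imp_polyholomorphic_on by (auto simp: poly_bergman_def L2_iff)

lemma poly_bergmanI:
  assumes "sq_integrable upper f" "polyholomorphic_on n half_plane f" "\<And>z. z \<notin> half_plane \<Longrightarrow> f z = 0"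
  shows "f \<in> poly_bergman n"
  using assms polyholomorphic_on_imp_polyanalytic by (auto simp: poly_bergman_def L2_iff)

lemma poly_bergman_add:
  "f \<in> poly_bergman n \<Longrightarrow> g \<in> poly_bergman n \<Longrightarrow> (\<lambda>z. f z + g z) \<in> poly_bergman n"
  by (rule poly_bergmanI)
     (auto intro: sq_integrable_add polyholomorphic_on_add poly_bergmanD(1,2) simp: poly_bergmanD(3))

lemma poly_bergman_cmult: "f \<in> poly_bergman n \<Longrightarrow> (\<lambda>z. c * f z) \<in> poly_bergman n"
  by (rule poly_bergmanI)
     (auto intro: sq_integrable_cmult polyholomorphic_on_mult poly_bergmanD(1,2) simp: poly_bergmanD(3))

lemma poly_bergman_diff:
  "f \<in> poly_bergman n \<Longrightarrow> g \<in> poly_bergman n \<Longrightarrow> (\<lambda>z. f z - g z) \<in> poly_bergman n"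
  using poly_bergman_add[of f n "\<lambda>z. -1 * g z"] poly_bergman_cmult[of g n "-1"] by simp

lemma power_exp_sq_integrable:
  assumes "c > 0"
  shows "sq_integrable halfline (\<lambda>t. of_real (sqrt (2 * t) * t ^ m * exp (- c * t)))"
proof -
  have i: "integrable halfline (\<lambda>t. 2 * (t ^ (2 * m + 1) * exp (- (2 * c) * t)))"
    by (intro integrable_mult_right integrable_power_exp) (use assms in simp)
  have eq: "2 * (t ^ (2 * m + 1) * exp (- (2 * c) * t)) = (cmod (of_real (sqrt (2 * t) * t ^ m * exp (- c * t))))\<^sup>2"
    if "t > 0" for t
  proof -
    have "(exp (- c * t))\<^sup>2 = exp (- (2 * c) * t)" by (simp add: power2_eq_square flip: exp_add)
    moreover have "cmod (of_real (sqrt (2 * t) * t ^ m * exp (- c * t))) = sqrt (2 * t) * t ^ m * exp (- c * t)"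
      using that by (simp only: norm_of_real) simp
    ultimately show ?thesis using that by (simp add: power_mult_distrib power_even_eq)
  qed
  have "integrable halfline (\<lambda>t. (cmod (of_real (sqrt (2 * t) * t ^ m * exp (- c * t))))\<^sup>2)"
    by (rule Bochner_Integration.integrable_cong[THEN iffD1, OF refl _ i]) (rule eq, simp)
  then show ?thesis unfolding sq_integrable_def by (auto intro!: halfline_measurable)
qed

text \<open>Up to a constant, the coefficient of \<open>(Im z)\<^sup>m\<close> in \<open>R_adj\<close> has this form.\<close>

definition laplace_term :: "nat \<Rightarrow> (real \<Rightarrow> complex) \<Rightarrow> complex \<Rightarrow> complex" where
  "laplace_term m F z = (\<integral>t. exp (\<i> * z * of_real t) * of_real (sqrt (2 * t) * t ^ m) * F t \<partial>halfline)"

lemma laplace_term_dominated: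
  assumes F: "sq_integrable halfline F" and c: "c > 0"
  shows "integrable halfline (\<lambda>t. exp (- c * t) * (sqrt (2 * t) * t ^ m) * cmod (F t))"
proof -
  have "integrable halfline (\<lambda>t. F t * cnj (of_real (sqrt (2 * t) * t ^ m * exp (- c * t))))"
    by (rule sq_integrable_mult_integrable[OF F power_exp_sq_integrable[OF c]])
  then have "integrable halfline (\<lambda>t. cmod (F t * cnj (of_real (sqrt (2 * t) * t ^ m * exp (- c * t)))))"
    by (rule integrable_norm)
  then show ?thesis
    by (rule Bochner_Integration.integrable_cong[THEN iffD1, rotated 2]) (auto simp: norm_mult abs_mult norm_power)
qed

lemma laplace_term_integrable:
  assumes F: "sq_integrable halfline F" and z: "Im z > 0"
  shows "integrable halfline (\<lambda>t. exp (\<i> * z * of_real t) * of_real (sqrt (2 * t) * t ^ m) * F t)"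
proof (rule Bochner_Integration.integrable_bound[OF laplace_term_dominated[OF F z, of m]])
  note [measurable] = sq_integrable_measurable[OF F]
  show "(\<lambda>t. exp (\<i> * z * of_real t) * of_real (sqrt (2 * t) * t ^ m) * F t) \<in> borel_measurable halfline"
    by (intro borel_measurable_times sq_integrable_measurable[OF F] halfline_measurable) measurable
qed (auto simp: norm_mult abs_mult norm_power power_abs)

text \<open>Differentiation under the integral sign: near \<open>z\<close> the difference quotients are dominated by the
  integrand at half the height of \<open>z\<close>, with one more power of \<open>t\<close>.\<close>

lemma laplace_term_holomorphic:
  assumes F: "sq_integrable halfline F"
  shows "laplace_term m F holomorphic_on half_plane"
  unfolding holomorphic_on_open[OF half_plane_open]
proof
  fix z assume "z \<in> half_plane"
  then have z: "Im z > 0" by (simp add: half_plane_def)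
  define c where "c = Im z / 2"
  have c: "c > 0" using z by (simp add: c_def)
  define G where "G w t = exp (\<i> * w * of_real t) * of_real (sqrt (2 * t) * t ^ m) * F t" for w and t :: real
  have Gi: "integrable halfline (G w)" if "Im w > 0" for w
    unfolding G_def[abs_def] by (rule laplace_term_integrable[OF F that])
  define L where "L = (\<integral>t. \<i> * of_real t * G z t \<partial>halfline)"
  have tm: "(\<lambda>t. complex_of_real t) \<in> borel_measurable halfline" by (rule halfline_measurable) simp
  have "((\<lambda>w. (laplace_term m F w - laplace_term m F z) / (w - z)) \<longlongrightarrow> L) (at z)"
    unfolding tendsto_at_iff_sequentially comp_def
  proof (intro allI impI)
    fix w :: "nat \<Rightarrow> complex" assume w: "\<forall>i. w i \<in> UNIV - {z}" "w \<longlonglongrightarrow> z"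
    have "\<forall>\<^sub>F i in sequentially. dist (w i) z < c" using w(2) c by (rule tendstoD)
    then obtain N where N: "\<And>i. i \<ge> N \<Longrightarrow> cmod (w i - z) < c"
      by (auto simp: eventually_sequentially dist_norm)
    define v where "v i = w (i + N)" for i
    have v: "cmod (v i - z) < c" "v i \<noteq> z" for i using N w(1) by (auto simp: v_def)
    have vlim: "v \<longlonglongrightarrow> z" unfolding v_def by (rule LIMSEQ_ignore_initial_segment[OF w(2)])
    have vIm: "Im (v i) > 0" for i
      using v(1)[of i] abs_Im_le_cmod[of "v i - z"] z by (simp add: c_def abs_if split: if_splits)
    have "(\<lambda>i. \<integral>t. (G (v i) t - G z t) / (v i - z) \<partial>halfline) \<longlonglongrightarrow> L"
      unfolding L_def
    proof (rule integral_dominated_convergence[OF _ _ laplace_term_dominated[OF F c, of "Suc m"]])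
      show "(\<lambda>t. \<i> * of_real t * G z t) \<in> borel_measurable halfline"
        using tm borel_measurable_integrable[OF Gi[OF z]] by measurable
      show "(\<lambda>t. (G (v i) t - G z t) / (v i - z)) \<in> borel_measurable halfline" for i
        using borel_measurable_integrable[OF Gi[OF z]] borel_measurable_integrable[OF Gi[OF vIm]] by measurable
      show "AE t in halfline. (\<lambda>i. (G (v i) t - G z t) / (v i - z)) \<longlonglongrightarrow> \<i> * of_real t * G z t"
      proof (rule AE_I2)
        fix t :: real
        have "((\<lambda>w. G w t) has_field_derivative \<i> * of_real t * G z t) (at z)"
          unfolding G_def by (auto intro!: derivative_eq_intros)
        then have "((\<lambda>w. (G w t - G z t) / (w - z)) \<longlongrightarrow> \<i> * of_real t * G z t) (at z)"
          by (simp add: has_field_derivative_iff)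
        then show "(\<lambda>i. (G (v i) t - G z t) / (v i - z)) \<longlonglongrightarrow> \<i> * of_real t * G z t"
          using vlim v(2) unfolding tendsto_at_iff_sequentially comp_def by blast
      qed
      fix i
      show "AE t in halfline. norm ((G (v i) t - G z t) / (v i - z)) \<le> exp (- c * t) * (sqrt (2 * t) * t ^ Suc m) * cmod (F t)"
      proof (rule AE_I2)
        fix t :: real assume "t \<in> space halfline"
        then have t: "t > 0" by simp
        define d where "d = v i - z"
        have d: "d \<noteq> 0" "cmod d < c" using v[of i] by (auto simp: d_def)
        have "cmod (exp (\<i> * d * of_real t) - 1) \<le> exp \<bar>Re (\<i> * d * of_real t)\<bar> * cmod (\<i> * d * of_real t)"
          using Taylor_exp[of "\<i> * d * of_real t" 0] by simp
        also have "\<dots> \<le> exp (c * t) * (cmod d * t)"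
          using t d abs_Im_le_cmod[of d] by (intro mult_mono) (auto simp: norm_mult abs_mult intro!: mult_right_mono)
        finally have e: "cmod (exp (\<i> * d * of_real t) - 1) \<le> exp (c * t) * (cmod d * t)" .
        have vz: "\<i> * v i * of_real t = \<i> * z * of_real t + \<i> * d * of_real t"
          by (simp add: d_def algebra_simps)
        have "exp (\<i> * v i * of_real t) - exp (\<i> * z * of_real t) = exp (\<i> * z * of_real t) * (exp (\<i> * d * of_real t) - 1)"
          unfolding vz exp_add by (simp add: algebra_simps)
        then have "G (v i) t - G z t = exp (\<i> * z * of_real t) * (exp (\<i> * d * of_real t) - 1) * of_real (sqrt (2 * t) * t ^ m) * F t"
          unfolding G_def by (metis left_diff_distrib)
        then have "cmod (G (v i) t - G z t) = exp (- Im z * t) * cmod (exp (\<i> * d * of_real t) - 1) * (sqrt (2 * t) * t ^ m) * cmod (F t)"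
          using t by (simp add: norm_mult abs_mult norm_power)
        also have "\<dots> \<le> exp (- Im z * t) * (exp (c * t) * (cmod d * t)) * (sqrt (2 * t) * t ^ m) * cmod (F t)"
          using t e by (intro mult_right_mono mult_left_mono) auto
        also have "\<dots> = cmod d * ((exp (- Im z * t) * exp (c * t)) * (sqrt (2 * t) * t ^ Suc m) * cmod (F t))"
          by (simp add: mult_ac)
        also have "exp (- Im z * t) * exp (c * t) = exp (- c * t)"
          unfolding exp_add[symmetric] c_def by (simp add: algebra_simps)
        finally have "cmod (G (v i) t - G z t) / cmod d \<le> exp (- c * t) * (sqrt (2 * t) * t ^ Suc m) * cmod (F t)"
          using d by (simp add: divide_le_eq mult_ac)
        then show "norm ((G (v i) t - G z t) / (v i - z)) \<le> exp (- c * t) * (sqrt (2 * t) * t ^ Suc m) * cmod (F t)"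
          by (simp add: norm_divide d_def)
      qed
    qed
    moreover have "(\<integral>t. (G (v i) t - G z t) / (v i - z) \<partial>halfline) = (laplace_term m F (v i) - laplace_term m F z) / (v i - z)" for i
    proof -
      have "laplace_term m F w = (\<integral>t. G w t \<partial>halfline)" for w by (simp only: laplace_term_def G_def)
      then show ?thesis using Gi[OF vIm[of i]] Gi[OF z] by simp
    qed
    ultimately have "(\<lambda>i. (laplace_term m F (w (i + N)) - laplace_term m F z) / (w (i + N) - z)) \<longlonglongrightarrow> L"
      by (simp only: v_def)
    then show "(\<lambda>i. (laplace_term m F (w i) - laplace_term m F z) / (w i - z)) \<longlonglongrightarrow> L"
      by (rule LIMSEQ_offset)
  qed
  then show "\<exists>f'. (laplace_term m F has_field_derivative f') (at z)"
    by (auto simp: has_field_derivative_iff)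
qed

lemma slice_expand:
  assumes "t > 0" "y > 0"
  shows "slice n f y t = of_real (exp (- y * t)) *
    (\<Sum>a<n. of_real y ^ a * (of_real (sqrt (2 * t) * t ^ a) * (\<Sum>j=1..n. of_real (2 ^ a * coeff (laguerre (j - 1)) a) * f j t)))"
proof -
  have N: "Nvec j (2 * t * y) = exp (- y * t) * (\<Sum>a<n. coeff (laguerre (j - 1)) a * (2 * t * y) ^ a)" if "j \<in> {1..n}" for j
  proof -
    have "degree (laguerre (j - 1)) < n" using degree_laguerre[of "j - 1"] that by auto
    then have "poly (laguerre (j - 1)) (2 * t * y) = (\<Sum>a<n. coeff (laguerre (j - 1)) a * (2 * t * y) ^ a)"
      unfolding poly_altdef by (intro sum.mono_neutral_left) (auto simp: coeff_eq_0)
    then show ?thesis using assms by (simp add: Nvec_eq mult.commute)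
  qed
  have "(\<Sum>j=1..n. of_real (Nvec j (2 * t * y)) * f j t)
    = (\<Sum>j=1..n. \<Sum>a<n. of_real (exp (- y * t)) * (of_real (coeff (laguerre (j - 1)) a * (2 * t * y) ^ a) * f j t))"
  proof (rule sum.cong[OF refl])
    fix j assume j: "j \<in> {1..n}"
    show "of_real (Nvec j (2 * t * y)) * f j t
      = (\<Sum>a<n. of_real (exp (- y * t)) * (of_real (coeff (laguerre (j - 1)) a * (2 * t * y) ^ a) * f j t))"
      unfolding N[OF j] by (simp add: sum_distrib_left sum_distrib_right mult.assoc)
  qed
  also have "\<dots> = (\<Sum>a<n. \<Sum>j=1..n. of_real (exp (- y * t)) * (of_real (coeff (laguerre (j - 1)) a * (2 * t * y) ^ a) * f j t))"
    by (rule sum.swap)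
  also have "\<dots> = of_real (exp (- y * t)) * (\<Sum>a<n. of_real y ^ a * (of_real (t ^ a) * (\<Sum>j=1..n. of_real (2 ^ a * coeff (laguerre (j - 1)) a) * f j t)))"
    by (simp add: sum_distrib_left power_mult_distrib mult_ac)
  finally show ?thesis unfolding slice_eq by (simp add: sum_distrib_left mult_ac)
qed

lemma R_adj_laplace:
  assumes f: "L2vec n f" and z: "z \<in> half_plane"
  shows "R_adj n f z = of_real (1 / sqrt (2 * pi)) *
    (\<Sum>a<n. of_real (Im z) ^ a * laplace_term a (\<lambda>t. \<Sum>j=1..n. of_real (2 ^ a * coeff (laguerre (j - 1)) a) * f j t) z)"
proof -
  define F where "F a t = (\<Sum>j=1..n. of_real (2 ^ a * coeff (laguerre (j - 1)) a) * f j t)" for a and t :: real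
  have F: "sq_integrable halfline (F a)" for a unfolding F_def[abs_def]
    by (intro sq_integrable_sum sq_integrable_cmult L2vecD[OF f])
  have y: "Im z > 0" using z by (simp add: half_plane_def)
  have "(\<integral>t. cis (Re z * t) * slice n f (Im z) t \<partial>halfline)
    = (\<integral>t. (\<Sum>a<n. of_real (Im z) ^ a * (exp (\<i> * z * of_real t) * of_real (sqrt (2 * t) * t ^ a) * F a t)) \<partial>halfline)"
  proof (rule Bochner_Integration.integral_cong[OF refl])
    fix t assume "t \<in> space halfline"
    then have t: "t > 0" by simp
    have "cis (Re z * t) * of_real (exp (- Im z * t)) = exp (\<i> * z * of_real t)"
    proof -
      have e: "\<i> * z * of_real t = \<i> * of_real (Re z * t) + of_real (- Im z * t)" by (simp add: complex_eq_iff)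
      show ?thesis by (simp only: e exp_add cis_conv_exp exp_of_real)
    qed
    then show "cis (Re z * t) * slice n f (Im z) t
      = (\<Sum>a<n. of_real (Im z) ^ a * (exp (\<i> * z * of_real t) * of_real (sqrt (2 * t) * t ^ a) * F a t))"
      unfolding slice_expand[OF t y] F_def[symmetric] mult.assoc[symmetric]
      by (simp add: sum_distrib_left mult_ac)
  qed
  also have "\<dots> = (\<Sum>a<n. of_real (Im z) ^ a * laplace_term a (F a) z)"
    unfolding laplace_term_def using laplace_term_integrable[OF F y]
    by (subst Bochner_Integration.integral_sum) (auto intro!: integrable_mult_right)
  finally show ?thesis using z unfolding F_def by (simp add: R_adj_eq)
qed

text \<open>The Laguerre functions are \<open>e\<^sup>-\<^sup>t\<^sup>y\<close> times polynomials in \<open>y\<close> of degree below \<open>n\<close>. Hence \<open>R_adj n f\<close> is a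
  polynomial in \<open>Im z\<close> of degree below \<open>n\<close> whose coefficients are Laplace transforms.\<close>

theorem R_adj_in_poly_bergman:
  assumes f: "L2vec n f"
  shows "R_adj n f \<in> poly_bergman n"
proof (rule poly_bergmanI)
  define F where "F a t = (\<Sum>j=1..n. of_real (2 ^ a * coeff (laguerre (j - 1)) a) * f j t)" for a and t :: real
  have F: "sq_integrable halfline (F a)" for a unfolding F_def[abs_def]
    by (intro sq_integrable_sum sq_integrable_cmult L2vecD[OF f])
  have "polyholomorphic_on n half_plane (\<lambda>z. of_real (1 / sqrt (2 * pi)) * (\<Sum>a<n. of_real (Im z) ^ a * laplace_term a (F a) z))"
    by (intro polyholomorphic_on_mult polyholomorphic_on_sum polyholomorphic_on_Im_power_mult
        laplace_term_holomorphic F holomorphic_intros) auto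
  then show "polyholomorphic_on n half_plane (R_adj n f)"
    unfolding polyholomorphic_on_def using R_adj_laplace[OF f] by (simp add: F_def[abs_def])
qed (use R_adj_isometry(1)[OF f] in \<open>auto simp: R_adj_def\<close>)

section \<open>The operator \<open>R\<close>\<close>

definition single_component :: "nat \<Rightarrow> (real \<Rightarrow> complex) \<Rightarrow> nat \<Rightarrow> real \<Rightarrow> complex" where
  "single_component j g k = (if k = j then g else (\<lambda>_. 0))"

lemma L2vec_single: "sq_integrable halfline g \<Longrightarrow> L2vec n (single_component j g)"
  by (simp add: L2vec_def single_component_def sq_integrable_zero)

lemma slice_single:
  assumes "j \<in> {1..n}"
  shows "slice n (single_component j g) y t = of_real (basis_fun j y t) * g t"
proof -
  have "slice n (single_component j g) y t = (\<Sum>k=1..n. if k = j then of_real (basis_fun j y t) * g t else 0)"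
    unfolding slice_def single_component_def by (intro sum.cong) auto
  then show ?thesis using assms by simp
qed

lemma R_adj_decompose:
  assumes "L2vec n f"
  shows "R_adj n f z = (\<Sum>j=1..n. R_adj n (single_component j (f j)) z)"
proof (cases "z \<in> half_plane")
  case True
  then have y: "Im z > 0" by (simp add: half_plane_def)
  have "(\<integral>t. cis (Re z * t) * slice n f (Im z) t \<partial>halfline)
      = (\<integral>t. (\<Sum>j=1..n. cis (Re z * t) * slice n (single_component j (f j)) (Im z) t) \<partial>halfline)"
  proof (rule Bochner_Integration.integral_cong[OF refl])
    fix t
    have "slice n f (Im z) t = (\<Sum>j=1..n. slice n (single_component j (f j)) (Im z) t)"
      unfolding slice_def[of n f] by (intro sum.cong refl) (simp add: slice_single)
    then show "cis (Re z * t) * slice n f (Im z) t = (\<Sum>j=1..n. cis (Re z * t) * slice n (single_component j (f j)) (Im z) t)"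
      by (simp add: sum_distrib_left)
  qed
  also have "\<dots> = (\<Sum>j=1..n. \<integral>t. cis (Re z * t) * slice n (single_component j (f j)) (Im z) t \<partial>halfline)"
    by (rule Bochner_Integration.integral_sum) (intro slice_cis_integrable y L2vec_single L2vecD[OF assms])
  finally show ?thesis using True by (simp add: R_adj_eq sum_distrib_left)
qed (simp add: R_adj_def)

lemma R_adj_single_norm:
  assumes "sq_integrable halfline g" "j \<in> {1..n}"
  shows "sq_norm upper (R_adj n (single_component j g)) = sq_norm halfline g"
proof -
  have "(sq_norm upper (R_adj n (single_component j g)))\<^sup>2 = (\<Sum>k=1..n. (sq_norm halfline (single_component j g k))\<^sup>2)"
    by (rule R_adj_isometry(2)[OF L2vec_single[OF assms(1)]])
  also have "\<dots> = (\<Sum>k=1..n. if k = j then (sq_norm halfline g)\<^sup>2 else 0)"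
    by (intro sum.cong refl) (simp add: single_component_def)
  also have "\<dots> = (sq_norm halfline g)\<^sup>2" using assms(2) by simp
  finally show ?thesis by (simp add: power2_eq_iff_nonneg)
qed

lemma R_adj_single_inner:
  assumes "L2vec n f" "sq_integrable halfline g" "j \<in> {1..n}"
  shows "sq_inner upper (R_adj n f) (R_adj n (single_component j g)) = sq_inner halfline (f j) g"
proof -
  have "(\<Sum>k=1..n. sq_inner halfline (f k) (single_component j g k)) = (\<Sum>k=1..n. if k = j then sq_inner halfline (f j) g else 0)"
    by (intro sum.cong refl) (simp add: single_component_def sq_inner_def)
  then show ?thesis using assms(3) R_adj_inner[OF assms(1) L2vec_single[OF assms(2)]] by simp
qed

text \<open>The truncated integral \<open>R_trunc j \<phi> N x\<close> is, up to a constant, the inner product of \<open>\<phi>\<close> with this function.\<close>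

definition trunc_kernel :: "real \<Rightarrow> nat \<Rightarrow> real \<Rightarrow> complex \<Rightarrow> complex" where
  "trunc_kernel N j x z = indicator {-N..N} (Re z) * (cis (x * Re z) * of_real (basis_fun j (Im z) x))"

definition strip_cut :: "real \<Rightarrow> (complex \<Rightarrow> complex) \<Rightarrow> complex \<Rightarrow> complex" where
  "strip_cut N \<phi> z = indicator {-N..N} (Re z) * \<phi> z"

lemma strip_cut_sq_integrable:
  assumes "sq_integrable upper \<phi>" shows "sq_integrable upper (strip_cut N \<phi>)"
  unfolding strip_cut_def[abs_def]
  by (rule sq_integrable_bounded_mult[OF assms, where C = 1])
     (auto intro!: upper_measurable simp: indicator_def)

lemma joint_kernel_measurable:
  "(\<lambda>p. trunc_kernel N j (fst p) (snd p)) \<in> borel_measurable (halfline \<Otimes>\<^sub>M upper)"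
proof -
  have [measurable]: "(\<lambda>t. t) \<in> borel_measurable halfline" by (rule halfline_measurable) simp
  show ?thesis unfolding trunc_kernel_def by measurable
qed

lemma trunc_kernel_measurable: "trunc_kernel N j x \<in> borel_measurable upper"
  unfolding trunc_kernel_def[abs_def] by (rule upper_measurable) measurable

lemma basis_fun_vertical_norm:
  assumes "x > 0" "j \<ge> 1"
  shows "(\<integral>\<^sup>+y. ennreal ((basis_fun j y x)\<^sup>2) \<partial>halfline) = 1"
proof -
  have "(\<integral>\<^sup>+y. ennreal ((cmod (slice j (single_component j (\<lambda>_. 1)) y x))\<^sup>2) \<partial>halfline)
    = ennreal (\<Sum>k=1..j. (cmod (single_component j (\<lambda>_. 1) k x))\<^sup>2)"
    by (rule slice_vertical_norm[OF assms(1)])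
  also have "(\<Sum>k=1..j. (cmod (single_component j (\<lambda>_. 1) k x))\<^sup>2) = (\<Sum>k=1..j. if k = j then 1 else 0)"
    by (intro sum.cong refl) (simp add: single_component_def)
  finally show ?thesis using assms(2) by (simp add: slice_single)
qed

lemma trunc_kernel_sq:
  assumes x: "x > 0" and j: "j \<ge> 1" and N: "N \<ge> 0"
  shows "sq_integrable upper (trunc_kernel N j x)" "sq_norm upper (trunc_kernel N j x) = sqrt (2 * N)"
proof -
  note m = trunc_kernel_measurable[of N j x]
  have "(\<integral>\<^sup>+z. ennreal ((cmod (trunc_kernel N j x z))\<^sup>2) \<partial>upper)
     = (\<integral>\<^sup>+y. (\<integral>\<^sup>+s. ennreal ((cmod (trunc_kernel N j x (Complex s y)))\<^sup>2) \<partial>lborel) \<partial>halfline)"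
    by (rule nn_integral_upper, rule measurable_compose[OF m]) measurable
  also have "\<dots> = (\<integral>\<^sup>+y. (\<integral>\<^sup>+s. ennreal ((basis_fun j y x)\<^sup>2) * indicator {-N..N} s \<partial>lborel) \<partial>halfline)"
    by (intro nn_integral_cong) (simp add: trunc_kernel_def norm_mult power_mult_distrib indicator_def)
  also have "\<dots> = (\<integral>\<^sup>+y. ennreal ((basis_fun j y x)\<^sup>2) * ennreal (2 * N) \<partial>halfline)"
    using N by (intro nn_integral_cong) (simp add: nn_integral_cmult_indicator)
  also have "\<dots> = ennreal (2 * N)"
    using basis_fun_vertical_norm[OF x j]
    by (subst nn_integral_multc) (auto intro!: halfline_measurable)
  finally have *: "(\<integral>\<^sup>+z. ennreal ((cmod (trunc_kernel N j x z))\<^sup>2) \<partial>upper) = ennreal (2 * N)" .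
  then show s: "sq_integrable upper (trunc_kernel N j x)"
    by (subst sq_integrable_nn_integral_iff[OF m]) simp
  have "(sq_norm upper (trunc_kernel N j x))\<^sup>2 = 2 * N"
    using * N unfolding nn_integral_sq[OF s] by simp
  then show "sq_norm upper (trunc_kernel N j x) = sqrt (2 * N)" by (metis real_sqrt_unique sq_norm_nonneg)
qed

lemma R_trunc_eq:
  assumes \<phi>: "sq_integrable upper \<phi>" and x: "x > 0" and j: "j \<ge> 1" and N: "N \<ge> 0"
  shows "R_trunc j \<phi> N x = of_real (1 / sqrt (2 * pi)) * sq_inner upper \<phi> (trunc_kernel N j x)"
proof -
  have "sq_inner upper \<phi> (trunc_kernel N j x)
    = (\<integral>s. (\<integral>r. \<phi> (Complex s r) * cnj (trunc_kernel N j x (Complex s r)) \<partial>halfline) \<partial>lborel)"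
    unfolding sq_inner_def by (rule integral_upper[OF sq_integrable_mult_integrable[OF \<phi> trunc_kernel_sq(1)[OF x j N]]])
  also have "\<dots> = (LINT t:{-N..N}|lborel. cis (- (x * t)) *
        (LINT r:{0<..}|lborel. \<phi> (Complex t r) * of_real (sqrt (2 * x) * Nvec j (2 * x * r))))"
    unfolding set_lebesgue_integral_def
  proof (rule Bochner_Integration.integral_cong[OF refl])
    fix s
    have "(\<integral>r. \<phi> (Complex s r) * cnj (trunc_kernel N j x (Complex s r)) \<partial>halfline)
      = (\<integral>r. (indicator {-N..N} s * cis (- (x * s))) * (\<phi> (Complex s r) * of_real (sqrt (2 * x) * Nvec j (2 * x * r))) \<partial>halfline)"
      by (intro Bochner_Integration.integral_cong refl)
         (simp add: trunc_kernel_def basis_fun_def indicator_def cis_cnj)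
    then show "(\<integral>r. \<phi> (Complex s r) * cnj (trunc_kernel N j x (Complex s r)) \<partial>halfline)
      = indicat_real {-N..N} s *\<^sub>R (cis (- (x * s)) *
        (\<integral>r. indicat_real {0<..} r *\<^sub>R (\<phi> (Complex s r) * of_real (sqrt (2 * x) * Nvec j (2 * x * r))) \<partial>lborel))"
      by (simp add: integral_restrict_space) (simp add: indicator_def)
  qed
  finally show ?thesis unfolding R_trunc_def by simp
qed

interpretation halfline_upper: pair_sigma_finite halfline upper ..

lemma R_trunc_measurable:
  assumes \<phi>: "sq_integrable upper \<phi>" and j: "j \<ge> 1" and N: "N \<ge> 0"
  shows "R_trunc j \<phi> N \<in> borel_measurable halfline"
proof -
  note [measurable] = sq_integrable_measurable[OF \<phi>] joint_kernel_measurable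
  have "(\<lambda>p. \<phi> (snd p) * cnj (trunc_kernel N j (fst p) (snd p))) \<in> borel_measurable (halfline \<Otimes>\<^sub>M upper)"
    by measurable
  then have "(\<lambda>x. \<integral>z. \<phi> z * cnj (trunc_kernel N j x z) \<partial>upper) \<in> borel_measurable halfline"
    by (intro upper.borel_measurable_lebesgue_integral) (simp add: split_beta')
  then have "(\<lambda>x. of_real (1 / sqrt (2 * pi)) * sq_inner upper \<phi> (trunc_kernel N j x)) \<in> borel_measurable halfline"
    unfolding sq_inner_def by measurable
  then show ?thesis
    by (subst measurable_cong[where g = "\<lambda>x. of_real (1 / sqrt (2 * pi)) * sq_inner upper \<phi> (trunc_kernel N j x)"])
       (auto simp: R_trunc_eq[OF \<phi> _ j N])
qed

lemma R_trunc_bounded: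
  assumes \<phi>: "sq_integrable upper \<phi>" and j: "j \<ge> 1" and N: "N \<ge> 0" and x: "x > 0"
  shows "cmod (R_trunc j \<phi> N x) \<le> sq_norm upper \<phi> * sqrt (2 * N)"
proof -
  have "sqrt (2 * pi) \<ge> 1" using pi_gt3 by simp
  then have "1 / sqrt (2 * pi) \<le> 1" by simp
  have "cmod (sq_inner upper \<phi> (trunc_kernel N j x)) \<le> sq_norm upper \<phi> * sqrt (2 * N)"
    using sq_inner_Cauchy_Schwarz[OF \<phi> trunc_kernel_sq(1)[OF x j N]] trunc_kernel_sq(2)[OF x j N] by simp
  then have "1 / sqrt (2 * pi) * cmod (sq_inner upper \<phi> (trunc_kernel N j x)) \<le> 1 * (sq_norm upper \<phi> * sqrt (2 * N))"
    using \<open>1 / sqrt (2 * pi) \<le> 1\<close> by (intro mult_mono) auto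
  then show ?thesis by (simp add: R_trunc_eq[OF \<phi> x j N] norm_mult norm_divide)
qed

text \<open>Fubini's theorem. It applies because the truncated kernels have the same norm \<open>sqrt (2 N)\<close> for all \<open>x\<close>
  and \<open>g\<close> is integrable.\<close>

lemma R_trunc_adjoint:
  assumes \<phi>: "sq_integrable upper \<phi>" and j: "j \<in> {1..n}" and N: "N \<ge> 0"
    and g: "sq_integrable halfline g" "integrable halfline g"
  shows "sq_inner halfline (R_trunc j \<phi> N) g
    = sq_inner upper (strip_cut N \<phi>) (R_adj n (single_component j g))"
proof -
  have j1: "j \<ge> 1" using j by simp
  note [measurable] = sq_integrable_measurable[OF \<phi>] joint_kernel_measurable sq_integrable_measurable[OF g(1)]
  let ?K = "\<lambda>x z. \<phi> z * cnj (trunc_kernel N j x z) * cnj (g x)"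
  have m: "(\<lambda>p. ?K (fst p) (snd p)) \<in> borel_measurable (halfline \<Otimes>\<^sub>M upper)" by measurable
  have i1: "integrable upper (\<lambda>z. \<phi> z * cnj (trunc_kernel N j x z))" if "x > 0" for x
    by (rule sq_integrable_mult_integrable[OF \<phi> trunc_kernel_sq(1)[OF that j1 N]])
  have int: "integrable (halfline \<Otimes>\<^sub>M upper) (\<lambda>(x, z). ?K x z)"
  proof (rule halfline_upper.Fubini_integrable)
    show "(\<lambda>(x, z). ?K x z) \<in> borel_measurable (halfline \<Otimes>\<^sub>M upper)" using m by (simp add: split_beta')
    show "integrable halfline (\<lambda>x. \<integral>z. norm (case (x, z) of (x, z) \<Rightarrow> ?K x z) \<partial>upper)"
    proof (rule Bochner_Integration.integrable_bound)
      show "integrable halfline (\<lambda>x. (sq_norm upper \<phi> * sqrt (2 * N)) * cmod (g x))" using g(2) by simp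
      show "(\<lambda>x. \<integral>z. norm (case (x, z) of (x, z) \<Rightarrow> ?K x z) \<partial>upper) \<in> borel_measurable halfline"
        by (rule upper.borel_measurable_lebesgue_integral) (use m in \<open>simp add: split_beta'\<close>)
      show "AE x in halfline. norm (\<integral>z. norm (case (x, z) of (x, z) \<Rightarrow> ?K x z) \<partial>upper)
         \<le> norm ((sq_norm upper \<phi> * sqrt (2 * N)) * cmod (g x))"
      proof (rule AE_I2)
        fix x assume "x \<in> space halfline" then have x: "x > 0" by simp
        note ks = trunc_kernel_sq[OF x j1 N]
        define a where "a z = complex_of_real (cmod (\<phi> z))" for z
        define b where "b z = complex_of_real (cmod (trunc_kernel N j x z))" for z
        have a: "sq_integrable upper a" "sq_norm upper a = sq_norm upper \<phi>"
          using \<phi> unfolding sq_integrable_def sq_norm_def a_def by auto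
        have b: "sq_integrable upper b" "sq_norm upper b = sqrt (2 * N)"
          using ks(1) ks(2)[symmetric] unfolding sq_integrable_def sq_norm_def b_def by auto
        have "sq_inner upper a b = of_real (\<integral>z. cmod (\<phi> z) * cmod (trunc_kernel N j x z) \<partial>upper)"
          unfolding sq_inner_def a_def b_def by (simp flip: of_real_mult)
        then have "\<bar>\<integral>z. cmod (\<phi> z) * cmod (trunc_kernel N j x z) \<partial>upper\<bar> \<le> sq_norm upper \<phi> * sqrt (2 * N)"
          using sq_inner_Cauchy_Schwarz[OF a(1) b(1)] a(2) b(2) by simp
        then have "\<bar>\<integral>z. cmod (\<phi> z) * cmod (trunc_kernel N j x z) \<partial>upper\<bar> * cmod (g x) \<le> sq_norm upper \<phi> * sqrt (2 * N) * cmod (g x)"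
          by (rule mult_right_mono) simp
        then show "norm (\<integral>z. norm (case (x, z) of (x, z) \<Rightarrow> ?K x z) \<partial>upper)
         \<le> norm ((sq_norm upper \<phi> * sqrt (2 * N)) * cmod (g x))"
          using N by (simp add: norm_mult abs_mult)
      qed
    qed
    show "AE x in halfline. integrable upper (\<lambda>z. case (x, z) of (x, z) \<Rightarrow> ?K x z)"
      using i1 by (auto intro!: AE_I2)
  qed
  have "sq_inner halfline (R_trunc j \<phi> N) g
    = (\<integral>x. of_real (1 / sqrt (2 * pi)) * (\<integral>z. ?K x z \<partial>upper) \<partial>halfline)"
    unfolding sq_inner_def[of halfline]
  proof (rule Bochner_Integration.integral_cong[OF refl])
    fix x assume "x \<in> space halfline" then have x: "x > 0" by simp
    have "(\<integral>z. ?K x z \<partial>upper) = sq_inner upper \<phi> (trunc_kernel N j x) * cnj (g x)"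
      unfolding sq_inner_def by simp
    then show "R_trunc j \<phi> N x * cnj (g x) = of_real (1 / sqrt (2 * pi)) * (\<integral>z. ?K x z \<partial>upper)"
      by (simp only: R_trunc_eq[OF \<phi> x j1 N] mult.assoc)
  qed
  also have "\<dots> = of_real (1 / sqrt (2 * pi)) * (\<integral>x. (\<integral>z. ?K x z \<partial>upper) \<partial>halfline)"
    by simp
  also have "(\<integral>x. (\<integral>z. ?K x z \<partial>upper) \<partial>halfline) = (\<integral>z. (\<integral>x. ?K x z \<partial>halfline) \<partial>upper)"
    by (rule halfline_upper.Fubini_integral[symmetric, OF int])
  also have "of_real (1 / sqrt (2 * pi)) * (\<integral>z. (\<integral>x. ?K x z \<partial>halfline) \<partial>upper)
     = (\<integral>z. strip_cut N \<phi> z * cnj (R_adj n (single_component j g) z) \<partial>upper)"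
  proof (subst integral_mult_right_zero[symmetric], rule Bochner_Integration.integral_cong[OF refl])
    fix z assume "z \<in> space upper"
    then have z: "z \<in> half_plane" by simp
    have "(\<integral>x. ?K x z \<partial>halfline) = (\<integral>x. strip_cut N \<phi> z * cnj (cis (Re z * x) * slice n (single_component j g) (Im z) x) \<partial>halfline)"
      unfolding slice_single[OF j]
      by (intro Bochner_Integration.integral_cong refl)
         (simp add: trunc_kernel_def strip_cut_def indicator_def mult.commute[of "Re z"])
    also have "\<dots> = strip_cut N \<phi> z * cnj (\<integral>x. cis (Re z * x) * slice n (single_component j g) (Im z) x \<partial>halfline)"
      by (simp only: integral_mult_right_zero Bochner_Integration.integral_cnj)
    finally show "of_real (1 / sqrt (2 * pi)) * (\<integral>x. ?K x z \<partial>halfline)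
      = strip_cut N \<phi> z * cnj (R_adj n (single_component j g) z)"
      by (simp only: R_adj_eq[OF z] complex_cnj_mult complex_cnj_complex_of_real mult.left_commute)
  qed
  finally show ?thesis unfolding sq_inner_def[of upper] .
qed

text \<open>Test the duality with the restrictions of \<open>R_trunc j \<phi> N\<close> to bounded intervals. They are bounded, hence
  admissible, and \<open>R\<^sup>*\<close> preserves their norms.\<close>

lemma R_trunc_norm_le:
  assumes \<phi>: "sq_integrable upper \<phi>" and j: "j \<ge> 1" and N: "N \<ge> 0"
  shows "sq_integrable halfline (R_trunc j \<phi> N)" "sq_norm halfline (R_trunc j \<phi> N) \<le> sq_norm upper \<phi>"
proof -
  let ?T = "R_trunc j \<phi> N"
  note Tm = R_trunc_measurable[OF \<phi> j N]
  define g where "g k x = indicator {..real k} x * ?T x" for k and x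
  have gm: "g k \<in> borel_measurable halfline" for k
    unfolding g_def by (rule borel_measurable_times[OF halfline_measurable Tm]) auto
  define B where "B = sq_norm upper \<phi> * sqrt (2 * N)"
  have B: "x > 0 \<Longrightarrow> cmod (?T x) \<le> B" for x unfolding B_def by (rule R_trunc_bounded[OF \<phi> j N])
  have B0: "B \<ge> 0" unfolding B_def using N by simp
  have i1: "integrable halfline (\<lambda>x. indicator {..real k} x * c)" for k and c :: real
  proof -
    have "(\<lambda>x. indicat_real {0<..} x * indicat_real {..real k} x) = indicat_real {0<..real k}"
      by (auto simp: indicator_def)
    moreover have "integrable lborel (indicat_real {0<..real k})"
      by (rule integrable_real_indicator) auto
    ultimately show ?thesis by (simp add: integrable_restrict_space)
  qed
  have gi: "integrable halfline (g k)" for k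
    by (rule Bochner_Integration.integrable_bound[OF i1[of k B] gm])
       (use B B0 in \<open>auto simp: g_def norm_mult indicator_def intro!: AE_I2\<close>)
  have gs: "sq_integrable halfline (g k)" for k
    unfolding sq_integrable_def
  proof (intro conjI gm, rule Bochner_Integration.integrable_bound[OF i1[of k "B\<^sup>2"]])
    show "(\<lambda>x. (cmod (g k x))\<^sup>2) \<in> borel_measurable halfline" using gm by measurable
    show "AE x in halfline. norm ((cmod (g k x))\<^sup>2) \<le> norm (indicator {..real k} x * B\<^sup>2)"
      using B B0 by (auto simp: g_def norm_mult indicator_def intro!: AE_I2 power_mono)
  qed
  have gn: "sq_norm halfline (g k) \<le> sq_norm upper \<phi>" for k
  proof -
    have e: "sq_inner halfline ?T (g k) = sq_inner halfline (g k) (g k)"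
      unfolding sq_inner_def by (intro Bochner_Integration.integral_cong refl) (simp add: g_def indicator_def)
    have "complex_of_real ((sq_norm halfline (g k))\<^sup>2) = sq_inner upper (strip_cut N \<phi>) (R_adj j (single_component j (g k)))"
      unfolding sq_inner_self[symmetric] e[symmetric]
      by (rule R_trunc_adjoint[OF \<phi> _ N gs gi]) (use j in simp)
    also have "cmod \<dots> \<le> sq_norm upper (strip_cut N \<phi>) * sq_norm halfline (g k)"
      using sq_inner_Cauchy_Schwarz[OF strip_cut_sq_integrable[OF \<phi>] R_adj_isometry(1)[OF L2vec_single[OF gs[of k]]], of N j j]
        R_adj_single_norm[OF gs, of j j] j by simp
    also have "\<dots> \<le> sq_norm upper \<phi> * sq_norm halfline (g k)"
    proof (rule mult_right_mono)
      show "sq_norm upper (strip_cut N \<phi>) \<le> sq_norm upper \<phi>"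
        by (rule sq_norm_mono[OF \<phi> sq_integrable_measurable[OF strip_cut_sq_integrable[OF \<phi>]]])
           (auto simp: strip_cut_def norm_mult indicator_def)
    qed simp
    finally have "sq_norm halfline (g k) * sq_norm halfline (g k) \<le> sq_norm upper \<phi> * sq_norm halfline (g k)"
      by (simp add: power2_eq_square norm_mult)
    then show ?thesis by (cases "sq_norm halfline (g k) = 0") (auto simp: mult_le_cancel_right order.strict_iff_order)
  qed
  have lim: "AE x in halfline. (\<lambda>k. g k x) \<longlonglongrightarrow> ?T x"
  proof (rule AE_I2, rule tendsto_eventually)
    fix x :: real
    obtain k where "real k \<ge> x" using real_arch_simple by blast
    then show "\<forall>\<^sub>F k in sequentially. g k x = ?T x"
      by (intro eventually_sequentiallyI[of k]) (auto simp: g_def)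
  qed
  show "sq_integrable halfline ?T" "sq_norm halfline ?T \<le> sq_norm upper \<phi>"
    by (rule sq_norm_le_liminf[OF gs Tm lim, of 0], rule gn)+
qed

lemma strip_cut_tendsto:
  assumes \<phi>: "sq_integrable upper \<phi>"
  shows "((\<lambda>N. sq_norm upper (\<lambda>z. strip_cut N \<phi> z - \<phi> z)) \<longlongrightarrow> 0) at_top"
proof (rule tendsto_at_topI_sequentially)
  fix X :: "nat \<Rightarrow> real" assume X: "filterlim X at_top sequentially"
  show "(\<lambda>i. sq_norm upper (\<lambda>z. strip_cut (X i) \<phi> z - \<phi> z)) \<longlonglongrightarrow> 0"
  proof (rule sq_norm_tendsto_dominated[OF \<phi>])
    show "(\<lambda>z. strip_cut (X i) \<phi> z - \<phi> z) \<in> borel_measurable upper" for i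
      using strip_cut_sq_integrable[OF \<phi>, of "X i"] \<phi> by (intro borel_measurable_diff sq_integrable_measurable)
    show "AE z in upper. (\<lambda>i. strip_cut (X i) \<phi> z - \<phi> z) \<longlonglongrightarrow> 0"
    proof (rule AE_I2, rule tendsto_eventually)
      fix z :: complex
      have "\<forall>\<^sub>F i in sequentially. X i \<ge> \<bar>Re z\<bar>" using X by (simp add: filterlim_at_top)
      then show "\<forall>\<^sub>F i in sequentially. strip_cut (X i) \<phi> z - \<phi> z = 0"
        by eventually_elim (auto simp: strip_cut_def indicator_def)
    qed
    show "AE z in upper. cmod (strip_cut (X i) \<phi> z - \<phi> z) \<le> cmod (\<phi> z)" for i
      by (rule AE_I2) (simp add: strip_cut_def indicator_def)
  qed
qed

text \<open>The increment is the transform of the part of \<open>\<phi>\<close> over \<open>N < \<bar>Re z\<bar> \<le> N'\<close>.\<close>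

lemma R_trunc_increment:
  assumes \<phi>: "sq_integrable upper \<phi>" and j: "j \<ge> 1" and N: "0 \<le> N" "N \<le> N'"
  shows "sq_norm halfline (\<lambda>x. R_trunc j \<phi> N' x - R_trunc j \<phi> N x) \<le> sq_norm upper (\<lambda>z. strip_cut N \<phi> z - \<phi> z)"
proof -
  define \<psi> where "\<psi> z = \<phi> z - strip_cut N \<phi> z" for z
  have \<psi>: "sq_integrable upper \<psi>" unfolding \<psi>_def[abs_def]
    by (intro sq_integrable_diff \<phi> strip_cut_sq_integrable)
  have N': "0 \<le> N'" using N by simp
  have "R_trunc j \<phi> N' x - R_trunc j \<phi> N x = R_trunc j \<psi> N' x" if x: "x > 0" for x
  proof -
    have "sq_inner upper (strip_cut N \<phi>) (trunc_kernel N' j x) = sq_inner upper \<phi> (trunc_kernel N j x)"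
      unfolding sq_inner_def using N
      by (intro Bochner_Integration.integral_cong refl) (auto simp: strip_cut_def trunc_kernel_def indicator_def)
    then have "sq_inner upper \<psi> (trunc_kernel N' j x) = sq_inner upper \<phi> (trunc_kernel N' j x) - sq_inner upper \<phi> (trunc_kernel N j x)"
      unfolding \<psi>_def[abs_def] using sq_inner_diff_left[OF \<phi> strip_cut_sq_integrable[OF \<phi>] trunc_kernel_sq(1)[OF x j N']] by simp
    then show ?thesis
      by (simp add: R_trunc_eq[OF \<phi> x j N'] R_trunc_eq[OF \<phi> x j N(1)] R_trunc_eq[OF \<psi> x j N'] diff_divide_distrib)
  qed
  then have "sq_norm halfline (\<lambda>x. R_trunc j \<phi> N' x - R_trunc j \<phi> N x) = sq_norm halfline (R_trunc j \<psi> N')"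
    unfolding sq_norm_def by (intro arg_cong[of _ _ sqrt] Bochner_Integration.integral_cong) auto
  also have "\<dots> \<le> sq_norm upper \<psi>" by (rule R_trunc_norm_le(2)[OF \<psi> j N'])
  also have "\<dots> = sq_norm upper (\<lambda>z. strip_cut N \<phi> z - \<phi> z)"
    unfolding \<psi>_def[abs_def] by (rule sq_norm_uminus_diff)
  finally show ?thesis .
qed

lemma R_op_limit:
  assumes \<phi>: "sq_integrable upper \<phi>" and j: "j \<in> {1..m}"
  shows "sq_integrable halfline (R_op m \<phi> j)"
    and "((\<lambda>N. sq_norm halfline (\<lambda>x. R_trunc j \<phi> N x - R_op m \<phi> j x)) \<longlongrightarrow> 0) at_top"
proof -
  have j1: "j \<ge> 1" using j by simp
  obtain f where f: "sq_integrable halfline f" "((\<lambda>N. sq_norm halfline (\<lambda>x. R_trunc j \<phi> N x - f x)) \<longlongrightarrow> 0) at_top"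
  proof (rule sq_norm_complete[of halfline "R_trunc j \<phi>" "\<lambda>N. sq_norm upper (\<lambda>z. strip_cut N \<phi> z - \<phi> z)"])
    show "\<And>N. 0 \<le> N \<Longrightarrow> sq_integrable halfline (R_trunc j \<phi> N)" by (rule R_trunc_norm_le(1)[OF \<phi> j1])
  qed (use R_trunc_increment[OF \<phi> j1] strip_cut_tendsto[OF \<phi>] in auto)
  have "\<forall>\<^sub>F N in at_top. sq_integrable halfline (R_trunc j \<phi> N)"
    using eventually_ge_at_top[of 0] by eventually_elim (rule R_trunc_norm_le(1)[OF \<phi> j1])
  then have "L2_tendsto {0<..} (R_trunc j \<phi>) f at_top"
    unfolding L2_tendsto_def using f by (simp add: L2_iff l2_norm_eq)
  then have "L2_tendsto {0<..} (R_trunc j \<phi>) (R_op m \<phi> j) at_top"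
    unfolding R_op_def using j by (auto intro: someI[where P = "\<lambda>f. L2_tendsto {0<..} (R_trunc j \<phi>) f at_top"])
  then show "sq_integrable halfline (R_op m \<phi> j)"
    "((\<lambda>N. sq_norm halfline (\<lambda>x. R_trunc j \<phi> N x - R_op m \<phi> j x)) \<longlongrightarrow> 0) at_top"
    unfolding L2_tendsto_def by (auto simp: L2_iff l2_norm_eq)
qed

lemma R_op_L2vec: "sq_integrable upper \<phi> \<Longrightarrow> L2vec m (R_op m \<phi>)"
  unfolding L2vec_def using R_op_limit(1) by blast

lemma R_op_adjoint_integrable:
  assumes \<phi>: "sq_integrable upper \<phi>" and j: "j \<in> {1..n}" and g: "sq_integrable halfline g" "integrable halfline g"
  shows "sq_inner halfline (R_op n \<phi> j) g = sq_inner upper \<phi> (R_adj n (single_component j g))"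
proof -
  have j1: "j \<ge> 1" using j by simp
  have e: "\<forall>\<^sub>F N in at_top. sq_integrable halfline (R_trunc j \<phi> N)"
    using eventually_ge_at_top[of 0] by eventually_elim (rule R_trunc_norm_le(1)[OF \<phi> j1])
  have 1: "((\<lambda>N. sq_inner halfline (R_trunc j \<phi> N) g) \<longlongrightarrow> sq_inner halfline (R_op n \<phi> j) g) at_top"
    by (rule sq_inner_tendsto_left[OF R_op_limit(1)[OF \<phi> j] g(1) e R_op_limit(2)[OF \<phi> j]])
  have 2: "((\<lambda>N. sq_inner upper (strip_cut N \<phi>) (R_adj n (single_component j g)))
      \<longlongrightarrow> sq_inner upper \<phi> (R_adj n (single_component j g))) at_top"
    by (rule sq_inner_tendsto_left[OF \<phi> R_adj_isometry(1)[OF L2vec_single[OF g(1)]] _ strip_cut_tendsto[OF \<phi>]])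
       (intro always_eventually allI strip_cut_sq_integrable \<phi>)
  have "\<forall>\<^sub>F N in at_top. sq_inner upper (strip_cut N \<phi>) (R_adj n (single_component j g)) = sq_inner halfline (R_trunc j \<phi> N) g"
    using eventually_ge_at_top[of 0] by eventually_elim (rule R_trunc_adjoint[OF \<phi> j _ g, symmetric])
  from Lim_transform_eventually[OF 2 this] have
    "((\<lambda>N. sq_inner halfline (R_trunc j \<phi> N) g) \<longlongrightarrow> sq_inner upper \<phi> (R_adj n (single_component j g))) at_top" .
  then show ?thesis using tendsto_unique[OF _ 1] by (simp add: trivial_limit_at_top_linorder)
qed

text \<open>Restricting \<open>g\<close> to bounded intervals makes it integrable, and both sides are continuous in \<open>g\<close>.\<close>

lemma R_op_adjoint_single:
  assumes \<phi>: "sq_integrable upper \<phi>" and j: "j \<in> {1..n}" and g: "sq_integrable halfline g"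
  shows "sq_inner halfline (R_op n \<phi> j) g = sq_inner upper \<phi> (R_adj n (single_component j g))"
proof -
  define h where "h k x = indicator {..real k} x * g x" for k and x
  have hs: "sq_integrable halfline (h k)" for k
    unfolding h_def by (rule sq_integrable_bounded_mult[OF g, where C = 1])
      (auto intro!: halfline_measurable simp: indicator_def)
  have hi: "integrable halfline (h k)" for k
  proof -
    have "integrable halfline (\<lambda>x. g x * cnj (of_real (indicator {..real k} x)))"
    proof (rule sq_integrable_mult_integrable[OF g])
      have "(\<lambda>x. indicat_real {0<..} x *\<^sub>R (cmod (of_real (indicat_real {..real k} x)))\<^sup>2) = indicat_real {0<..real k}"
        by (auto simp: indicator_def)
      moreover have "integrable lborel (indicat_real {0<..real k})"
        by (rule integrable_real_indicator) auto
      ultimately show "sq_integrable halfline (\<lambda>x. complex_of_real (indicat_real {..real k} x))"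
        unfolding sq_integrable_def by (auto simp: integrable_restrict_space intro!: halfline_measurable)
    qed
    then show ?thesis unfolding h_def
      by (rule Bochner_Integration.integrable_cong[THEN iffD1, rotated 2]) (auto simp: indicator_def)
  qed
  have hlim: "(\<lambda>k. sq_norm halfline (\<lambda>x. h k x - g x)) \<longlonglongrightarrow> 0"
  proof (rule sq_norm_tendsto_dominated[OF g])
    show "(\<lambda>x. h k x - g x) \<in> borel_measurable halfline" for k
      using hs[of k] g by (intro borel_measurable_diff sq_integrable_measurable)
    show "AE x in halfline. (\<lambda>k. h k x - g x) \<longlonglongrightarrow> 0"
    proof (rule AE_I2, rule tendsto_eventually)
      fix x :: real
      obtain k where "real k \<ge> x" using real_arch_simple by blast
      then show "\<forall>\<^sub>F k in sequentially. h k x - g x = 0"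
        by (intro eventually_sequentiallyI[of k]) (auto simp: h_def)
    qed
    show "AE x in halfline. cmod (h k x - g x) \<le> cmod (g x)" for k
      by (rule AE_I2) (simp add: h_def indicator_def)
  qed
  note U = R_adj_isometry(1)[OF L2vec_single]
  have hlim2: "(\<lambda>k. sq_norm upper (\<lambda>z. R_adj n (single_component j (h k)) z - R_adj n (single_component j g) z)) \<longlonglongrightarrow> 0"
  proof -
    have "sq_norm upper (\<lambda>z. R_adj n (single_component j (h k)) z - R_adj n (single_component j g) z)
       = sq_norm halfline (\<lambda>x. h k x - g x)" for k
    proof -
      have "(\<lambda>i x. single_component j (h k) i x + (-1) * single_component j g i x) = single_component j (\<lambda>x. h k x - g x)"
        by (auto simp: single_component_def fun_eq_iff)
      then have "R_adj n (single_component j (\<lambda>x. h k x - g x))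
          = (\<lambda>z. R_adj n (single_component j (h k)) z - R_adj n (single_component j g) z)"
        using R_adj_add_cmult[OF L2vec_single[OF hs[of k], where j = j] L2vec_single[OF g, where j = j], where c = "-1" and n = n] by simp
      then show ?thesis using R_adj_single_norm[OF sq_integrable_diff[OF hs g] j, of k] by simp
    qed
    then show ?thesis using hlim by simp
  qed
  have 1: "(\<lambda>k. sq_inner halfline (h k) (R_op n \<phi> j)) \<longlonglongrightarrow> sq_inner halfline g (R_op n \<phi> j)"
    by (rule sq_inner_tendsto_left[OF g R_op_limit(1)[OF \<phi> j] _ hlim]) (intro always_eventually allI hs)
  have 2: "(\<lambda>k. sq_inner upper (R_adj n (single_component j (h k))) \<phi>) \<longlonglongrightarrow> sq_inner upper (R_adj n (single_component j g)) \<phi>"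
    by (rule sq_inner_tendsto_left[OF U[OF g] \<phi> _ hlim2]) (intro always_eventually allI U hs)
  have "sq_inner upper (R_adj n (single_component j (h k))) \<phi> = sq_inner halfline (h k) (R_op n \<phi> j)" for k
    using R_op_adjoint_integrable[OF \<phi> j hs hi, of k] by (metis sq_inner_commute)
  then have "sq_inner upper (R_adj n (single_component j g)) \<phi> = sq_inner halfline g (R_op n \<phi> j)"
    using LIMSEQ_unique[OF 1] 2 by simp
  then show ?thesis by (metis sq_inner_commute)
qed

theorem R_op_adjoint:
  assumes \<phi>: "sq_integrable upper \<phi>" and g: "L2vec n g"
  shows "sq_inner upper \<phi> (R_adj n g) = (\<Sum>j=1..n. sq_inner halfline (R_op n \<phi> j) (g j))"
proof -
  have "sq_inner upper (R_adj n g) \<phi> = (\<Sum>j=1..n. sq_inner upper (R_adj n (single_component j (g j))) \<phi>)"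
    unfolding R_adj_decompose[OF g, abs_def]
    by (intro sq_inner_sum_left R_adj_isometry(1) L2vec_single L2vecD[OF g] \<phi>)
  then have "sq_inner upper \<phi> (R_adj n g) = (\<Sum>j=1..n. sq_inner upper \<phi> (R_adj n (single_component j (g j))))"
    by (subst sq_inner_commute) (simp add: sq_inner_commute[of upper \<phi>])
  also have "\<dots> = (\<Sum>j=1..n. sq_inner halfline (R_op n \<phi> j) (g j))"
    by (intro sum.cong refl R_op_adjoint_single[symmetric] \<phi> L2vecD[OF g])
  finally show ?thesis .
qed

text \<open>The isometry and the duality give both sides the same inner product with every \<open>g\<close>.\<close>

theorem R_op_R_adj:
  assumes f: "L2vec n f" and j: "j \<in> {1..n}"
  shows "AE t in halfline. R_op n (R_adj n f) j t = f j t"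
proof -
  note U = R_adj_isometry(1)[OF f]
  define d where "d t = R_op n (R_adj n f) j t - f j t" for t
  have s: "sq_integrable halfline (R_op n (R_adj n f) j)" by (rule R_op_limit(1)[OF U j])
  have d: "sq_integrable halfline d" unfolding d_def[abs_def] by (intro sq_integrable_diff s L2vecD[OF f j])
  have "sq_inner halfline (R_op n (R_adj n f) j) d = sq_inner halfline (f j) d"
    using R_op_adjoint_single[OF U j d] R_adj_single_inner[OF f d j] by simp
  then have "sq_inner halfline d d = 0"
    using sq_inner_diff_left[OF s L2vecD[OF f j] d] by (simp add: d_def[abs_def, symmetric])
  then have "sq_norm halfline d = 0" unfolding sq_inner_self by simp
  then have "AE t in halfline. d t = 0" using sq_norm_eq_0_iff[OF d] by simp
  then show ?thesis by eventually_elim (simp add: d_def)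
qed

section \<open>Conformal change of variables\<close>

text \<open>Coordinates, in which Jacobian determinants are computed.\<close>

definition to_vec :: "complex \<Rightarrow> real^2" where
  "to_vec z = vector [Re z, Im z]"

definition of_vec :: "real^2 \<Rightarrow> complex" where
  "of_vec v = Complex (v $ 1) (v $ 2)"

lemma of_to_vec [simp]: "of_vec (to_vec z) = z" "to_vec (of_vec v) = v"
  by (simp_all add: to_vec_def of_vec_def vec_eq_iff forall_2)

lemma bounded_linear_to_vec: "bounded_linear to_vec"
  unfolding linear_conv_bounded_linear[symmetric] by (auto intro!: linearI simp: to_vec_def vec_eq_iff forall_2)

lemma bounded_linear_of_vec: "bounded_linear of_vec"
  unfolding linear_conv_bounded_linear[symmetric] by (auto intro!: linearI simp: of_vec_def complex_eq_iff)

lemma of_vec_measurable [measurable]: "of_vec \<in> borel_measurable borel"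
  by (intro borel_measurable_continuous_onI linear_continuous_on bounded_linear_of_vec)

lemma lborel_complex_of_vec: "(lborel :: complex measure) = distr lborel borel of_vec"
proof (rule lborel_eqI)
  fix l u :: complex assume le: "\<And>b. b \<in> Basis \<Longrightarrow> l \<bullet> b \<le> u \<bullet> b"
  have le': "Re l \<le> Re u" "Im l \<le> Im u" using le[of 1] le[of \<i>] by (auto simp: Basis_complex_def inner_complex_def)
  have "of_vec -` box l u = box (to_vec l) (to_vec u)"
    by (auto simp: in_box_complex_iff of_vec_def to_vec_def interval_cart forall_2)
  then have "emeasure (distr lborel borel of_vec) (box l u) = emeasure lborel (box (to_vec l) (to_vec u))"
    by (subst emeasure_distr) auto
  also have "\<dots> = ennreal (\<Prod>b\<in>Basis. (to_vec u - to_vec l) \<bullet> b)"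
    using le' by (subst emeasure_lborel_box_eq) (auto simp: Basis_vec_def inner_axis to_vec_def forall_2 UNIV_2)
  also have "(\<Prod>b\<in>Basis. (to_vec u - to_vec l) \<bullet> b) = (Re u - Re l) * (Im u - Im l)"
  proof -
    have B: "(Basis :: (real^2) set) = {axis 1 1, axis 2 1}" by (auto simp: Basis_vec_def UNIV_2)
    have "axis 1 1 \<noteq> (axis 2 1 :: real^2)" by (simp add: axis_eq_axis)
    then show ?thesis unfolding B by (simp add: inner_axis to_vec_def)
  qed
  also have "\<dots> = (\<Prod>b\<in>Basis. (u - l) \<bullet> b)" by (simp add: Basis_complex_def inner_complex_def)
  finally show "emeasure (distr lborel borel of_vec) (box l u) = ennreal (\<Prod>b\<in>Basis. (u - l) \<bullet> b)" .
qed simp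

lemma set_integrable_of_vec:
  fixes f :: "complex \<Rightarrow> complex"
  assumes m: "set_borel_measurable borel S f"
  shows "set_integrable lborel S f \<longleftrightarrow> set_integrable lborel (of_vec -` S) (\<lambda>v. to_vec (f (of_vec v)))"
    and "set_integrable lborel S f \<Longrightarrow>
      to_vec (LINT z:S|lborel. f z) = (LINT v:of_vec -` S|lborel. to_vec (f (of_vec v)))"
proof -
  define F where "F z = indicator S z *\<^sub>R f z" for z
  have Fm: "F \<in> borel_measurable borel" using m unfolding set_borel_measurable_def F_def by simp
  have 1: "integrable lborel F \<longleftrightarrow> integrable lborel (\<lambda>v. F (of_vec v))"
    by (subst lborel_complex_of_vec, subst integrable_distr_eq) (use Fm in auto)
  have e: "indicator (of_vec -` S) v *\<^sub>R to_vec (f (of_vec v)) = to_vec (F (of_vec v))" for v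
    unfolding F_def by (simp add: linear_scale[OF bounded_linear.linear[OF bounded_linear_to_vec]] indicator_def)
  have 2: "integrable lborel (\<lambda>v. F (of_vec v)) \<longleftrightarrow> integrable lborel (\<lambda>v. to_vec (F (of_vec v)))"
    using integrable_bounded_linear[OF bounded_linear_to_vec, of lborel "\<lambda>v. F (of_vec v)"]
      integrable_bounded_linear[OF bounded_linear_of_vec, of lborel "\<lambda>v. to_vec (F (of_vec v))"] by auto
  show "set_integrable lborel S f \<longleftrightarrow> set_integrable lborel (of_vec -` S) (\<lambda>v. to_vec (f (of_vec v)))"
  proof -
    have "set_integrable lborel S f \<longleftrightarrow> integrable lborel F" unfolding set_integrable_def F_def ..
    then show ?thesis unfolding set_integrable_def[of _ "of_vec -` S"] e using 1 2 by simp
  qed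
  assume "set_integrable lborel S f"
  then have i: "integrable lborel (\<lambda>v. F (of_vec v))" using 1 by (simp add: set_integrable_def F_def[abs_def])
  have "(LINT z:S|lborel. f z) = (\<integral>v. F (of_vec v) \<partial>lborel)"
    unfolding set_lebesgue_integral_def F_def[symmetric]
    by (subst lborel_complex_of_vec, subst integral_distr) (use Fm in auto)
  then show "to_vec (LINT z:S|lborel. f z) = (LINT v:of_vec -` S|lborel. to_vec (f (of_vec v)))"
    unfolding set_lebesgue_integral_def e using integral_bounded_linear[OF bounded_linear_to_vec i] by simp
qed

lemma det_matrix_complex_mult: "det (matrix (\<lambda>v. to_vec (c * of_vec v))) = (cmod c)\<^sup>2"
  unfolding det_2 matrix_def
  by (simp add: to_vec_def of_vec_def axis_def cmod_power2) (simp add: power2_eq_square)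

lemma set_borel_measurable_continuous_open:
  fixes f :: "complex \<Rightarrow> complex"
  assumes "open S" "continuous_on S f"
  shows "set_borel_measurable borel S f"
  unfolding set_borel_measurable_def using assms by (intro borel_measurable_continuous_on_indicator) auto

text \<open>The Jacobian determinant of a holomorphic map is \<open>\<bar>g'\<bar>\<^sup>2\<close>.\<close>

theorem conformal_change_of_variables:
  fixes f :: "complex \<Rightarrow> complex"
  assumes S: "open S" and g: "g holomorphic_on S" "inj_on g S" and T: "g ` S = T" "open T"
    and f: "continuous_on T f" "set_integrable lborel T f"
  shows "set_integrable lborel S (\<lambda>z. of_real ((cmod (deriv g z))\<^sup>2) * f (g z))"
    and "(LINT z:S|lborel. of_real ((cmod (deriv g z))\<^sup>2) * f (g z)) = (LINT z:T|lborel. f z)"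
proof -
  define S' where "S' = of_vec -` S"
  define g' where "g' v = to_vec (g (of_vec v))" for v
  define f' where "f' v = to_vec (f (of_vec v))" for v
  define h where "h z = of_real ((cmod (deriv g z))\<^sup>2) * f (g z)" for z
  have gc: "continuous_on S g" by (rule holomorphic_on_imp_continuous_on[OF g(1)])
  have dc: "continuous_on S (deriv g)"
    by (rule holomorphic_on_imp_continuous_on[OF holomorphic_deriv[OF g(1) S]])
  have hm: "set_borel_measurable borel S h"
    unfolding h_def[abs_def] using T(1)
    by (intro set_borel_measurable_continuous_open[OF S] continuous_intros dc continuous_on_compose2[OF f(1) gc]) auto
  have fm: "set_borel_measurable borel T f"
    by (rule set_borel_measurable_continuous_open[OF T(2) f(1)])
  have S'o: "open S'" unfolding S'_def
    by (intro open_vimage S linear_continuous_on bounded_linear_of_vec)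
  have img: "g' ` S' = of_vec -` T"
  proof (intro set_eqI iffI)
    fix v assume "v \<in> of_vec -` T"
    then obtain z where z: "z \<in> S" "of_vec v = g z" using T(1) by auto
    then have "v = g' (to_vec z)" unfolding g'_def by (metis of_to_vec)
    then show "v \<in> g' ` S'" using z(1) by (simp add: S'_def)
  qed (use T(1) in \<open>auto simp: g'_def S'_def\<close>)
  have der: "(g' has_derivative (\<lambda>v. to_vec (deriv g (of_vec x) * of_vec v))) (at x within S')" if "x \<in> S'" for x
  proof -
    have x: "of_vec x \<in> S" using that by (simp add: S'_def)
    have 1: "(of_vec has_derivative of_vec) (at x)" by (rule bounded_linear_imp_has_derivative[OF bounded_linear_of_vec])
    have 2: "(g has_derivative (\<lambda>v. deriv g (of_vec x) * v)) (at (of_vec x))"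
      using holomorphic_derivI[OF g(1) S x] by (simp add: has_field_derivative_def)
    have "((\<lambda>v. g (of_vec v)) has_derivative (\<lambda>v. deriv g (of_vec x) * of_vec v)) (at x)"
      by (rule has_derivative_compose[OF 1 2])
    then have "(g' has_derivative (\<lambda>v. to_vec (deriv g (of_vec x) * of_vec v))) (at x)"
      unfolding g'_def[abs_def] by (rule bounded_linear.has_derivative[OF bounded_linear_to_vec])
    then show ?thesis by (rule has_derivative_at_withinI)
  qed
  have inj: "inj_on g' S'"
    using g(2) unfolding inj_on_def g'_def S'_def by (metis of_to_vec vimage_eq)
  have fi: "set_integrable lborel (g' ` S') f'"
    using set_integrable_of_vec(1)[OF fm] f(2) by (simp add: img f'_def[abs_def])
  have hv: "\<bar>det (matrix (\<lambda>v. to_vec (deriv g (of_vec x) * of_vec v)))\<bar> *\<^sub>R f' (g' x) = to_vec (h (of_vec x))" for x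
  proof -
    have "\<bar>(cmod c)\<^sup>2\<bar> *\<^sub>R to_vec w = to_vec (of_real ((cmod c)\<^sup>2) * w)" for c w
      using linear_scale[OF bounded_linear.linear[OF bounded_linear_to_vec], of "(cmod c)\<^sup>2" w]
      by (simp add: scaleR_conv_of_real)
    then show ?thesis unfolding det_matrix_complex_mult f'_def g'_def h_def by simp
  qed
  have "f' absolutely_integrable_on (g' ` S') \<and> integral (g' ` S') f' = (LINT v:g' ` S'|lborel. f' v)"
    using fi set_borel_integral_eq_integral(2)[OF fi]
    unfolding set_integrable_def by (simp add: integrable_completion borel_measurable_integrable)
  then have *: "(\<lambda>x. to_vec (h (of_vec x))) absolutely_integrable_on S'"
      "integral S' (\<lambda>x. to_vec (h (of_vec x))) = (LINT v:g' ` S'|lborel. f' v)"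
    using has_absolute_integral_change_of_variables[OF _ der inj, of f' "LINT v:g' ` S'|lborel. f' v"] S'o
    unfolding hv by auto
  have "(\<lambda>v. indicator S' v *\<^sub>R to_vec (h (of_vec v))) = (\<lambda>v. to_vec (indicator S (of_vec v) *\<^sub>R h (of_vec v)))"
    by (auto simp: S'_def indicator_def linear_0[OF bounded_linear.linear[OF bounded_linear_to_vec]])
  moreover have "(\<lambda>v. to_vec (indicator S (of_vec v) *\<^sub>R h (of_vec v))) \<in> borel_measurable borel"
    by (rule measurable_compose[OF measurable_compose[OF of_vec_measurable]])
       (use hm in \<open>auto simp: set_borel_measurable_def intro!: borel_measurable_continuous_onI linear_continuous_on bounded_linear_to_vec\<close>)
  ultimately have hi: "set_integrable lborel S' (\<lambda>v. to_vec (h (of_vec v)))"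
    using *(1) unfolding set_integrable_def by (simp add: integrable_completion)
  show hint: "set_integrable lborel S (\<lambda>z. of_real ((cmod (deriv g z))\<^sup>2) * f (g z))"
    using set_integrable_of_vec(1)[OF hm] hi unfolding S'_def h_def[abs_def] by blast
  have "to_vec (LINT z:S|lborel. h z) = (LINT v:S'|lborel. to_vec (h (of_vec v)))"
    unfolding S'_def by (rule set_integrable_of_vec(2)[OF hm]) (use hint in \<open>simp add: h_def[abs_def]\<close>)
  also have "\<dots> = (LINT v:g' ` S'|lborel. f' v)"
    using set_borel_integral_eq_integral(2)[OF hi] *(2) by simp
  also have "\<dots> = to_vec (LINT z:T|lborel. f z)"
    using set_integrable_of_vec(2)[OF fm f(2)] by (simp add: img f'_def[abs_def])
  finally show "(LINT z:S|lborel. of_real ((cmod (deriv g z))\<^sup>2) * f (g z)) = (LINT z:T|lborel. f z)"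
    unfolding h_def[abs_def] by (metis of_to_vec(1))
qed

section \<open>Polyanalytic functions on the disc\<close>

lemma integrable_bounded_ball:
  fixes f :: "complex \<Rightarrow> complex"
  assumes "continuous_on (cball 0 \<rho>) f"
  shows "set_integrable lborel (ball 0 \<rho>) f"
proof -
  have "set_integrable lborel (cball 0 \<rho>) f"
    unfolding set_integrable_def by (rule borel_integrable_compact[OF compact_cball assms])
  then show ?thesis by (rule set_integrable_subset) auto
qed

lemma integral_rotate:
  fixes f :: "complex \<Rightarrow> complex"
  assumes f: "continuous_on (cball 0 \<rho>) f"
  shows "(LINT z:ball 0 \<rho>|lborel. f (cis \<theta> * z)) = (LINT z:ball 0 \<rho>|lborel. f z)"
proof -
  have "(\<lambda>z. cis \<theta> * z) ` ball 0 \<rho> = ball 0 \<rho>"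
  proof (intro set_eqI iffI)
    fix z :: complex assume z: "z \<in> ball 0 \<rho>"
    have "z = cis \<theta> * (cis (- \<theta>) * z)" by (metis cis_mult add.right_inverse cis_zero mult.assoc mult_1)
    then show "z \<in> (\<lambda>z. cis \<theta> * z) ` ball 0 \<rho>" by (rule image_eqI[of _ _ "cis (- \<theta>) * z"]) (use z in \<open>simp add: norm_mult\<close>)
  qed (auto simp: norm_mult)
  then have "(LINT z:ball 0 \<rho>|lborel. of_real ((cmod (deriv (\<lambda>z. cis \<theta> * z) z))\<^sup>2) * f (cis \<theta> * z))
     = (LINT z:ball 0 \<rho>|lborel. f z)"
    by (intro conformal_change_of_variables(2) integrable_bounded_ball f)
       (auto intro!: holomorphic_intros inj_onI continuous_on_subset[OF f])
  moreover have "deriv (\<lambda>z. cis \<theta> * z) z = cis \<theta>" for z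
    by (rule DERIV_imp_deriv) (auto intro!: derivative_eq_intros)
  ultimately show ?thesis by simp
qed

definition radial_moment :: "real poly \<Rightarrow> nat \<Rightarrow> real \<Rightarrow> complex" where
  "radial_moment q k \<rho> = (LINT z:ball 0 \<rho>|lborel. of_real ((cmod z)\<^sup>2 ^ k * poly q ((cmod z)\<^sup>2)))"

text \<open>Area measure and radial weights are invariant under rotations, while the monomial is not.\<close>

lemma monomial_orthogonal:
  assumes "k \<noteq> l"
  shows "(LINT z:ball 0 \<rho>|lborel. cnj z ^ k * z ^ l * of_real (poly q ((cmod z)\<^sup>2))) = 0"
proof -
  define f where "f z = cnj z ^ k * z ^ l * of_real (poly q ((cmod z)\<^sup>2))" for z
  have fc: "continuous_on (cball 0 \<rho>) f" unfolding f_def by (intro continuous_intros)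
  \<comment> \<open>a rotation under which the monomial changes sign\<close>
  define \<theta> where "\<theta> = pi / (real l - real k)"
  have "f (cis \<theta> * z) = - f z" for z
  proof -
    have "cis (- \<theta>) ^ k * cis \<theta> ^ l = cis ((real l - real k) * \<theta>)"
      unfolding Complex.DeMoivre cis_mult by (rule arg_cong[where f = cis]) (simp add: algebra_simps)
    also have "\<dots> = -1" using assms by (simp add: \<theta>_def)
    finally have r: "cis (- \<theta>) ^ k * cis \<theta> ^ l = -1" .
    have "f (cis \<theta> * z) = (cis (- \<theta>) ^ k * cis \<theta> ^ l) * f z"
      unfolding f_def by (simp add: norm_mult power_mult_distrib cis_cnj mult_ac)
    then show ?thesis unfolding r by simp
  qed
  then have "- (LINT z:ball 0 \<rho>|lborel. f z) = (LINT z:ball 0 \<rho>|lborel. f z)"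
    using integral_rotate[OF fc, of \<theta>] by (simp add: set_lebesgue_integral_def)
  then show ?thesis unfolding f_def by simp
qed

text \<open>Integrate the Taylor series of \<open>h\<close> term by term; only the term of order \<open>k\<close> is not annihilated.\<close>

lemma holomorphic_disc_moment:
  assumes h: "h holomorphic_on ball 0 1" and \<rho>: "0 < \<rho>" "\<rho> < 1"
  shows "(LINT z:ball 0 \<rho>|lborel. cnj z ^ k * h z * of_real (poly q ((cmod z)\<^sup>2)))
    = (deriv ^^ k) h 0 / fact k * radial_moment q k \<rho>"
proof -
  define a where "a l = (deriv ^^ l) h 0 / fact l" for l
  have sums: "(\<lambda>l. a l * z ^ l) sums h z" if "cmod z < 1" for z
    using holomorphic_power_series[OF h, of z] that by (simp add: a_def)
  obtain r where r: "\<rho> < r" "r < 1" using \<rho>(2) dense by blast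
  have sa: "summable (\<lambda>l. cmod (a l) * \<rho> ^ l)"
    using powser_insidea[of a "of_real r" "of_real \<rho>"] sums[of "of_real r"] r \<rho>
    by (auto simp: sums_iff norm_mult norm_power)
  define \<omega> where "\<omega> z = complex_of_real (poly q ((cmod z)\<^sup>2))" for z
  have \<omega>c: "continuous_on A \<omega>" for A unfolding \<omega>_def by (intro continuous_intros)
  have "compact (\<omega> ` cball 0 \<rho>)" by (intro compact_continuous_image \<omega>c) auto
  then obtain C where C: "\<And>z. z \<in> cball 0 \<rho> \<Longrightarrow> cmod (\<omega> z) \<le> C"
    using compact_imp_bounded bounded_iff by (metis imageI)
  define F where "F l z = indicator (ball 0 \<rho>) z *\<^sub>R (cnj z ^ k * (a l * z ^ l) * \<omega> z)" for l z
  have Fi: "integrable lborel (F l)" for l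
    unfolding F_def set_integrable_def[symmetric] by (intro integrable_bounded_ball continuous_intros \<omega>c)
  define D where "D = measure lborel (ball (0::complex) \<rho>)"
  have Fb: "cmod (F l z) \<le> (cmod (a l) * \<rho> ^ l * (\<rho> ^ k * C)) * indicator (ball 0 \<rho>) z" for l z
  proof (cases "z \<in> ball 0 \<rho>")
    case True
    then have "cmod z ^ k * (cmod (a l) * cmod z ^ l) * cmod (\<omega> z) \<le> \<rho> ^ k * (cmod (a l) * \<rho> ^ l) * C"
      using C[of z] \<rho>(1) by (intro mult_mono power_mono) auto
    then show ?thesis using True by (simp add: F_def norm_mult norm_power mult_ac)
  qed (simp add: F_def)
  have bi: "integrable lborel (\<lambda>z. c * indicat_real (ball (0::complex) \<rho>) z)" for c
    by (rule integrable_mult_right, rule integrable_real_indicator, simp, rule emeasure_bounded_finite, simp)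
  have "(\<lambda>l. \<integral>z. F l z \<partial>lborel) sums (\<integral>z. (\<Sum>l. F l z) \<partial>lborel)"
  proof (rule sums_integral[OF Fi])
    show "AE z in lborel. summable (\<lambda>l. cmod (F l z))"
    proof (rule AE_I2)
      fix z :: complex
      have "summable (\<lambda>l. (cmod (a l) * \<rho> ^ l * (\<rho> ^ k * C)) * indicator (ball 0 \<rho>) z)"
        by (intro summable_mult2 sa)
      then show "summable (\<lambda>l. cmod (F l z))" by (rule summable_comparison_test') (use Fb in auto)
    qed
    show "summable (\<lambda>l. \<integral>z. cmod (F l z) \<partial>lborel)"
    proof (rule summable_comparison_test'[of "\<lambda>l. cmod (a l) * \<rho> ^ l * (\<rho> ^ k * C) * D"])
      show "summable (\<lambda>l. cmod (a l) * \<rho> ^ l * (\<rho> ^ k * C) * D)" by (intro summable_mult2 sa)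
      fix l
      have "(\<integral>z. cmod (F l z) \<partial>lborel) \<le> (\<integral>z. (cmod (a l) * \<rho> ^ l * (\<rho> ^ k * C)) * indicat_real (ball (0::complex) \<rho>) z \<partial>lborel)"
        by (intro integral_mono integrable_norm Fi bi Fb)
      then show "norm (\<integral>z. cmod (F l z) \<partial>lborel) \<le> cmod (a l) * \<rho> ^ l * (\<rho> ^ k * C) * D"
        by (simp add: integral_nonneg_AE D_def)
    qed
  qed
  moreover have "(\<Sum>l. F l z) = indicator (ball 0 \<rho>) z *\<^sub>R (cnj z ^ k * h z * \<omega> z)" for z
  proof (cases "z \<in> ball 0 \<rho>")
    case True
    then have "(\<lambda>l. cnj z ^ k * (a l * z ^ l) * \<omega> z) sums (cnj z ^ k * h z * \<omega> z)"
      using \<rho> by (intro sums_mult sums_mult2 sums) auto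
    then show ?thesis using True by (simp add: F_def sums_iff)
  qed (simp add: F_def)
  moreover have "(\<integral>z. F l z \<partial>lborel) = (if l = k then a k * radial_moment q k \<rho> else 0)" for l
  proof -
    have "(\<integral>z. F l z \<partial>lborel) = a l * (LINT z:ball 0 \<rho>|lborel. cnj z ^ k * z ^ l * \<omega> z)"
      unfolding F_def set_lebesgue_integral_def integral_mult_right_zero[symmetric]
      by (intro Bochner_Integration.integral_cong refl) (simp add: mult_ac)
    moreover have "(LINT z:ball 0 \<rho>|lborel. cnj z ^ k * z ^ k * \<omega> z) = radial_moment q k \<rho>"
      unfolding radial_moment_def \<omega>_def
    proof (intro arg_cong[of _ _ "set_lebesgue_integral lborel (ball 0 \<rho>)"] ext)
      fix z :: complex
      have "cnj z ^ k * z ^ k = of_real ((cmod z)\<^sup>2 ^ k)"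
        unfolding power_mult_distrib[symmetric] of_real_power[of _ k] complex_norm_square by (simp add: mult.commute)
      then show "cnj z ^ k * z ^ k * of_real (poly q ((cmod z)\<^sup>2)) = of_real ((cmod z)\<^sup>2 ^ k * poly q ((cmod z)\<^sup>2))"
        by simp
    qed
    ultimately show ?thesis using monomial_orthogonal[of k l \<rho> q] by (auto simp: \<omega>_def)
  qed
  ultimately have "(\<lambda>l. if l = k then a k * radial_moment q k \<rho> else 0) sums
      (LINT z:ball 0 \<rho>|lborel. cnj z ^ k * h z * \<omega> z)"
    by (simp add: set_lebesgue_integral_def)
  moreover have "(\<lambda>l. if l = k then a k * radial_moment q k \<rho> else 0) sums (a k * radial_moment q k \<rho>)"
    using sums_single[of k "\<lambda>_. a k * radial_moment q k \<rho>"] by simp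
  ultimately show ?thesis using sums_unique2 unfolding a_def \<omega>_def by blast
qed

lemma tendsto_integral_discs:
  fixes f :: "complex \<Rightarrow> complex"
  assumes f: "set_integrable lborel (ball 0 1) f"
  defines "\<rho> \<equiv> \<lambda>i. 1 - 1 / real (i + 2)"
  shows "(\<lambda>i. LINT z:ball 0 (\<rho> i)|lborel. f z) \<longlonglongrightarrow> (LINT z:ball 0 1|lborel. f z)"
  unfolding set_lebesgue_integral_def
proof (rule integral_dominated_convergence)
  let ?f = "\<lambda>z. indicator (ball 0 1) z *\<^sub>R f z"
  have \<rho>1: "\<rho> i < 1" for i by (simp add: \<rho>_def)
  show "integrable lborel (\<lambda>z. cmod (?f z))" using f by (simp add: set_integrable_def del: norm_scaleR)
  have fm: "?f \<in> borel_measurable lborel" using f borel_measurable_integrable unfolding set_integrable_def by blast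
  then show "?f \<in> borel_measurable lborel" .
  have e: "indicator (ball 0 (\<rho> i)) z *\<^sub>R f z = indicator (ball 0 (\<rho> i)) z *\<^sub>R ?f z" for i z
    using \<rho>1[of i] by (auto simp: indicator_def)
  show "(\<lambda>z. indicator (ball 0 (\<rho> i)) z *\<^sub>R f z) \<in> borel_measurable lborel" for i
    unfolding e by (rule borel_measurable_scaleR[OF borel_measurable_indicator fm]) simp
  show "AE z in lborel. (\<lambda>i. indicator (ball 0 (\<rho> i)) z *\<^sub>R f z) \<longlonglongrightarrow> ?f z"
  proof (rule AE_I2, rule tendsto_eventually)
    fix z :: complex
    show "\<forall>\<^sub>F i in sequentially. indicator (ball 0 (\<rho> i)) z *\<^sub>R f z = ?f z"
    proof (cases "cmod z < 1")
      case True
      have "\<rho> \<longlonglongrightarrow> 1 - 0" unfolding \<rho>_def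
        by (intro tendsto_intros LIMSEQ_ignore_initial_segment[OF lim_1_over_n])
      then have "\<forall>\<^sub>F i in sequentially. cmod z < \<rho> i" using True order_tendstoD(1) by fastforce
      then show ?thesis by eventually_elim (use True in \<open>simp add: indicator_def\<close>)
    next
      case False
      then show ?thesis using \<rho>1 less_trans by (intro always_eventually allI) (force simp: indicator_def)
    qed
  qed
  show "AE z in lborel. norm (indicator (ball 0 (\<rho> i)) z *\<^sub>R f z) \<le> cmod (?f z)" for i
    using \<rho>1[of i] by (intro AE_I2) (auto simp: indicator_def)
qed

text \<open>Over a smaller disc the integral is a combination of Taylor coefficients weighted by radial
  moments. As the radius tends to \<open>1\<close> only the moment of order \<open>0\<close> survives, and it carries the
  value of \<open>F\<close> at the centre.\<close>

theorem polyholomorphic_disc_mean: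
  assumes F: "polyholomorphic_on n (ball 0 1) F" and n: "n \<ge> 1"
    and int: "set_integrable lborel (ball 0 1) (\<lambda>z. F z * of_real (poly q ((cmod z)\<^sup>2)))"
    and q: "\<And>k. 1 \<le> k \<Longrightarrow> k < n \<Longrightarrow> radial_moment q k 1 = 0"
  shows "(LINT z:ball 0 1|lborel. F z * of_real (poly q ((cmod z)\<^sup>2))) = F 0 * radial_moment q 0 1"
proof -
  obtain h where h: "\<And>a. a < n \<Longrightarrow> h a holomorphic_on ball 0 1"
    and Fh: "\<And>z. z \<in> ball 0 1 \<Longrightarrow> F z = (\<Sum>a<n. cnj z ^ a * h a z)"
    using F unfolding polyholomorphic_on_def by metis
  define \<rho> where "\<rho> i = 1 - 1 / real (i + 2)" for i
  have \<rho>: "0 < \<rho> i" "\<rho> i < 1" for i by (auto simp: \<rho>_def)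
  define c where "c k = (deriv ^^ k) (h k) 0 / fact k" for k
  have *: "(LINT z:ball 0 (\<rho> i)|lborel. F z * of_real (poly q ((cmod z)\<^sup>2))) = (\<Sum>k<n. c k * radial_moment q k (\<rho> i))" for i
  proof -
    have sub: "cball 0 (\<rho> i) \<subseteq> ball (0::complex) 1" using \<rho>(2)[of i] by auto
    have "(LINT z:ball 0 (\<rho> i)|lborel. F z * of_real (poly q ((cmod z)\<^sup>2)))
      = (LINT z:ball 0 (\<rho> i)|lborel. \<Sum>k<n. cnj z ^ k * h k z * of_real (poly q ((cmod z)\<^sup>2)))"
      using \<rho>(2)[of i] by (intro set_lebesgue_integral_cong) (auto simp: Fh sum_distrib_right)
    also have "\<dots> = (\<Sum>k<n. LINT z:ball 0 (\<rho> i)|lborel. cnj z ^ k * h k z * of_real (poly q ((cmod z)\<^sup>2)))"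
      unfolding set_lebesgue_integral_def scaleR_sum_right
    proof (rule Bochner_Integration.integral_sum, unfold set_integrable_def[symmetric])
      fix k assume "k \<in> {..<n}"
      then have "continuous_on (cball 0 (\<rho> i)) (h k)"
        by (intro continuous_on_subset[OF holomorphic_on_imp_continuous_on[OF h] sub]) auto
      then show "set_integrable lborel (ball 0 (\<rho> i)) (\<lambda>z. cnj z ^ k * h k z * of_real (poly q ((cmod z)\<^sup>2)))"
        by (intro integrable_bounded_ball continuous_intros)
    qed
    also have "\<dots> = (\<Sum>k<n. c k * radial_moment q k (\<rho> i))"
      unfolding c_def by (intro sum.cong refl holomorphic_disc_moment h \<rho>) auto
    finally show ?thesis .
  qed
  have "(\<lambda>i. radial_moment q k (\<rho> i)) \<longlonglongrightarrow> radial_moment q k 1" for k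
    unfolding radial_moment_def \<rho>_def
    by (intro tendsto_integral_discs integrable_bounded_ball continuous_intros)
  then have "(\<lambda>i. \<Sum>k<n. c k * radial_moment q k (\<rho> i)) \<longlonglongrightarrow> (\<Sum>k<n. c k * radial_moment q k 1)"
    by (intro tendsto_intros)
  moreover have "(\<lambda>i. \<Sum>k<n. c k * radial_moment q k (\<rho> i)) \<longlonglongrightarrow> (LINT z:ball 0 1|lborel. F z * of_real (poly q ((cmod z)\<^sup>2)))"
    using tendsto_integral_discs[OF int] unfolding *[symmetric] by (simp only: \<rho>_def)
  ultimately have "(LINT z:ball 0 1|lborel. F z * of_real (poly q ((cmod z)\<^sup>2))) = (\<Sum>k<n. c k * radial_moment q k 1)"
    by (rule LIMSEQ_unique[symmetric])
  also have "\<dots> = (\<Sum>k\<in>{0}. c k * radial_moment q k 1)"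
    using n q by (intro sum.mono_neutral_right) auto
  also have "\<dots> = F 0 * radial_moment q 0 1"
  proof -
    have "F 0 = (\<Sum>a<n. 0 ^ a * h a 0)" using Fh[of 0] by simp
    also have "\<dots> = (\<Sum>a\<in>{0}. 0 ^ a * h a 0)" using n by (intro sum.mono_neutral_right) auto
    finally show ?thesis by (simp add: c_def)
  qed
  finally show ?thesis .
qed

section \<open>A radial weight with vanishing higher moments\<close>

definition disc_form :: "real poly \<Rightarrow> real poly \<Rightarrow> real" where
  "disc_form p q = (LINT z:ball (0::complex) 1|lborel. poly (p * q) ((cmod z)\<^sup>2))"

lemma disc_form_integrable: "set_integrable lborel (ball (0::complex) 1) (\<lambda>z. poly p ((cmod z)\<^sup>2))"
proof -
  have "set_integrable lborel (cball (0::complex) 1) (\<lambda>z. poly p ((cmod z)\<^sup>2))"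
    unfolding set_integrable_def by (rule borel_integrable_compact) (auto intro!: continuous_intros)
  then show ?thesis by (rule set_integrable_subset) auto
qed

lemma disc_form_add: "disc_form (p + r) q = disc_form p q + disc_form r q"
proof -
  have "disc_form (p + r) q = (LINT z:ball (0::complex) 1|lborel. poly (p * q) ((cmod z)\<^sup>2) + poly (r * q) ((cmod z)\<^sup>2))"
    unfolding disc_form_def by (simp add: algebra_simps)
  also have "\<dots> = disc_form p q + disc_form r q"
    unfolding disc_form_def by (rule set_integral_add(2)) (rule disc_form_integrable)+
  finally show ?thesis .
qed

lemma disc_form_smult: "disc_form (smult a p) q = a * disc_form p q"
  unfolding disc_form_def by (simp add: mult.assoc)

lemma disc_form_diff: "disc_form (p - r) q = disc_form p q - disc_form r q"
  using disc_form_add[of p "smult (-1) r" q] disc_form_smult[of "-1" r q] by simp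

lemma disc_form_commute: "disc_form p q = disc_form q p"
  unfolding disc_form_def by (simp add: mult.commute)

lemma disc_form_pos:
  assumes "p \<noteq> 0" shows "disc_form p p \<noteq> 0"
proof
  assume 0: "disc_form p p = 0"
  have "AE z in lborel. indicator (ball (0::complex) 1) z *\<^sub>R poly (p * p) ((cmod z)\<^sup>2) = 0"
    using 0 disc_form_integrable[of "p * p"] unfolding disc_form_def set_lebesgue_integral_def set_integrable_def
    by (subst integral_nonneg_eq_0_iff_AE[symmetric]) (auto simp: indicator_def)
  then have "AE z in lebesgue. indicator (ball (0::complex) 1) z *\<^sub>R poly (p * p) ((cmod z)\<^sup>2) = 0"
    by (simp add: AE_completion_iff)
  then have ae: "AE z\<in>ball (0::complex) 1 in lebesgue. z \<in> {z. poly p ((cmod z)\<^sup>2) = 0}"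
    by eventually_elim (auto simp: indicator_def)
  have cl: "closed {z::complex. poly p ((cmod z)\<^sup>2) = 0}"
    by (intro closed_Collect_eq continuous_intros)
  have "poly p s = 0" if "0 \<le> s" "s < 1" for s
  proof -
    have "complex_of_real (sqrt s) \<in> {z. poly p ((cmod z)\<^sup>2) = 0}"
      by (rule mem_closed_if_AE_lebesgue_open[OF open_ball cl ae]) (use that in \<open>auto simp: real_sqrt_lt_1_iff\<close>)
    then show ?thesis using that by simp
  qed
  then have "{0..<1} \<subseteq> {s. poly p s = 0}" by auto
  moreover have "infinite {0..<1::real}" by (simp add: infinite_Ico)
  ultimately show False using poly_roots_finite[OF assms] finite_subset by blast
qed

text \<open>Gram-Schmidt orthogonalisation, one monomial at a time.\<close>

lemma disc_form_projection:
  "\<exists>r. degree r \<le> m \<and> coeff r 0 = 0 \<and> (\<forall>r'. degree r' \<le> m \<longrightarrow> coeff r' 0 = 0 \<longrightarrow> disc_form (p - r) r' = 0)"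
proof (induction m arbitrary: p)
  case 0
  have "r' = 0" if "degree r' \<le> 0" "coeff r' 0 = 0" for r' :: "real poly"
    using that leading_coeff_0_iff[of r'] by simp
  moreover have "disc_form (p - 0) 0 = 0" by (simp add: disc_form_def set_lebesgue_integral_def)
  ultimately show ?case by (intro exI[of _ 0] conjI allI impI) auto
next
  case (Suc m)
  obtain r0 where r0: "degree r0 \<le> m" "coeff r0 0 = 0"
    "\<And>r'. degree r' \<le> m \<Longrightarrow> coeff r' 0 = 0 \<Longrightarrow> disc_form (p - r0) r' = 0" using Suc.IH[of p] by blast
  obtain r1 where r1: "degree r1 \<le> m" "coeff r1 0 = 0"
    "\<And>r'. degree r' \<le> m \<Longrightarrow> coeff r' 0 = 0 \<Longrightarrow> disc_form (monom 1 (Suc m) - r1) r' = 0" using Suc.IH[of "monom 1 (Suc m)"] by blast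
  define e where "e = monom 1 (Suc m) - r1"
  have e: "degree e \<le> Suc m" "coeff e 0 = 0" "coeff e (Suc m) = 1"
    unfolding e_def using r1(1,2) by (auto intro!: degree_diff_le simp: degree_monom_le coeff_eq_0)
  then have e0: "disc_form e e \<noteq> 0" by (intro disc_form_pos) auto
  define r where "r = r0 + smult (disc_form (p - r0) e / disc_form e e) e"
  have orth: "disc_form (p - r) r' = 0" if r': "degree r' \<le> Suc m" "coeff r' 0 = 0" for r'
  proof -
    define r'' where "r'' = r' - smult (coeff r' (Suc m)) e"
    have "degree r'' \<le> Suc m" "coeff r'' (Suc m) = 0" "coeff r'' 0 = 0"
      unfolding r''_def using r' e by (auto intro!: degree_diff_le)
    moreover from this have "degree r'' \<noteq> Suc m" by (metis degree_0 leading_coeff_0_iff nat.simps(3))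
    ultimately have r'': "degree r'' \<le> m" "coeff r'' 0 = 0" by auto
    have pr: "disc_form (p - r) x = disc_form (p - r0) x - disc_form (p - r0) e / disc_form e e * disc_form e x" for x
    proof -
      have "p - r = (p - r0) - smult (disc_form (p - r0) e / disc_form e e) e" by (simp add: r_def)
      then show ?thesis by (simp only: disc_form_diff[of "p - r0"] disc_form_smult)
    qed
    have "disc_form (p - r) r'' = 0" unfolding pr using r0(3)[OF r''] r1(3)[OF r''] by (simp add: e_def)
    moreover have "disc_form (p - r) e = 0" unfolding pr using e0 by simp
    moreover have "r' = r'' + smult (coeff r' (Suc m)) e" by (simp add: r''_def)
    ultimately show ?thesis
      by (metis add.right_neutral disc_form_add disc_form_commute disc_form_smult mult_zero_right)
  qed
  show ?case
    by (rule exI[of _ r]) (use orth r0(1,2) e(1,2) in \<open>auto simp: r_def intro!: degree_add_le order_trans[OF degree_smult_le]\<close>)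
qed

lemma radial_moment_disc_form: "radial_moment q k 1 = of_real (disc_form q (monom 1 k))"
proof -
  have "radial_moment q k 1 = (LINT z:ball 0 1|lborel. complex_of_real (poly (q * monom 1 k) ((cmod z)\<^sup>2)))"
    unfolding radial_moment_def by (simp add: poly_monom mult.commute)
  also have "\<dots> = of_real (disc_form q (monom 1 k))"
    unfolding disc_form_def set_lebesgue_integral_def by (simp add: scaleR_conv_of_real flip: of_real_mult)
  finally show ?thesis .
qed

text \<open>Take \<open>q = 1 - r\<close> with \<open>r\<close> the projection of \<open>1\<close> onto the span of \<open>s, \<dots>, s\<^sup>n\<^sup>-\<^sup>1\<close>. Then \<open>q \<noteq> 0\<close> because
  \<open>q(0) = 1\<close>, and the moment of order \<open>0\<close> is the squared norm of \<open>q\<close>.\<close>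

lemma radial_weight_exists:
  assumes "n \<ge> 1"
  obtains q where "degree q < n" "radial_moment q 0 1 \<noteq> 0" "\<And>k. 1 \<le> k \<Longrightarrow> k < n \<Longrightarrow> radial_moment q k 1 = 0"
proof -
  obtain r where r: "degree r \<le> n - 1" "coeff r 0 = 0"
    "\<And>r'. degree r' \<le> n - 1 \<Longrightarrow> coeff r' 0 = 0 \<Longrightarrow> disc_form (1 - r) r' = 0"
    using disc_form_projection[of "n - 1" 1] by blast
  define q where "q = 1 - r"
  have dq: "degree q \<le> n - 1" unfolding q_def using r(1) by (intro degree_diff_le) auto
  have "coeff q 0 = 1" using r(2) by (simp add: q_def)
  then have "q \<noteq> 0" by auto
  then have "disc_form q q \<noteq> 0" by (rule disc_form_pos)
  moreover have "disc_form q q = disc_form q 1"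
  proof -
    have "disc_form q (1 - q) = 0" unfolding q_def using r by (intro r(3)) auto
    then show ?thesis by (metis diff_eq_diff_eq disc_form_commute disc_form_diff eq_iff_diff_eq_0)
  qed
  ultimately have "radial_moment q 0 1 \<noteq> 0" by (simp add: radial_moment_disc_form monom_0 flip: one_pCons)
  moreover have "radial_moment q k 1 = 0" if "1 \<le> k" "k < n" for k
    unfolding radial_moment_disc_form q_def using that by (subst r(3)) (auto intro!: order_trans[OF degree_monom_le])
  moreover have "degree q < n" using dq assms by linarith
  ultimately show thesis using that by blast
qed

section \<open>The reproducing kernel\<close>

text \<open>The conformal map of the unit disc onto the half-plane that sends \<open>0\<close> to \<open>w\<close>.\<close>

definition cayley :: "complex \<Rightarrow> complex \<Rightarrow> complex" where
  "cayley w \<zeta> = (w - cnj w * \<zeta>) / (1 - \<zeta>)"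

lemma cayley_facts:
  assumes w: "Im w > 0" and \<zeta>: "cmod \<zeta> < 1"
  shows "Im (cayley w \<zeta>) > 0" "1 - \<zeta> \<noteq> 0"
    and "cayley w \<zeta> - cnj w = (w - cnj w) / (1 - \<zeta>)"
    and "cayley w \<zeta> - w = \<zeta> * (w - cnj w) / (1 - \<zeta>)"
    and "cayley w \<zeta> - cnj w \<noteq> 0"
    and "(cayley w \<zeta> - w) / (cayley w \<zeta> - cnj w) = \<zeta>"
proof -
  show n: "1 - \<zeta> \<noteq> 0" using \<zeta> by auto
  have wn: "w - cnj w \<noteq> 0" using w by (simp add: complex_eq_iff)
  show a: "cayley w \<zeta> - cnj w = (w - cnj w) / (1 - \<zeta>)" and b: "cayley w \<zeta> - w = \<zeta> * (w - cnj w) / (1 - \<zeta>)"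
    unfolding cayley_def using n by (simp_all add: field_simps)
  show c: "cayley w \<zeta> - cnj w \<noteq> 0" unfolding a using n wn by simp
  show "(cayley w \<zeta> - w) / (cayley w \<zeta> - cnj w) = \<zeta>" unfolding a b using n wn by simp
  have "cayley w \<zeta> = (w - cnj w * \<zeta>) * cnj (1 - \<zeta>) / of_real ((cmod (1 - \<zeta>))\<^sup>2)"
  proof -
    have cn: "cnj (1 - \<zeta>) \<noteq> 0" using n by (simp only: complex_cnj_zero_iff not_False_eq_True)
    show ?thesis unfolding cayley_def complex_norm_square nonzero_mult_divide_mult_cancel_right[OF cn] ..
  qed
  then have "Im (cayley w \<zeta>) = Im ((w - cnj w * \<zeta>) * cnj (1 - \<zeta>)) / (cmod (1 - \<zeta>))\<^sup>2"
    by (simp only: Im_divide_of_real)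
  also have "Im ((w - cnj w * \<zeta>) * cnj (1 - \<zeta>)) = Im w * (1 - (cmod \<zeta>)\<^sup>2)"
    by (simp add: cmod_power2) (simp add: power2_eq_square algebra_simps)
  finally have e: "Im (cayley w \<zeta>) = Im w * (1 - (cmod \<zeta>)\<^sup>2) / (cmod (1 - \<zeta>))\<^sup>2" .
  have "(cmod \<zeta>)\<^sup>2 < 1" using \<zeta> by (simp add: power_less_one_iff abs_square_less_1)
  then show "Im (cayley w \<zeta>) > 0" unfolding e using w n by simp
qed

lemma upper_diff_cnj_nonzero: "Im z > 0 \<Longrightarrow> Im w > 0 \<Longrightarrow> z - cnj w \<noteq> 0"
  by (auto simp: complex_eq_iff)

lemma cayley_image:
  assumes w: "Im w > 0"
  shows "cayley w ` ball 0 1 = half_plane"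
proof (intro set_eqI iffI)
  fix z assume "z \<in> half_plane"
  then have z: "Im z > 0" by (simp add: half_plane_def)
  note n = upper_diff_cnj_nonzero[OF z w]
  have wn: "w - cnj w \<noteq> 0" using w by (simp add: complex_eq_iff)
  define \<zeta> where "\<zeta> = (z - w) / (z - cnj w)"
  have 1: "1 - \<zeta> = (w - cnj w) / (z - cnj w)" unfolding \<zeta>_def using n by (simp add: field_simps)
  have 2: "w - cnj w * \<zeta> = z * (w - cnj w) / (z - cnj w)" unfolding \<zeta>_def using n by (simp add: field_simps)
  have "cayley w \<zeta> = z" unfolding cayley_def 1 2 using n wn by simp
  moreover have "cmod \<zeta> < 1"
  proof -
    have "(cmod (z - w))\<^sup>2 < (cmod (z - cnj w))\<^sup>2"
      unfolding cmod_power2 using z w mult_pos_pos[OF z w] by (simp add: power2_eq_square algebra_simps)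
    then have "cmod (z - w) < cmod (z - cnj w)" by (rule power2_less_imp_less) simp
    then show ?thesis unfolding \<zeta>_def norm_divide using n by simp
  qed
  ultimately show "z \<in> cayley w ` ball 0 1" by (intro image_eqI[of _ _ \<zeta>]) auto
qed (use cayley_facts(1)[OF w] in \<open>auto simp: half_plane_def\<close>)

lemma cayley_inj: "Im w > 0 \<Longrightarrow> inj_on (cayley w) (ball 0 1)"
  by (rule inj_on_inverseI[of _ "\<lambda>z. (z - w) / (z - cnj w)"]) (use cayley_facts(6) in auto)

lemma cayley_deriv:
  assumes "Im w > 0" "cmod \<zeta> < 1"
  shows "(cayley w has_field_derivative (w - cnj w) / (1 - \<zeta>)\<^sup>2) (at \<zeta>)"
proof -
  have "((\<lambda>\<zeta>. (w - cnj w * \<zeta>) / (1 - \<zeta>)) has_field_derivative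
      ((0 - cnj w * 1) * (1 - \<zeta>) - (w - cnj w * \<zeta>) * (0 - 1)) / ((1 - \<zeta>) * (1 - \<zeta>))) (at \<zeta>)"
    by (intro derivative_intros DERIV_cmult cayley_facts(2)[OF assms])
  then show ?thesis unfolding cayley_def[abs_def]
    by (rule DERIV_cong) (simp add: power2_eq_square algebra_simps)
qed

lemma cayley_holomorphic: "Im w > 0 \<Longrightarrow> cayley w holomorphic_on ball 0 1"
  unfolding holomorphic_on_open[OF open_ball] using cayley_deriv by fastforce

text \<open>For \<open>n = 1\<close> and constant \<open>q\<close> this is the Bergman kernel up to a constant. Its conjugate is to cancel
  the powers of \<open>1 - cnj \<zeta>\<close> in the denominator of \<open>\<phi> (cayley w \<zeta>)\<close>, which come from \<open>cnj z\<close>; this is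
  the purpose of the unimodular factor.\<close>

definition poly_kernel :: "nat \<Rightarrow> real poly \<Rightarrow> complex \<Rightarrow> complex \<Rightarrow> complex" where
  "poly_kernel n q w z = (cnj (z - cnj w) / (z - cnj w)) ^ (n - 1) / (z - cnj w)\<^sup>2 *
     of_real (poly q ((cmod ((z - w) / (z - cnj w)))\<^sup>2))"

lemma poly_kernel_continuous:
  assumes w: "Im w > 0" shows "continuous_on half_plane (poly_kernel n q w)"
  unfolding poly_kernel_def[abs_def]
  by (intro continuous_intros) (use upper_diff_cnj_nonzero[OF _ w] in \<open>auto simp: half_plane_def\<close>)

lemma polyholomorphic_continuous:
  assumes "polyholomorphic_on n S f" shows "continuous_on S f"
proof -
  obtain h where h: "\<forall>a<n. h a holomorphic_on S" "\<forall>z\<in>S. f z = (\<Sum>a<n. cnj z ^ a * h a z)"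
    using assms unfolding polyholomorphic_on_def by blast
  have "continuous_on S (\<lambda>z. \<Sum>a<n. cnj z ^ a * h a z)"
    by (intro continuous_intros holomorphic_on_imp_continuous_on) (use h(1) in auto)
  then show ?thesis by (rule continuous_on_eq) (use h(2) in auto)
qed

text \<open>In the disc coordinate \<open>cnj z = (cnj w - w cnj \<zeta>) / (1 - cnj \<zeta>)\<close>, so the \<open>n - 1\<close> extra factors \<open>1 - cnj \<zeta>\<close> clear
  all antiholomorphic denominators and the degree in \<open>cnj \<zeta>\<close> stays below \<open>n\<close>.\<close>

lemma cayley_transplant:
  assumes \<phi>: "polyholomorphic_on n half_plane \<phi>" and w: "Im w > 0" and n: "n \<ge> 1"
  shows "polyholomorphic_on n (ball 0 1) (\<lambda>\<zeta>. (1 - cnj \<zeta>) ^ (n - 1) / (1 - \<zeta>) ^ (n + 1) * \<phi> (cayley w \<zeta>))"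
proof -
  obtain h where h: "\<And>a. a < n \<Longrightarrow> h a holomorphic_on ball 0 1"
    and \<phi>h: "\<And>\<zeta>. \<zeta> \<in> ball 0 1 \<Longrightarrow> \<phi> (cayley w \<zeta>) = (\<Sum>a<n. cnj (cayley w \<zeta>) ^ a * h a \<zeta>)"
    by (rule polyholomorphic_on_compose[OF \<phi> cayley_holomorphic[OF w]]) (use cayley_image[OF w] in auto)
  have "polyholomorphic_on n (ball 0 1) (\<lambda>\<zeta>. \<Sum>a<n. (cnj w + (- w) * cnj \<zeta>) ^ a * ((1 + (-1) * cnj \<zeta>) ^ (n - 1 - a) * (h a \<zeta> / (1 - \<zeta>) ^ (n + 1))))"
  proof (rule polyholomorphic_on_sum)
    fix a assume "a \<in> {..<n}"
    then have a: "a < n" by simp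
    have "polyholomorphic_on 1 (ball 0 1) (\<lambda>\<zeta>. h a \<zeta> / (1 - \<zeta>) ^ (n + 1))"
      by (intro holomorphic_imp_polyholomorphic_on holomorphic_intros h a) auto
    from polyholomorphic_on_affine_power_mult[OF polyholomorphic_on_affine_power_mult[OF this]]
    have "polyholomorphic_on (1 + (n - 1 - a) + a) (ball 0 1) (\<lambda>\<zeta>. (cnj w + (- w) * cnj \<zeta>) ^ a * ((1 + (-1) * cnj \<zeta>) ^ (n - 1 - a) * (h a \<zeta> / (1 - \<zeta>) ^ (n + 1))))" .
    then show "polyholomorphic_on n (ball 0 1) (\<lambda>\<zeta>. (cnj w + (- w) * cnj \<zeta>) ^ a * ((1 + (-1) * cnj \<zeta>) ^ (n - 1 - a) * (h a \<zeta> / (1 - \<zeta>) ^ (n + 1))))"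
      using a by (simp add: add.commute)
  qed
  moreover have "(\<Sum>a<n. (cnj w + (- w) * cnj \<zeta>) ^ a * ((1 + (-1) * cnj \<zeta>) ^ (n - 1 - a) * (h a \<zeta> / (1 - \<zeta>) ^ (n + 1))))
    = (1 - cnj \<zeta>) ^ (n - 1) / (1 - \<zeta>) ^ (n + 1) * \<phi> (cayley w \<zeta>)" if "\<zeta> \<in> ball 0 1" for \<zeta>
  proof -
    have z: "cmod \<zeta> < 1" using that by simp
    have nz: "1 - cnj \<zeta> \<noteq> 0" using cayley_facts(2)[OF w z] by (metis complex_cnj_cnj complex_cnj_diff complex_cnj_one complex_cnj_zero)
    have "(cnj w - w * cnj \<zeta>) ^ a * (1 - cnj \<zeta>) ^ (n - 1 - a) = (1 - cnj \<zeta>) ^ (n - 1) * cnj (cayley w \<zeta>) ^ a" if "a < n" for a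
    proof -
      have "cnj w - w * cnj \<zeta> = (1 - cnj \<zeta>) * cnj (cayley w \<zeta>)" unfolding cayley_def using nz by simp
      moreover have "(1 - cnj \<zeta>) ^ a * (1 - cnj \<zeta>) ^ (n - 1 - a) = (1 - cnj \<zeta>) ^ (n - 1)"
        using that by (simp flip: power_add)
      ultimately show ?thesis by (simp add: power_mult_distrib mult_ac)
    qed
    then show ?thesis unfolding \<phi>h[OF that] sum_distrib_left
      by (intro sum.cong refl) (simp add: mult.assoc[symmetric])
  qed
  ultimately show ?thesis unfolding polyholomorphic_on_def by simp
qed

lemma cayley_kernel_identity:
  assumes w: "Im w > 0" and z: "cmod \<zeta> < 1" and n: "n \<ge> 1"
  shows "of_real ((cmod ((w - cnj w) / (1 - \<zeta>)\<^sup>2))\<^sup>2) * cnj (poly_kernel n q w (cayley w \<zeta>))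
    = (-1) ^ n * ((1 - cnj \<zeta>) ^ (n - 1) / (1 - \<zeta>) ^ (n + 1)) * of_real (poly q ((cmod \<zeta>)\<^sup>2))"
proof -
  define d where "d = w - cnj w"
  define e where "e = 1 - \<zeta>"
  have d: "d \<noteq> 0" "cnj d = - d" using w by (auto simp: d_def complex_eq_iff)
  have e: "e \<noteq> 0" "cnj e \<noteq> 0" using cayley_facts(2)[OF w z] by (auto simp: e_def)
  have ec: "1 - cnj \<zeta> = cnj e" by (simp add: e_def)
  have mc: "cayley w \<zeta> - cnj w = d / e" unfolding d_def e_def by (rule cayley_facts(3)[OF w z])
  have "cnj (poly_kernel n q w (cayley w \<zeta>))
    = ((d / e) / cnj (d / e)) ^ (n - 1) / (cnj (d / e))\<^sup>2 * of_real (poly q ((cmod \<zeta>)\<^sup>2))"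
    unfolding poly_kernel_def cayley_facts(6)[OF w z] unfolding mc by simp
  also have "(d / e) / cnj (d / e) = - (cnj e / e)" using d e by simp
  also have "(cnj (d / e))\<^sup>2 = d\<^sup>2 / (cnj e)\<^sup>2" using d by (simp add: power_divide)
  finally have 1: "cnj (poly_kernel n q w (cayley w \<zeta>))
    = (- (cnj e / e)) ^ (n - 1) / (d\<^sup>2 / (cnj e)\<^sup>2) * of_real (poly q ((cmod \<zeta>)\<^sup>2))" .
  have 2: "of_real ((cmod (d / e\<^sup>2))\<^sup>2) = - d\<^sup>2 / (e\<^sup>2 * (cnj e)\<^sup>2)"
    unfolding complex_norm_square using d by (simp add: power2_eq_square)
  have key: "- d\<^sup>2 / (e\<^sup>2 * (cnj e)\<^sup>2) * ((- (cnj e / e)) ^ (n - 1) / (d\<^sup>2 / (cnj e)\<^sup>2))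
    = (-1) ^ n * (cnj e ^ (n - 1) / e ^ (n + 1))"
  proof -
    obtain m where m: "n = Suc m" using n by (cases n) auto
    show ?thesis using d e unfolding m
      by (simp add: power_minus[of "cnj e / e"] power_divide power_add field_simps power2_eq_square)
  qed
  show ?thesis unfolding d_def[symmetric] e_def[symmetric] ec 1 2
    by (simp only: mult.assoc[symmetric] key)
qed

text \<open>Substituting \<open>z = cayley w \<zeta>\<close> turns the inner product into the integral of a polyanalytic function
  on the disc against a radial weight, and the mean value property evaluates it at \<open>\<zeta> = 0\<close>.\<close>

theorem poly_kernel_reproducing:
  assumes \<phi>: "sq_integrable upper \<phi>" "polyholomorphic_on n half_plane \<phi>" and w: "Im w > 0" and n: "n \<ge> 1"
    and K: "sq_integrable upper (poly_kernel n q w)"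
    and q: "\<And>k. 1 \<le> k \<Longrightarrow> k < n \<Longrightarrow> radial_moment q k 1 = 0"
  shows "sq_inner upper \<phi> (poly_kernel n q w) = (-1) ^ n * radial_moment q 0 1 * \<phi> w"
proof -
  define f where "f z = \<phi> z * cnj (poly_kernel n q w z)" for z
  define F where "F \<zeta> = (1 - cnj \<zeta>) ^ (n - 1) / (1 - \<zeta>) ^ (n + 1) * \<phi> (cayley w \<zeta>)" for \<zeta>
  have F: "polyholomorphic_on n (ball 0 1) F"
    unfolding F_def[abs_def] by (rule cayley_transplant[OF \<phi>(2) w n])
  have fc: "continuous_on half_plane f"
    unfolding f_def by (intro continuous_intros polyholomorphic_continuous[OF \<phi>(2)] poly_kernel_continuous w)
  have fi: "set_integrable lborel half_plane f"
    using sq_integrable_mult_integrable[OF \<phi>(1) K] unfolding f_def[abs_def]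
    by (simp add: set_integrable_def integrable_restrict_space)
  have e: "of_real ((cmod (deriv (cayley w) \<zeta>))\<^sup>2) * f (cayley w \<zeta>) = (-1) ^ n * (F \<zeta> * of_real (poly q ((cmod \<zeta>)\<^sup>2)))"
    if "\<zeta> \<in> ball 0 1" for \<zeta>
  proof -
    have z: "cmod \<zeta> < 1" using that by simp
    have "of_real ((cmod (deriv (cayley w) \<zeta>))\<^sup>2) * f (cayley w \<zeta>)
      = \<phi> (cayley w \<zeta>) * (of_real ((cmod ((w - cnj w) / (1 - \<zeta>)\<^sup>2))\<^sup>2) * cnj (poly_kernel n q w (cayley w \<zeta>)))"
      unfolding f_def DERIV_imp_deriv[OF cayley_deriv[OF w z]] by (simp only: mult_ac)
    then show ?thesis unfolding cayley_kernel_identity[OF w z n] F_def by (simp only: mult_ac)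
  qed
  note cv = conformal_change_of_variables[OF open_ball cayley_holomorphic[OF w] cayley_inj[OF w] cayley_image[OF w] half_plane_open fc fi]
  have "set_integrable lborel (ball 0 1) (\<lambda>\<zeta>. (-1) ^ n * (F \<zeta> * of_real (poly q ((cmod \<zeta>)\<^sup>2))))"
    using cv(1) by (rule set_integrable_cong[THEN iffD1, rotated 3]) (use e in auto)
  then have "set_integrable lborel (ball 0 1) (\<lambda>\<zeta>. (-1) ^ n * ((-1) ^ n * (F \<zeta> * of_real (poly q ((cmod \<zeta>)\<^sup>2)))))"
    by (rule set_integrable_mult_right)
  then have Fi: "set_integrable lborel (ball 0 1) (\<lambda>\<zeta>. F \<zeta> * of_real (poly q ((cmod \<zeta>)\<^sup>2)))"
    by (simp add: mult.assoc[symmetric] flip: power_mult_distrib)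
  have "sq_inner upper \<phi> (poly_kernel n q w) = (LINT z:half_plane|lborel. f z)"
    unfolding sq_inner_def f_def set_lebesgue_integral_def by (simp add: integral_restrict_space)
  also have "\<dots> = (LINT \<zeta>:ball 0 1|lborel. (-1) ^ n * (F \<zeta> * of_real (poly q ((cmod \<zeta>)\<^sup>2))))"
    unfolding cv(2)[symmetric] by (rule set_lebesgue_integral_cong) (use e in auto)
  also have "\<dots> = (-1) ^ n * (F 0 * radial_moment q 0 1)"
    using polyholomorphic_disc_mean[OF F n Fi q] by simp
  also have "F 0 = \<phi> w" by (simp add: F_def cayley_def)
  finally show ?thesis by (simp add: mult_ac)
qed

subsection \<open>The kernel lies in the range of \<open>R\<^sup>*\<close>\<close>

definition in_range :: "nat \<Rightarrow> (complex \<Rightarrow> complex) \<Rightarrow> bool" where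
  "in_range n F \<longleftrightarrow> (\<exists>f. L2vec n f \<and> (\<forall>z\<in>half_plane. F z = R_adj n f z))"

lemma in_range_add_cmult:
  assumes "in_range n F" "in_range n G"
  shows "in_range n (\<lambda>z. F z + c * G z)"
proof -
  obtain f g where "L2vec n f" "\<forall>z\<in>half_plane. F z = R_adj n f z" "L2vec n g" "\<forall>z\<in>half_plane. G z = R_adj n g z"
    using assms unfolding in_range_def by blast
  then show ?thesis unfolding in_range_def
    by (intro exI[of _ "\<lambda>j x. f j x + c * g j x"])
       (auto simp: R_adj_add_cmult L2vec_def intro!: sq_integrable_add sq_integrable_cmult)
qed

lemma monomial_laguerre_span:
  assumes "a < n"
  obtains d where "\<And>s. s ^ a = (\<Sum>j=1..n. d j * poly (laguerre (j - 1)) s)"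
proof -
  obtain c where c: "monom 1 a = (\<Sum>j<n. smult (c j) (laguerre j))"
    using laguerre_span[of "monom 1 a" n] assms by (auto simp: degree_monom_eq)
  have "s ^ a = (\<Sum>j=1..n. c (j - 1) * poly (laguerre (j - 1)) s)" for s
  proof -
    have "s ^ a = poly (monom 1 a) s" by (simp add: poly_monom)
    also have "\<dots> = (\<Sum>j<n. c j * poly (laguerre j) s)" unfolding c by (simp add: poly_sum)
    also have "\<dots> = (\<Sum>j=1..n. c (j - 1) * poly (laguerre (j - 1)) s)"
      by (rule sum.reindex_bij_witness[of _ "\<lambda>j. j - 1" Suc]) auto
    finally show ?thesis .
  qed
  then show thesis using that[of "\<lambda>j. c (j - 1)"] by blast
qed

text \<open>A power of \<open>1 / (z - cnj w)\<close> is the Laplace transform of a power of \<open>t\<close> times \<open>exp (- \<i> cnj w t)\<close>. The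
  remaining factor \<open>(t Im z)\<^sup>a\<close> is a combination of the first \<open>n\<close> Laguerre polynomials in \<open>2 t Im z\<close>.\<close>

lemma in_range_base:
  assumes w: "Im w > 0" and a: "a < n"
  shows "in_range n (\<lambda>z. (of_real (Im z) * (1 / (z - cnj w))) ^ a * (1 / (z - cnj w)) ^ (2 + m))"
proof -
  define p where "p = 1 + a + m"
  obtain d where d: "\<And>s. s ^ a = (\<Sum>j=1..n. d j * poly (laguerre (j - 1)) s)"
    using monomial_laguerre_span[OF a] by metis
  define C where "C = (- \<i>) ^ Suc p / fact p"
  define b where "b t = of_real (sqrt (2 * t)) * of_real t ^ m * exp (- \<i> * cnj w * of_real t)" for t :: real
  define f where "f j t = (C * of_real (sqrt (2 * pi) * (d j / 2 ^ a) / 2)) * b t" for j and t :: real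
  have bs: "sq_integrable halfline b"
  proof (rule sq_integrable_dominated[OF power_exp_sq_integrable[OF w, of m], where C = 1])
    show "b \<in> borel_measurable halfline" unfolding b_def[abs_def] by (rule halfline_measurable) measurable
    show "AE t in halfline. cmod (b t) \<le> 1 * cmod (of_real (sqrt (2 * t) * t ^ m * exp (- Im w * t)))"
      by (rule AE_I2) (simp add: b_def norm_mult norm_power abs_mult)
  qed
  have f: "L2vec n f" unfolding L2vec_def f_def[abs_def] using sq_integrable_cmult[OF bs] by blast
  have "(of_real (Im z) * (1 / (z - cnj w))) ^ a * (1 / (z - cnj w)) ^ (2 + m) = R_adj n f z" if zp: "z \<in> half_plane" for z
  proof -
    have z: "Im z > 0" using zp by (simp add: half_plane_def)
    define y where "y = Im z"
    define c where "c = - \<i> * (z - cnj w)"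
    have c: "Re c > 0" using z w by (simp add: c_def)
    have n0: "z - cnj w \<noteq> 0" by (rule upper_diff_cnj_nonzero[OF z w])
    have cX: "1 / (z - cnj w) = - \<i> * (1 / c)" using n0 by (simp add: c_def field_simps)
    have sl: "cis (Re z * t) * slice n f y t = (C * of_real (sqrt (2 * pi))) * (of_real y ^ a * (of_real t ^ p * exp (- c * of_real t)))"
      if t: "t > 0" for t
    proof -
      have N: "(\<Sum>j=1..n. complex_of_real (Nvec j (2 * t * y)) * of_real (d j)) = of_real (exp (- t * y) * (2 * t * y) ^ a)"
        unfolding d[of "2 * t * y"] using t z
        by (simp add: Nvec_eq y_def sum_distrib_left mult_ac)
      have "slice n f y t = of_real (sqrt (2 * t)) * ((C * of_real (sqrt (2 * pi))) / (2 * 2 ^ a) * b t * (\<Sum>j=1..n. complex_of_real (Nvec j (2 * t * y)) * of_real (d j)))"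
        unfolding slice_eq f_def sum_distrib_left by (intro sum.cong refl) (simp add: mult_ac)
      also have "\<dots> = (C * of_real (sqrt (2 * pi))) * ((of_real (sqrt (2 * t)) * of_real (sqrt (2 * t)) / 2) * of_real t ^ m * (of_real (t * y) ^ a) * (exp (- \<i> * cnj w * of_real t) * of_real (exp (- t * y))))"
        unfolding N b_def by (simp add: power_mult_distrib)
      also have "complex_of_real (sqrt (2 * t)) * of_real (sqrt (2 * t)) / 2 = of_real t"
      proof -
        have "sqrt (2 * t) * sqrt (2 * t) = 2 * t" using t by simp
        then have "complex_of_real (sqrt (2 * t) * sqrt (2 * t)) = of_real (2 * t)" by (rule arg_cong)
        then have e: "complex_of_real (sqrt (2 * t)) * of_real (sqrt (2 * t)) = 2 * of_real t"
          by (simp only: of_real_mult of_real_numeral)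
        show ?thesis unfolding e by simp
      qed
      finally have "cis (Re z * t) * slice n f y t = (C * of_real (sqrt (2 * pi))) * (of_real t * of_real t ^ m * (of_real (t * y) ^ a) * (cis (Re z * t) * (exp (- \<i> * cnj w * of_real t) * of_real (exp (- t * y)))))"
        by (simp add: mult_ac)
      also have "cis (Re z * t) * (exp (- \<i> * cnj w * of_real t) * of_real (exp (- t * y))) = exp (- c * of_real t)"
      proof -
        have "- c * of_real t = \<i> * of_real (Re z * t) + (- \<i> * cnj w * of_real t + of_real (- t * y))"
          by (simp add: c_def y_def complex_eq_iff algebra_simps)
        then show ?thesis by (simp only: exp_add cis_conv_exp exp_of_real)
      qed
      also have "complex_of_real t * of_real t ^ m * of_real (t * y) ^ a = of_real y ^ a * of_real t ^ p"
        by (simp add: p_def power_mult_distrib power_add mult_ac)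
      finally show ?thesis by (simp add: mult.assoc)
    qed
    have "(\<integral>t. cis (Re z * t) * slice n f y t \<partial>halfline)
      = (\<integral>t. (C * of_real (sqrt (2 * pi)) * of_real y ^ a) * (of_real t ^ p * exp (- c * of_real t)) \<partial>halfline)"
      by (intro Bochner_Integration.integral_cong refl) (simp add: sl mult.assoc)
    also have "\<dots> = (C * of_real (sqrt (2 * pi)) * of_real y ^ a) * (fact p / c ^ Suc p)"
      unfolding integral_mult_right_zero integral_cpower_exp[OF c] ..
    finally have "R_adj n f z = of_real (1 / sqrt (2 * pi)) * ((C * of_real (sqrt (2 * pi)) * of_real y ^ a) * (fact p / c ^ Suc p))"
      unfolding R_adj_eq[OF zp] y_def by simp
    also have "\<dots> = of_real y ^ a * ((- \<i>) ^ Suc p * (1 / c) ^ Suc p)"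
      unfolding C_def by (simp add: power_divide)
    also have "\<dots> = of_real y ^ a * (1 / (z - cnj w)) ^ Suc p"
      unfolding cX power_mult_distrib[symmetric] ..
    also have "\<dots> = (of_real y * (1 / (z - cnj w))) ^ a * (1 / (z - cnj w)) ^ (2 + m)"
      unfolding power_mult_distrib p_def by (simp add: power_add)
    finally show ?thesis unfolding y_def by simp
  qed
  then show ?thesis using f unfolding in_range_def by blast
qed

text \<open>In these functions a power of \<open>Im z\<close> always comes with as many powers of \<open>1 / (z - cnj w)\<close>, and two
  more remain, so that the functions \<open>f\<close> in the preceding lemma are square integrable at \<open>0\<close>.\<close>

inductive kernel_span :: "complex \<Rightarrow> nat \<Rightarrow> (complex \<Rightarrow> complex) \<Rightarrow> bool" for w where
  base: "a < N \<Longrightarrow> kernel_span w N (\<lambda>z. (of_real (Im z) * (1 / (z - cnj w))) ^ a * (1 / (z - cnj w)) ^ (2 + m))"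
| add: "kernel_span w N F \<Longrightarrow> kernel_span w N G \<Longrightarrow> kernel_span w N (\<lambda>z. F z + c * G z)"

lemma kernel_span_in_range: "kernel_span w n F \<Longrightarrow> Im w > 0 \<Longrightarrow> in_range n F"
proof (induction rule: kernel_span.induct)
  case (base a N m)
  then show ?case by (intro in_range_base)
qed (intro in_range_add_cmult)

lemma kernel_span_mono: "kernel_span w N F \<Longrightarrow> kernel_span w (Suc N) F"
  by (induction rule: kernel_span.induct) (rule kernel_span.intros; simp)+

lemma kernel_span_inverse_mult: "kernel_span w N F \<Longrightarrow> kernel_span w N (\<lambda>z. 1 / (z - cnj w) * F z)"
proof (induction rule: kernel_span.induct)
  case (base a N m)
  have "(\<lambda>z. 1 / (z - cnj w) * ((of_real (Im z) * (1 / (z - cnj w))) ^ a * (1 / (z - cnj w)) ^ (2 + m)))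
     = (\<lambda>z. (of_real (Im z) * (1 / (z - cnj w))) ^ a * (1 / (z - cnj w)) ^ (2 + Suc m))"
    by (intro ext) (simp only: add_Suc_right power_Suc mult_ac)
  then show ?case using kernel_span.base[OF base, of w "Suc m"] by simp
next
  case (add N F G c)
  from kernel_span.add[OF add.IH, of c] show ?case by (simp only: distrib_left mult_ac)
qed

lemma kernel_span_Im_mult:
  "kernel_span w N F \<Longrightarrow> kernel_span w (Suc N) (\<lambda>z. (of_real (Im z) * (1 / (z - cnj w))) * F z)"
proof (induction rule: kernel_span.induct)
  case (base a N m)
  have "(\<lambda>z. (of_real (Im z) * (1 / (z - cnj w))) * ((of_real (Im z) * (1 / (z - cnj w))) ^ a * (1 / (z - cnj w)) ^ (2 + m)))
     = (\<lambda>z. (of_real (Im z) * (1 / (z - cnj w))) ^ Suc a * (1 / (z - cnj w)) ^ (2 + m))"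
    by (intro ext) (simp only: power_Suc mult_ac)
  then show ?case using kernel_span.base[of "Suc a" "Suc N" w m] base by simp
next
  case (add N F G c)
  from kernel_span.add[OF add.IH, of c] show ?case by (simp only: distrib_left mult_ac)
qed

lemma kernel_span_factor_mult:
  assumes "kernel_span w N F"
  shows "kernel_span w (Suc N) (\<lambda>z. (1 + \<alpha> * (1 / (z - cnj w)) + \<beta> * (of_real (Im z) * (1 / (z - cnj w)))
    + \<gamma> * (of_real (Im z) * (1 / (z - cnj w)) * (1 / (z - cnj w)))) * F z)"
proof -
  from kernel_span.add[OF kernel_span.add[OF kernel_span.add[OF
      kernel_span_mono[OF assms] kernel_span_mono[OF kernel_span_inverse_mult[OF assms]], of \<alpha>]
      kernel_span_Im_mult[OF assms], of \<beta>]
      kernel_span_Im_mult[OF kernel_span_inverse_mult[OF assms]], of \<gamma>]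
  show ?thesis by (simp only: distrib_left distrib_right mult_1_left mult_ac)
qed

lemma kernel_span_factors_power:
  assumes "kernel_span w N F"
  shows "kernel_span w (N + k) (\<lambda>z. (1 + \<alpha> * (1 / (z - cnj w)) + \<beta> * (of_real (Im z) * (1 / (z - cnj w)))
    + \<gamma> * (of_real (Im z) * (1 / (z - cnj w)) * (1 / (z - cnj w)))) ^ k * F z)"
proof (induction k)
  case 0 then show ?case using assms by simp
next
  case (Suc k)
  from kernel_span_factor_mult[OF Suc, of \<alpha> \<beta> \<gamma>] show ?case by (simp only: power_Suc mult.assoc add_Suc_right)
qed

lemma in_range_sum:
  assumes "\<And>i. i \<in> I \<Longrightarrow> in_range n (F i)"
  shows "in_range n (\<lambda>z. \<Sum>i\<in>I. c i * F i z)"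
  using assms
proof (induction I rule: infinite_finite_induct)
  case (insert i I)
  from in_range_add_cmult[OF insert.IH insert.prems[of i], of "c i"] insert.hyps show ?case
    using insert.prems by (simp add: add.commute)
qed (auto simp: in_range_def R_adj_def L2vec_def sq_integrable_zero intro!: exI[of _ "\<lambda>_ _. 0"])

text \<open>Let \<open>X = 1 / (z - cnj w)\<close> and let \<open>\<zeta>\<close> be the disc coordinate of \<open>z\<close>. Both \<open>A = cnj (z - cnj w) / (z - cnj w)\<close>
  and \<open>B = A \<bar>\<zeta>\<bar>\<^sup>2\<close> are of degree one in \<open>Im z X\<close> with coefficients polynomial in \<open>X\<close>, and the term of
  order \<open>k\<close> of the kernel is a product of \<open>n - 1\<close> of these factors with \<open>X\<^sup>2\<close>.\<close>

theorem poly_kernel_in_range: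
  assumes w: "Im w > 0" and q: "degree q < n"
  shows "in_range n (poly_kernel n q w)"
proof -
  define v where "v = complex_of_real (Im w)"
  define A where "A z = 1 + (- 2 * \<i> * v) * (1 / (z - cnj w)) + (- 2 * \<i>) * (of_real (Im z) * (1 / (z - cnj w)))
    + 0 * (of_real (Im z) * (1 / (z - cnj w)) * (1 / (z - cnj w)))" for z
  define B where "B z = 1 + (- 2 * \<i> * v) * (1 / (z - cnj w)) + (- 2 * \<i>) * (of_real (Im z) * (1 / (z - cnj w)))
    + (- 4 * v) * (of_real (Im z) * (1 / (z - cnj w)) * (1 / (z - cnj w)))" for z
  have term_span: "in_range n (\<lambda>z. A z ^ (n - 1 - k) * (B z ^ k * (1 / (z - cnj w)) ^ 2))" if k: "k < n" for k
  proof -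
    have "kernel_span w 1 (\<lambda>z. (1 / (z - cnj w)) ^ 2)" using kernel_span.base[of 0 1 w 0] by simp
    from kernel_span_factors_power[OF kernel_span_factors_power[OF this]]
    have "kernel_span w (1 + k + (n - 1 - k)) (\<lambda>z. A z ^ (n - 1 - k) * (B z ^ k * (1 / (z - cnj w)) ^ 2))"
      unfolding A_def B_def .
    then show ?thesis using k kernel_span_in_range[OF _ w] by simp
  qed
  have "in_range n (\<lambda>z. \<Sum>k<n. of_real (coeff q k) * (A z ^ (n - 1 - k) * (B z ^ k * (1 / (z - cnj w)) ^ 2)))"
    by (rule in_range_sum) (use term_span in auto)
  moreover have "poly_kernel n q w z = (\<Sum>k<n. of_real (coeff q k) * (A z ^ (n - 1 - k) * (B z ^ k * (1 / (z - cnj w)) ^ 2)))"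
    if zp: "z \<in> half_plane" for z
  proof -
    have z: "Im z > 0" using zp by (simp add: half_plane_def)
    define b where "b = z - cnj w"
    have b: "b \<noteq> 0" unfolding b_def by (rule upper_diff_cnj_nonzero[OF z w])
    have cb: "cnj b = b - 2 * \<i> * (v + of_real (Im z))" by (simp add: b_def v_def complex_eq_iff)
    have A: "A z = cnj b / b" unfolding A_def b_def[symmetric] cb using b by (simp add: field_simps)
    define s where "s = (cmod ((z - w) / b))\<^sup>2"
    have "complex_of_real s = ((z - w) * cnj (z - w)) / (b * cnj b)"
      unfolding s_def complex_norm_square by simp
    also have "(z - w) * cnj (z - w) = b * cnj b - 4 * v * of_real (Im z)"
      by (simp add: b_def v_def complex_eq_iff algebra_simps)
    finally have s: "of_real s = (b * cnj b - 4 * v * of_real (Im z)) / (b * cnj b)" .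
    have B: "B z = A z * of_real s"
    proof -
      have "B z = A z - 4 * v * of_real (Im z) / (b * b)" unfolding A_def B_def b_def by (simp add: algebra_simps)
      also have "\<dots> = A z * of_real s" unfolding A s using b by (simp add: field_simps)
      finally show ?thesis .
    qed
    have "complex_of_real (poly q s) = (\<Sum>k<n. of_real (coeff q k) * of_real s ^ k)"
    proof -
      have "poly q s = (\<Sum>k<n. coeff q k * s ^ k)"
        unfolding poly_altdef using q by (intro sum.mono_neutral_left) (auto simp: coeff_eq_0)
      then show ?thesis by simp
    qed
    then have "poly_kernel n q w z = A z ^ (n - 1) / b\<^sup>2 * (\<Sum>k<n. of_real (coeff q k) * of_real s ^ k)"
      unfolding poly_kernel_def b_def[symmetric] A s_def[symmetric] by simp
    also have "\<dots> = (\<Sum>k<n. of_real (coeff q k) * (A z ^ (n - 1 - k) * (B z ^ k * (1 / b) ^ 2)))"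
      unfolding sum_distrib_left
    proof (rule sum.cong[OF refl])
      fix k assume "k \<in> {..<n}"
      then have "A z ^ (n - 1) = A z ^ (n - 1 - k) * A z ^ k" by (simp flip: power_add)
      then show "A z ^ (n - 1) / b\<^sup>2 * (of_real (coeff q k) * of_real s ^ k) = of_real (coeff q k) * (A z ^ (n - 1 - k) * (B z ^ k * (1 / b) ^ 2))"
        unfolding B by (simp add: power_mult_distrib power_divide)
    qed
    finally show ?thesis unfolding b_def .
  qed
  ultimately show ?thesis unfolding in_range_def by auto
qed

text \<open>Evaluation at \<open>w\<close>, a multiple of an inner product, is represented by a vector in the range of \<open>R\<^sup>*\<close>.\<close>

theorem reproducing_vector:
  assumes n: "n \<ge> 1" and w: "w \<in> half_plane"
  obtains f c where "L2vec n f" "c \<noteq> 0" "\<And>\<phi>. \<phi> \<in> poly_bergman n \<Longrightarrow> sq_inner upper \<phi> (R_adj n f) = c * \<phi> w"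
proof -
  have w': "Im w > 0" using w by (simp add: half_plane_def)
  obtain q where q: "degree q < n" "radial_moment q 0 1 \<noteq> 0" "\<And>k. 1 \<le> k \<Longrightarrow> k < n \<Longrightarrow> radial_moment q k 1 = 0"
    using radial_weight_exists[OF n] by metis
  obtain f where f: "L2vec n f" "\<And>z. z \<in> half_plane \<Longrightarrow> poly_kernel n q w z = R_adj n f z"
    using poly_kernel_in_range[OF w' q(1)] unfolding in_range_def by blast
  have K: "sq_integrable upper (poly_kernel n q w)"
    by (rule sq_integrable_cong_AE[OF _ R_adj_isometry(1)[OF f(1)]])
       (use f(2) in \<open>auto intro!: AE_I2 measurable_cong[THEN iffD2, OF _ R_adj_measurable[OF f(1)]]\<close>)
  have "sq_inner upper \<phi> (R_adj n f) = ((-1) ^ n * radial_moment q 0 1) * \<phi> w" if "\<phi> \<in> poly_bergman n" for \<phi>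
  proof -
    have "sq_inner upper \<phi> (R_adj n f) = sq_inner upper \<phi> (poly_kernel n q w)"
      unfolding sq_inner_def by (intro Bochner_Integration.integral_cong refl) (simp add: f(2))
    then show ?thesis
      using poly_kernel_reproducing[OF poly_bergmanD(1,2)[OF that] w' n K q(3)] by simp
  qed
  then show thesis using that[OF f(1), of "(-1) ^ n * radial_moment q 0 1"] q(2) by auto
qed

text \<open>Both sides lie in the polyanalytic space, and by the isometry and the duality they have the same
  inner product with the reproducing vector of each point.\<close>

theorem R_adj_R_op:
  assumes n: "n \<ge> 1" and \<phi>: "\<phi> \<in> poly_bergman n"
  shows "R_adj n (R_op n \<phi>) = \<phi>"
proof
  fix w
  show "R_adj n (R_op n \<phi>) w = \<phi> w"
  proof (cases "w \<in> half_plane")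
    case True
    obtain f c where f: "L2vec n f" and c: "c \<noteq> 0"
      and rep: "\<And>\<phi>. \<phi> \<in> poly_bergman n \<Longrightarrow> sq_inner upper \<phi> (R_adj n f) = c * \<phi> w"
      using reproducing_vector[OF n True] by metis
    have R: "L2vec n (R_op n \<phi>)" by (rule R_op_L2vec[OF poly_bergmanD(1)[OF \<phi>]])
    have "c * R_adj n (R_op n \<phi>) w = (\<Sum>j=1..n. sq_inner halfline (R_op n \<phi> j) (f j))"
      unfolding rep[OF R_adj_in_poly_bergman[OF R], symmetric] by (rule R_adj_inner[OF R f])
    also have "\<dots> = c * \<phi> w"
      unfolding rep[OF \<phi>, symmetric] by (rule R_op_adjoint[symmetric, OF poly_bergmanD(1)[OF \<phi>] f])
    finally show ?thesis using c by simp
  next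
    case False
    then show ?thesis using poly_bergmanD(3)[OF \<phi>] by (simp add: R_adj_def)
  qed
qed

lemma poly_bergman_eqI:
  assumes n: "n \<ge> 1" and f: "f \<in> poly_bergman n" and g: "g \<in> poly_bergman n"
    and 0: "sq_norm upper (\<lambda>z. f z - g z) = 0"
  shows "f = g"
proof
  fix w
  show "f w = g w"
  proof (cases "w \<in> half_plane")
    case True
    obtain h c where h: "L2vec n h" and c: "c \<noteq> 0"
      and rep: "\<And>\<phi>. \<phi> \<in> poly_bergman n \<Longrightarrow> sq_inner upper \<phi> (R_adj n h) = c * \<phi> w"
      using reproducing_vector[OF n True] by metis
    have d: "(\<lambda>z. f z - g z) \<in> poly_bergman n" by (rule poly_bergman_diff[OF f g])
    have "cmod (c * (f w - g w)) \<le> 0"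
      using sq_inner_Cauchy_Schwarz[OF poly_bergmanD(1)[OF d] R_adj_isometry(1)[OF h]] rep[OF d] 0 by simp
    then show ?thesis using c by simp
  next
    case False
    then show ?thesis using poly_bergmanD(3)[OF f] poly_bergmanD(3)[OF g] by simp
  qed
qed

section \<open>Multiplication operators on the Bergman space\<close>

text \<open>With its inverse \<open>coord\<close>, the identification of the Bergman space with \<open>L\<^sub>2\<close> of the half-line; \<open>coord\<close> is
  determined up to null sets.\<close>

definition emb :: "(real \<Rightarrow> complex) \<Rightarrow> complex \<Rightarrow> complex" where
  "emb f = R_adj 1 (\<lambda>_. f)"

definition coord :: "(complex \<Rightarrow> complex) \<Rightarrow> real \<Rightarrow> complex" where
  "coord \<phi> = R_op 1 \<phi> 1"

lemma L2vec_1: "sq_integrable halfline f \<Longrightarrow> L2vec 1 (\<lambda>_. f)"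
  by (simp add: L2vec_def)

lemma emb_in_bergman: "sq_integrable halfline f \<Longrightarrow> emb f \<in> poly_bergman 1"
  unfolding emb_def by (intro R_adj_in_poly_bergman L2vec_1)

lemma emb_inner:
  "sq_integrable halfline f \<Longrightarrow> sq_integrable halfline g \<Longrightarrow> sq_inner upper (emb f) (emb g) = sq_inner halfline f g"
  using R_adj_inner[OF L2vec_1 L2vec_1] unfolding emb_def by simp

lemma emb_cong_AE:
  "sq_integrable halfline f \<Longrightarrow> sq_integrable halfline g \<Longrightarrow> AE t in halfline. f t = g t \<Longrightarrow> emb f = emb g"
  unfolding emb_def by (intro R_adj_cong_AE L2vec_1)

lemma emb_add_cmult:
  "sq_integrable halfline f \<Longrightarrow> sq_integrable halfline g \<Longrightarrow> emb (\<lambda>t. f t + c * g t) = (\<lambda>z. emb f z + c * emb g z)"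
  unfolding emb_def by (rule R_adj_add_cmult[OF L2vec_1 L2vec_1])

lemma coord_sq_integrable: "\<phi> \<in> poly_bergman 1 \<Longrightarrow> sq_integrable halfline (coord \<phi>)"
  unfolding coord_def by (rule R_op_limit(1)[OF poly_bergmanD(1)]) auto

lemma coord_emb: "sq_integrable halfline f \<Longrightarrow> AE t in halfline. coord (emb f) t = f t"
  unfolding coord_def emb_def by (rule R_op_R_adj[OF L2vec_1]) auto

lemma emb_coord: "\<phi> \<in> poly_bergman 1 \<Longrightarrow> emb (coord \<phi>) = \<phi>"
proof -
  assume \<phi>: "\<phi> \<in> poly_bergman 1"
  have "R_adj 1 (\<lambda>_. coord \<phi>) = R_adj 1 (R_op 1 \<phi>)"
    using coord_sq_integrable[OF \<phi>] by (intro R_adj_cong_AE) (auto simp: L2vec_def coord_def)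
  then show ?thesis using R_adj_R_op[of 1 \<phi>] \<phi> unfolding emb_def by simp
qed

lemma coord_inner:
  "\<phi> \<in> poly_bergman 1 \<Longrightarrow> \<psi> \<in> poly_bergman 1 \<Longrightarrow> sq_inner halfline (coord \<phi>) (coord \<psi>) = sq_inner upper \<phi> \<psi>"
  using emb_inner[OF coord_sq_integrable coord_sq_integrable] by (simp add: emb_coord)

lemma coord_norm: "\<phi> \<in> poly_bergman 1 \<Longrightarrow> sq_norm halfline (coord \<phi>) = sq_norm upper \<phi>"
proof -
  assume \<phi>: "\<phi> \<in> poly_bergman 1"
  have "complex_of_real ((sq_norm halfline (coord \<phi>))\<^sup>2) = complex_of_real ((sq_norm upper \<phi>)\<^sup>2)"
    unfolding sq_inner_self[symmetric] by (rule coord_inner[OF \<phi> \<phi>])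
  then show ?thesis by (simp only: of_real_eq_iff) (simp add: power2_eq_iff_nonneg)
qed

lemma R_op_add_cmult:
  assumes n: "n \<ge> 1" and \<phi>: "\<phi> \<in> poly_bergman n" and \<psi>: "\<psi> \<in> poly_bergman n" and j: "j \<in> {1..n}"
  shows "AE t in halfline. R_op n (\<lambda>z. \<phi> z + c * \<psi> z) j t = R_op n \<phi> j t + c * R_op n \<psi> j t"
proof -
  have L: "L2vec n (R_op n \<phi>)" "L2vec n (R_op n \<psi>)" using R_op_L2vec poly_bergmanD(1) \<phi> \<psi> by auto
  then have L': "L2vec n (\<lambda>j t. R_op n \<phi> j t + c * R_op n \<psi> j t)"
    unfolding L2vec_def by (auto intro!: sq_integrable_add sq_integrable_cmult)
  have "R_adj n (\<lambda>j t. R_op n \<phi> j t + c * R_op n \<psi> j t) = (\<lambda>z. \<phi> z + c * \<psi> z)"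
    unfolding R_adj_add_cmult[OF L] R_adj_R_op[OF n \<phi>] R_adj_R_op[OF n \<psi>] ..
  then show ?thesis using R_op_R_adj[OF L' j] by simp
qed

definition multiplier :: "(real \<Rightarrow> real) \<Rightarrow> bool" where
  "multiplier m \<longleftrightarrow> m \<in> borel_measurable borel \<and> (\<exists>C. \<forall>t>0. \<bar>m t\<bar> \<le> C)"

text \<open>Multiplication by \<open>m\<close> on the half-line, carried over to the Bergman space.\<close>

definition mult_op :: "(real \<Rightarrow> real) \<Rightarrow> (complex \<Rightarrow> complex) \<Rightarrow> complex \<Rightarrow> complex" where
  "mult_op m \<phi> = emb (\<lambda>t. of_real (m t) * coord \<phi> t)"

lemma multiplierD: "multiplier m \<Longrightarrow> m \<in> borel_measurable borel" "multiplier m \<Longrightarrow> \<exists>C. \<forall>t>0. \<bar>m t\<bar> \<le> C"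
  by (auto simp: multiplier_def)

lemma multiplier_const: "multiplier (\<lambda>_. a)"
  by (auto simp: multiplier_def)

lemma multiplier_mult: "multiplier m \<Longrightarrow> multiplier m' \<Longrightarrow> multiplier (\<lambda>t. m t * m' t)"
proof -
  assume m: "multiplier m" "multiplier m'"
  obtain C C' where "\<forall>t>0. \<bar>m t\<bar> \<le> C" "\<forall>t>0. \<bar>m' t\<bar> \<le> C'" using m multiplierD(2) by metis
  then have "\<forall>t>0. \<bar>m t * m' t\<bar> \<le> C * C'" by (auto simp: abs_mult intro!: mult_mono order_trans[OF abs_ge_zero])
  then show ?thesis using m unfolding multiplier_def by (auto intro!: borel_measurable_times)
qed

lemma multiplier_add: "multiplier m \<Longrightarrow> multiplier m' \<Longrightarrow> multiplier (\<lambda>t. m t + m' t)"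
proof -
  assume m: "multiplier m" "multiplier m'"
  obtain C C' where "\<forall>t>0. \<bar>m t\<bar> \<le> C" "\<forall>t>0. \<bar>m' t\<bar> \<le> C'" using m multiplierD(2) by metis
  then have "\<forall>t>0. \<bar>m t + m' t\<bar> \<le> C + C'" by (auto intro!: order_trans[OF abs_triangle_ineq] add_mono)
  then show ?thesis using m unfolding multiplier_def by (auto intro!: borel_measurable_add)
qed

lemma multiplier_sq_integrable:
  assumes m: "multiplier m" and f: "sq_integrable halfline f"
  shows "sq_integrable halfline (\<lambda>t. of_real (m t) * f t)"
proof -
  obtain C where "\<forall>t>0. \<bar>m t\<bar> \<le> C" using multiplierD(2)[OF m] by blast
  moreover have "(\<lambda>t. complex_of_real (m t)) \<in> borel_measurable halfline"
    using multiplierD(1)[OF m] by (intro halfline_measurable) measurable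
  ultimately show ?thesis using f by (intro sq_integrable_bounded_mult[where C = C]) auto
qed

lemma multiplier_coord_sq_integrable:
  "multiplier m \<Longrightarrow> \<phi> \<in> poly_bergman 1 \<Longrightarrow> sq_integrable halfline (\<lambda>t. of_real (m t) * coord \<phi> t)"
  by (intro multiplier_sq_integrable coord_sq_integrable)

lemma mult_op_in_bergman: "multiplier m \<Longrightarrow> \<phi> \<in> poly_bergman 1 \<Longrightarrow> mult_op m \<phi> \<in> poly_bergman 1"
  unfolding mult_op_def by (intro emb_in_bergman multiplier_coord_sq_integrable)

lemma mult_op_emb:
  assumes m: "multiplier m" and f: "sq_integrable halfline f"
  shows "mult_op m (emb f) = emb (\<lambda>t. of_real (m t) * f t)"
  unfolding mult_op_def
proof (rule emb_cong_AE)
  show "AE t in halfline. of_real (m t) * coord (emb f) t = of_real (m t) * f t"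
    using coord_emb[OF f] by eventually_elim simp
qed (intro multiplier_coord_sq_integrable multiplier_sq_integrable m f emb_in_bergman)+

lemma mult_op_mult_op:
  assumes m: "multiplier m" and m': "multiplier m'" and \<phi>: "\<phi> \<in> poly_bergman 1"
  shows "mult_op m (mult_op m' \<phi>) = mult_op (\<lambda>t. m t * m' t) \<phi>"
  unfolding mult_op_def[of m' \<phi>]
  by (subst mult_op_emb[OF m multiplier_coord_sq_integrable[OF m' \<phi>]]) (simp add: mult_op_def mult.assoc)

lemma mult_op_cong:
  assumes "\<And>t. t > 0 \<Longrightarrow> m t = m' t" "multiplier m" "multiplier m'" "\<phi> \<in> poly_bergman 1"
  shows "mult_op m \<phi> = mult_op m' \<phi>"
  unfolding mult_op_def
  by (intro emb_cong_AE multiplier_coord_sq_integrable assms(2-4) AE_I2) (simp add: assms(1))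

lemma mult_op_add_cmult:
  assumes m: "multiplier m" and \<phi>: "\<phi> \<in> poly_bergman 1" and \<psi>: "\<psi> \<in> poly_bergman 1"
  shows "mult_op m (\<lambda>z. \<phi> z + c * \<psi> z) = (\<lambda>z. mult_op m \<phi> z + c * mult_op m \<psi> z)"
proof -
  note s = coord_sq_integrable[OF \<phi>] coord_sq_integrable[OF \<psi>]
  have e: "(\<lambda>z. \<phi> z + c * \<psi> z) = emb (\<lambda>t. coord \<phi> t + c * coord \<psi> t)"
    unfolding emb_add_cmult[OF s] emb_coord[OF \<phi>] emb_coord[OF \<psi>] ..
  have "mult_op m (\<lambda>z. \<phi> z + c * \<psi> z) = emb (\<lambda>t. of_real (m t) * (coord \<phi> t + c * coord \<psi> t))"
    unfolding e by (intro mult_op_emb m sq_integrable_add sq_integrable_cmult s)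
  also have "\<dots> = emb (\<lambda>t. of_real (m t) * coord \<phi> t + c * (of_real (m t) * coord \<psi> t))"
    by (simp add: algebra_simps)
  also have "\<dots> = (\<lambda>z. mult_op m \<phi> z + c * mult_op m \<psi> z)"
    unfolding mult_op_def by (intro emb_add_cmult multiplier_coord_sq_integrable m \<phi> \<psi>)
  finally show ?thesis .
qed

lemma mult_op_plus:
  assumes m: "multiplier m" and m': "multiplier m'" and \<phi>: "\<phi> \<in> poly_bergman 1"
  shows "mult_op (\<lambda>t. m t + c * m' t) \<phi> = (\<lambda>z. mult_op m \<phi> z + of_real c * mult_op m' \<phi> z)"
proof -
  have "mult_op (\<lambda>t. m t + c * m' t) \<phi> = emb (\<lambda>t. of_real (m t) * coord \<phi> t + of_real c * (of_real (m' t) * coord \<phi> t))"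
    unfolding mult_op_def by (simp add: algebra_simps)
  also have "\<dots> = (\<lambda>z. mult_op m \<phi> z + of_real c * mult_op m' \<phi> z)"
    unfolding mult_op_def by (intro emb_add_cmult multiplier_coord_sq_integrable m m' \<phi>)
  finally show ?thesis .
qed

lemma mult_op_const: "\<phi> \<in> poly_bergman 1 \<Longrightarrow> mult_op (\<lambda>_. a) \<phi> = (\<lambda>z. of_real a * \<phi> z)"
proof -
  assume \<phi>: "\<phi> \<in> poly_bergman 1"
  have "emb (\<lambda>t. 0 + of_real a * coord \<phi> t) = (\<lambda>z. emb (\<lambda>t. 0) z + of_real a * emb (coord \<phi>) z)"
    by (rule emb_add_cmult[OF sq_integrable_zero coord_sq_integrable[OF \<phi>]])
  moreover have "emb (\<lambda>t. 0) = (\<lambda>z. 0)" by (simp add: emb_def R_adj_def fun_eq_iff)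
  ultimately show ?thesis by (simp add: mult_op_def emb_coord[OF \<phi>])
qed

lemma mult_op_norm_le:
  assumes m: "multiplier m" and \<phi>: "\<phi> \<in> poly_bergman 1" and C: "\<And>t. t > 0 \<Longrightarrow> \<bar>m t\<bar> \<le> C" 
  shows "sq_norm upper (mult_op m \<phi>) \<le> C * sq_norm upper \<phi>"
proof -
  note s = multiplier_coord_sq_integrable[OF m \<phi>]
  have C0: "0 \<le> C" using C[of 1] by simp
  have "sq_norm upper (mult_op m \<phi>) = sq_norm halfline (\<lambda>t. of_real (m t) * coord \<phi> t)"
  proof -
    have "complex_of_real ((sq_norm upper (mult_op m \<phi>))\<^sup>2) = complex_of_real ((sq_norm halfline (\<lambda>t. of_real (m t) * coord \<phi> t))\<^sup>2)"
      unfolding sq_inner_self[symmetric] mult_op_def by (rule emb_inner[OF s s])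
    then show ?thesis by (simp only: of_real_eq_iff) (simp add: power2_eq_iff_nonneg)
  qed
  also have "\<dots> \<le> sq_norm halfline (\<lambda>t. of_real C * coord \<phi> t)"
    using C C0 by (intro sq_norm_mono sq_integrable_cmult coord_sq_integrable \<phi> sq_integrable_measurable[OF s] AE_I2)
      (auto simp: norm_mult intro!: mult_right_mono)
  also have "\<dots> = C * sq_norm upper \<phi>" using C0 by (simp add: sq_norm_cmult coord_norm[OF \<phi>])
  finally show ?thesis .
qed

lemma mult_op_inner_self:
  assumes m: "multiplier m" and \<phi>: "\<phi> \<in> poly_bergman 1"
  shows "sq_inner upper (mult_op m \<phi>) \<phi> = of_real (\<integral>t. m t * (cmod (coord \<phi> t))\<^sup>2 \<partial>halfline)"
    and "integrable halfline (\<lambda>t. m t * (cmod (coord \<phi> t))\<^sup>2)"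
proof -
  note s = multiplier_coord_sq_integrable[OF m \<phi>]
  have e: "of_real (m t) * coord \<phi> t * cnj (coord \<phi> t) = of_real (m t * (cmod (coord \<phi> t))\<^sup>2)" for t
    unfolding of_real_mult complex_norm_square by (simp add: mult.assoc)
  have "sq_inner upper (mult_op m \<phi>) \<phi> = sq_inner halfline (\<lambda>t. of_real (m t) * coord \<phi> t) (coord \<phi>)"
    using emb_inner[OF s coord_sq_integrable[OF \<phi>]] by (simp add: mult_op_def emb_coord[OF \<phi>])
  then show "sq_inner upper (mult_op m \<phi>) \<phi> = of_real (\<integral>t. m t * (cmod (coord \<phi> t))\<^sup>2 \<partial>halfline)"
    unfolding sq_inner_def e integral_complex_of_real .
  show "integrable halfline (\<lambda>t. m t * (cmod (coord \<phi> t))\<^sup>2)"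
    using sq_integrable_mult_integrable[OF s coord_sq_integrable[OF \<phi>]]
    unfolding e complex_of_real_integrable_eq .
qed

section \<open>Square roots of multiplication operators\<close>

lemma bounded_operator_onD:
  assumes "bounded_operator_on half_plane (poly_bergman 1) S"
  shows "f \<in> poly_bergman 1 \<Longrightarrow> S f \<in> poly_bergman 1"
    and "f \<in> poly_bergman 1 \<Longrightarrow> g \<in> poly_bergman 1 \<Longrightarrow> S (\<lambda>z. f z + c * g z) = (\<lambda>z. S f z + c * S g z)"
    and "\<exists>C. \<forall>f\<in>poly_bergman 1. sq_norm upper (S f) \<le> C * sq_norm upper f"
proof -
  note b = assms[unfolded bounded_operator_on_def]
  show "f \<in> poly_bergman 1 \<Longrightarrow> S f \<in> poly_bergman 1" using b by blast
  show "\<exists>C. \<forall>f\<in>poly_bergman 1. sq_norm upper (S f) \<le> C * sq_norm upper f"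
    using b by (simp add: l2_norm_eq)
  assume f: "f \<in> poly_bergman 1" and g: "g \<in> poly_bergman 1"
  have cg: "(\<lambda>z. c * g z) \<in> poly_bergman 1" by (rule poly_bergman_cmult[OF g])
  have add: "\<forall>f\<in>poly_bergman 1. \<forall>g\<in>poly_bergman 1. S (\<lambda>x. f x + g x) = (\<lambda>x. S f x + S g x)"
    and cmult: "\<forall>c. \<forall>f\<in>poly_bergman 1. S (\<lambda>x. c * f x) = (\<lambda>x. c * S f x)"
    using b by (auto simp del: One_nat_def)
  have "S (\<lambda>z. f z + c * g z) = (\<lambda>z. S f z + S (\<lambda>z. c * g z) z)" by (rule add[rule_format, OF f cg])
  also have "S (\<lambda>z. c * g z) = (\<lambda>z. c * S g z)" by (rule cmult[rule_format, OF g])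
  finally show "S (\<lambda>z. f z + c * g z) = (\<lambda>z. S f z + c * S g z)" .
qed

lemma poly_bergman_add_cmult:
  "f \<in> poly_bergman n \<Longrightarrow> g \<in> poly_bergman n \<Longrightarrow> (\<lambda>z. f z + c * g z) \<in> poly_bergman n"
  by (intro poly_bergman_add poly_bergman_cmult)

lemma multiplier_poly: "multiplier m \<Longrightarrow> multiplier (\<lambda>t. poly p (m t))"
  by (induction p) (auto intro: multiplier_const multiplier_add multiplier_mult)

lemma commute_poly:
  assumes S: "bounded_operator_on half_plane (poly_bergman 1) S" and m: "multiplier m"
    and comm: "\<And>f. f \<in> poly_bergman 1 \<Longrightarrow> S (mult_op m f) = mult_op m (S f)"
  shows "f \<in> poly_bergman 1 \<Longrightarrow> S (mult_op (\<lambda>t. poly p (m t)) f) = mult_op (\<lambda>t. poly p (m t)) (S f)"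
proof (induction p arbitrary: f)
  case 0
  have "S (\<lambda>z. f z + (-1) * f z) = (\<lambda>z. S f z + (-1) * S f z)"
    by (rule bounded_operator_onD(2)[OF S 0 0])
  then show ?case using mult_op_const[OF 0, of 0] mult_op_const[OF bounded_operator_onD(1)[OF S 0], of 0] by simp
next
  case (pCons a p)
  note mp = multiplier_poly[OF m, of p]
  have e: "mult_op (\<lambda>t. poly (pCons a p) (m t)) g = (\<lambda>z. mult_op m (mult_op (\<lambda>t. poly p (m t)) g) z + of_real a * g z)"
    if g: "g \<in> poly_bergman 1" for g
  proof -
    have "mult_op (\<lambda>t. poly (pCons a p) (m t)) g = mult_op (\<lambda>t. m t * poly p (m t) + a * 1) g"
      by (simp add: add.commute)
    also have "\<dots> = (\<lambda>z. mult_op (\<lambda>t. m t * poly p (m t)) g z + of_real a * mult_op (\<lambda>_. 1) g z)"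
      by (intro mult_op_plus multiplier_mult m mp multiplier_const g)
    finally show ?thesis unfolding mult_op_mult_op[OF m mp g] mult_op_const[OF g] by simp
  qed
  note Sf = bounded_operator_onD(1)[OF S pCons.prems]
  note pf = mult_op_in_bergman[OF mp pCons.prems]
  show ?case
    unfolding e[OF pCons.prems] e[OF Sf] bounded_operator_onD(2)[OF S mult_op_in_bergman[OF m pf] pCons.prems]
      comm[OF pf] pCons.IH[OF pCons.prems] ..
qed

lemma sqrt_poly_approx:
  assumes "e > 0"
  obtains p where "\<And>x. 0 \<le> x \<Longrightarrow> x \<le> 1 \<Longrightarrow> \<bar>sqrt x - poly p x\<bar> < e"
proof -
  obtain g where g: "real_polynomial_function g" "\<And>x. x \<in> {0..1::real} \<Longrightarrow> \<bar>sqrt x - g x\<bar> < e"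
    by (rule Stone_Weierstrass_real_polynomial_function[of "{0..1}" sqrt e]) (use assms in \<open>auto intro!: continuous_intros\<close>)
  obtain a n where a: "g = (\<lambda>x. \<Sum>i\<le>n. a i * x ^ i)" using g(1) by (auto simp: real_polynomial_function_iff_sum)
  show thesis
    by (rule that[of "\<Sum>i\<le>n. monom (a i) i"]) (use g(2) in \<open>auto simp: a poly_sum poly_monom\<close>)
qed

text \<open>By the Weierstrass theorem the square root is a uniform limit of polynomials on \<open>[0, 1]\<close>.\<close>

lemma commute_sqrt:
  assumes S: "bounded_operator_on half_plane (poly_bergman 1) S" and m: "multiplier m"
    and range: "\<And>t. t > 0 \<Longrightarrow> 0 \<le> m t \<and> m t \<le> 1"
    and comm: "\<And>f. f \<in> poly_bergman 1 \<Longrightarrow> S (mult_op m f) = mult_op m (S f)"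
    and sm: "multiplier (\<lambda>t. sqrt (m t))" and f: "f \<in> poly_bergman 1"
  shows "S (mult_op (\<lambda>t. sqrt (m t)) f) = mult_op (\<lambda>t. sqrt (m t)) (S f)"
proof (rule poly_bergman_eqI)
  let ?s = "\<lambda>t. sqrt (m t)"
  note Sf = bounded_operator_onD(1)[OF S f]
  show L: "S (mult_op ?s f) \<in> poly_bergman 1" by (intro bounded_operator_onD(1)[OF S] mult_op_in_bergman sm f)
  show R: "mult_op ?s (S f) \<in> poly_bergman 1" by (intro mult_op_in_bergman sm Sf)
  obtain C where C: "\<And>g. g \<in> poly_bergman 1 \<Longrightarrow> sq_norm upper (S g) \<le> C * sq_norm upper g"
    using bounded_operator_onD(3)[OF S] by blast
  have bound: "sq_norm upper (\<lambda>z. S (mult_op ?s f) z - mult_op ?s (S f) z) \<le> e * (\<bar>C\<bar> * sq_norm upper f + sq_norm upper (S f))"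
    if e: "e > 0" for e
  proof -
    obtain p where p: "\<And>x. 0 \<le> x \<Longrightarrow> x \<le> 1 \<Longrightarrow> \<bar>sqrt x - poly p x\<bar> < e" using sqrt_poly_approx[OF e] by blast
    let ?p = "\<lambda>t. poly p (m t)"
    note mp = multiplier_poly[OF m, of p]
    have md: "multiplier (\<lambda>t. ?s t + (-1) * ?p t)" by (intro multiplier_add multiplier_mult multiplier_const sm mp)
    have de: "\<bar>?s t + (-1) * ?p t\<bar> \<le> e" if "t > 0" for t using p[of "m t"] range[OF that] by simp
    have d: "(\<lambda>z. mult_op ?s g z - mult_op ?p g z) = mult_op (\<lambda>t. ?s t + (-1) * ?p t) g" if "g \<in> poly_bergman 1" for g
      unfolding mult_op_plus[OF sm mp that] by simp
    have cp: "S (mult_op ?p f) = mult_op ?p (S f)" by (rule commute_poly[OF S m comm f])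
    note ps = poly_bergmanD(1)
    note sf = mult_op_in_bergman[OF sm f] and pf = mult_op_in_bergman[OF mp f] and pS = mult_op_in_bergman[OF mp Sf]
    have "sq_norm upper (\<lambda>z. S (mult_op ?s f) z - mult_op ?s (S f) z)
      \<le> sq_norm upper (\<lambda>z. S (mult_op ?s f) z - S (mult_op ?p f) z) + sq_norm upper (\<lambda>z. S (mult_op ?p f) z - mult_op ?s (S f) z)"
      by (intro sq_norm_triangle_diff ps[OF L] ps[OF R] ps[OF bounded_operator_onD(1)[OF S pf]])
    also have "sq_norm upper (\<lambda>z. S (mult_op ?p f) z - mult_op ?s (S f) z) = sq_norm upper (mult_op (\<lambda>t. ?s t + (-1) * ?p t) (S f))"
      unfolding cp d[OF Sf, symmetric] by (rule sq_norm_uminus_diff)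
    also have "\<dots> \<le> e * sq_norm upper (S f)" by (rule mult_op_norm_le[OF md Sf de])
    also have "sq_norm upper (\<lambda>z. S (mult_op ?s f) z - S (mult_op ?p f) z) = sq_norm upper (S (mult_op (\<lambda>t. ?s t + (-1) * ?p t) f))"
      using bounded_operator_onD(2)[OF S sf pf, of "-1"] d[OF f] by simp
    also have "\<dots> \<le> C * sq_norm upper (mult_op (\<lambda>t. ?s t + (-1) * ?p t) f)" by (rule C[OF mult_op_in_bergman[OF md f]])
    also have "\<dots> \<le> \<bar>C\<bar> * (e * sq_norm upper f)"
      by (intro mult_mono mult_op_norm_le[OF md f de]) auto
    finally show ?thesis by (simp add: algebra_simps)
  qed
  show "sq_norm upper (\<lambda>z. S (mult_op ?s f) z - mult_op ?s (S f) z) = 0"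
  proof (rule ccontr)
    define N where "N = sq_norm upper (\<lambda>z. S (mult_op ?s f) z - mult_op ?s (S f) z)"
    define K where "K = \<bar>C\<bar> * sq_norm upper f + sq_norm upper (S f)"
    assume "sq_norm upper (\<lambda>z. S (mult_op ?s f) z - mult_op ?s (S f) z) \<noteq> 0"
    then have N: "N > 0" unfolding N_def using sq_norm_nonneg[of upper] by (metis order_le_less)
    have K: "K \<ge> 0" by (simp add: K_def)
    \<comment> \<open>an accuracy so small that the bound becomes \<open>N < N\<close>\<close>
    have "N \<le> N / (2 * (K + 1)) * K" using bound[of "N / (2 * (K + 1))"] N K unfolding N_def[symmetric] K_def[symmetric] by simp
    then have "N * (2 * (K + 1)) \<le> N * K" using K by (simp add: field_simps)
    then show False using N K by simp
  qed
qed simp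

lemma mult_op_positive:
  assumes m: "multiplier m" and pos: "\<And>t. t > 0 \<Longrightarrow> 0 \<le> m t"
  shows "positive_operator_on half_plane (poly_bergman 1) (\<lambda>f. if f \<in> poly_bergman 1 then mult_op m f else (\<lambda>x. 0))"
  unfolding positive_operator_on_def bounded_operator_on_def
proof (intro conjI ballI allI)
  obtain C where C: "\<And>t. t > 0 \<Longrightarrow> \<bar>m t\<bar> \<le> C" using multiplierD(2)[OF m] by blast
  let ?S = "\<lambda>f. if f \<in> poly_bergman 1 then mult_op m f else (\<lambda>x. 0)"
  show "\<exists>C. \<forall>f\<in>poly_bergman 1. l2_norm half_plane (?S f) \<le> C * l2_norm half_plane f"
    using mult_op_norm_le[OF m _ C] by (intro exI[of _ C]) (simp add: l2_norm_eq)
  fix f assume f: "f \<in> poly_bergman 1"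
  show "?S f \<in> poly_bergman 1" using mult_op_in_bergman[OF m f] f by simp
  show "?S (\<lambda>x. f x + g x) = (\<lambda>x. ?S f x + ?S g x)" if g: "g \<in> poly_bergman 1" for g
    using mult_op_add_cmult[OF m f g, of 1] f g poly_bergman_add[OF f g] by simp
  show "?S (\<lambda>x. c * f x) = (\<lambda>x. c * ?S f x)" for c
  proof -
    \<comment> \<open>\<open>c f = f + (c - 1) f\<close>\<close>
    have "mult_op m (\<lambda>z. f z + (c - 1) * f z) = (\<lambda>z. mult_op m f z + (c - 1) * mult_op m f z)"
      by (rule mult_op_add_cmult[OF m f f])
    then show ?thesis using f poly_bergman_cmult[OF f, of c] by (simp add: algebra_simps)
  qed
  have "(\<integral>t. m t * (cmod (coord f t))\<^sup>2 \<partial>halfline) \<ge> 0" using pos by (intro integral_nonneg_AE AE_I2) auto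
  then show "l2_inner half_plane (?S f) f \<in> \<real>\<^sub>\<ge>\<^sub>0"
    using mult_op_inner_self(1)[OF m f] f by (simp add: l2_inner_eq nonneg_Reals_of_real_iff)
qed

text \<open>The point is uniqueness. A positive \<open>S\<close> with \<open>S\<^sup>2 = T\<close> commutes with \<open>T\<close>, hence with multiplication \<open>S0\<close>
  by \<open>sqrt m\<close>. Then \<open>(S + S0) (S - S0) = 0\<close>, so for \<open>x = (S - S0) f\<close> the inner products of \<open>S x\<close> and
  \<open>S0 x\<close> with \<open>x\<close> vanish, and \<open>x = 0\<close> because \<open>m\<close> is strictly positive.\<close>

theorem operator_sqrt_mult_op:
  assumes m: "multiplier m" and range: "\<And>t. t > 0 \<Longrightarrow> 0 < m t \<and> m t \<le> 1"
    and T: "\<And>f. f \<in> poly_bergman 1 \<Longrightarrow> T f = mult_op m f" and f: "f \<in> poly_bergman 1"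
  shows "operator_sqrt half_plane (poly_bergman 1) T f = mult_op (\<lambda>t. sqrt (m t)) f"
proof -
  let ?s = "\<lambda>t. sqrt (m t)"
  define S0 where "S0 f = (if f \<in> poly_bergman 1 then mult_op ?s f else (\<lambda>x. 0))" for f
  have range': "0 \<le> m t \<and> m t \<le> 1" if "t > 0" for t using range[OF that] by simp
  have sm: "multiplier ?s"
    unfolding multiplier_def using multiplierD(1)[OF m] range'
    by (auto intro!: exI[of _ 1] borel_measurable_sqrt)
  have S0: "positive_operator_on half_plane (poly_bergman 1) S0"
    unfolding S0_def[abs_def] by (rule mult_op_positive[OF sm]) (use range' in auto)
  have S0sq: "S0 (S0 f) = T f" if f: "f \<in> poly_bergman 1" for f
  proof -
    have "S0 (S0 f) = mult_op (\<lambda>t. ?s t * ?s t) f"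
      using f mult_op_in_bergman[OF sm f] by (simp add: S0_def mult_op_mult_op[OF sm sm f])
    also have "\<dots> = mult_op m f"
      by (rule mult_op_cong) (use range' m f multiplier_mult[OF sm sm] in auto)
    finally show ?thesis by (simp add: T[OF f])
  qed
  have "operator_sqrt half_plane (poly_bergman 1) T = S0"
    unfolding operator_sqrt_def
  proof (rule the_equality)
    show "positive_operator_on half_plane (poly_bergman 1) S0 \<and> (\<forall>f\<in>poly_bergman 1. S0 (S0 f) = T f) \<and>
      (\<forall>f. f \<notin> poly_bergman 1 \<longrightarrow> S0 f = (\<lambda>x. 0))"
      using S0 S0sq by (auto simp: S0_def)
    fix S assume asm: "positive_operator_on half_plane (poly_bergman 1) S \<and> (\<forall>f\<in>poly_bergman 1. S (S f) = T f) \<and>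
      (\<forall>f. f \<notin> poly_bergman 1 \<longrightarrow> S f = (\<lambda>x. 0))"
    have Sb: "bounded_operator_on half_plane (poly_bergman 1) S"
      and Spos: "\<And>f. f \<in> poly_bergman 1 \<Longrightarrow> sq_inner upper (S f) f \<in> \<real>\<^sub>\<ge>\<^sub>0"
      and Ssq: "\<And>f. f \<in> poly_bergman 1 \<Longrightarrow> S (S f) = mult_op m f"
      using asm T unfolding positive_operator_on_def by (auto simp: l2_inner_eq)
    note Sin = bounded_operator_onD(1)[OF Sb]
    have comm: "S (mult_op m f) = mult_op m (S f)" if f: "f \<in> poly_bergman 1" for f
      by (metis Ssq f Sin)
    have comms: "S (mult_op ?s f) = mult_op ?s (S f)" if f: "f \<in> poly_bergman 1" for f
      by (rule commute_sqrt[OF Sb m range' comm sm f])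
    show "S = S0"
    proof
      fix f
      show "S f = S0 f"
      proof (cases "f \<in> poly_bergman 1")
        case f: True
        note Sf = Sin[OF f] and sf = mult_op_in_bergman[OF sm f]
        \<comment> \<open>\<open>(S + S0) (S - S0) f = 0\<close>, and both summands are positive\<close>
        define x where "x z = S f z + (-1) * mult_op ?s f z" for z
        have x: "x \<in> poly_bergman 1" unfolding x_def[abs_def] by (rule poly_bergman_add_cmult[OF Sf sf])
        have Sx: "S x = (\<lambda>z. mult_op m f z + (-1) * mult_op ?s (S f) z)"
          unfolding x_def[abs_def] bounded_operator_onD(2)[OF Sb Sf sf] Ssq[OF f] comms[OF f] ..
        have "mult_op ?s (mult_op ?s f) = mult_op m f" using S0sq[OF f] f sf by (simp add: S0_def T)
        then have sx: "mult_op ?s x = (\<lambda>z. mult_op ?s (S f) z + (-1) * mult_op m f z)"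
          unfolding x_def[abs_def] mult_op_add_cmult[OF sm Sf sf] by simp
        have "sq_inner upper (S x) x + sq_inner upper (mult_op ?s x) x = sq_inner upper (\<lambda>z. S x z + mult_op ?s x z) x"
          by (intro sq_inner_add_left[symmetric] poly_bergmanD(1)[of _ 1] Sin mult_op_in_bergman sm x)
        also have "\<dots> = 0" unfolding Sx sx by (simp add: sq_inner_def)
        finally have sum0: "sq_inner upper (S x) x + sq_inner upper (mult_op ?s x) x = 0" .
        define I where "I = (\<integral>t. ?s t * (cmod (coord x t))\<^sup>2 \<partial>halfline)"
        have I: "sq_inner upper (mult_op ?s x) x = of_real I" unfolding I_def by (rule mult_op_inner_self(1)[OF sm x])
        have nn: "?s t * (cmod (coord x t))\<^sup>2 \<ge> 0" if "t > 0" for t using range'[OF that] by simp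
        have "I \<ge> 0" unfolding I_def using nn by (intro integral_nonneg_AE AE_I2) auto
        moreover have "Re (sq_inner upper (S x) x) \<ge> 0" using Spos[OF x] by (simp add: complex_nonneg_Reals_iff)
        moreover have "Re (sq_inner upper (S x) x) + I = 0" using arg_cong[OF sum0, of Re] by (simp add: I)
        ultimately have "I = 0" by linarith
        then have "AE t in halfline. ?s t * (cmod (coord x t))\<^sup>2 = 0"
          unfolding I_def using nn mult_op_inner_self(2)[OF sm x]
          by (subst (asm) integral_nonneg_eq_0_iff_AE) (auto intro!: AE_I2)
        moreover have "AE t in halfline. t > 0" by (rule AE_I2) simp
        ultimately have "AE t in halfline. coord x t = 0"
        proof eventually_elim
          case (elim t)
          then show ?case using range[of t] by auto
        qed
        then have "sq_norm halfline (coord x) = 0" using sq_norm_eq_0_iff[OF coord_sq_integrable[OF x]] by simp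
        then have "sq_norm upper x = 0" using coord_norm[OF x] by simp
        moreover have "x = (\<lambda>z. S f z - mult_op ?s f z)" by (simp add: x_def[abs_def])
        ultimately have "S f = mult_op ?s f" by (intro poly_bergman_eqI[OF _ Sf sf]) simp_all
        then show ?thesis using f by (simp add: S0_def)
      qed (use asm in \<open>simp add: S0_def\<close>)
    qed
  qed
  then show ?thesis using f by (simp add: S0_def)
qed

section \<open>Toeplitz operators with horizontal symbols\<close>

definition symbol_set :: "nat \<Rightarrow> nat \<Rightarrow> real set" where
  "symbol_set n k = (if k = n then {real n - 1..} else {real k - 1..<real k})"

lemma symbol_eq: "symbol n k z = indicator (symbol_set n k) (Im z)"
  by (simp add: symbol_def symbol_set_def)

lemma symbol_set_borel [measurable]: "symbol_set n k \<in> sets borel"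
  by (simp add: symbol_set_def)

text \<open>Except for \<open>k = n\<close> a difference of two consecutive exponentials, so that the sum over \<open>k\<close> telescopes.\<close>

lemma gam_eq: "gam n k t = exp (- 2 * t * (real k - 1)) - (if k = n then 0 else exp (- 2 * t * real k))"
proof (cases "k = n")
  case True
  then show ?thesis by (simp add: gam_def algebra_simps)
next
  case False
  have "- 2 * real k * t + 2 * t = - 2 * t * (real k - 1)" "- 2 * real k * t = - 2 * t * real k"
    by (simp_all add: algebra_simps)
  then have "exp (- 2 * real k * t) * (exp (2 * t) - 1) = exp (- 2 * t * (real k - 1)) - exp (- 2 * t * real k)"
    by (simp only: right_diff_distrib mult_1_right exp_add[symmetric])
  then show ?thesis using False unfolding gam_def by simp
qed

lemma gam_measurable [measurable]: "gam n k \<in> borel_measurable borel"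
  unfolding gam_eq[abs_def] by measurable

lemma gam_range:
  assumes "k \<in> {1..n}" "t > 0"
  shows "0 < gam n k t \<and> gam n k t \<le> 1"
proof -
  define a where "a = exp (- 2 * t * (real k - 1))"
  define b where "b = exp (- 2 * t * real k)"
  have "b < a" unfolding a_def b_def using assms by (simp add: algebra_simps)
  moreover have "a \<le> 1" unfolding a_def using assms by (simp add: mult_nonneg_nonneg)
  moreover have "0 < b" by (simp add: b_def)
  ultimately show ?thesis unfolding gam_eq a_def[symmetric] b_def[symmetric] by auto
qed

lemma gam_multiplier: "k \<in> {1..n} \<Longrightarrow> multiplier (gam n k)"
proof -
  assume k: "k \<in> {1..n}"
  have "\<bar>gam n k t\<bar> \<le> 1" if "t > 0" for t using gam_range[OF k that] by linarith
  then show ?thesis unfolding multiplier_def by (intro conjI exI[of _ 1]) auto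
qed

lemma sqrt_gam_multiplier: "k \<in> {1..n} \<Longrightarrow> multiplier (\<lambda>t. sqrt (gam n k t))"
proof -
  assume k: "k \<in> {1..n}"
  have "\<bar>sqrt (gam n k t)\<bar> \<le> 1" if "t > 0" for t using gam_range[OF k that] by simp
  then show ?thesis unfolding multiplier_def by (intro conjI exI[of _ 1]) auto
qed

lemma sum_gam:
  assumes "n \<ge> 1" shows "(\<Sum>k=1..n. gam n k t) = 1"
proof -
  obtain m where n: "n = Suc m" using assms by (cases n) auto
  have "(\<Sum>k=1..m. gam n k t) = (\<Sum>k=1..m. exp (- 2 * t * (real k - 1)) - exp (- 2 * t * real k))"
    using n by (intro sum.cong refl) (simp add: gam_eq)
  also have "\<dots> = 1 - exp (- 2 * t * real m)" by (induction m) (auto simp: algebra_simps)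
  moreover have "gam n n t = exp (- 2 * t * real m)" unfolding gam_eq using n by simp
  ultimately show ?thesis using n by simp
qed

lemma nn_integral_exp_symbol:
  assumes k: "k \<in> {1..n}" and t: "t > 0"
  shows "(\<integral>\<^sup>+y. indicator (symbol_set n k) y * ennreal (2 * t * exp (- 2 * t * y)) \<partial>halfline) = ennreal (gam n k t)"
proof -
  define F where "F y = - exp (- 2 * t * y)" for y
  define f where "f y = 2 * t * exp (- 2 * t * y)" for y
  have der: "(F has_real_derivative f y) (at y)" for y
    unfolding F_def f_def by (auto intro!: derivative_eq_intros)
  have fm: "f \<in> borel_measurable borel" unfolding f_def by measurable
  have f0: "0 \<le> f y" for y using t by (simp add: f_def)
  define A where "A = (if k = n then {real n - 1..} else {real k - 1..real k})"
  have "(\<integral>\<^sup>+y. indicator (symbol_set n k) y * ennreal (f y) \<partial>halfline) = (\<integral>\<^sup>+y. ennreal (f y) * indicator A y \<partial>lborel)"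
  proof (subst nn_integral_restrict_space)
    have "AE y in lborel. y \<noteq> 0 \<and> y \<noteq> real k" using AE_lborel_singleton[of 0] AE_lborel_singleton[of "real k"] by eventually_elim simp
    then show "(\<integral>\<^sup>+y. indicator (symbol_set n k) y * ennreal (f y) * indicator {0<..} y \<partial>lborel) = (\<integral>\<^sup>+y. ennreal (f y) * indicator A y \<partial>lborel)"
      by (rule nn_integral_cong_AE[OF eventually_mono]) (use k in \<open>auto simp: symbol_set_def A_def indicator_def\<close>)
  qed simp
  also have "\<dots> = ennreal (gam n k t)"
  proof (cases "k = n")
    case True
    have "((\<lambda>y. exp (- (2 * t) * y)) \<longlongrightarrow> 0) at_top"
      using t by (intro filterlim_compose[OF exp_at_bot] filterlim_tendsto_neg_mult_at_bot[OF tendsto_const _ filterlim_ident]) auto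
    then have "(F \<longlongrightarrow> 0) at_top" unfolding F_def using tendsto_minus[of "\<lambda>y. exp (- (2 * t) * y)" 0] by simp
    then have "(\<integral>\<^sup>+y. ennreal (f y) * indicator {real n - 1..} y \<partial>lborel) = ennreal (0 - F (real n - 1))"
      by (intro nn_integral_FTC_atLeast fm der f0)
    then show ?thesis using True by (simp add: A_def F_def gam_eq)
  next
    case False
    have "(\<integral>\<^sup>+y. ennreal (f y) * indicator {real k - 1..real k} y \<partial>lborel) = ennreal (F (real k) - F (real k - 1))"
      by (intro nn_integral_FTC_Icc fm f0) (auto intro: has_field_derivative_at_within der)
    then show ?thesis using False by (simp add: A_def F_def gam_eq)
  qed
  finally show ?thesis unfolding f_def .
qed

lemma slice_1:
  assumes "t > 0" "y > 0"
  shows "(cmod (slice 1 (\<lambda>_. f) y t))\<^sup>2 = 2 * t * exp (- 2 * t * y) * (cmod (f t))\<^sup>2"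
proof -
  have "laguerre 0 = 1" by (simp add: laguerre_def monom_0 one_pCons)
  then have N: "Nvec 1 (2 * t * y) = exp (- t * y)" using assms by (simp add: Nvec_eq)
  have "(exp (- t * y))\<^sup>2 = exp (- 2 * t * y)" by (simp add: power2_eq_square flip: exp_add)
  then show ?thesis using assms by (simp add: slice_def basis_fun_def N norm_mult abs_mult power_mult_distrib del: One_nat_def)
qed

text \<open>A weight depending on \<open>Im z\<close> passes through Plancherel's theorem on horizontal lines.\<close>

lemma symbol_emb_norm:
  assumes k: "k \<in> {1..n}" and f: "sq_integrable halfline f"
  shows "sq_integrable upper (\<lambda>z. symbol n k z * emb f z)"
    and "sq_norm upper (\<lambda>z. symbol n k z * emb f z) = sq_norm halfline (\<lambda>t. of_real (sqrt (gam n k t)) * f t)"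
proof -
  note L = L2vec_1[OF f]
  have sm: "symbol n k \<in> borel_measurable upper"
    unfolding symbol_eq[abs_def] by (rule upper_measurable) measurable
  show s: "sq_integrable upper (\<lambda>z. symbol n k z * emb f z)"
    unfolding emb_def
    by (rule sq_integrable_bounded_mult[OF R_adj_isometry(1)[OF L] sm, where C = 1]) (simp add: symbol_eq indicator_def)
  note g = multiplier_sq_integrable[OF sqrt_gam_multiplier[OF k] f]
  have "(\<integral>\<^sup>+z. ennreal ((cmod (symbol n k z * emb f z))\<^sup>2) \<partial>upper)
    = (\<integral>\<^sup>+z. indicator (symbol_set n k) (Im z) * ennreal ((cmod (emb f z))\<^sup>2) \<partial>upper)"
    by (intro nn_integral_cong) (simp add: symbol_eq indicator_def)
  also have "\<dots> = (\<integral>\<^sup>+t. (\<integral>\<^sup>+y. indicator (symbol_set n k) y * ennreal ((cmod (slice 1 (\<lambda>_. f) y t))\<^sup>2) \<partial>halfline) \<partial>halfline)"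
    unfolding emb_def by (rule R_adj_weighted_norm[OF L]) measurable
  also have "\<dots> = (\<integral>\<^sup>+t. ennreal ((cmod (of_real (sqrt (gam n k t)) * f t))\<^sup>2) \<partial>halfline)"
  proof (rule nn_integral_cong)
    fix t assume "t \<in> space halfline" then have t: "t > 0" by simp
    have "(\<integral>\<^sup>+y. indicator (symbol_set n k) y * ennreal ((cmod (slice 1 (\<lambda>_. f) y t))\<^sup>2) \<partial>halfline)
      = (\<integral>\<^sup>+y. (indicator (symbol_set n k) y * ennreal (2 * t * exp (- 2 * t * y))) * ennreal ((cmod (f t))\<^sup>2) \<partial>halfline)"
      using t by (intro nn_integral_cong) (simp add: slice_1 ennreal_mult mult.assoc del: One_nat_def)
    also have "\<dots> = ennreal (gam n k t) * ennreal ((cmod (f t))\<^sup>2)"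
      unfolding nn_integral_exp_symbol[OF k t, symmetric]
      by (intro nn_integral_multc halfline_measurable) measurable
    also have "\<dots> = ennreal ((cmod (of_real (sqrt (gam n k t)) * f t))\<^sup>2)"
      using gam_range[OF k t] by (simp add: norm_mult power_mult_distrib ennreal_mult)
    finally show "(\<integral>\<^sup>+y. indicator (symbol_set n k) y * ennreal ((cmod (slice 1 (\<lambda>_. f) y t))\<^sup>2) \<partial>halfline)
      = ennreal ((cmod (of_real (sqrt (gam n k t)) * f t))\<^sup>2)" .
  qed
  finally have "ennreal ((sq_norm upper (\<lambda>z. symbol n k z * emb f z))\<^sup>2) = ennreal ((sq_norm halfline (\<lambda>t. of_real (sqrt (gam n k t)) * f t))\<^sup>2)"
    unfolding nn_integral_sq[OF s] nn_integral_sq[OF g] .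
  then show "sq_norm upper (\<lambda>z. symbol n k z * emb f z) = sq_norm halfline (\<lambda>t. of_real (sqrt (gam n k t)) * f t)"
    by (simp add: power2_eq_iff_nonneg)
qed

lemma symbol_emb_inner:
  assumes k: "k \<in> {1..n}" and f: "sq_integrable halfline f" and g: "sq_integrable halfline g"
  shows "sq_inner upper (\<lambda>z. symbol n k z * emb f z) (emb g) = sq_inner halfline (\<lambda>t. of_real (gam n k t) * f t) g"
proof -
  let ?s = "\<lambda>t. complex_of_real (sqrt (gam n k t))"
  note sg = multiplier_sq_integrable[OF sqrt_gam_multiplier[OF k]]
  have "4 * sq_inner upper (\<lambda>z. symbol n k z * emb f z) (\<lambda>z. symbol n k z * emb g z)
    = 4 * sq_inner halfline (\<lambda>t. ?s t * f t) (\<lambda>t. ?s t * g t)"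
    unfolding sq_inner_polarization[OF symbol_emb_norm(1)[OF k f] symbol_emb_norm(1)[OF k g]]
      sq_inner_polarization[OF sg[OF f] sg[OF g]]
  proof (intro sum.cong refl)
    fix i :: nat
    have fg: "sq_integrable halfline (\<lambda>t. f t + \<i> ^ i * g t)" by (intro sq_integrable_add sq_integrable_cmult f g)
    have "(\<lambda>z. symbol n k z * emb f z + \<i> ^ i * (symbol n k z * emb g z)) = (\<lambda>z. symbol n k z * emb (\<lambda>t. f t + \<i> ^ i * g t) z)"
      unfolding emb_add_cmult[OF f g] by (simp add: algebra_simps)
    moreover have "(\<lambda>t. ?s t * f t + \<i> ^ i * (?s t * g t)) = (\<lambda>t. ?s t * (f t + \<i> ^ i * g t))"
      by (simp add: algebra_simps)
    ultimately show "\<i> ^ i * complex_of_real ((sq_norm upper (\<lambda>z. symbol n k z * emb f z + \<i> ^ i * (symbol n k z * emb g z)))\<^sup>2)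
      = \<i> ^ i * complex_of_real ((sq_norm halfline (\<lambda>t. ?s t * f t + \<i> ^ i * (?s t * g t)))\<^sup>2)"
      using symbol_emb_norm(2)[OF k fg] by simp
  qed
  moreover have "sq_inner upper (\<lambda>z. symbol n k z * emb f z) (\<lambda>z. symbol n k z * emb g z) = sq_inner upper (\<lambda>z. symbol n k z * emb f z) (emb g)"
    unfolding sq_inner_def by (intro Bochner_Integration.integral_cong refl) (simp add: symbol_eq indicator_def)
  moreover have "sq_inner halfline (\<lambda>t. ?s t * f t) (\<lambda>t. ?s t * g t) = sq_inner halfline (\<lambda>t. of_real (gam n k t) * f t) g"
    unfolding sq_inner_def
  proof (rule Bochner_Integration.integral_cong[OF refl])
    fix t assume "t \<in> space halfline" then have "0 \<le> gam n k t" using gam_range[OF k, of t] by simp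
    then have "?s t * ?s t = of_real (gam n k t)" by (simp flip: of_real_mult)
    then show "?s t * f t * cnj (?s t * g t) = of_real (gam n k t) * f t * cnj (g t)" by (simp add: mult_ac)
  qed
  ultimately show ?thesis by simp
qed

text \<open>Polarising the weighted norm identity gives the Toeplitz form as the form of multiplication by \<open>gam n k\<close>.\<close>

theorem toeplitz_symbol:
  assumes k: "k \<in> {1..n}" and f: "f \<in> poly_bergman 1"
  shows "toeplitz (symbol n k) f = mult_op (gam n k) f"
  unfolding toeplitz_def bergman_projection_def l2_inner_eq[OF half_plane_borel]
proof (rule the_equality)
  let ?g = "mult_op (gam n k) f"
  note gm = gam_multiplier[OF k]
  note Wf = coord_sq_integrable[OF f] and gWf = multiplier_coord_sq_integrable[OF gm f]
  have g: "?g \<in> poly_bergman 1" by (rule mult_op_in_bergman[OF gm f])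
  have af: "sq_integrable upper (\<lambda>z. symbol n k z * f z)"
    using symbol_emb_norm(1)[OF k Wf] by (simp only: emb_coord[OF f])
  have orth: "sq_inner upper (\<lambda>z. symbol n k z * f z - ?g z) h = 0" if h: "h \<in> poly_bergman 1" for h
  proof -
    note Wh = coord_sq_integrable[OF h]
    have "sq_inner upper (\<lambda>z. symbol n k z * f z) h = sq_inner upper ?g h"
      using symbol_emb_inner[OF k Wf Wh] emb_inner[OF gWf Wh]
      by (simp add: emb_coord[OF f] emb_coord[OF h] mult_op_def)
    then show ?thesis by (simp add: sq_inner_diff_left[OF af poly_bergmanD(1)[OF g] poly_bergmanD(1)[OF h]])
  qed
  then show "?g \<in> poly_bergman 1 \<and> (\<forall>h\<in>poly_bergman 1. sq_inner upper (\<lambda>z. symbol n k z * f z - ?g z) h = 0)"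
    using g by blast
  fix g' assume g': "g' \<in> poly_bergman 1 \<and> (\<forall>h\<in>poly_bergman 1. sq_inner upper (\<lambda>z. symbol n k z * f z - g' z) h = 0)"
  then have g'b: "g' \<in> poly_bergman 1" by blast
  define d where "d z = g' z - ?g z" for z
  have d: "d \<in> poly_bergman 1" unfolding d_def[abs_def] by (rule poly_bergman_diff[OF g'b g])
  have "sq_inner upper d d = sq_inner upper (\<lambda>z. (symbol n k z * f z - ?g z) - (symbol n k z * f z - g' z)) d"
    by (simp add: d_def[abs_def])
  also have "\<dots> = 0"
    using orth[OF d] g' d sq_inner_diff_left[OF sq_integrable_diff[OF af poly_bergmanD(1)[OF g]] sq_integrable_diff[OF af poly_bergmanD(1)[OF g'b]] poly_bergmanD(1)[OF d]]
    by simp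
  finally have "sq_norm upper d = 0" unfolding sq_inner_self by simp
  then show "g' = ?g" unfolding d_def[abs_def] by (intro poly_bergman_eqI[OF _ g'b g]) auto
qed

lemma toeplitz_sqrt_emb:
  assumes k: "k \<in> {1..n}" and f: "sq_integrable halfline f"
  shows "toeplitz_sqrt (symbol n k) (emb f) = emb (\<lambda>t. of_real (sqrt (gam n k t)) * f t)"
proof -
  have "toeplitz_sqrt (symbol n k) (emb f) = mult_op (\<lambda>t. sqrt (gam n k t)) (emb f)"
    unfolding toeplitz_sqrt_def
    by (rule operator_sqrt_mult_op[OF gam_multiplier[OF k] gam_range[OF k] toeplitz_symbol[OF k] emb_in_bergman[OF f]])
  then show ?thesis by (simp only: mult_op_emb[OF sqrt_gam_multiplier[OF k] f])
qed

section \<open>The projection and its kernel\<close>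

text \<open>The action of the matrix \<open>P_gam n t\<close>, pointwise in \<open>t\<close>.\<close>

definition gam_mult :: "nat \<Rightarrow> (nat \<Rightarrow> real \<Rightarrow> complex) \<Rightarrow> nat \<Rightarrow> real \<Rightarrow> complex" where
  "gam_mult n r j t = (\<Sum>k=1..n. of_real (P_gam n t j k) * r k t)"

lemma P_gam_multiplier: "j \<in> {1..n} \<Longrightarrow> k \<in> {1..n} \<Longrightarrow> multiplier (\<lambda>t. P_gam n t j k)"
  unfolding P_gam_def by (intro multiplier_mult sqrt_gam_multiplier)

lemma gam_mult_L2vec: "L2vec n r \<Longrightarrow> L2vec n (gam_mult n r)"
  unfolding L2vec_def gam_mult_def[abs_def]
  by (auto intro!: sq_integrable_sum multiplier_sq_integrable P_gam_multiplier)

text \<open>\<open>P_gam n t\<close> is the matrix \<open>v v\<^sup>t\<close> for the unit vector \<open>v\<close> with entries \<open>sqrt (gam n k t)\<close>.\<close>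

lemma gam_mult_idem:
  assumes n: "n \<ge> 1" and t: "t > 0" and j: "j \<in> {1..n}"
  shows "gam_mult n (gam_mult n r) j t = gam_mult n r j t"
proof -
  have "gam_mult n (gam_mult n r) j t
    = (\<Sum>k=1..n. \<Sum>l=1..n. of_real (gam n k t) * (of_real (P_gam n t j l) * r l t))"
    unfolding gam_mult_def sum_distrib_left
  proof (intro sum.cong refl)
    fix k l assume k: "k \<in> {1..n}"
    have "P_gam n t j k * P_gam n t k l = gam n k t * P_gam n t j l"
      unfolding P_gam_def using gam_range[OF k t] real_sqrt_mult_self[of "gam n k t"] by (simp add: mult_ac)
    then have "complex_of_real (P_gam n t j k) * of_real (P_gam n t k l) = of_real (gam n k t) * of_real (P_gam n t j l)"
      by (metis of_real_mult)
    then show "complex_of_real (P_gam n t j k) * (of_real (P_gam n t k l) * r l t) = of_real (gam n k t) * (of_real (P_gam n t j l) * r l t)"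
      by (simp only: mult.assoc[symmetric])
  qed
  also have "\<dots> = of_real (\<Sum>k=1..n. gam n k t) * gam_mult n r j t"
    by (simp only: gam_mult_def of_real_sum sum_product)
  finally show ?thesis by (simp only: sum_gam[OF n] of_real_1 mult_1_left)
qed

lemma P_gam_commute: "P_gam n t j k = P_gam n t k j"
  by (simp add: P_gam_def mult.commute)

lemma gam_mult_selfadjoint:
  assumes r: "L2vec n r" and s: "L2vec n s"
  shows "(\<Sum>j=1..n. sq_inner halfline (gam_mult n r j) (s j)) = (\<Sum>j=1..n. sq_inner halfline (r j) (gam_mult n s j))"
proof -
  define c where "c j k = sq_inner halfline (\<lambda>t. of_real (P_gam n t j k) * r k t) (s j)" for j k
  have c: "c j k = sq_inner halfline (r k) (\<lambda>t. of_real (P_gam n t k j) * s j t)" for j k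
    unfolding c_def sq_inner_def P_gam_commute[of n _ j k] by (intro Bochner_Integration.integral_cong refl) (simp add: mult_ac)
  have "(\<Sum>j=1..n. sq_inner halfline (gam_mult n r j) (s j)) = (\<Sum>j=1..n. \<Sum>k=1..n. c j k)"
    unfolding gam_mult_def[abs_def] c_def
    by (intro sum.cong refl sq_inner_sum_left multiplier_sq_integrable P_gam_multiplier L2vecD[OF r] L2vecD[OF s]) auto
  also have "\<dots> = (\<Sum>k=1..n. \<Sum>j=1..n. c j k)" by (rule sum.swap)
  also have "\<dots> = (\<Sum>k=1..n. sq_inner halfline (r k) (gam_mult n s k))"
  proof (intro sum.cong refl)
    fix k assume k: "k \<in> {1..n}"
    have "sq_inner halfline (gam_mult n s k) (r k) = (\<Sum>j=1..n. sq_inner halfline (\<lambda>t. of_real (P_gam n t k j) * s j t) (r k))"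
      unfolding gam_mult_def[abs_def]
      by (intro sq_inner_sum_left multiplier_sq_integrable P_gam_multiplier L2vecD[OF r] L2vecD[OF s] k)
    then have "sq_inner halfline (r k) (gam_mult n s k) = (\<Sum>j=1..n. cnj (sq_inner halfline (\<lambda>t. of_real (P_gam n t k j) * s j t) (r k)))"
      by (subst sq_inner_commute) simp
    then show "(\<Sum>j=1..n. c j k) = sq_inner halfline (r k) (gam_mult n s k)"
      unfolding c by (simp flip: sq_inner_commute)
  qed
  finally show ?thesis .
qed

lemma emb_sum:
  assumes "\<And>i. i \<in> I \<Longrightarrow> sq_integrable halfline (f i)"
  shows "emb (\<lambda>t. \<Sum>i\<in>I. f i t) = (\<lambda>z. \<Sum>i\<in>I. emb (f i) z)"
  using assms
proof (induction I rule: infinite_finite_induct)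
  case (insert i I)
  have "emb (\<lambda>t. (\<Sum>i\<in>I. f i t) + 1 * f i t) = (\<lambda>z. emb (\<lambda>t. \<Sum>i\<in>I. f i t) z + 1 * emb (f i) z)"
    by (intro emb_add_cmult sq_integrable_sum insert.prems) auto
  then show ?case using insert by (simp add: add.commute)
qed (auto simp: emb_def R_adj_def)

text \<open>In the coordinates on the half-line all Toeplitz square roots are multiplications, and the maps
  between the Bergman space and the half-line cancel.\<close>

theorem P_op_eq:
  assumes \<phi>: "\<phi> \<in> poly_bergman n"
  shows "P_op n \<phi> = R_adj n (gam_mult n (R_op n \<phi>))"
proof -
  define r where "r = R_op n \<phi>"
  have r: "L2vec n r" unfolding r_def by (rule R_op_L2vec[OF poly_bergmanD(1)[OF \<phi>]])
  note sg = multiplier_sq_integrable[OF sqrt_gam_multiplier]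
  have PT: "P_T n (R_sum_adj n r) j = emb (gam_mult n r j)" if j: "j \<in> {1..n}" for j
  proof -
    have "toeplitz_sqrt (symbol n j) (toeplitz_sqrt (symbol n k) (R_sum_adj n r k)) = emb (\<lambda>t. of_real (P_gam n t j k) * r k t)"
      if k: "k \<in> {1..n}" for k
    proof -
      note rk = L2vecD[OF r k]
      show ?thesis using k
        by (simp add: R_sum_adj_def emb_def[symmetric] toeplitz_sqrt_emb[OF k rk] toeplitz_sqrt_emb[OF j sg[OF k rk]] P_gam_def mult.assoc del: One_nat_def)
    qed
    then have "P_T n (R_sum_adj n r) j = (\<lambda>z. \<Sum>k=1..n. emb (\<lambda>t. of_real (P_gam n t j k) * r k t) z)"
      using j by (simp add: P_T_def del: One_nat_def)
    also have "\<dots> = emb (\<lambda>t. \<Sum>k=1..n. of_real (P_gam n t j k) * r k t)"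
      by (rule emb_sum[symmetric]) (intro multiplier_sq_integrable P_gam_multiplier j L2vecD[OF r])
    finally show ?thesis unfolding gam_mult_def[abs_def] .
  qed
  have "P_op n \<phi> = R_adj n (R_sum n (P_T n (R_sum_adj n r)))" by (simp add: P_op_def r_def)
  also have "\<dots> = R_adj n (gam_mult n r)"
  proof (rule R_adj_cong_AE)
    note g = L2vecD[OF gam_mult_L2vec[OF r]]
    have e: "R_sum n (P_T n (R_sum_adj n r)) j = coord (emb (gam_mult n r j))" if j: "j \<in> {1..n}" for j
      using j by (simp add: R_sum_def PT[OF j] coord_def del: One_nat_def)
    show "L2vec n (R_sum n (P_T n (R_sum_adj n r)))"
      unfolding L2vec_def using e coord_sq_integrable[OF emb_in_bergman[OF g]] by simp
    show "L2vec n (gam_mult n r)" by (rule gam_mult_L2vec[OF r])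
    show "\<And>j. j \<in> {1..n} \<Longrightarrow> AE t in halfline. R_sum n (P_T n (R_sum_adj n r)) j t = gam_mult n r j t"
      using e coord_emb[OF g] by simp
  qed
  finally show ?thesis unfolding r_def .
qed

lemma gam_mult_cong_AE:
  assumes "\<And>k. k \<in> {1..n} \<Longrightarrow> AE t in halfline. r k t = s k t"
  shows "AE t in halfline. gam_mult n r j t = gam_mult n s j t"
proof -
  have "AE t in halfline. \<forall>k\<in>{1..n}. r k t = s k t" by (rule AE_finite_allI) (use assms in auto)
  then show ?thesis by eventually_elim (simp add: gam_mult_def)
qed

lemma P_op_in_bergman: "\<phi> \<in> poly_bergman n \<Longrightarrow> P_op n \<phi> \<in> poly_bergman n"
  unfolding P_op_eq by (intro R_adj_in_poly_bergman gam_mult_L2vec R_op_L2vec poly_bergmanD(1))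

lemma P_op_inner:
  assumes n: "n \<ge> 1" and \<phi>: "\<phi> \<in> poly_bergman n" and g: "L2vec n g"
  shows "sq_inner upper (P_op n \<phi>) (R_adj n g) = sq_inner upper \<phi> (R_adj n (gam_mult n g))"
proof -
  have r: "L2vec n (R_op n \<phi>)" by (rule R_op_L2vec[OF poly_bergmanD(1)[OF \<phi>]])
  have "sq_inner upper (P_op n \<phi>) (R_adj n g) = (\<Sum>j=1..n. sq_inner halfline (gam_mult n (R_op n \<phi>) j) (g j))"
    unfolding P_op_eq[OF \<phi>] by (rule R_adj_inner[OF gam_mult_L2vec[OF r] g])
  also have "\<dots> = (\<Sum>j=1..n. sq_inner halfline (R_op n \<phi> j) (gam_mult n g j))" by (rule gam_mult_selfadjoint[OF r g])
  also have "\<dots> = sq_inner upper \<phi> (R_adj n (gam_mult n g))"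
    by (rule R_op_adjoint[symmetric, OF poly_bergmanD(1)[OF \<phi>] gam_mult_L2vec[OF g]])
  finally show ?thesis .
qed

text \<open>The isomorphism transports the pointwise matrix projection. Boundedness follows from idempotence
  and symmetry.\<close>

theorem P_op_orthogonal_projection:
  assumes n: "n \<ge> 1"
  shows "orthogonal_projection_on half_plane (poly_bergman n) (P_op n)"
proof -
  let ?H = "poly_bergman n"
  have lin: "P_op n (\<lambda>z. f z + c * g z) = (\<lambda>z. P_op n f z + c * P_op n g z)" if f: "f \<in> ?H" and g: "g \<in> ?H" for f g c
  proof -
    have r: "L2vec n (R_op n f)" "L2vec n (R_op n g)" using R_op_L2vec poly_bergmanD(1) f g by auto
    note gr = gam_mult_L2vec[OF r(1)] gam_mult_L2vec[OF r(2)]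
    note fg = poly_bergman_add_cmult[OF f g, of c]
    have e: "gam_mult n (\<lambda>j t. R_op n f j t + c * R_op n g j t) = (\<lambda>j t. gam_mult n (R_op n f) j t + c * gam_mult n (R_op n g) j t)"
      by (intro ext) (simp add: gam_mult_def distrib_left sum.distrib sum_distrib_left mult_ac)
    have "R_adj n (gam_mult n (R_op n (\<lambda>z. f z + c * g z))) = R_adj n (\<lambda>j t. gam_mult n (R_op n f) j t + c * gam_mult n (R_op n g) j t)"
      unfolding e[symmetric]
    proof (rule R_adj_cong_AE)
      show "L2vec n (gam_mult n (R_op n (\<lambda>z. f z + c * g z)))" by (intro gam_mult_L2vec R_op_L2vec poly_bergmanD(1)[OF fg])
      show "L2vec n (gam_mult n (\<lambda>j t. R_op n f j t + c * R_op n g j t))"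
        unfolding e using gr unfolding L2vec_def by (auto intro!: sq_integrable_add sq_integrable_cmult)
      show "AE t in halfline. gam_mult n (R_op n (\<lambda>z. f z + c * g z)) j t = gam_mult n (\<lambda>j t. R_op n f j t + c * R_op n g j t) j t" for j
        by (rule gam_mult_cong_AE) (rule R_op_add_cmult[OF n f g])
    qed
    then show ?thesis unfolding P_op_eq[OF fg] P_op_eq[OF f] P_op_eq[OF g] R_adj_add_cmult[OF gr] .
  qed
  have sa: "sq_inner upper (P_op n f) g = sq_inner upper f (P_op n g)" if f: "f \<in> ?H" and g: "g \<in> ?H" for f g
    using P_op_inner[OF n f R_op_L2vec[OF poly_bergmanD(1)[OF g]]]
    unfolding R_adj_R_op[OF n g] P_op_eq[OF g, symmetric] .
  have idem: "P_op n (P_op n f) = P_op n f" if f: "f \<in> ?H" for f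
  proof -
    note r = R_op_L2vec[OF poly_bergmanD(1)[OF f], of n]
    note Pf = P_op_in_bergman[OF f]
    note gr = gam_mult_L2vec[OF r]
    have "R_adj n (gam_mult n (R_op n (P_op n f))) = R_adj n (gam_mult n (R_op n f))"
    proof (rule R_adj_cong_AE[OF gam_mult_L2vec[OF R_op_L2vec[OF poly_bergmanD(1)[OF Pf]]] gr])
      fix j assume j: "j \<in> {1..n}"
      have "AE t in halfline. gam_mult n (R_op n (P_op n f)) j t = gam_mult n (gam_mult n (R_op n f)) j t"
        unfolding P_op_eq[OF f] by (rule gam_mult_cong_AE) (rule R_op_R_adj[OF gr])
      moreover have "AE t in halfline. t > 0" by (rule AE_I2) simp
      ultimately show "AE t in halfline. gam_mult n (R_op n (P_op n f)) j t = gam_mult n (R_op n f) j t"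
        by eventually_elim (simp add: gam_mult_idem[OF n _ j])
    qed
    then show ?thesis by (rule trans[OF P_op_eq[OF Pf] trans[OF _ P_op_eq[OF f, symmetric]]])
  qed
  have bound: "sq_norm upper (P_op n f) \<le> 1 * sq_norm upper f" if f: "f \<in> ?H" for f
  proof -
    note Pf = P_op_in_bergman[OF f]
    have "complex_of_real ((sq_norm upper (P_op n f))\<^sup>2) = sq_inner upper (P_op n f) f"
      unfolding sq_inner_self[symmetric] using sa[OF Pf f] idem[OF f] by simp
    then have "(sq_norm upper (P_op n f))\<^sup>2 = cmod (sq_inner upper (P_op n f) f)"
      by (metis norm_of_real abs_of_nonneg zero_le_power2)
    also have "\<dots> \<le> sq_norm upper (P_op n f) * sq_norm upper f"
      by (rule sq_inner_Cauchy_Schwarz[OF poly_bergmanD(1)[OF Pf] poly_bergmanD(1)[OF f]])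
    finally show ?thesis
      by (cases "sq_norm upper (P_op n f) = 0") (auto simp: power2_eq_square mult_le_cancel_left order.strict_iff_order)
  qed
  have cm: "P_op n (\<lambda>z. c * f z) = (\<lambda>z. c * P_op n f z)" if f: "f \<in> ?H" for f c
    using lin[OF f f, of "c - 1"] by (simp add: algebra_simps)
  have add: "P_op n (\<lambda>z. f z + g z) = (\<lambda>z. P_op n f z + P_op n g z)" if "f \<in> ?H" "g \<in> ?H" for f g
    using lin[OF that, of 1] by simp
  show ?thesis
    unfolding orthogonal_projection_on_def bounded_operator_on_def l2_inner_eq[OF half_plane_borel] l2_norm_eq[OF half_plane_borel]
    using P_op_in_bergman add cm bound idem sa by blast
qed

text \<open>Represents the evaluation of \<open>R_adj n f\<close> at \<open>z\<close> as an inner product with \<open>f\<close>.\<close>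

definition eval_vec :: "complex \<Rightarrow> nat \<Rightarrow> real \<Rightarrow> complex" where
  "eval_vec z j t = of_real (1 / sqrt (2 * pi)) * (cis (- (Re z * t)) * of_real (basis_fun j (Im z) t))"

lemma eval_vec_L2vec:
  assumes "z \<in> half_plane" shows "L2vec n (eval_vec z)"
  unfolding L2vec_def
proof
  fix j
  have y: "Im z > 0" using assms by (simp add: half_plane_def)
  have "sq_integrable halfline (\<lambda>t. cis (- (Re z * t)) * of_real (basis_fun j (Im z) t))"
    by (rule sq_integrable_bounded_mult[OF basis_fun_sq_integrable[OF y], where C = 1]) (auto intro!: halfline_measurable)
  then show "sq_integrable halfline (eval_vec z j)" unfolding eval_vec_def[abs_def] by (rule sq_integrable_cmult)
qed

lemma R_adj_eval:
  assumes f: "L2vec n f" and z: "z \<in> half_plane"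
  shows "R_adj n f z = (\<Sum>j=1..n. sq_inner halfline (f j) (eval_vec z j))"
proof -
  have "(\<Sum>j=1..n. sq_inner halfline (f j) (eval_vec z j)) = (\<integral>t. (\<Sum>j=1..n. f j t * cnj (eval_vec z j t)) \<partial>halfline)"
    unfolding sq_inner_def
    by (rule Bochner_Integration.integral_sum[symmetric]) (intro sq_integrable_mult_integrable L2vecD[OF f] L2vecD[OF eval_vec_L2vec[OF z]])
  also have "\<dots> = (\<integral>t. of_real (1 / sqrt (2 * pi)) * (cis (Re z * t) * slice n f (Im z) t) \<partial>halfline)"
    by (intro Bochner_Integration.integral_cong refl) (simp add: slice_def eval_vec_def cis_cnj sum_distrib_left sum_divide_distrib mult_ac)
  finally show ?thesis unfolding R_adj_eq[OF z] by simp
qed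

lemma K_integrand_eq:
  assumes t: "t > 0"
  shows "K_integrand n z w t = of_real (sqrt (2 * pi) / 2) * cnj (cis (Re w * t) * slice n (gam_mult n (eval_vec z)) (Im w) t)"
proof -
  have b: "basis_fun k (Im w) t * basis_fun j (Im z) t = 2 * t * (Nvec j (2 * t * Im z) * Nvec k (2 * t * Im w))" for j k
    using t by (simp add: basis_fun_def mult_ac)
  have "cnj (slice n (gam_mult n (eval_vec z)) (Im w) t)
    = (\<Sum>k=1..n. \<Sum>j=1..n. of_real (1 / sqrt (2 * pi)) * cis (Re z * t) * of_real (P_gam n t k j * (basis_fun k (Im w) t * basis_fun j (Im z) t)))"
    unfolding slice_def gam_mult_def eval_vec_def sum_distrib_left cnj_sum
    by (intro sum.cong refl) (simp add: cis_cnj mult_ac)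
  also have "\<dots> = (\<Sum>j=1..n. \<Sum>k=1..n. of_real (1 / sqrt (2 * pi)) * cis (Re z * t) * of_real (P_gam n t k j * (basis_fun k (Im w) t * basis_fun j (Im z) t)))"
    by (rule sum.swap)
  also have "\<dots> = (of_real (1 / sqrt (2 * pi)) * cis (Re z * t)) * of_real (\<Sum>j=1..n. \<Sum>k=1..n. P_gam n t k j * (basis_fun k (Im w) t * basis_fun j (Im z) t))"
    by (simp only: sum_distrib_left of_real_sum)
  also have "(\<Sum>j=1..n. \<Sum>k=1..n. P_gam n t k j * (basis_fun k (Im w) t * basis_fun j (Im z) t))
    = 2 * (t * (\<Sum>j=1..n. \<Sum>k=1..n. Nvec j (2 * t * Im z) * P_gam n t j k * Nvec k (2 * t * Im w)))"
    unfolding b sum_distrib_left by (intro sum.cong refl) (simp add: P_gam_commute[of n t] mult_ac)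
  finally have s: "cnj (slice n (gam_mult n (eval_vec z)) (Im w) t) = (of_real (1 / sqrt (2 * pi)) * cis (Re z * t)) *
    of_real (2 * (t * (\<Sum>j=1..n. \<Sum>k=1..n. Nvec j (2 * t * Im z) * P_gam n t j k * Nvec k (2 * t * Im w))))" .
  have c: "cis (t * (Re z - Re w)) = cis (- (Re w * t)) * cis (Re z * t)" unfolding cis_mult by (simp add: algebra_simps)
  show ?thesis unfolding K_integrand_def complex_cnj_mult s c by (simp add: cis_cnj)
qed

text \<open>Thus \<open>K_gam n z\<close> is the conjugate of a function in the range of \<open>R\<^sup>*\<close>, hence square integrable.\<close>

lemma K_gam_eq:
  assumes z: "z \<in> half_plane" and w: "w \<in> half_plane"
  shows "set_integrable lborel {0<..} (K_integrand n z w)"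
    and "K_gam n z w = cnj (R_adj n (gam_mult n (eval_vec z)) w)"
proof -
  let ?g = "gam_mult n (eval_vec z)"
  have y: "Im w > 0" using w by (simp add: half_plane_def)
  note gi = slice_cis_integrable[OF gam_mult_L2vec[OF eval_vec_L2vec[OF z]] y, where x = "Re w" and n = n]
  have "integrable halfline (\<lambda>t. of_real (sqrt (2 * pi) / 2) * cnj (cis (Re w * t) * slice n ?g (Im w) t))"
    using gi by (intro integrable_mult_right) (simp only: integrable_cnj)
  then have "integrable halfline (K_integrand n z w)"
    by (rule Bochner_Integration.integrable_cong[THEN iffD1, rotated 2]) (auto simp: K_integrand_eq)
  then show "set_integrable lborel {0<..} (K_integrand n z w)"
    by (simp add: set_integrable_def integrable_restrict_space)
  have "(LINT t:{0<..}|lborel. K_integrand n z w t) = (\<integral>t. K_integrand n z w t \<partial>halfline)"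
    by (simp add: set_lebesgue_integral_def integral_restrict_space)
  also have "\<dots> = (\<integral>t. of_real (sqrt (2 * pi) / 2) * cnj (cis (Re w * t) * slice n ?g (Im w) t) \<partial>halfline)"
    by (intro Bochner_Integration.integral_cong refl) (simp add: K_integrand_eq)
  also have "\<dots> = of_real (sqrt (2 * pi) / 2) * cnj (\<integral>t. cis (Re w * t) * slice n ?g (Im w) t \<partial>halfline)"
    by (simp only: integral_mult_right_zero Bochner_Integration.integral_cnj)
  finally have I: "(LINT t:{0<..}|lborel. K_integrand n z w t) = of_real (sqrt (2 * pi) / 2) * cnj (\<integral>t. cis (Re w * t) * slice n ?g (Im w) t \<partial>halfline)" .
  have "1 / pi * (sqrt (2 * pi) / 2) = 1 / sqrt (2 * pi)"
    using real_sqrt_mult_self[of "2 * pi"] by (simp add: field_simps)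
  then have c: "complex_of_real (1 / pi) * of_real (sqrt (2 * pi) / 2) = of_real (1 / sqrt (2 * pi))"
    by (metis of_real_mult)
  show "K_gam n z w = cnj (R_adj n ?g w)"
    unfolding K_gam_def I R_adj_eq[OF w] complex_cnj_mult complex_cnj_complex_of_real mult.assoc[symmetric] c ..
qed

text \<open>By the duality of \<open>R\<close> and \<open>R\<^sup>*\<close>, \<open>P_op n \<phi> z = \<langle>gam_mult n (R_op n \<phi>), eval_vec z\<rangle>
  = \<langle>\<phi>, R_adj n (gam_mult n (eval_vec z))\<rangle>\<close>.\<close>

theorem theorem9:
  fixes n :: nat
  assumes "n \<ge> 1"
  shows "orthogonal_projection_on half_plane (poly_bergman n) (P_op n) \<and>
    (\<forall>z\<in>half_plane. \<forall>w\<in>half_plane. set_integrable lborel {0<..} (K_integrand n z w)) \<and>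
    (\<forall>\<phi>\<in>poly_bergman n. \<forall>z\<in>half_plane.
       set_integrable lborel half_plane (\<lambda>w. \<phi> w * K_gam n z w) \<and>
       P_op n \<phi> z = (LINT w:half_plane|lborel. \<phi> w * K_gam n z w))"
proof (intro conjI ballI)
  show "orthogonal_projection_on half_plane (poly_bergman n) (P_op n)"
    by (rule P_op_orthogonal_projection[OF assms])
  show "set_integrable lborel {0<..} (K_integrand n z w)" if "z \<in> half_plane" "w \<in> half_plane" for z w
    by (rule K_gam_eq(1)[OF that])
  fix \<phi> z assume \<phi>: "\<phi> \<in> poly_bergman n" and z: "z \<in> half_plane"
  let ?k = "R_adj n (gam_mult n (eval_vec z))"
  note e = eval_vec_L2vec[OF z, of n]
  have k: "sq_integrable upper ?k" by (rule R_adj_isometry(1)[OF gam_mult_L2vec[OF e]])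
  have "integrable upper (\<lambda>w. \<phi> w * cnj (?k w))" by (rule sq_integrable_mult_integrable[OF poly_bergmanD(1)[OF \<phi>] k])
  then have "integrable upper (\<lambda>w. \<phi> w * K_gam n z w)"
    by (rule Bochner_Integration.integrable_cong[THEN iffD1, rotated 2]) (auto simp: K_gam_eq(2)[OF z])
  then show "set_integrable lborel half_plane (\<lambda>w. \<phi> w * K_gam n z w)"
    by (simp add: set_integrable_def integrable_restrict_space)
  note r = R_op_L2vec[OF poly_bergmanD(1)[OF \<phi>], of n]
  have "P_op n \<phi> z = (\<Sum>j=1..n. sq_inner halfline (gam_mult n (R_op n \<phi>) j) (eval_vec z j))"
    unfolding P_op_eq[OF \<phi>] by (rule R_adj_eval[OF gam_mult_L2vec[OF r] z])
  also have "\<dots> = (\<Sum>j=1..n. sq_inner halfline (R_op n \<phi> j) (gam_mult n (eval_vec z) j))"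
    by (rule gam_mult_selfadjoint[OF r e])
  also have "\<dots> = sq_inner upper \<phi> ?k"
    by (rule R_op_adjoint[symmetric, OF poly_bergmanD(1)[OF \<phi>] gam_mult_L2vec[OF e]])
  also have "\<dots> = (\<integral>w. \<phi> w * K_gam n z w \<partial>upper)"
    unfolding sq_inner_def by (intro Bochner_Integration.integral_cong refl) (simp add: K_gam_eq(2)[OF z])
  also have "\<dots> = (LINT w:half_plane|lborel. \<phi> w * K_gam n z w)"
    by (simp add: set_lebesgue_integral_def integral_restrict_space)
  finally show "P_op n \<phi> z = (LINT w:half_plane|lborel. \<phi> w * K_gam n z w)" .
qed

end
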